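(* There is an algorithm which takes as input a prime number $\ell$ and a consistent power-conjugate presentation for a finite soluble group $G$, and produces as output a full set of absolutely irreducible representations of $G$ in characteristic $\ell$, each written over its minimal field. That is, if $\mathbb{K}$ denotes a fixed algebraic closure of the field with $\ell$ elements, the output is a finite list $\sigma_1,\dots,\sigma_s$ of matrix representations of $G$ (each given by the matrices representing the generators $g_1,\dots,g_n$ of the presentation) such that: (i) each $\sigma_i$ is absolutely irreducible and is written over its (unique) minimal subfield of $\mathbb{K}$; and (ii) every absolutely irreducible representation of $G$ over $\mathbb{K}$ is equivalent over $\mathbb{K}$ to exactly one of the $\sigma_i$.
   Context: A consistent power-conjugate presentation for a finite group $G$ consists of generators $g_1,g_2,\dots,g_n$, where $n$ is the composition length of $G$, with defining relations $$g_i^{p_i}=v_i\quad(1\le i\le n),\qquad g_i^{-1}g_jg_i=w_{ij}\quad(1\le i<j\le n),$$ where each $p_i$ is a prime, each $v_i$ is a word in the generators $g_j$ with $i<j\le n$, and each $w_{ij}$ is a word in the generators $g_k$ with $i<k\le n$. A finite group has such a presentation if and only if it is soluble. The minimal field of an absolutely irreducible representation $\sigma$ of a finite group over a subfield of $\mathbb{K}$ is the unique subfield $\mathbb{F}$ of $\mathbb{K}$, minimal with respect to inclusion, such that $\sigma$ is equivalent over $\mathbb{K}$ to a matrix representation with all entries in $\mathbb{F}$ (it is the subfield generated by the character values of $\sigma$). A representation is written over its minimal field if all its matrix entries lie in that field. *)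

theory Defs
  imports
    "HOL-Library.Nat_Bijection"
    "HOL-Algebra.Algebra"
    "Jordan_Normal_Form.Matrix"
begin

section \<open>Algorithms: partial recursive functions\<close>

datatype recf =
    Zero
  | Succ
  | Proj nat
  | Comp recf "recf list"
  | Prec recf recf
  | Mu recf

text \<open>\<open>computes r xs y\<close>: the program \<open>r\<close> halts on the arguments \<open>xs\<close> with result \<open>y\<close>
  (Kleene's schemes: zero, successor, projections, composition, primitive recursion on the first
  argument, and unbounded minimisation in the first argument).\<close>

inductive computes :: "recf \<Rightarrow> nat list \<Rightarrow> nat \<Rightarrow> bool" where
  zero: "computes Zero xs 0"
| succ: "computes Succ [x] (Suc x)"
| proj: "i < length xs \<Longrightarrow> computes (Proj i) xs (xs ! i)"
| comp: "list_all2 (\<lambda>g y. computes g xs y) gs ys \<Longrightarrow> computes f ys z \<Longrightarrow> computes (Comp f gs) xs z"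
| prec_0: "computes f xs y \<Longrightarrow> computes (Prec f g) (0 # xs) y"
| prec_Suc: "computes (Prec f g) (k # xs) y \<Longrightarrow> computes g (k # y # xs) z \<Longrightarrow>
    computes (Prec f g) (Suc k # xs) z"
| mu: "computes f (m # xs) 0 \<Longrightarrow> (\<And>k. k < m \<Longrightarrow> \<exists>y. computes f (k # xs) (Suc y)) \<Longrightarrow>
    computes (Mu f) xs m"

inductive_cases computes_ZeroE: "computes Zero xs y"
inductive_cases computes_SuccE: "computes Succ xs y"
inductive_cases computes_ProjE: "computes (Proj i) xs y"
inductive_cases computes_Prec0E: "computes (Prec f g) (0 # xs) y"
inductive_cases computes_PrecSE: "computes (Prec f g) (Suc k # xs) y"
inductive_cases computes_MuE: "computes (Mu f) xs y"

lemma computes_unique: "computes r xs y \<Longrightarrow> computes r xs y' \<Longrightarrow> y = y'"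
proof (induction arbitrary: y' rule: computes.induct)
  case (comp xs gs ys f z)
  obtain ys' where ys': "list_all2 (\<lambda>g y. computes g xs y) gs ys'" "computes f ys' y'"
    using comp.prems by cases blast
  have "ys = ys'"
    using comp.IH(1) ys'(1) by (auto simp: list_all2_conv_all_nth intro!: nth_equalityI)
  thus ?case using comp.IH(2) ys'(2) by simp
next
  case (mu f m xs)
  from mu.prems have m': "computes f (y' # xs) 0"
    "\<And>k. k < y' \<Longrightarrow> \<exists>y. computes f (k # xs) (Suc y)" by (rule computes_MuE, blast)+
  show ?case
  proof (rule linorder_cases[of m y'])
    assume "m < y'"
    then obtain y where "computes f (m # xs) (Suc y)" using m'(2) by blast
    hence "0 = Suc y" by (rule mu.IH(1))
    thus ?thesis by simp
  next
    assume "y' < m"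
    then obtain y where "\<forall>z. computes f (y' # xs) z \<longrightarrow> Suc y = z"
      using mu.IH(2) by blast
    thus ?thesis using m'(1) by blast
  qed simp
next
  case (prec_Suc f g k xs y z)
  from prec_Suc.prems obtain u where u: "computes (Prec f g) (k # xs) u"
    "computes g (k # u # xs) y'" by (rule computes_PrecSE)
  from prec_Suc.IH(1)[OF u(1)] have "y = u" .
  thus ?case using prec_Suc.IH(2) u(2) by simp
next
  case (prec_0 f xs y g)
  from prec_0.prems have "computes f xs y'" by (rule computes_Prec0E)
  thus ?case by (rule prec_0.IH)
next
  case (zero xs)
  thus ?case by (rule computes_ZeroE) simp
next
  case (succ x)
  thus ?case by (rule computes_SuccE) simp
next
  case (proj i xs)
  from proj.prems show ?case by (rule computes_ProjE) simp
qed


section \<open>Finitely presented groups\<close>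

text \<open>The letter \<open>(i, False)\<close> stands for the generator with index \<open>i\<close>, and \<open>(i, True)\<close> for its
  inverse. Generators are numbered from \<open>0\<close>.\<close>

type_synonym gword = "(nat \<times> bool) list"

definition gwords :: "nat \<Rightarrow> gword set" where
  "gwords n = {w. fst ` set w \<subseteq> {..<n}}"

inductive word_eq :: "nat \<Rightarrow> (gword \<times> gword) set \<Rightarrow> gword \<Rightarrow> gword \<Rightarrow> bool"
  for n R where
  refl: "w \<in> gwords n \<Longrightarrow> word_eq n R w w"
| sym: "word_eq n R u v \<Longrightarrow> word_eq n R v u"
| trans: "word_eq n R u v \<Longrightarrow> word_eq n R v w \<Longrightarrow> word_eq n R u w"
| cancel: "u @ v \<in> gwords n \<Longrightarrow> i < n \<Longrightarrow> word_eq n R (u @ [(i, b), (i, \<not> b)] @ v) (u @ v)"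
| rel: "(r, s) \<in> R \<Longrightarrow> u @ r @ v \<in> gwords n \<Longrightarrow> u @ s @ v \<in> gwords n \<Longrightarrow>
    word_eq n R (u @ r @ v) (u @ s @ v)"

definition word_class :: "nat \<Rightarrow> (gword \<times> gword) set \<Rightarrow> gword \<Rightarrow> gword set" where
  "word_class n R w = {u. word_eq n R w u}"

text \<open>The group \<open>\<langle>g\<^sub>0, \<dots>, g\<^bsub>n-1\<^esub> | r = s for (r, s) \<in> R\<rangle>\<close>.\<close>

definition presented_group :: "nat \<Rightarrow> (gword \<times> gword) set \<Rightarrow> gword set monoid" where
  "presented_group n R =
    \<lparr>carrier = word_class n R ` gwords n,
     monoid.mult = (\<lambda>A B. \<Union>u\<in>A. \<Union>v\<in>B. word_class n R (u @ v)),
     one = word_class n R []\<rparr>"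


section \<open>Composition length\<close>

definition composition_series :: "('a, 'b) monoid_scheme \<Rightarrow> 'a set list \<Rightarrow> bool" where
  "composition_series G Hs \<longleftrightarrow>
    Hs \<noteq> [] \<and> hd Hs = {\<one>\<^bsub>G\<^esub>} \<and> last Hs = carrier G \<and>
    (\<forall>H \<in> set Hs. subgroup H G) \<and>
    (\<forall>i. Suc i < length Hs \<longrightarrow>
      Hs ! i \<lhd> G\<lparr>carrier := Hs ! Suc i\<rparr> \<and>
      simple_group (G\<lparr>carrier := Hs ! Suc i\<rparr> Mod (Hs ! i)))"

definition has_composition_length :: "('a, 'b) monoid_scheme \<Rightarrow> nat \<Rightarrow> bool" where
  "has_composition_length G n \<longleftrightarrow> (\<exists>Hs. composition_series G Hs \<and> length Hs = Suc n)"


section \<open>Power-conjugate presentations\<close>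

text \<open>With generators \<open>g\<^sub>0, \<dots>, g\<^bsub>n-1\<^esub>\<close>, the right-hand side \<open>w\<^bsub>ij\<^esub>\<close> (\<open>i < j < n\<close>) of the conjugation
  relation is stored as \<open>conjs P ! i ! (j - Suc i)\<close>.\<close>

datatype pc_presentation =
  PC_Presentation (exps: "nat list") (powers: "gword list") (conjs: "gword list list")

definition pc_size :: "pc_presentation \<Rightarrow> nat" where
  "pc_size P = length (exps P)"

definition pc_presentation_wf :: "pc_presentation \<Rightarrow> bool" where
  "pc_presentation_wf P \<longleftrightarrow>
    (let n = pc_size P in
      length (powers P) = n \<and> length (conjs P) = n \<and>
      (\<forall>i < n.
        Factorial_Ring.prime (exps P ! i) \<and>
        fst ` set (powers P ! i) \<subseteq> {i<..<n} \<and>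
        length (conjs P ! i) = n - Suc i \<and>
        (\<forall>w \<in> set (conjs P ! i). fst ` set w \<subseteq> {i<..<n})))"

definition pc_relations :: "pc_presentation \<Rightarrow> (gword \<times> gword) set" where
  "pc_relations P =
    {(replicate (exps P ! i) (i, False), powers P ! i) | i. i < pc_size P} \<union>
    {([(i, True), (j, False), (i, False)], conjs P ! i ! (j - Suc i)) | i j. i < j \<and> j < pc_size P}"

definition pc_group :: "pc_presentation \<Rightarrow> gword set monoid" where
  "pc_group P = presented_group (pc_size P) (pc_relations P)"

definition pc_gen :: "pc_presentation \<Rightarrow> nat \<Rightarrow> gword set" where
  "pc_gen P i = word_class (pc_size P) (pc_relations P) [(i, False)]"

definition consistent_pc_presentation :: "pc_presentation \<Rightarrow> bool" where
  "consistent_pc_presentation P \<longleftrightarrow>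
    pc_presentation_wf P \<and> finite (carrier (pc_group P)) \<and>
    has_composition_length (pc_group P) (pc_size P)"


section \<open>Matrix representations over a field\<close>

text \<open>The field is a ring record rather than a type, as the prime \<open>\<ell>\<close>, and with it the field,
  varies inside the main statement. Only the container types for matrices and vectors
  are used, since their library arithmetic is tied to type classes.\<close>

definition mat_monoid :: "('k, 'b) ring_scheme \<Rightarrow> nat \<Rightarrow> 'k mat monoid" where
  "mat_monoid K d =
    \<lparr>carrier = {A \<in> carrier_mat d d. elements_mat A \<subseteq> carrier K},
     monoid.mult = (\<lambda>A B. mat d d (\<lambda>(i, j). \<Oplus>\<^bsub>K\<^esub>l \<in> {..<d}. A $$ (i, l) \<otimes>\<^bsub>K\<^esub> B $$ (l, j))),
     one = mat d d (\<lambda>(i, j). if i = j then \<one>\<^bsub>K\<^esub> else \<zero>\<^bsub>K\<^esub>)\<rparr>"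

definition GL :: "('k, 'b) ring_scheme \<Rightarrow> nat \<Rightarrow> 'k mat monoid" where
  "GL K d = units_of (mat_monoid K d)"

definition coord_space :: "('k, 'b) ring_scheme \<Rightarrow> nat \<Rightarrow> ('k, 'k vec) module" where
  "coord_space K d =
    \<lparr>carrier = {v \<in> carrier_vec d. \<forall>i < d. v $ i \<in> carrier K},
     monoid.mult = undefined, one = undefined,
     ring.zero = vec d (\<lambda>_. \<zero>\<^bsub>K\<^esub>),
     ring.add = (\<lambda>v w. vec d (\<lambda>i. v $ i \<oplus>\<^bsub>K\<^esub> w $ i)),
     module.smult = (\<lambda>a v. vec d (\<lambda>i. a \<otimes>\<^bsub>K\<^esub> v $ i))\<rparr>"

definition mat_apply :: "('k, 'b) ring_scheme \<Rightarrow> 'k mat \<Rightarrow> 'k vec \<Rightarrow> 'k vec" where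
  "mat_apply K A v = vec (dim_row A) (\<lambda>i. \<Oplus>\<^bsub>K\<^esub>j \<in> {..<dim_col A}. A $$ (i, j) \<otimes>\<^bsub>K\<^esub> v $ j)"

definition matrix_rep ::
  "('k, 'b) ring_scheme \<Rightarrow> ('g, 'c) monoid_scheme \<Rightarrow> nat \<Rightarrow> ('g \<Rightarrow> 'k mat) \<Rightarrow> bool" where
  "matrix_rep K G d \<sigma> \<longleftrightarrow> \<sigma> \<in> hom G (GL K d)"

definition equivalent_reps ::
  "('k, 'b) ring_scheme \<Rightarrow> ('g, 'c) monoid_scheme \<Rightarrow> nat \<Rightarrow> ('g \<Rightarrow> 'k mat) \<Rightarrow> ('g \<Rightarrow> 'k mat) \<Rightarrow> bool"
  where
  "equivalent_reps K G d \<sigma> \<tau> \<longleftrightarrow>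
    (\<exists>T \<in> carrier (GL K d). \<forall>g \<in> carrier G. \<tau> g = T \<otimes>\<^bsub>GL K d\<^esub> \<sigma> g \<otimes>\<^bsub>GL K d\<^esub> inv\<^bsub>GL K d\<^esub> T)"

definition irreducible_rep ::
  "('k, 'b) ring_scheme \<Rightarrow> ('g, 'c) monoid_scheme \<Rightarrow> nat \<Rightarrow> ('g \<Rightarrow> 'k mat) \<Rightarrow> bool" where
  "irreducible_rep K G d \<sigma> \<longleftrightarrow>
    matrix_rep K G d \<sigma> \<and> 0 < d \<and>
    (\<forall>W. submodule W K (coord_space K d) \<and>
         (\<forall>g \<in> carrier G. \<forall>v \<in> W. mat_apply K (\<sigma> g) v \<in> W) \<longrightarrow>
         W = {\<zero>\<^bsub>coord_space K d\<^esub>} \<or> W = carrier (coord_space K d))"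

text \<open>Irreducible over every extension field \<open>h : K \<rightarrow> L\<close>. Extensions carried by the
  element type of \<open>K\<close> suffice when \<open>K\<close> is infinite, in particular when it is algebraically closed:
  a proper invariant subspace over any extension is defined over one that is finitely
  generated over \<open>K\<close>, and that one has the cardinality of \<open>K\<close>.\<close>

definition absolutely_irreducible_rep ::
  "'k ring \<Rightarrow> ('g, 'c) monoid_scheme \<Rightarrow> nat \<Rightarrow> ('g \<Rightarrow> 'k mat) \<Rightarrow> bool" where
  "absolutely_irreducible_rep K G d \<sigma> \<longleftrightarrow>
    matrix_rep K G d \<sigma> \<and>
    (\<forall>(L :: 'k ring) h. field L \<and> h \<in> Ring.ring_hom K L \<longrightarrow>
      irreducible_rep L G d (\<lambda>g. map_mat h (\<sigma> g)))"

definition entries_in ::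
  "('g, 'c) monoid_scheme \<Rightarrow> ('g \<Rightarrow> 'k mat) \<Rightarrow> 'k set \<Rightarrow> bool" where
  "entries_in G \<sigma> F \<longleftrightarrow> (\<forall>g \<in> carrier G. elements_mat (\<sigma> g) \<subseteq> F)"

definition realizable_over ::
  "('k, 'b) ring_scheme \<Rightarrow> ('g, 'c) monoid_scheme \<Rightarrow> nat \<Rightarrow> ('g \<Rightarrow> 'k mat) \<Rightarrow> 'k set \<Rightarrow> bool" where
  "realizable_over K G d \<sigma> F \<longleftrightarrow>
    (\<exists>\<tau>. matrix_rep K G d \<tau> \<and> equivalent_reps K G d \<sigma> \<tau> \<and> entries_in G \<tau> F)"

definition is_minimal_field ::
  "('k, 'b) ring_scheme \<Rightarrow> ('g, 'c) monoid_scheme \<Rightarrow> nat \<Rightarrow> ('g \<Rightarrow> 'k mat) \<Rightarrow> 'k set \<Rightarrow> bool" where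
  "is_minimal_field K G d \<sigma> F \<longleftrightarrow>
    subfield F K \<and> realizable_over K G d \<sigma> F \<and>
    (\<forall>F'. subfield F' K \<and> realizable_over K G d \<sigma> F' \<and> F' \<subseteq> F \<longrightarrow> F' = F)"

definition written_over_minimal_field ::
  "('k, 'b) ring_scheme \<Rightarrow> ('g, 'c) monoid_scheme \<Rightarrow> nat \<Rightarrow> ('g \<Rightarrow> 'k mat) \<Rightarrow> bool" where
  "written_over_minimal_field K G d \<sigma> \<longleftrightarrow>
    (\<exists>!F. is_minimal_field K G d \<sigma> F) \<and>
    entries_in G \<sigma> (THE F. is_minimal_field K G d \<sigma> F)"

text \<open>A list entry \<open>(d, \<sigma>)\<close> is a representation \<open>\<sigma>\<close> together with its degree.\<close>

definition full_set_of_reps ::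
  "'k ring \<Rightarrow> ('g, 'c) monoid_scheme \<Rightarrow> (nat \<times> ('g \<Rightarrow> 'k mat)) list \<Rightarrow> bool" where
  "full_set_of_reps K G \<sigma>s \<longleftrightarrow>
    (\<forall>(d, \<sigma>) \<in> set \<sigma>s.
      absolutely_irreducible_rep K G d \<sigma> \<and> written_over_minimal_field K G d \<sigma>) \<and>
    (\<forall>d \<tau>. absolutely_irreducible_rep K G d \<tau> \<longrightarrow>
      (\<exists>!i. i < length \<sigma>s \<and> fst (\<sigma>s ! i) = d \<and> equivalent_reps K G d \<tau> (snd (\<sigma>s ! i))))"


section \<open>Input and output data\<close>

definition encode_gword :: "gword \<Rightarrow> nat" where
  "encode_gword w = list_encode (map (\<lambda>(i, b). prod_encode (i, if b then 1 else 0)) w)"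

definition encode_input :: "nat \<Rightarrow> pc_presentation \<Rightarrow> nat" where
  "encode_input l P =
    prod_encode (l,
    prod_encode (list_encode (exps P),
    prod_encode (list_encode (map encode_gword (powers P)),
      list_encode (map (\<lambda>ws. list_encode (map encode_gword ws)) (conjs P)))))"

text \<open>An output \<open>(f, reps)\<close> consists of a polynomial \<open>f\<close>, irreducible over the prime field, and of a
  list of pairs \<open>(d, Ms)\<close>, with \<open>Ms\<close> the list of \<open>d \<times> d\<close> matrices (lists of rows) representing the
  generators. A polynomial over the prime field is a list of natural numbers, reduced
  modulo \<open>\<ell>\<close>, with leading coefficient first. A matrix entry is a polynomial in a root of \<open>f\<close>. One
  \<open>f\<close> serves all the representations: with unrelated roots for different representations, their
  equivalence over \<open>K\<close> would depend on how these roots are chosen.\<close>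

type_synonym field_elem = "nat list"
type_synonym matrix_data = "field_elem list list"
type_synonym rep_data = "nat \<times> matrix_data list"

definition encode_matrix :: "matrix_data \<Rightarrow> nat" where
  "encode_matrix M = list_encode (map (\<lambda>row. list_encode (map list_encode row)) M)"

definition encode_rep :: "rep_data \<Rightarrow> nat" where
  "encode_rep = (\<lambda>(d, Ms). prod_encode (d, list_encode (map encode_matrix Ms)))"

definition encode_output :: "nat list \<Rightarrow> rep_data list \<Rightarrow> nat" where
  "encode_output f reps = prod_encode (list_encode f, list_encode (map encode_rep reps))"

definition poly_over :: "('k, 'b) ring_scheme \<Rightarrow> nat list \<Rightarrow> 'k list" where
  "poly_over K p = map (\<lambda>c. [c] \<cdot>\<^bsub>K\<^esub> \<one>\<^bsub>K\<^esub>) p"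

definition elem_at :: "('k, 'b) ring_scheme \<Rightarrow> 'k \<Rightarrow> field_elem \<Rightarrow> 'k" where
  "elem_at K \<alpha> e = ring.eval K (poly_over K e) \<alpha>"

definition matrix_at :: "('k, 'b) ring_scheme \<Rightarrow> 'k \<Rightarrow> nat \<Rightarrow> matrix_data \<Rightarrow> 'k mat" where
  "matrix_at K \<alpha> d M = mat d d (\<lambda>(i, j). elem_at K \<alpha> (M ! i ! j))"

text \<open>The matrices of \<open>(d, Ms)\<close>, evaluated at the root \<open>\<alpha>\<close>, are the images of the generators
  under \<open>\<sigma>\<close>.\<close>

definition rep_data_denotes ::
  "('k, 'b) ring_scheme \<Rightarrow> 'k \<Rightarrow> pc_presentation \<Rightarrow> rep_data \<Rightarrow> nat \<times> (gword set \<Rightarrow> 'k mat) \<Rightarrow> bool"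
  where
  "rep_data_denotes K \<alpha> P = (\<lambda>(d, Ms) (e, \<sigma>).
    e = d \<and> length Ms = pc_size P \<and>
    (\<forall>M \<in> set Ms. length M = d \<and> (\<forall>row \<in> set M. length row = d)) \<and>
    (\<forall>j < pc_size P. \<sigma> (pc_gen P j) = matrix_at K \<alpha> d (Ms ! j)))"

definition correct_output ::
  "'k ring \<Rightarrow> 'k set \<Rightarrow> pc_presentation \<Rightarrow> nat list \<Rightarrow> rep_data list \<Rightarrow> bool" where
  "correct_output K k0 P f reps \<longleftrightarrow>
    poly_over K f \<in> carrier (univ_poly K k0) \<and> pirreducible\<^bsub>K\<^esub> k0 (poly_over K f) \<and>
    (\<forall>\<alpha> \<in> carrier K. ring.eval K (poly_over K f) \<alpha> = \<zero>\<^bsub>K\<^esub> \<longrightarrow>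
      (\<exists>\<sigma>s. list_all2 (rep_data_denotes K \<alpha> P) reps \<sigma>s \<and> full_set_of_reps K (pc_group P) \<sigma>s))"

end

theory Submission
  imports Defs "HOL-Number_Theory.Cong" "HOL-Number_Theory.Residues"
begin

text \<open>
  The program searches through all numbers for a certificate and computes its output from the first one
  that it finds (\<open>search_program\<close>). It remains to describe certificates that a program can check, that
  exist for every admissible input, and that guarantee a correct output over every
  algebraic closure.

  A certificate has three parts. The first shows that the presented group is a given finite
  multiplication table: it lists a word for every element, derivations of the multiplication table from the
  relations, and the fact that the relations hold for right multiplication in the table
  (\<open>group_cert_sound\<close>, \<open>group_cert_exists\<close>). The second is a monic polynomial over the prime field modulo
  which every nonzero residue is invertible, so that vectors of digits modulo \<open>l\<close> form a finite
  field that embeds into every algebraic closure (\<open>dfield_irreducible\<close>, \<open>dfield_exists\<close>). The third consists of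
  matrices over this field together with the following evidence (\<open>good_def\<close>). Every matrix unit is a combination
  of the representing matrices, which makes the representation irreducible over every extension. It is fixed by
  the Frobenius map of exponent \<open>e\<close> and inequivalent to its twists by smaller exponents, which makes the
  fixed field the minimal field (\<open>minrep_field\<close>). Different representations are inequivalent, by an element of
  the group algebra that one kills and the other does not. Finally the regular
  module has a composition series with constituents in the list, so that every irreducible
  representation, being a quotient of the regular module, occurs (\<open>chain_complete\<close>).

  That certificates exist is the representation theory. Over an algebraically closed field Burnside's theorem
  gives the matrix units (\<open>burnside\<close>), and with them inequivalence has witnesses in the group algebra
  (\<open>kernel_inclusion_eqv\<close>). A representation that is equivalent to its Frobenius twist can be
  written over the fixed field, because a semilinear bijection fixes a nonzero vector
  (\<open>frobenius_descent\<close>). A composition series of the regular module is built step by step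
  (\<open>composition_series\<close>). All entries of the certificate lie in a finite subfield, hence are given by digit
  vectors, and the conditions are preserved and reflected by the embedding of the digits
  (\<open>good_transfer\<close>). Vectors and matrices are functions on natural numbers, in order that the dimensions
  may vary inside the proofs and that all conditions become finite sums over initial segments.
\<close>

section \<open>Computable functions on coded types\<close>

subsection \<open>Programs on natural numbers\<close>

text \<open>Only total functions occur below, except for the final unbounded search, so programs are composed as total
  functions on argument lists of fixed length.\<close>

definition total_rec :: "nat => (nat list => nat) => bool" where
  "total_rec n F \<longleftrightarrow> (\<exists>r. \<forall>xs. length xs = n --> computes r xs (F xs))"

lemma total_rec_cong:
  "total_rec n F ==> (!!xs. length xs = n ==> F xs = G xs) ==> total_rec n G"
  unfolding total_rec_def by metis

lemma total_rec_proj: "i < n ==> total_rec n (%xs. xs ! i)"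
  unfolding total_rec_def by (metis computes.proj)

lemma total_rec_comp:
  assumes F: "total_rec (length Gs) F" and G: "\<forall>G \<in> set Gs. total_rec n G"
  shows "total_rec n (%xs. F (map (%G. G xs) Gs))"
proof -
  obtain f where f: "!!xs. length xs = length Gs ==> computes f xs (F xs)"
    using F unfolding total_rec_def by blast
  obtain g where g: "!!G xs. G \<in> set Gs ==> length xs = n ==> computes (g G) xs (G xs)"
    using G unfolding total_rec_def by metis
  have "computes (Comp f (map g Gs)) xs (F (map (%G. G xs) Gs))" if "length xs = n" for xs
    by (rule computes.comp[where ys = "map (%G. G xs) Gs"])
      (auto simp: list_all2_conv_all_nth f g that)
  thus ?thesis unfolding total_rec_def by blast
qed

lemma total_rec_comp1:
  "total_rec 1 (%xs. f (xs ! 0)) ==> total_rec n G ==> total_rec n (%xs. f (G xs))"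
  using total_rec_comp[of "[G]" "%xs. f (xs ! 0)" n] by simp

lemma total_rec_comp2:
  "total_rec 2 (%xs. f (xs ! 0) (xs ! 1)) ==> total_rec n G ==> total_rec n H ==>
    total_rec n (%xs. f (G xs) (H xs))"
  using total_rec_comp[of "[G, H]" "%xs. f (xs ! 0) (xs ! 1)" n] by (simp add: numeral_2_eq_2)

lemma total_rec_Suc: "total_rec 1 (%xs. Suc (xs ! 0))"
  unfolding total_rec_def
proof (intro exI allI impI)
  fix xs :: "nat list" assume "length xs = 1"
  then obtain x where "xs = [x]" by (auto simp: length_Suc_conv)
  thus "computes Succ xs (Suc (xs ! 0))" by (simp add: computes.succ)
qed

lemma total_rec_const: "total_rec n (%_. c)"
proof (induction c)
  case 0
  show ?case unfolding total_rec_def by (metis computes.zero)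
next
  case (Suc c)
  show ?case by (rule total_rec_comp1[OF total_rec_Suc Suc])
qed

lemma total_rec_rec_nat:
  assumes B: "total_rec n B" and S: "total_rec (Suc (Suc n)) (%xs. H (xs ! 0) (xs ! 1) (tl (tl xs)))"
  shows "total_rec (Suc n) (%xs. rec_nat (B (tl xs)) (%k y. H k y (tl xs)) (hd xs))"
proof -
  obtain b where b: "!!xs. length xs = n ==> computes b xs (B xs)"
    using B unfolding total_rec_def by blast
  obtain h where h: "!!xs. length xs = Suc (Suc n) ==> computes h xs (H (xs ! 0) (xs ! 1) (tl (tl xs)))"
    using S unfolding total_rec_def by blast
  have *: "computes (Prec b h) (k # xs) (rec_nat (B xs) (%k y. H k y xs) k)" if "length xs = n" for k xs
  proof (induction k)
    case 0
    show ?case using computes.prec_0[OF b[OF that]] by simp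
  next
    case (Suc k)
    have "computes h (k # y # xs) (H k y xs)" for y using h[of "k # y # xs"] that by simp
    thus ?case using computes.prec_Suc[OF Suc] by simp
  qed
  have "computes (Prec b h) xs (rec_nat (B (tl xs)) (%k y. H k y (tl xs)) (hd xs))"
    if "length xs = Suc n" for xs
    using that *[of "tl xs" "hd xs"] by (cases xs) auto
  thus ?thesis unfolding total_rec_def by blast
qed

lemma computes_search:
  assumes f: "!!m. computes f (m # xs) (F m)" and ex: "\<exists>m. F m = 0"
  shows "computes (Mu f) xs (LEAST m. F m = 0)"
proof (rule computes.mu)
  show "computes f ((LEAST m. F m = 0) # xs) 0"
    using f[of "LEAST m. F m = 0"] LeastI_ex[OF ex] by simp
  show "\<exists>y. computes f (k # xs) (Suc y)" if "k < (LEAST m. F m = 0)" for k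
    using f[of k] not_less_Least[OF that] by (cases "F k") auto
qed

lemma total_rec_search:
  assumes F: "total_rec (Suc n) F" and ex: "!!xs. length xs = n ==> \<exists>m. F (m # xs) = 0"
  shows "total_rec n (%xs. LEAST m. F (m # xs) = 0)"
proof -
  obtain f where f: "!!xs. length xs = Suc n ==> computes f xs (F xs)"
    using F unfolding total_rec_def by blast
  have "computes (Mu f) xs (LEAST m. F (m # xs) = 0)" if "length xs = n" for xs
    by (rule computes_search) (use f that ex in auto)
  thus ?thesis unfolding total_rec_def by blast
qed

lemma two_args: "length xs = 2 ==> \<exists>x y. xs = [x, y]" for xs :: "'a list"
  by (auto simp: length_Suc_conv numeral_2_eq_2)

lemma one_arg: "length xs = 1 ==> \<exists>x. xs = [x]" for xs :: "'a list"
  by (auto simp: length_Suc_conv)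

lemma total_rec_rec2:
  assumes "total_rec 1 (%xs. b (xs ! 0))" "total_rec 3 (%xs. h (xs ! 0) (xs ! 1) (xs ! 2))"
  shows "total_rec 2 (%xs. rec_nat (b (xs ! 1)) (%k y. h k y (xs ! 1)) (xs ! 0))"
proof -
  have "total_rec 2 (%xs. rec_nat (b (tl xs ! 0)) (%k y. h k y (tl xs ! 0)) (hd xs))"
    unfolding numeral_2_eq_2
  proof (rule total_rec_rec_nat[where B = "%xs. b (xs ! 0)" and H = "%k y xs. h k y (xs ! 0)"])
    show "total_rec (Suc 0) (%xs. b (xs ! 0))" using assms(1) by simp
    show "total_rec (Suc (Suc (Suc 0))) (%xs. h (xs ! 0) (xs ! 1) (tl (tl xs) ! 0))"
      unfolding numeral_3_eq_3[symmetric]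
      by (rule total_rec_cong[OF assms(2)]) (auto simp: length_Suc_conv numeral_3_eq_3)
  qed
  thus ?thesis by (rule total_rec_cong) (auto dest!: two_args)
qed

lemma total_rec_rec1:
  assumes "total_rec 2 (%xs. h (xs ! 0) (xs ! 1))"
  shows "total_rec 1 (%xs. rec_nat b h (xs ! 0))"
proof -
  have "total_rec 2 (%xs. rec_nat b h (xs ! 0))"
    by (rule total_rec_rec2[where h = "%k y _. h k y"])
      (rule total_rec_const, rule total_rec_comp2[OF assms total_rec_proj total_rec_proj], simp_all)
  from total_rec_comp[of "[%xs. xs ! 0, %xs. 0]" _ 1, OF _, of "%xs. rec_nat b h (xs ! 0)"] this
  show ?thesis by (simp add: total_rec_proj total_rec_const numeral_2_eq_2)
qed

lemma total_rec_plus: "total_rec 2 (%xs. xs ! 0 + xs ! 1)"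
proof (rule total_rec_cong)
  show "total_rec 2 (%xs. rec_nat (xs ! 1) (%k y. Suc y) (xs ! 0))"
    by (rule total_rec_rec2[where b = "%x. x" and h = "%k y x. Suc y"])
      (intro total_rec_proj total_rec_comp1[OF total_rec_Suc]; simp)+
  have "rec_nat y (%k y. Suc y) x = x + y" for x y by (induction x) auto
  thus "rec_nat (xs ! 1) (%k y. Suc y) (xs ! 0) = xs ! 0 + xs ! 1" for xs by simp
qed

lemma total_rec_pred: "total_rec 1 (%xs. xs ! 0 - 1)"
proof (rule total_rec_cong)
  show "total_rec 1 (%xs. rec_nat 0 (%k y. k) (xs ! 0))"
    by (rule total_rec_rec1) (rule total_rec_proj, simp)
  have "rec_nat 0 (%k y. k) x = x - 1" for x by (cases x) auto
  thus "rec_nat 0 (%k y. k) (xs ! 0) = xs ! 0 - 1" for xs by simp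
qed

lemma total_rec_minus: "total_rec 2 (%xs. xs ! 0 - xs ! 1)"
proof -
  have "total_rec 2 (%xs. rec_nat (xs ! 1) (%k y. y - 1) (xs ! 0))"
    by (rule total_rec_rec2[where b = "%x. x" and h = "%k y x. y - 1"])
      (intro total_rec_proj total_rec_comp1[OF total_rec_pred]; simp)+
  moreover have "rec_nat y (%k y. y - 1) x = y - x" for x y :: nat by (induction x) auto
  ultimately have "total_rec 2 (%xs. xs ! 1 - xs ! 0)" by simp
  from total_rec_comp2[where f = "%x y. y - x", OF this, of 2 "%xs. xs ! 1" "%xs. xs ! 0"] show ?thesis
    by (simp add: total_rec_proj)
qed

lemma total_rec_triangle: "total_rec 1 (%xs. triangle (xs ! 0))"
proof (rule total_rec_cong)
  show "total_rec 1 (%xs. rec_nat 0 (%k y. y + Suc k) (xs ! 0))"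
    by (rule total_rec_rec1, rule total_rec_comp2[OF total_rec_plus])
      (intro total_rec_proj total_rec_comp1[OF total_rec_Suc]; simp)+
  have "rec_nat 0 (%k y. y + Suc k) x = triangle x" for x by (induction x) auto
  thus "rec_nat 0 (%k y. y + Suc k) (xs ! 0) = triangle (xs ! 0)" for xs by simp
qed

lemma total_rec_prod_encode: "total_rec 2 (%xs. prod_encode (xs ! 0, xs ! 1))"
  unfolding prod_encode_def prod.case
  by (rule total_rec_comp2[where f = "%x y. x + y", OF total_rec_plus]
      total_rec_comp1[where f = triangle, OF total_rec_triangle] total_rec_proj | simp)+

text \<open>The sum of the two components of a pair is the least \<open>s\<close> for which the next triangular number exceeds
  the code of the pair.\<close>

lemma prod_encode_sum:
  "(LEAST s. Suc (prod_encode (a, b)) - triangle (Suc s) = 0) = a + b"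
proof (rule Least_equality)
  show "Suc (prod_encode (a, b)) - triangle (Suc (a + b)) = 0"
    by (simp add: prod_encode_def)
  fix s assume "Suc (prod_encode (a, b)) - triangle (Suc s) = 0"
  hence *: "triangle (a + b) < triangle (Suc s)"
    unfolding prod_encode_def by (simp del: triangle_Suc)
  have mono: "x \<le> y ==> triangle x \<le> triangle y" for x y
    by (induction y) (auto simp: le_Suc_eq)
  show "a + b \<le> s"
    using * mono[of "Suc s" "a + b"] by (rule_tac ccontr) (simp del: triangle_Suc)
qed

lemma total_rec_decode_sum: "total_rec 1 (%xs. fst (prod_decode (xs ! 0)) + snd (prod_decode (xs ! 0)))"
proof (rule total_rec_cong)
  show "total_rec 1 (%xs. LEAST m. Suc ((m # xs) ! 1) - triangle (Suc ((m # xs) ! 0)) = 0)"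
  proof (rule total_rec_search)
    show "total_rec (Suc 1) (%xs. Suc (xs ! 1) - triangle (Suc (xs ! 0)))"
      by (rule total_rec_comp2[where f = "%x y. x - y", OF total_rec_minus]
          total_rec_comp1[where f = triangle, OF total_rec_triangle]
          total_rec_comp1[where f = Suc, OF total_rec_Suc] total_rec_proj | simp)+
    have "x \<le> triangle x" for x by (induction x) auto
    thus "\<exists>m. Suc ((m # xs) ! 1) - triangle (Suc ((m # xs) ! 0)) = 0" for xs
      by (auto simp del: triangle_Suc intro!: exI[of _ "xs ! 0"])
  qed
  show "(LEAST m. Suc ((m # xs) ! 1) - triangle (Suc ((m # xs) ! 0)) = 0) =
      fst (prod_decode (xs ! 0)) + snd (prod_decode (xs ! 0))" for xs
    using prod_encode_sum[of "fst (prod_decode (xs ! 0))" "snd (prod_decode (xs ! 0))"]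
    by (simp del: triangle_Suc)
qed

lemma total_rec_decode_fst: "total_rec 1 (%xs. fst (prod_decode (xs ! 0)))"
proof (rule total_rec_cong)
  show "total_rec 1 (%xs. xs ! 0 - triangle (fst (prod_decode (xs ! 0)) + snd (prod_decode (xs ! 0))))"
    by (rule total_rec_comp2[where f = "%x y. x - y", OF total_rec_minus])
      (rule total_rec_comp1[where f = triangle, OF total_rec_triangle] total_rec_proj total_rec_decode_sum | simp)+
  show "xs ! 0 - triangle (fst (prod_decode (xs ! 0)) + snd (prod_decode (xs ! 0))) = fst (prod_decode (xs ! 0))" for xs
  proof -
    obtain a b where "xs ! 0 = prod_encode (a, b)" by (metis prod_decode_inverse surj_pair)
    thus ?thesis by (simp, simp add: prod_encode_def)
  qed
qed

lemma total_rec_decode_snd: "total_rec 1 (%xs. snd (prod_decode (xs ! 0)))"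
proof (rule total_rec_cong)
  show "total_rec 1 (%xs. fst (prod_decode (xs ! 0)) + snd (prod_decode (xs ! 0)) - fst (prod_decode (xs ! 0)))"
    by (rule total_rec_comp2[where f = "%x y. x - y", OF total_rec_minus total_rec_decode_sum total_rec_decode_fst])
qed simp

subsection \<open>Coded types\<close>

text \<open>With bijective codes every number is a certificate, so unbounded minimisation searches through all
  certificates.\<close>

class coded =
  fixes code :: "'a => nat"
  assumes bij_code: "bij code"

lemma code_inject [simp]: "code x = code y \<longleftrightarrow> x = y"
  using bij_code by (auto simp: bij_def inj_def)

lemma code_surj: obtains x :: "'a :: coded" where "code x = n"
  using bij_code[where 'a = 'a] unfolding bij_def surj_def by metis

instantiation nat :: coded
begin
definition code_nat :: "nat => nat" where "code_nat n = n"
instance by standard (simp add: code_nat_def[abs_def] bij_id[unfolded id_def])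
end

instantiation prod :: (coded, coded) coded
begin
definition code_prod :: "'a \<times> 'b => nat" where "code_prod p = prod_encode (code (fst p), code (snd p))"
instance
proof (standard, rule bijI)
  show "inj (code :: 'a \<times> 'b => nat)"
    by (rule injI) (simp add: code_prod_def prod_eq_iff)
  show "surj (code :: 'a \<times> 'b => nat)"
  proof (rule surjI)
    fix n
    obtain a :: 'a where a: "code a = fst (prod_decode n)" by (rule code_surj)
    obtain b :: 'b where b: "code b = snd (prod_decode n)" by (rule code_surj)
    have "\<exists>p :: 'a \<times> 'b. code p = n" by (rule exI[of _ "(a, b)"]) (simp add: code_prod_def a b)
    thus "code (SOME p :: 'a \<times> 'b. code p = n) = n" by (rule someI_ex)
  qed
qed
end

instantiation list :: (coded) coded
begin
definition code_list :: "'a list => nat" where "code_list xs = list_encode (map code xs)"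
instance
proof (standard, rule bijI)
  show "inj (code :: 'a list => nat)"
    by (rule injI) (metis code_list_def list_encode_eq inj_map_eq_map inj_def code_inject)
  show "surj (code :: 'a list => nat)"
  proof (rule surjI)
    fix n
    have "list_decode n \<in> lists (range (code :: 'a => nat))"
      using bij_code[where 'a = 'a] by (simp add: bij_def)
    then obtain xs where "list_decode n = map (code :: 'a => nat) xs" by (auto simp: lists_image)
    hence "code xs = n" by (metis code_list_def list_decode_inverse)
    hence "\<exists>xs :: 'a list. code xs = n" by blast
    thus "code (SOME xs :: 'a list. code xs = n) = n" by (rule someI_ex)
  qed
qed
end

lemma code_Nil [simp]: "code [] = 0"
  by (simp add: code_list_def)

lemma code_Cons [simp]: "code (x # xs) = Suc (prod_encode (code x, code xs))"
  by (simp add: code_list_def)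

lemma length_le_code: "length xs \<le> code xs"
proof (induction xs)
  case (Cons x xs)
  have "code xs \<le> prod_encode (code x, code xs)" by (rule le_prod_encode_2)
  with Cons show ?case by simp
qed simp

definition computable :: "('a :: coded => 'b :: coded) => bool" where
  "computable f \<longleftrightarrow> (\<exists>r. \<forall>x. computes r [code x] (code (f x)))"

definition dec :: "('a :: coded => bool) => bool" where
  "dec P \<longleftrightarrow> computable (%x. if P x then 1 else (0 :: nat))"

lemma computableI:
  assumes "total_rec 1 (%xs. F (xs ! 0))" "!!x. F (code x) = code (f x)"
  shows "computable f"
proof -
  obtain r where r: "!!xs. length xs = 1 ==> computes r xs (F (xs ! 0))"
    using assms(1) unfolding total_rec_def by blast
  have "computes r [code x] (code (f x))" for x using r[of "[code x]"] assms(2)[of x] by simp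
  thus ?thesis unfolding computable_def by blast
qed

lemma computableD:
  fixes f :: "'a :: coded => 'b :: coded"
  assumes "computable f"
  obtains F where "total_rec 1 (%xs. F (xs ! 0))" "!!x. F (code x) = code (f x)"
proof -
  obtain r where r: "!!x. computes r [code x] (code (f x))" using assms unfolding computable_def by blast
  define F where "F n = code (f (inv_into UNIV code n))" for n
  have F: "F (code x) = code (f x)" for x using bij_code[where 'a = 'a] by (simp add: F_def bij_def)
  have "computes r xs (F (xs ! 0))" if "length xs = 1" for xs
  proof -
    from one_arg[OF \<open>length xs = 1\<close>] obtain n where xs: "xs = [n]" by blast
    obtain x :: 'a where "code x = n" by (rule code_surj)
    thus ?thesis using r[of x] F xs by auto
  qed
  hence "total_rec 1 (%xs. F (xs ! 0))" unfolding total_rec_def by blast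
  thus ?thesis using that F by blast
qed

lemma comp_id: "computable (%x. x)"
  by (rule computableI[where F = "%n. n"]) (simp_all add: total_rec_proj)

lemma comp_const: "computable (%x. c)"
  by (rule computableI[where F = "%n. code c"]) (simp_all add: total_rec_const)

lemma comp_comp:
  assumes "computable f" "computable g"
  shows "computable (%x. f (g x))"
proof -
  obtain F where F: "total_rec 1 (%xs. F (xs ! 0))" "!!x. F (code x) = code (f x)"
    using computableD[OF assms(1)] by blast
  obtain G where G: "total_rec 1 (%xs. G (xs ! 0))" "!!x. G (code x) = code (g x)"
    using computableD[OF assms(2)] by blast
  show ?thesis by (rule computableI[where F = "%n. F (G n)", OF total_rec_comp1[where f = F, OF F(1) G(1)]]) (simp add: F(2) G(2))
qed

lemma comp_code1:
  assumes "total_rec 1 (%xs. F (xs ! 0))" "!!x. F (code x) = code (f x)" "computable g"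
  shows "computable (%x. f (g x))"
  by (rule comp_comp[OF computableI[OF assms(1,2)] assms(3)])

lemma comp_code2:
  assumes "total_rec 2 (%xs. F (xs ! 0) (xs ! 1))" "!!x y. F (code x) (code y) = code (f x y)"
    "computable g" "computable h"
  shows "computable (%x. f (g x) (h x))"
proof -
  obtain G where G: "total_rec 1 (%xs. G (xs ! 0))" "!!x. G (code x) = code (g x)"
    using computableD[OF assms(3)] by blast
  obtain H where H: "total_rec 1 (%xs. H (xs ! 0))" "!!x. H (code x) = code (h x)"
    using computableD[OF assms(4)] by blast
  show ?thesis
    by (rule computableI[where F = "%n. F (G n) (H n)", OF total_rec_comp2[where f = F, OF assms(1) G(1) H(1)]]) (simp add: G(2) H(2) assms(2))
qed

lemma comp_Pair: "computable f ==> computable g ==> computable (%x. (f x, g x))"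
  by (rule comp_code2[where F = "%a b. prod_encode (a, b)" and f = Pair, OF total_rec_prod_encode]) (simp_all add: code_prod_def)

lemma comp_fst: "computable f ==> computable (%x. fst (f x))"
  by (rule comp_code1[where F = "%n. fst (prod_decode n)" and f = fst, OF total_rec_decode_fst]) (simp_all add: code_prod_def)

lemma comp_snd: "computable f ==> computable (%x. snd (f x))"
  by (rule comp_code1[where F = "%n. snd (prod_decode n)" and f = snd, OF total_rec_decode_snd]) (simp_all add: code_prod_def)

lemma comp_Suc: "computable f ==> computable (%x. Suc (f x))"
  by (rule comp_code1[where F = Suc and f = Suc, OF total_rec_Suc]) (simp_all add: code_nat_def)

lemma comp_plus: "computable f ==> computable g ==> computable (%x. f x + g x :: nat)"
  by (rule comp_code2[where F = "(+)" and f = "(+)", OF total_rec_plus]) (simp_all add: code_nat_def)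

lemma comp_minus: "computable f ==> computable g ==> computable (%x. f x - g x :: nat)"
  by (rule comp_code2[where F = "(-)" and f = "(-)", OF total_rec_minus]) (simp_all add: code_nat_def)

lemma comp_Cons: "computable f ==> computable g ==> computable (%x. f x # g x)"
proof (rule comp_code2[where F = "%a b. Suc (prod_encode (a, b))" and f = "%x xs. x # xs"])
  show "total_rec 2 (%xs. Suc (prod_encode (xs ! 0, xs ! 1)))"
    by (rule total_rec_comp1[OF total_rec_Suc total_rec_prod_encode])
qed simp_all

lemma comp_rec_nat:
  assumes b: "computable b" and s: "computable (%p. s (fst p) (fst (snd p)) (snd (snd p)))"
    and n: "computable n"
  shows "computable (%x. rec_nat (b x) (%k y. s x k y) (n x))"
proof -
  obtain B where B: "total_rec 1 (%xs. B (xs ! 0))" "!!x. B (code x) = code (b x)"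
    using computableD[OF b] by blast
  obtain S where S: "total_rec 1 (%xs. S (xs ! 0))"
    "!!p. S (code p) = code (s (fst p) (fst (snd p)) (snd (snd p)))"
    using computableD[OF s] by blast
  obtain N where N: "total_rec 1 (%xs. N (xs ! 0))" "!!x. N (code x) = code (n x)"
    using computableD[OF n] by blast
  let ?H = "%k y x. S (prod_encode (x, prod_encode (k, y)))"
  have "total_rec 3 (%xs. ?H (xs ! 0) (xs ! 1) (xs ! 2))"
    by (rule total_rec_comp1[OF S(1)] total_rec_comp2[where f = "%x y. prod_encode (x, y)", OF total_rec_prod_encode]
        total_rec_proj | simp)+
  from total_rec_rec2[OF B(1) this]
  have "total_rec 1 (%xs. rec_nat (B (xs ! 0)) (%k y. ?H k y (xs ! 0)) (N (xs ! 0)))"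
    by (rule total_rec_comp2[where f = "%n x. rec_nat (B x) (%k y. ?H k y x) n"]) (rule N(1), rule total_rec_proj, simp)
  thus ?thesis
  proof (rule computableI)
    fix x
    have "rec_nat (B (code x)) (%k y. ?H k y (code x)) m = code (rec_nat (b x) (%k y. s x k y) m)" for m
    proof (induction m)
      case (Suc m)
      have "prod_encode (code x, prod_encode (m, code (rec_nat (b x) (s x) m))) = code (x, m, rec_nat (b x) (s x) m)"
        by (simp add: code_prod_def code_nat_def)
      thus ?case using S(2)[of "(x, m, rec_nat (b x) (s x) m)"] Suc by simp
    qed (simp add: B(2))
    thus "rec_nat (B (code x)) (%k y. ?H k y (code x)) (N (code x)) = code (rec_nat (b x) (s x) (n x))"
      by (simp add: N(2) code_nat_def)
  qed
qed

lemma comp_If: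
  assumes P: "dec P" and f: "computable f" and g: "computable g"
  shows "computable (%x. if P x then f x else g x)"
proof -
  have "computable (%x. rec_nat (g x) (%k y. f x) (if P x then 1 else 0))"
    by (rule comp_rec_nat[OF g _ P[unfolded dec_def]]) (rule comp_comp[OF f comp_fst[OF comp_id]])
  moreover have "rec_nat (g x) (%k y. f x) (if P x then 1 else 0) = (if P x then f x else g x)" for x by simp
  ultimately show ?thesis by simp
qed

text \<open>A number stands for the statement that it is not zero.\<close>

lemma dec_nonzero: 
  assumes "computable f"
  shows "dec (%x. f x ~= (0 :: nat))"
proof -
  have "computable (%x. rec_nat 0 (%k y. 1 :: nat) (f x))"
    by (rule comp_rec_nat[OF comp_const comp_const assms])
  moreover have "rec_nat 0 (%k y. 1) n = (if n ~= 0 then 1 else (0 :: nat))" for n by (cases n) auto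
  ultimately show ?thesis unfolding dec_def by simp
qed

lemma dec_not: "dec P ==> dec (%x. \<not> P x)"
proof -
  assume "dec P"
  hence "computable (%x. if P x then 0 else (1 :: nat))" by (intro comp_If comp_const)
  moreover have "(if P x then 0 else (1 :: nat)) = (if \<not> P x then 1 else 0)" for x by simp
  ultimately show ?thesis unfolding dec_def by simp
qed

lemma dec_and: "dec P ==> dec Q ==> dec (%x. P x \<and> Q x)"
proof -
  assume "dec P" "dec Q"
  hence "computable (%x. if P x then if Q x then 1 else 0 else (0 :: nat))"
    by (intro comp_If comp_const)
  moreover have "(if P x then if Q x then 1 else 0 else (0 :: nat)) = (if P x \<and> Q x then 1 else 0)" for x by simp
  ultimately show ?thesis unfolding dec_def by simp
qed

lemma dec_or: "dec P ==> dec Q ==> dec (%x. P x \<or> Q x)"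
  using dec_not[OF dec_and[OF dec_not dec_not, of P Q]] by simp

lemma dec_imp: "dec P ==> dec Q ==> dec (%x. P x --> Q x)"
  using dec_or[OF dec_not, of P Q] by (simp only: imp_conv_disj)

lemma dec_le: "computable f ==> computable g ==> dec (%x. f x \<le> (g x :: nat))"
  using dec_not[OF dec_nonzero[OF comp_minus[of f g]]] by simp

lemma dec_less: "computable f ==> computable g ==> dec (%x. f x < (g x :: nat))"
  using dec_not[OF dec_le[of g f]] by (simp add: not_le)

lemma comp_code: "computable f ==> computable (%x. code (f x))"
  by (rule comp_code1[where F = "%n. n" and f = code]) (simp_all add: total_rec_proj code_nat_def)

lemma dec_eq: "computable f ==> computable g ==> dec (%x. f x = g x)"
  using dec_and[OF dec_le[OF comp_code comp_code] dec_le[OF comp_code comp_code], of f g g f]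
  by (simp add: eq_iff[symmetric])

lemma dec_comp: "dec P ==> computable f ==> dec (%x. P (f x))"
  unfolding dec_def by (rule comp_comp[where f = "%x. if P x then 1 else 0" and g = f])

lemma dec_all_less:
  assumes "dec (%p. P (fst p) (snd p))" "computable n"
  shows "dec (%x. \<forall>i < (n x :: nat). P x i)"
proof -
  have "computable (%x. rec_nat 1 (%k y. if P x k \<and> y ~= 0 then 1 else (0 :: nat)) (n x))"
    by (intro comp_rec_nat comp_const comp_If dec_and dec_nonzero assms
        dec_comp[OF assms(1), of "%p. (fst p, fst (snd p))", simplified] comp_Pair comp_fst comp_snd comp_id)
  moreover have "rec_nat 1 (%k y. if P x k \<and> y ~= 0 then 1 else (0 :: nat)) m = (if \<forall>i < m. P x i then 1 else 0)" for x m
    by (induction m) (auto simp: less_Suc_eq)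
  ultimately show ?thesis unfolding dec_def by simp
qed

lemma dec_ex_less:
  assumes "dec (%p. P (fst p) (snd p))" "computable n"
  shows "dec (%x. \<exists>i < (n x :: nat). P x i)"
  using dec_not[OF dec_all_less[where P = "%x i. \<not> P x i", OF dec_not[OF assms(1)] assms(2)]] by simp

lemma comp_tl: "computable f ==> computable (%x. tl (f x))"
proof (rule comp_code1[where F = "%n. snd (prod_decode (n - 1))" and f = tl])
  show "total_rec 1 (%xs. snd (prod_decode (xs ! 0 - 1)))"
    by (rule total_rec_comp1[OF total_rec_decode_snd total_rec_pred])
  show "snd (prod_decode (code xs - 1)) = code (tl xs)" for xs :: "'b list"
  proof (cases xs)
    case Nil
    have "prod_encode (0, 0) = 0" by (simp add: prod_encode_def)
    hence "prod_decode 0 = (0, 0)" by (metis prod_encode_inverse)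
    thus ?thesis using Nil by simp
  qed simp
qed

lemma comp_hd: "computable f ==> computable (%x. hd (f x))"
proof -
  assume f: "computable f"
  let ?d = "hd [] :: 'b"
  have "computable (%xs :: 'b list. if xs = [] then ?d else hd xs)"
  proof -
    obtain d where d: "code ?d = d" by blast
    let ?F = "%n. rec_nat d (%k y. fst (prod_decode k)) n"
    have "total_rec 1 (%xs. ?F (xs ! 0))"
      by (rule total_rec_rec1) (rule total_rec_comp1[OF total_rec_decode_fst total_rec_proj], simp)
    thus ?thesis
    proof (rule computableI)
      show "?F (code xs) = code (if xs = [] then ?d else hd xs)" for xs :: "'b list"
        by (cases xs) (simp_all add: d)
    qed
  qed
  moreover have "(if xs = [] then ?d else hd xs) = hd xs" for xs :: "'b list" by simp
  ultimately show ?thesis using comp_comp[OF _ f, of hd] by simp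
qed

lemma comp_foldl:
  assumes s: "computable (%p. s (fst p) (fst (snd p)) (snd (snd p)))"
    and b: "computable b" and l: "computable l"
  shows "computable (%x. foldl (%acc e. s x acc e) (b x) (l x))"
proof -
  let ?step = "%x k y. if snd y = [] then y else (s x (fst y) (hd (snd y)), tl (snd y))"
  have "computable (%x. fst (rec_nat (b x, l x) (?step x) (code (l x))))"
    by (intro comp_fst comp_rec_nat comp_If dec_eq comp_const comp_Pair comp_snd comp_hd comp_tl comp_id comp_code b l
        comp_comp[OF s, of "%p. (fst p, fst (snd (snd p)), hd (snd (snd (snd p))))", simplified])
  moreover have "rec_nat (a, xs) (?step x) m = (foldl (s x) a (take m xs), drop m xs)" for x a xs m
    by (induction m) (auto simp: take_Suc_conv_app_nth hd_drop_conv_nth drop_Suc tl_drop)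
  ultimately show ?thesis by (simp add: length_le_code)
qed

lemma comp_rev: "computable f ==> computable (%x. rev (f x))"
proof -
  assume f: "computable f"
  have "computable (%x. foldl (%acc e. e # acc) [] (f x))"
    by (intro comp_foldl comp_Cons comp_snd comp_fst comp_id comp_const f)
  moreover have "foldl (%acc e. e # acc) ys xs = rev xs @ ys" for xs ys :: "'b list"
    by (induction xs arbitrary: ys) auto
  ultimately show ?thesis by simp
qed

lemma comp_append: "computable f ==> computable g ==> computable (%x. f x @ g x)"
proof -
  assume f: "computable f" and g: "computable g"
  have "computable (%x. foldl (%acc e. e # acc) (g x) (rev (f x)))"
    by (intro comp_foldl comp_Cons comp_snd comp_fst comp_id comp_const comp_rev f g)
  moreover have "foldl (%acc e. e # acc) ys xs = rev xs @ ys" for xs ys :: "'b list"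
    by (induction xs arbitrary: ys) auto
  ultimately show ?thesis by simp
qed

lemma comp_map:
  assumes f: "computable (%p. f (fst p) (snd p))" and l: "computable l"
  shows "computable (%x. map (%e. f x e) (l x))"
proof -
  have "computable (%x. rev (foldl (%acc e. f x e # acc) [] (l x)))"
    by (intro comp_rev comp_foldl comp_Cons comp_snd comp_fst comp_id comp_const l
        comp_comp[OF f, of "%p. (fst p, snd (snd p))", simplified] comp_Pair)
  moreover have "foldl (%acc e. f x e # acc) ys xs = rev (map (f x) xs) @ ys" for x xs ys
    by (induction xs arbitrary: ys) auto
  ultimately show ?thesis by simp
qed

lemma comp_length: "computable f ==> computable (%x. length (f x))"
proof -
  assume f: "computable f"
  have "computable (%x. foldl (%acc e. Suc acc) 0 (f x))"
    by (intro comp_foldl comp_Suc comp_snd comp_fst comp_id comp_const f)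
  moreover have "foldl (%acc e. Suc acc) n xs = n + length xs" for xs :: "'b list" and n
    by (induction xs arbitrary: n) auto
  ultimately show ?thesis by simp
qed

lemma comp_drop: "computable n ==> computable f ==> computable (%x. drop (n x) (f x))"
proof -
  assume n: "computable n" and f: "computable f"
  have "computable (%x. rec_nat (f x) (%k y. tl y) (n x))"
    by (intro comp_rec_nat comp_tl comp_snd comp_id n f)
  moreover have "rec_nat xs (%k y. tl y) m = drop m xs" for xs :: "'b list" and m
    by (induction m) (auto simp: drop_Suc tl_drop)
  ultimately show ?thesis by simp
qed

lemma dec_ball_set:
  assumes P: "dec (%p. P (fst p) (snd p))" and l: "computable l"
  shows "dec (%x. \<forall>e \<in> set (l x). P x e)"
proof -
  have "dec (%x. foldl (%acc e. if P x e then acc else 0) (1 :: nat) (l x) ~= 0)"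
    by (intro dec_nonzero comp_foldl comp_If comp_const comp_fst comp_snd comp_id l
        dec_comp[OF P, of "%p. (fst p, snd (snd p))", simplified] comp_Pair)
  moreover have "foldl (%acc e. if P x e then acc else 0) a xs ~= 0 \<longleftrightarrow> a ~= (0 :: nat) \<and> (\<forall>e \<in> set xs. P x e)" for x xs a
    by (induction xs arbitrary: a) auto
  ultimately show ?thesis by simp
qed

lemma dec_bex_set:
  assumes P: "dec (%p. P (fst p) (snd p))" and l: "computable l"
  shows "dec (%x. \<exists>e \<in> set (l x). P x e)"
  using dec_not[OF dec_ball_set[where P = "%x i. \<not> P x i", OF dec_not[OF P] l]] by simp

lemma comp_times: "computable f ==> computable g ==> computable (%x. f x * g x :: nat)"
proof -
  assume f: "computable f" and g: "computable g"
  have "computable (%x. rec_nat 0 (%k y. g x + y) (f x))"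
    by (intro comp_rec_nat comp_plus comp_const comp_snd comp_id comp_comp[OF g comp_fst] f)
  moreover have "rec_nat 0 (%k y. b + y) a = a * b" for a b :: nat by (induction a) auto
  ultimately show ?thesis by simp
qed

lemma comp_mod: "computable f ==> computable g ==> computable (%x. f x mod g x :: nat)"
proof -
  assume f: "computable f" and g: "computable g"
  have "computable (%x. rec_nat 0 (%k y. if Suc y = g x then 0 else Suc y) (f x))"
    by (intro comp_rec_nat comp_If dec_eq comp_Suc comp_const comp_snd comp_id comp_comp[OF g comp_fst] f)
  moreover have "rec_nat 0 (%k y. if Suc y = b then 0 else Suc y) a = a mod b" for a b :: nat
    by (induction a) (auto simp: mod_Suc)
  ultimately show ?thesis by simp
qed

lemma comp_replicate: "computable n ==> computable f ==> computable (%x. replicate (n x) (f x))"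
proof -
  assume n: "computable n" and f: "computable f"
  have "computable (%x. rec_nat [] (%k y. f x # y) (n x))"
    by (intro comp_rec_nat comp_Cons comp_const comp_snd comp_id comp_comp[OF f comp_fst] n)
  moreover have "rec_nat [] (%k y. a # y) m = replicate m a" for m and a :: 'b by (induction m) auto
  ultimately show ?thesis by simp
qed

lemma comp_upt: "computable n ==> computable (%x. [0..<n x])"
proof -
  assume n: "computable n"
  have "computable (%x. rec_nat [] (%k y. y @ [k]) (n x))"
    by (intro comp_rec_nat comp_Cons comp_append comp_const comp_snd comp_fst comp_id n)
  moreover have "rec_nat [] (%k y. y @ [k]) m = [0..<m]" for m by (induction m) auto
  ultimately show ?thesis by simp
qed

lemma comp_concat: "computable f ==> computable (%x. concat (f x))"
proof -
  assume f: "computable f"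
  have "computable (%x. foldl (%acc e. acc @ e) [] (f x))"
    by (intro comp_foldl comp_append comp_snd comp_fst comp_id comp_const f)
  moreover have "foldl (%acc e. acc @ e) ys xs = ys @ concat xs" for xs and ys :: "'b list"
    by (induction xs arbitrary: ys) auto
  ultimately show ?thesis by simp
qed

text \<open>Unbounded search over the values of a coded type. The program need not halt on an argument
  without a solution.\<close>

lemma search_program:
  fixes D :: "'a :: coded => 'b :: coded => bool" and out :: "'a \<times> 'b => 'c :: coded"
  assumes D: "dec (%p. D (fst p) (snd p))" and out: "computable out"
  shows "\<exists>r. \<forall>x. (\<exists>c. D x c) --> (\<exists>c. D x c \<and> computes r [code x] (code (out (x, c))))"
proof -
  have "computable (%p. if D (fst p) (snd p) then 0 else (1 :: nat))" by (intro comp_If comp_const D)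
  then obtain F where F: "total_rec 1 (%xs. F (xs ! 0))"
    "!!p. F (code p) = code (if D (fst p) (snd p) then 0 else (1 :: nat))"
    using computableD by blast
  have "total_rec 2 (%xs. F (prod_encode (xs ! 1, xs ! 0)))"
    by (rule total_rec_comp1[OF F(1)] total_rec_comp2[where f = "%x y. prod_encode (x, y)", OF total_rec_prod_encode]
        total_rec_proj | simp)+
  then obtain f where f: "!!xs. length xs = 2 ==> computes f xs (F (prod_encode (xs ! 1, xs ! 0)))"
    unfolding total_rec_def by blast
  obtain Q where Q: "total_rec 1 (%xs. Q (xs ! 0))" "!!p. Q (code p) = code (out p)"
    using computableD[OF out] by blast
  have "total_rec 2 (%xs. Q (prod_encode (xs ! 0, xs ! 1)))"
    by (rule total_rec_comp1[OF Q(1) total_rec_prod_encode])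
  then obtain q where q: "!!xs. length xs = 2 ==> computes q xs (Q (prod_encode (xs ! 0, xs ! 1)))"
    unfolding total_rec_def by blast
  show ?thesis
  proof (intro exI[of _ "Comp q [Proj 0, Mu f]"] allI impI)
    fix x assume "\<exists>c. D x c"
    then obtain c where c: "D x c" by blast
    let ?G = "%m. F (prod_encode (code x, m))"
    have G: "?G (code c) = 0 \<longleftrightarrow> D x c" for c
      using F(2)[of "(x, c)"] by (simp add: code_prod_def code_nat_def split: if_splits)
    have ex: "\<exists>m. ?G m = 0" using G c by blast
    have mu: "computes (Mu f) [code x] (LEAST m. ?G m = 0)"
      by (rule computes_search[OF _ ex]) (use f[of "[m, code x]" for m] in simp)
    obtain c' :: 'b where c': "code c' = (LEAST m. ?G m = 0)" by (rule code_surj)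
    have "D x c'" using LeastI_ex[OF ex] G c' by metis
    moreover have "computes (Comp q [Proj 0, Mu f]) [code x] (code (out (x, c')))"
    proof (rule computes.comp)
      show "list_all2 (%g y. computes g [code x] y) [Proj 0, Mu f] [code x, code c']"
        using mu c' computes.proj[of 0 "[code x]"] by simp
      show "computes q [code x, code c'] (code (out (x, c')))"
        using q[of "[code x, code c']"] Q(2)[of "(x, c')"] by (simp add: code_prod_def)
    qed
    ultimately show "\<exists>c. D x c \<and> computes (Comp q [Proj 0, Mu f]) [code x] (code (out (x, c)))" by blast
  qed
qed

section \<open>Linear algebra over a field record\<close>

subsection \<open>Finite sums\<close>

primrec gsum :: "('e => 'e => 'e) => 'e => nat => (nat => 'e) => 'e" where
  "gsum p z 0 f = z"
| "gsum p z (Suc n) f = p (gsum p z n f) (f n)"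

lemma gsum_cong: "(!!i. i < n ==> f i = g i) ==> gsum p z n f = gsum p z n g"
  by (induction n) auto

abbreviation rsum :: "('a, 'b) ring_scheme => nat => (nat => 'a) => 'a" where
  "rsum R \<equiv> gsum (\<oplus>\<^bsub>R\<^esub>) \<zero>\<^bsub>R\<^esub>"

context ring
begin

abbreviation S :: "nat => (nat => 'a) => 'a" where "S \<equiv> rsum R"

lemma S_closed [simp, intro]: "(!!i. i < n ==> f i \<in> carrier R) ==> S n f \<in> carrier R"
  by (induction n) auto

lemma S_finsum: "(!!i. i < n ==> f i \<in> carrier R) ==> finsum R f {..<n} = S n f"
  by (induction n) (auto simp: lessThan_Suc a_comm Pi_def)

lemma S_zero [simp]: "S n (%_. \<zero>) = \<zero>"
  by (induction n) auto

lemma S_eq_zero: "(!!i. i < n ==> f i = \<zero>) ==> S n f = \<zero>"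
  by (induction n) auto

lemma S_add:
  "(!!i. i < n ==> f i \<in> carrier R) ==> (!!i. i < n ==> g i \<in> carrier R) ==>
    S n (%i. f i \<oplus> g i) = S n f \<oplus> S n g"
proof (induction n)
  case (Suc n)
  have "S n f \<in> carrier R" "S n g \<in> carrier R" "f n \<in> carrier R" "g n \<in> carrier R" using Suc.prems by auto
  with Suc show ?case by (simp add: a_ac)
qed simp

lemma S_lmult:
  "a \<in> carrier R ==> (!!i. i < n ==> f i \<in> carrier R) ==> a \<otimes> S n f = S n (%i. a \<otimes> f i)"
  by (induction n) (auto simp: r_distr)

lemma S_rmult:
  "a \<in> carrier R ==> (!!i. i < n ==> f i \<in> carrier R) ==> S n f \<otimes> a = S n (%i. f i \<otimes> a)"
  by (induction n) (auto simp: l_distr)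

lemma S_minus:
  "(!!i. i < n ==> f i \<in> carrier R) ==> (!!i. i < n ==> g i \<in> carrier R) ==>
    S n (%i. f i \<ominus> g i) = S n f \<ominus> S n g"
proof (induction n)
  case (Suc n)
  have "S n f \<in> carrier R" "S n g \<in> carrier R" "f n \<in> carrier R" "g n \<in> carrier R" using Suc.prems by auto
  with Suc show ?case by (simp add: a_ac a_minus_def minus_add)
qed (simp add: a_minus_def)

lemma S_swap:
  "(!!i j. i < n ==> j < m ==> f i j \<in> carrier R) ==>
    S n (%i. S m (%j. f i j)) = S m (%j. S n (%i. f i j))"
proof (induction n)
  case (Suc n)
  have "S m (%j. S n (%i. f i j) \<oplus> f n j) = S m (%j. S n (%i. f i j)) \<oplus> S m (%j. f n j)"
    by (rule S_add) (use Suc.prems in auto)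
  with Suc show ?case by simp
qed simp

lemma S_delta:
  "k < n ==> f k \<in> carrier R ==> S n (%i. if i = k then f i else \<zero>) = f k"
proof (induction n)
  case (Suc n)
  show ?case
  proof (cases "k = n")
    case True
    have "S n (%i. if i = k then f i else \<zero>) = \<zero>" by (rule S_eq_zero) (use True in auto)
    thus ?thesis using True Suc.prems by simp
  next
    case False
    thus ?thesis using Suc by simp
  qed
qed simp

lemma S_split:
  "(!!i. i < m + d ==> f i \<in> carrier R) ==> S (m + d) f = S m f \<oplus> S d (%i. f (m + i))"
proof (induction d)
  case (Suc d)
  have "S m f \<in> carrier R" "S d (%i. f (m + i)) \<in> carrier R" "f (m + d) \<in> carrier R" using Suc.prems by auto
  with Suc show ?case by (simp add: a_assoc)
qed simp

lemma S_reindex: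
  assumes p: "bij_betw p {..<n} {..<n}" and f: "!!i. i < n ==> f i \<in> carrier R"
  shows "S n (%i. f (p i)) = S n f"
proof -
  have "S n (%i. f (p i)) = finsum R (%i. f (p i)) {..<n}"
    by (rule S_finsum[symmetric]) (use p f in "auto simp: bij_betw_def")
  also have "\<dots> = finsum R f (p ` {..<n})"
    by (rule add.finprod_reindex[symmetric]) (use p f in "auto simp: bij_betw_def Pi_def")
  also have "\<dots> = S n f" using p f by (simp add: bij_betw_def S_finsum)
  finally show ?thesis .
qed

lemma S_Suc_shift:
  "(!!i. i < Suc n ==> f i \<in> carrier R) ==> S (Suc n) f = f 0 \<oplus> S n (%i. f (Suc i))"
  using S_split[of 1 n f] by simp

end

context cring
begin

text \<open>The two ways of bracketing a product of three matrices, or of two matrices and a vector.\<close>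

lemma S_assoc:
  assumes "!!i. i < n ==> a i \<in> carrier R" "!!i j. i < n ==> j < m ==> b i j \<in> carrier R"
    "!!j. j < m ==> c j \<in> carrier R"
  shows "S n (%i. a i \<otimes> S m (%j. b i j \<otimes> c j)) = S m (%j. S n (%i. a i \<otimes> b i j) \<otimes> c j)"
proof -
  have "S n (%i. a i \<otimes> S m (%j. b i j \<otimes> c j)) = S n (%i. S m (%j. a i \<otimes> b i j \<otimes> c j))"
    by (rule gsum_cong) (use assms in "simp add: S_lmult m_assoc cong: gsum_cong")
  also have "\<dots> = S m (%j. S n (%i. a i \<otimes> b i j \<otimes> c j))"
    by (rule S_swap) (use assms in auto)
  also have "\<dots> = S m (%j. S n (%i. a i \<otimes> b i j) \<otimes> c j)"
    by (rule gsum_cong) (use assms in "simp add: S_rmult")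
  finally show ?thesis .
qed

lemma S_mult_delta:
  "k < n ==> f k \<in> carrier R ==> S n (%i. f i \<otimes> (if i = k then \<one> else \<zero>)) = f k"
  "k < n ==> f k \<in> carrier R ==> S n (%i. (if i = k then \<one> else \<zero>) \<otimes> f i) = f k" 
  if "!!i. i < n ==> f i \<in> carrier R"
proof -
  assume k: "k < n" "f k \<in> carrier R"
  have "S n (%i. f i \<otimes> (if i = k then \<one> else \<zero>)) = S n (%i. if i = k then f i else \<zero>)"
    "S n (%i. (if i = k then \<one> else \<zero>) \<otimes> f i) = S n (%i. if i = k then f i else \<zero>)"
    by (rule gsum_cong; use that in auto)+
  thus "S n (%i. f i \<otimes> (if i = k then \<one> else \<zero>)) = f k"
    "S n (%i. (if i = k then \<one> else \<zero>) \<otimes> f i) = f k"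
    using S_delta[of k n f] k by auto
qed

lemma S_mult_delta':
  assumes "!!i. i < n ==> f i \<in> carrier R" "k < n"
  shows "S n (%i. f i \<otimes> (if k = i then \<one> else \<zero>)) = f k" "S n (%i. (if k = i then \<one> else \<zero>) \<otimes> f i) = f k"
  using S_mult_delta[of n f k] assms by (simp_all add: eq_commute[of k])

end

subsection \<open>Vectors and spans\<close>

text \<open>Vectors and matrices are functions on indices with all values in the field, so that closure is
  unconditional; only the values below the dimension matter.\<close>

definition vecs :: "('a, 'b) ring_scheme => (nat => 'a) set" where
  "vecs R = {v. \<forall>i. v i \<in> carrier R}"

definition mats :: "('a, 'b) ring_scheme => (nat => nat => 'a) set" where
  "mats R = {A. \<forall>i j. A i j \<in> carrier R}"

lemma vecsD [simp]: "v \<in> vecs R ==> v i \<in> carrier R"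
  by (simp add: vecs_def)

lemma vecsI: "(!!i. v i \<in> carrier R) ==> v \<in> vecs R"
  unfolding vecs_def by blast

lemma matsD [simp]: "A \<in> mats R ==> A i j \<in> carrier R"
  unfolding mats_def by blast

lemma matsD' [simp]: "A \<in> mats R ==> A i \<in> vecs R"
  unfolding mats_def vecs_def by blast

lemma matsI: "(!!i j. A i j \<in> carrier R) ==> A \<in> mats R"
  unfolding mats_def by blast

definition uvec :: "('a, 'b) ring_scheme => nat => nat => 'a" where
  "uvec R j = (%i. if i = j then \<one>\<^bsub>R\<^esub> else \<zero>\<^bsub>R\<^esub>)"

definition in_span :: "('a, 'b) ring_scheme => nat => (nat => nat => 'a) => nat => (nat => 'a) => bool" where
  "in_span R N u m t \<longleftrightarrow> (\<exists>c \<in> vecs R. \<forall>i < N. t i = rsum R m (%p. c p \<otimes>\<^bsub>R\<^esub> u p i))"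

definition indep :: "('a, 'b) ring_scheme => nat => (nat => nat => 'a) => nat => bool" where
  "indep R N u m \<longleftrightarrow> (\<forall>c \<in> vecs R. (\<forall>i < N. rsum R m (%p. c p \<otimes>\<^bsub>R\<^esub> u p i) = \<zero>\<^bsub>R\<^esub>) --> (\<forall>p < m. c p = \<zero>\<^bsub>R\<^esub>))"

lemma indepD:
  "indep R N u m ==> c \<in> vecs R ==> (!!i. i < N ==> rsum R m (%p. c p \<otimes>\<^bsub>R\<^esub> u p i) = \<zero>\<^bsub>R\<^esub>) ==> p < m ==> c p = \<zero>\<^bsub>R\<^esub>"
  unfolding indep_def by simp

context cring
begin

lemma uvec_vecs [simp, intro]: "uvec R j \<in> vecs R" 
  by (auto simp: uvec_def intro!: vecsI)

lemma in_span_member: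
  assumes "u \<in> mats R" "p < m"
  shows "in_span R N u m (u p)"
  unfolding in_span_def
proof (rule bexI[of _ "uvec R p"])
  show "\<forall>i < N. u p i = S m (%q. uvec R p q \<otimes> u q i)"
    unfolding uvec_def by (intro allI impI S_mult_delta(2)[symmetric]) (use assms in auto)
qed simp

lemma in_span_cong:
  "(!!i. i < N ==> t i = t' i) ==> in_span R N u m t \<longleftrightarrow> in_span R N u m t'"
  unfolding in_span_def by simp

lemma in_span_zero: "u \<in> mats R ==> (!!i. i < N ==> t i = \<zero>) ==> in_span R N u m t"
  unfolding in_span_def by (intro bexI[of _ "%_. \<zero>"]) (auto intro!: vecsI)

lemma in_span_comb:
  assumes u: "u \<in> mats R" and x: "x \<in> vecs R" and T: "!!q. q < k ==> in_span R N u m (t q)"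
  shows "in_span R N u m (%i. S k (%q. x q \<otimes> t q i))"
proof -
  have "\<forall>q. \<exists>c. q < k --> c \<in> vecs R \<and> (\<forall>i < N. t q i = S m (%p. c p \<otimes> u p i))"
    using T unfolding in_span_def by blast
  then obtain c where c: "!!q. q < k ==> c q \<in> vecs R"
    "!!q i. q < k ==> i < N ==> t q i = S m (%p. c q p \<otimes> u p i)" by metis
  have *: "S k (%q. x q \<otimes> t q i) = S m (%p. S k (%q. x q \<otimes> c q p) \<otimes> u p i)" if "i < N" for i
  proof -
    have "S k (%q. x q \<otimes> t q i) = S k (%q. x q \<otimes> S m (%p. c q p \<otimes> u p i))"
      by (rule gsum_cong) (simp add: c that)
    also have "\<dots> = S m (%p. S k (%q. x q \<otimes> c q p) \<otimes> u p i)"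
      by (rule S_assoc) (use u x c(1) in auto)
    finally show ?thesis .
  qed
  show ?thesis unfolding in_span_def
    by (rule bexI[of _ "%p. S k (%q. x q \<otimes> c q p)"]) (use * x c(1) in "auto intro!: vecsI")
qed

lemma in_span_trans:
  assumes "v \<in> mats R" "in_span R N u m t" "!!p. p < m ==> in_span R N v k (u p)"
  shows "in_span R N v k t"
proof -
  obtain c where c: "c \<in> vecs R" "\<forall>i < N. t i = S m (%p. c p \<otimes> u p i)"
    using assms(2) unfolding in_span_def by blast
  have "in_span R N v k (%i. S m (%p. c p \<otimes> u p i))"
    by (rule in_span_comb[OF assms(1) c(1) assms(3)])
  thus ?thesis using in_span_cong[of N t "%i. S m (%p. c p \<otimes> u p i)" v k] c(2) by simp
qed

lemma in_span_mono:
  assumes "v \<in> mats R" "in_span R N u m t" "m \<le> k" "!!p. p < m ==> v p = u p"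
  shows "in_span R N v k t"
  by (rule in_span_trans[OF assms(1,2)]) (use in_span_member[OF assms(1)] assms(3,4) in "metis order_less_le_trans")

lemma in_span_add:
  assumes "u \<in> mats R" "in_span R N u m s" "in_span R N u m t" "s \<in> vecs R" "t \<in> vecs R"
  shows "in_span R N u m (%i. s i \<oplus> t i)"
proof -
  have "in_span R N u m (%i. S 2 (%q. \<one> \<otimes> (if q = 0 then s else t) i))"
    by (rule in_span_comb[where x = "%_. \<one>"]) (use assms in "auto intro!: vecsI")
  thus ?thesis using assms by (simp add: numeral_2_eq_2)
qed

lemma in_span_smult:
  assumes "u \<in> mats R" "in_span R N u m t" "t \<in> vecs R" "a \<in> carrier R"
  shows "in_span R N u m (%i. a \<otimes> t i)"
proof -
  have "in_span R N u m (%i. S 1 (%q. a \<otimes> t i))"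
    by (rule in_span_comb[where x = "%_. a" and t = "%_. t"]) (use assms in "auto intro!: vecsI")
  thus ?thesis using assms by simp
qed

lemma in_span_uvecs:
  assumes "t \<in> vecs R"
  shows "in_span R N (uvec R) N t"
  unfolding in_span_def
proof (rule bexI[of _ t])
  show "\<forall>i < N. t i = S N (%p. t p \<otimes> uvec R p i)"
    using assms S_mult_delta(1)[of N t] by (auto simp: uvec_def eq_commute cong: gsum_cong if_cong)
qed (rule assms)

end

context field
begin

lemma field_inverse:
  assumes "a \<in> carrier R" "a ~= \<zero>"
  obtains b where "b \<in> carrier R" "a \<otimes> b = \<one>" "b \<otimes> a = \<one>" "b ~= \<zero>"
proof -
  have "a \<in> Units R" using assms by (simp add: field_Units)
  thus ?thesis using that[of "inv a"] by (metis Units_inv_closed Units_l_inv Units_r_inv assms(1) r_null zero_not_one)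
qed

text \<open>More unknowns than equations. One unknown is eliminated with a row in which it occurs.\<close>

lemma kernel_vector_aux:
  assumes "A \<in> mats R" "J \<subseteq> {..<N}" "card J > m"
  shows "\<exists>x \<in> vecs R. (\<exists>j \<in> J. x j ~= \<zero>) \<and> (\<forall>j. j \<notin> J --> x j = \<zero>) \<and> (\<forall>i < m. S N (%j. A i j \<otimes> x j) = \<zero>)"
  using assms
proof (induction m arbitrary: J A)
  case 0
  then obtain j where "j \<in> J" by (metis card.empty equals0I less_numeral_extra(3))
  thus ?case by (intro bexI[of _ "uvec R j"]) (auto simp: uvec_def intro!: vecsI)
next
  case (Suc m)
  have fin: "finite J" using Suc.prems(2) finite_subset by blast
  show ?case
  proof (cases "\<forall>j \<in> J. A m j = \<zero>")
    case True
    obtain x where x: "x \<in> vecs R" "\<exists>j \<in> J. x j ~= \<zero>" "\<forall>j. j \<notin> J --> x j = \<zero>"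
      "\<forall>i < m. S N (%j. A i j \<otimes> x j) = \<zero>"
      using Suc.IH[OF Suc.prems(1,2)] Suc.prems(3) by auto
    have "A m j \<otimes> x j = \<zero>" for j by (cases "j \<in> J") (use True x Suc.prems(1) in auto)
    hence "S N (%j. A m j \<otimes> x j) = \<zero>" by simp
    thus ?thesis using x by (auto simp: less_Suc_eq)
  next
    case False
    then obtain j0 where j0: "j0 \<in> J" "A m j0 ~= \<zero>" by blast
    obtain b where b: "b \<in> carrier R" "A m j0 \<otimes> b = \<one>" "b \<otimes> A m j0 = \<one>" "b ~= \<zero>"
      using field_inverse[of "A m j0"] j0 Suc.prems(1) by auto
    have A[simp]: "A i j \<in> carrier R" for i j using Suc.prems(1) by simp
    let ?B = "%i j. A i j \<ominus> A i j0 \<otimes> b \<otimes> A m j"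
    have "card (J - {j0}) > m" using Suc.prems(3) j0 fin by simp
    moreover have "?B \<in> mats R" using b by (auto intro!: matsI)
    moreover have "J - {j0} \<subseteq> {..<N}" using Suc.prems(2) by blast
    ultimately obtain x where x: "x \<in> vecs R" "\<exists>j \<in> J - {j0}. x j ~= \<zero>" "\<forall>j. j \<notin> J - {j0} --> x j = \<zero>"
      "\<forall>i < m. S N (%j. ?B i j \<otimes> x j) = \<zero>"
      using Suc.IH[of ?B "J - {j0}"] by blast
    define s where "s = S N (%j. A m j \<otimes> x j)"
    have s: "s \<in> carrier R" using x by (auto simp: s_def)
    define y where "y j = (if j = j0 then \<ominus> (b \<otimes> s) else x j)" for j
    have y: "y \<in> vecs R" by (rule vecsI) (use x(1) b s in "simp add: y_def")
    have sum_y: "S N (%j. A i j \<otimes> y j) = S N (%j. A i j \<otimes> x j) \<ominus> A i j0 \<otimes> (b \<otimes> s)" for i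
    proof -
      have "S N (%j. A i j \<otimes> y j) = S N (%j. A i j \<otimes> x j \<oplus> (if j = j0 then A i j \<otimes> \<ominus> (b \<otimes> s) else \<zero>))"
        by (rule gsum_cong) (use x b s in "auto simp: y_def")
      also have "\<dots> = S N (%j. A i j \<otimes> x j) \<oplus> S N (%j. if j = j0 then A i j \<otimes> \<ominus> (b \<otimes> s) else \<zero>)"
        by (rule S_add) (use x b s in auto)
      also have "S N (%j. if j = j0 then A i j \<otimes> \<ominus> (b \<otimes> s) else \<zero>) = A i j0 \<otimes> \<ominus> (b \<otimes> s)"
        by (rule S_delta) (use j0 Suc.prems(2) b s in auto)
      finally show ?thesis using b s by (simp add: a_minus_def r_minus)
    qed
    have "S N (%j. A i j \<otimes> y j) = \<zero>" if "i < m" for i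
    proof -
      have "\<zero> = S N (%j. ?B i j \<otimes> x j)" using x(4) that by metis
      also have "\<dots> = S N (%j. A i j \<otimes> x j \<ominus> (A i j0 \<otimes> b) \<otimes> (A m j \<otimes> x j))"
        by (rule gsum_cong) (use x b in "simp add: a_minus_def l_distr l_minus m_assoc")
      also have "\<dots> = S N (%j. A i j \<otimes> x j) \<ominus> (A i j0 \<otimes> b) \<otimes> s"
        unfolding s_def using x b by (subst S_minus) (auto simp: S_lmult)
      finally show ?thesis using sum_y[of i] b s by (simp add: m_assoc)
    qed
    moreover have "S N (%j. A m j \<otimes> y j) = \<zero>"
      using sum_y[of m] b s by (simp add: s_def[symmetric] m_assoc[symmetric] r_neg a_minus_def)
    moreover have "\<exists>j \<in> J. y j ~= \<zero>" using x(2) by (auto simp: y_def)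
    moreover have "\<forall>j. j \<notin> J --> y j = \<zero>" using x(3) j0 by (auto simp: y_def)
    ultimately show ?thesis using y by (auto simp: less_Suc_eq)
  qed
qed

lemma kernel_vector:
  assumes "A \<in> mats R" "m < n"
  obtains x j where "x \<in> vecs R" "j < n" "x j ~= \<zero>" "!!i. i < m ==> S n (%j. A i j \<otimes> x j) = \<zero>"
proof -
  obtain x where x: "x \<in> vecs R" "\<exists>j \<in> {..<n}. x j ~= \<zero>" "\<forall>i < m. S n (%j. A i j \<otimes> x j) = \<zero>"
    using kernel_vector_aux[OF assms(1), of "{..<n}" n m] assms(2) by auto
  then obtain j where "j < n" "x j ~= \<zero>" by blast
  thus ?thesis using that x by blast
qed

text \<open>By induction on \<open>m\<close>: a form that vanishes on the first \<open>m\<close> vectors and not on the next one is used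
  to eliminate the next one.\<close>

lemma separation:
  assumes u: "u \<in> mats R"
  shows "t \<in> vecs R ==> in_span R N u m t \<or>
    (\<exists>y \<in> vecs R. (\<forall>p < m. S N (%i. y i \<otimes> u p i) = \<zero>) \<and> S N (%i. y i \<otimes> t i) = \<one>)"
proof (induction m arbitrary: t)
  case 0
  show ?case
  proof (cases "\<forall>i < N. t i = \<zero>")
    case True
    thus ?thesis using in_span_zero[OF u] by blast
  next
    case False
    then obtain i where i: "i < N" "t i ~= \<zero>" by blast
    then obtain b where b: "b \<in> carrier R" "b \<otimes> t i = \<one>" using field_inverse[of "t i"] 0 by auto
    have "S N (%j. (if j = i then b else \<zero>) \<otimes> t j) = S N (%j. if j = i then b \<otimes> t j else \<zero>)"
      by (rule gsum_cong) (use 0 b in auto)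
    also have "\<dots> = \<one>" using S_delta[of i N "%j. b \<otimes> t j"] i b 0 by simp
    finally show ?thesis using b by (intro disjI2 bexI[of _ "%j. if j = i then b else \<zero>"]) (auto intro!: vecsI)
  qed
next
  case (Suc m)
  have mono: "in_span R N u (Suc m) s" if "in_span R N u m s" for s
    using in_span_mono[OF u that] by simp
  consider "in_span R N u m (u m)" | z where "z \<in> vecs R" "\<forall>p < m. S N (%i. z i \<otimes> u p i) = \<zero>"
      "S N (%i. z i \<otimes> u m i) = \<one>"
    using Suc.IH[of "u m"] u by auto
  thus ?case
  proof cases
    case 1
    show ?thesis
    proof (cases "in_span R N u m t")
      case True thus ?thesis using mono by blast
    next
      case False
      then obtain y where y: "y \<in> vecs R" "\<forall>p < m. S N (%i. y i \<otimes> u p i) = \<zero>" "S N (%i. y i \<otimes> t i) = \<one>"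
        using Suc by blast
      obtain c where c: "c \<in> vecs R" "\<forall>i < N. u m i = S m (%p. c p \<otimes> u p i)"
        using 1 unfolding in_span_def by blast
      have "S N (%i. y i \<otimes> u m i) = S N (%i. y i \<otimes> S m (%p. u p i \<otimes> c p))"
        by (rule gsum_cong) (use c u in \<open>auto simp: m_comm intro!: arg_cong[where f = "%s. y _ \<otimes> s"] gsum_cong\<close>)
      also have "\<dots> = S m (%p. S N (%i. y i \<otimes> u p i) \<otimes> c p)" by (rule S_assoc) (use y c u in auto)
      also have "\<dots> = \<zero>" by (rule S_eq_zero) (use y c in auto)
      finally show ?thesis using y by (auto simp: less_Suc_eq)
    qed
  next
    case 2
    define a where "a = S N (%i. z i \<otimes> t i)"
    have a: "a \<in> carrier R" using 2 Suc.prems by (auto simp: a_def)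
    let ?t = "%i. t i \<ominus> a \<otimes> u m i"
    have t': "?t \<in> vecs R" using a Suc.prems u by (auto intro!: vecsI)
    show ?thesis
    proof (cases "in_span R N u m ?t")
      case True
      have "in_span R N u (Suc m) (%i. ?t i \<oplus> a \<otimes> u m i)"
        by (rule in_span_add[OF u mono[OF True] in_span_smult[OF u in_span_member[OF u]]])
          (use t' a u Suc.prems in "auto intro!: vecsI")
      moreover have "?t i \<oplus> a \<otimes> u m i = t i" for i
        using a u Suc.prems by (simp add: a_minus_def a_assoc l_neg)
      ultimately show ?thesis by simp
    next
      case False
      then obtain y where y: "y \<in> vecs R" "\<forall>p < m. S N (%i. y i \<otimes> u p i) = \<zero>" "S N (%i. y i \<otimes> ?t i) = \<one>"
        using Suc.IH[OF t'] by blast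
      define b where "b = S N (%i. y i \<otimes> u m i)"
      have b: "b \<in> carrier R" using y u by (auto simp: b_def)
      let ?y = "%i. y i \<ominus> b \<otimes> z i"
      have pair: "S N (%i. ?y i \<otimes> s i) = S N (%i. y i \<otimes> s i) \<ominus> b \<otimes> S N (%i. z i \<otimes> s i)" if "s \<in> vecs R" for s
      proof -
        have "S N (%i. ?y i \<otimes> s i) = S N (%i. y i \<otimes> s i \<ominus> b \<otimes> (z i \<otimes> s i))"
          by (rule gsum_cong) (use that b y 2 in "simp add: a_minus_def l_distr l_minus m_assoc")
        thus ?thesis using that b y 2 by (subst (asm) S_minus) (auto simp: S_lmult)
      qed
      have "S N (%i. y i \<otimes> ?t i) = S N (%i. y i \<otimes> t i \<ominus> a \<otimes> (y i \<otimes> u m i))"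
        by (rule gsum_cong) (use y a u Suc.prems in "simp add: a_minus_def r_distr r_minus m_lcomm")
      also have "\<dots> = S N (%i. y i \<otimes> t i) \<ominus> a \<otimes> b"
        unfolding b_def using y a u Suc.prems by (subst S_minus) (auto simp: S_lmult)
      finally have "S N (%i. ?y i \<otimes> t i) = \<one>"
        using pair[OF Suc.prems] y(3) a b by (simp add: a_def[symmetric] m_comm)
      moreover have "S N (%i. ?y i \<otimes> u m i) = \<zero>"
        using pair[of "u m"] u 2(3) b by (simp add: b_def[symmetric] a_minus_def r_neg)
      moreover have "S N (%i. ?y i \<otimes> u p i) = \<zero>" if "p < m" for p
        using pair[of "u p"] u 2(2) y(2) b that by (simp add: a_minus_def)
      ultimately show ?thesis
        using y b 2 by (intro disjI2 bexI[of _ ?y]) (auto simp: less_Suc_eq intro!: vecsI)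
    qed
  qed
qed

lemma steinitz:
  assumes u: "u \<in> mats R" and w: "w \<in> mats R" "indep R N w k" and sp: "!!q. q < k ==> in_span R N u m (w q)"
  shows "k \<le> m"
proof (rule ccontr)
  assume "\<not> k \<le> m"
  hence "m < k" by simp
  have "\<forall>q. \<exists>c. q < k --> c \<in> vecs R \<and> (\<forall>i < N. w q i = S m (%p. c p \<otimes> u p i))"
    using sp unfolding in_span_def by blast
  then obtain c where c: "!!q. q < k ==> c q \<in> vecs R"
    "!!q i. q < k ==> i < N ==> w q i = S m (%p. c q p \<otimes> u p i)" by metis
  have cm: "(%p q. if q < k then c q p else \<zero>) \<in> mats R" by (intro matsI) (use c(1) in simp)
  obtain x j where x: "x \<in> vecs R" "j < k" "x j ~= \<zero>"
    "!!p. p < m ==> S k (%q. (if q < k then c q p else \<zero>) \<otimes> x q) = \<zero>"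
    using kernel_vector[OF cm \<open>m < k\<close>] by blast
  have x4: "S k (%q. x q \<otimes> c q p) = \<zero>" if "p < m" for p
    using x(4)[OF that] x(1) c(1) by (subst gsum_cong[where g = "%q. (if q < k then c q p else \<zero>) \<otimes> x q"]) (auto simp: m_comm)
  have "S k (%q. x q \<otimes> w q i) = \<zero>" if "i < N" for i
  proof -
    have "S k (%q. x q \<otimes> w q i) = S k (%q. x q \<otimes> S m (%p. c q p \<otimes> u p i))"
      by (rule gsum_cong) (simp add: c that)
    also have "\<dots> = S m (%p. S k (%q. x q \<otimes> c q p) \<otimes> u p i)"
      by (rule S_assoc) (use u x c(1) in auto)
    also have "\<dots> = \<zero>" by (rule S_eq_zero) (use u x4 in auto)
    finally show ?thesis .
  qed
  from indepD[OF w(2) x(1) this x(2)] x(3) show False by simp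
qed

lemma indep_extend:
  assumes u: "u \<in> mats R" "indep R N u m" and t: "t \<in> vecs R" "\<not> in_span R N u m t"
  shows "indep R N (u(m := t)) (Suc m)"
  unfolding indep_def
proof (intro ballI impI)
  fix c assume c: "c \<in> vecs R" "\<forall>i < N. S (Suc m) (%p. c p \<otimes> (u(m := t)) p i) = \<zero>"
  have *: "S m (%p. c p \<otimes> u p i) \<oplus> c m \<otimes> t i = \<zero>" if "i < N" for i
  proof -
    have "S m (%p. c p \<otimes> (u(m := t)) p i) = S m (%p. c p \<otimes> u p i)" by (rule gsum_cong) auto
    thus ?thesis using c(2) that by auto
  qed
  have cm: "c m = \<zero>"
  proof (rule ccontr)
    assume "c m ~= \<zero>"
    then obtain b where b: "b \<in> carrier R" "b \<otimes> c m = \<one>" using field_inverse[of "c m"] c by auto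
    have "t i = S m (%p. (\<ominus> b \<otimes> c p) \<otimes> u p i)" if "i < N" for i
    proof -
      have s: "S m (%p. c p \<otimes> u p i) \<in> carrier R" using c u by auto
      have "\<ominus> (c m \<otimes> t i) = S m (%p. c p \<otimes> u p i)"
        by (rule minus_equality[OF *[OF that]]) (use c t s in auto)
      moreover have "t i = \<ominus> b \<otimes> \<ominus> (c m \<otimes> t i)"
        using b c t by (simp add: l_minus r_minus m_assoc[symmetric])
      ultimately have "t i = \<ominus> b \<otimes> S m (%p. c p \<otimes> u p i)" by simp
      thus ?thesis using b c u by (simp add: S_lmult m_assoc)
    qed
    hence "in_span R N u m t" unfolding in_span_def
      by (intro bexI[of _ "%p. \<ominus> b \<otimes> c p"]) (use b c in "auto intro!: vecsI")
    thus False using t by blast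
  qed
  have "S m (%p. c p \<otimes> u p i) = \<zero>" if "i < N" for i using *[OF that] cm c u t by simp
  from indepD[OF u(2) c(1) this] cm show "\<forall>p < Suc m. c p = \<zero>" by (auto simp: less_Suc_eq)
qed

text \<open>The given vectors are taken one after the other, and each is added unless it already lies in the span.\<close>

lemma basis_extension:
  assumes u: "u \<in> mats R" "indep R N u m" and w: "w \<in> mats R"
  shows "\<exists>u' m'. u' \<in> mats R \<and> m \<le> m' \<and> (\<forall>p < m. u' p = u p) \<and> (\<forall>p. m \<le> p \<and> p < m' --> (\<exists>k < n. u' p = w k)) \<and>
    indep R N u' m' \<and> (\<forall>k < n. in_span R N u' m' (w k))"
proof (induction n)
  case 0
  show ?case using u by (intro exI[of _ u] exI[of _ m]) auto
next
  case (Suc n)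
  then obtain v k where v: "v \<in> mats R" "m \<le> k" "\<forall>p < m. v p = u p" "\<forall>p. m \<le> p \<and> p < k --> (\<exists>i < n. v p = w i)"
    "indep R N v k" "\<forall>i < n. in_span R N v k (w i)" by blast
  show ?case
  proof (cases "in_span R N v k (w n)")
    case True
    thus ?thesis using v by (intro exI[of _ v] exI[of _ k]) (auto simp: less_Suc_eq)
  next
    case False
    let ?v = "v(k := w n)"
    have v': "?v \<in> mats R" using v w by (auto intro!: matsI)
    have "in_span R N ?v (Suc k) (w i)" if "i < Suc n" for i
    proof (cases "i = n")
      case True
      thus ?thesis using in_span_member[OF v', of k "Suc k" N] by simp
    next
      case False
      hence "in_span R N v k (w i)" using v that by simp
      thus ?thesis by (rule in_span_mono[OF v']) auto
    qed
    moreover have "indep R N ?v (Suc k)" using indep_extend[OF v(1,5) _ False] w by simp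
    moreover have "\<forall>p < m. ?v p = u p" using v(2,3) by simp
    moreover have "\<forall>p. m \<le> p \<and> p < Suc k --> (\<exists>i < Suc n. ?v p = w i)"
      using v(4) by (auto simp: less_Suc_eq)
    ultimately show ?thesis using v(2) v' le_SucI by blast
  qed
qed

lemma dual_basis:
  assumes u: "u \<in> mats R" "indep R N u m"
  obtains y where "y \<in> mats R" "!!p q. p < m ==> q < m ==> S N (%i. y p i \<otimes> u q i) = (if p = q then \<one> else \<zero>)"
proof -
  have "\<forall>p. \<exists>y. p < m --> y \<in> vecs R \<and> (\<forall>q < m. S N (%i. y i \<otimes> u q i) = (if p = q then \<one> else \<zero>))"
  proof (intro allI)
    fix p
    let ?u = "u(p := %_. \<zero>)"
    have u': "?u \<in> mats R" using u by (auto intro!: matsI)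
    show "\<exists>y. p < m --> y \<in> vecs R \<and> (\<forall>q < m. S N (%i. y i \<otimes> u q i) = (if p = q then \<one> else \<zero>))"
    proof (cases "in_span R N ?u m (u p) \<and> p < m")
      case True
      then obtain c where c: "c \<in> vecs R" "\<forall>i < N. u p i = S m (%q. c q \<otimes> ?u q i)"
        unfolding in_span_def by blast
      define d where "d q = (if q = p then \<ominus> \<one> else c q)" for q
      have d: "d \<in> vecs R" using c by (auto simp: d_def intro!: vecsI)
      have "S m (%q. d q \<otimes> u q i) = \<zero>" if "i < N" for i
      proof -
        have "S m (%q. d q \<otimes> u q i) = S m (%q. c q \<otimes> ?u q i \<oplus> (if q = p then \<ominus> u q i else \<zero>))"
          by (rule gsum_cong) (use c u in "auto simp: d_def l_minus")
        also have "\<dots> = u p i \<oplus> S m (%q. if q = p then \<ominus> u q i else \<zero>)"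
          using c u u' that by (subst S_add) auto
        also have "S m (%q. if q = p then \<ominus> u q i else \<zero>) = \<ominus> u p i"
          by (rule S_delta) (use True u in auto)
        finally show ?thesis using u by (simp add: r_neg)
      qed
      hence "d p = \<zero>" using indepD[OF u(2) d] True by blast
      hence False by (simp add: d_def)
      thus ?thesis by blast
    next
      case False
      show ?thesis
      proof (cases "p < m")
        case True
        hence "\<not> in_span R N ?u m (u p)" using False by blast
        moreover have "u p \<in> vecs R" using u by simp
        ultimately obtain y where y: "y \<in> vecs R" "\<forall>q < m. S N (%i. y i \<otimes> ?u q i) = \<zero>" "S N (%i. y i \<otimes> u p i) = \<one>"
          using separation[OF u'] by blast
        have "S N (%i. y i \<otimes> u q i) = (if p = q then \<one> else \<zero>)" if "q < m" for q
          using y(2)[rule_format, OF that] y(3) by (cases "p = q") auto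
        thus ?thesis using y(1) by blast
      qed auto
    qed
  qed
  then obtain y where y: "!!p. p < m ==> y p \<in> vecs R \<and> (\<forall>q < m. S N (%i. y p i \<otimes> u q i) = (if p = q then \<one> else \<zero>))"
    by metis
  show ?thesis
    by (rule that[of "%p. if p < m then y p else (%_. \<zero>)"]) (use y in "auto intro!: matsI")
qed

end

subsection \<open>Matrices\<close>

definition mv :: "('a, 'b) ring_scheme => nat => (nat => nat => 'a) => (nat => 'a) => nat => 'a" where
  "mv R d A v = (%i. rsum R d (%j. A i j \<otimes>\<^bsub>R\<^esub> v j))"

definition mm :: "('a, 'b) ring_scheme => nat => (nat => nat => 'a) => (nat => nat => 'a) => nat => nat => 'a" where
  "mm R d A B = (%i j. rsum R d (%c. A i c \<otimes>\<^bsub>R\<^esub> B c j))"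

text \<open>Only the entries below the dimensions are compared; beyond them matrices and vectors are arbitrary.\<close>

definition meq :: "nat => nat => (nat => nat => 'a) => (nat => nat => 'a) => bool" where
  "meq d e A B \<longleftrightarrow> (\<forall>i < d. \<forall>j < e. A i j = B i j)"

definition veq :: "nat => (nat => 'a) => (nat => 'a) => bool" where
  "veq d u v \<longleftrightarrow> (\<forall>i < d. u i = v i)"

lemma meq_refl [simp]: "meq d e A A" by (simp add: meq_def)
lemma meq_sym: "meq d e A B ==> meq d e B A" by (simp add: meq_def)
lemma meq_trans [trans]: "meq d e A B ==> meq d e B C ==> meq d e A C" by (simp add: meq_def)
lemma meq_eq_trans [trans]: "A = B ==> meq d e B C ==> meq d e A C" "meq d e A B ==> B = C ==> meq d e A C" by simp_all
lemma veq_eq_trans [trans]: "u = v ==> veq d v w ==> veq d u w" "veq d u v ==> v = w ==> veq d u w" by simp_all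
lemma veq_refl [simp]: "veq d v v" by (simp add: veq_def)
lemma veq_trans [trans]: "veq d u v ==> veq d v w ==> veq d u w" by (simp add: veq_def)

lemma mm_cong: "meq d c A A' ==> meq c e B B' ==> meq d e (mm R c A B) (mm R c A' B')"
  unfolding meq_def mm_def by (auto intro!: gsum_cong)

lemma mv_cong: "meq d c A A' ==> veq c v v' ==> veq d (mv R c A v) (mv R c A' v')"
  unfolding meq_def veq_def mv_def by (auto intro!: gsum_cong)

context cring
begin

lemma mv_vecs [simp, intro]: "A \<in> mats R ==> v \<in> vecs R ==> mv R d A v \<in> vecs R"
  by (auto simp: mv_def intro!: vecsI matsI)

lemma mm_mats [simp, intro]: "A \<in> mats R ==> B \<in> mats R ==> mm R d A B \<in> mats R"
  by (auto simp: mm_def intro!: matsI)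

lemma unit_mats [simp, intro]: "uvec R \<in> mats R"
  by (auto simp: uvec_def intro!: matsI)

lemma mm_assoc:
  "A \<in> mats R ==> B \<in> mats R ==> C \<in> mats R ==> mm R d A (mm R e B C) = mm R e (mm R d A B) C"
  unfolding mm_def by (intro ext S_assoc) auto

lemma mv_mm: "A \<in> mats R ==> B \<in> mats R ==> v \<in> vecs R ==> mv R e (mm R d A B) v = mv R d A (mv R e B v)"
  unfolding mm_def mv_def by (intro ext S_assoc[symmetric]) auto

lemma mm_unit_right: "A \<in> mats R ==> meq c d (mm R d A (uvec R)) A"
  unfolding mm_def meq_def uvec_def
  using S_mult_delta'(1)[of d "%i. A _ i"] by auto

lemma mm_unit_left: "A \<in> mats R ==> meq d c (mm R d (uvec R) A) A"
  unfolding mm_def meq_def uvec_def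
  using S_mult_delta(2)[of d "%i. A i _"] by auto

lemma mv_uvec: "A \<in> mats R ==> j < d ==> mv R d A (uvec R j) = (%i. A i j)"
  unfolding mv_def uvec_def using S_mult_delta(1)[of d "%i. A _ i" j] by auto

lemma mv_unit_mat: "v \<in> vecs R ==> veq d (mv R d (uvec R) v) v"
  unfolding veq_def mv_def uvec_def using S_mult_delta(2)[of d v] by auto

lemma mv_comb:
  assumes "A \<in> mats R" "x \<in> vecs R" "!!q. q < k ==> t q \<in> vecs R"
  shows "mv R d A (%i. S k (%q. x q \<otimes> t q i)) = (%i. S k (%q. x q \<otimes> mv R d A (t q) i))"
proof
  fix i
  have "mv R d A (%i. S k (%q. x q \<otimes> t q i)) i = S d (%j. A i j \<otimes> S k (%q. t q j \<otimes> x q))"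
    unfolding mv_def by (rule gsum_cong, rule arg_cong[where f = "%s. A i _ \<otimes> s"], rule gsum_cong) (use assms in "auto simp: m_comm")
  also have "\<dots> = S k (%q. S d (%j. A i j \<otimes> t q j) \<otimes> x q)" by (rule S_assoc) (use assms in auto)
  also have "\<dots> = S k (%q. x q \<otimes> mv R d A (t q) i)"
    unfolding mv_def by (rule gsum_cong) (use assms in "auto simp: m_comm")
  finally show "mv R d A (%i. S k (%q. x q \<otimes> t q i)) i = S k (%q. x q \<otimes> mv R d A (t q) i)" .
qed

lemma mv_zero: "A \<in> mats R ==> (!!j. j < d ==> v j = \<zero>) ==> mv R d A v i = \<zero>"
  unfolding mv_def by (rule S_eq_zero) auto

lemma mv_smult: "A \<in> mats R ==> v \<in> vecs R ==> a \<in> carrier R ==> mv R d A (%i. a \<otimes> v i) = (%i. a \<otimes> mv R d A v i)"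
  unfolding mv_def by (simp add: S_lmult m_lcomm)

lemma in_span_mv:
  assumes "A \<in> mats R" "u \<in> mats R" "v \<in> mats R" "in_span R D u m t" "!!p. p < m ==> in_span R D v k (mv R D A (u p))"
  shows "in_span R D v k (mv R D A t)"
proof -
  obtain c where c: "c \<in> vecs R" "\<forall>i < D. t i = S m (%p. c p \<otimes> u p i)"
    using assms(4) unfolding in_span_def by blast
  have "veq D (mv R D A t) (mv R D A (%i. S m (%p. c p \<otimes> u p i)))"
    by (rule mv_cong) (use c(2) in "auto simp: veq_def")
  also have "mv R D A (%i. S m (%p. c p \<otimes> u p i)) = (%i. S m (%p. c p \<otimes> mv R D A (u p) i))"
    by (rule mv_comb) (use assms c in auto)
  finally show ?thesis
    using in_span_comb[OF assms(3) c(1) assms(5), of m]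
      in_span_cong[of D "mv R D A t" "%i. S m (%p. c p \<otimes> mv R D A (u p) i)" v k]
    unfolding veq_def by simp
qed

end

context field
begin

text \<open>The preimages of the unit vectors form a right inverse, and injectivity makes it a left inverse; the
  dimensions agree by the exchange lemma.\<close>

lemma square_inverse:
  assumes A: "A \<in> mats R"
    and inj: "!!x. x \<in> vecs R ==> veq e (mv R d A x) (%_. \<zero>) ==> veq d x (%_. \<zero>)"
    and surj: "!!t. t \<in> vecs R ==> \<exists>x \<in> vecs R. veq e (mv R d A x) t"
  shows "d = e \<and> (\<exists>B \<in> mats R. meq d d (mm R d A B) (uvec R) \<and> meq d d (mm R d B A) (uvec R))"
proof -
  have "\<forall>j. \<exists>x. x \<in> vecs R \<and> veq e (mv R d A x) (uvec R j)" using surj by blast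
  then obtain Y where Y: "!!j. Y j \<in> vecs R" "!!j. veq e (mv R d A (Y j)) (uvec R j)" by metis
  define B where "B i j = Y j i" for i j
  have B: "B \<in> mats R" using Y by (auto simp: B_def intro!: matsI)
  have AB: "meq e e (mm R d A B) (uvec R)"
    using Y(2) unfolding meq_def veq_def mm_def mv_def B_def by (auto simp: uvec_def)
  have "d \<le> e"
  proof (rule ccontr)
    assume "\<not> d \<le> e"
    hence "e < d" by simp
    then obtain x j where x: "x \<in> vecs R" "j < d" "x j ~= \<zero>" "!!i. i < e ==> S d (%j. A i j \<otimes> x j) = \<zero>"
      using kernel_vector[OF A] by metis
    have "veq d x (%_. \<zero>)" by (rule inj[OF x(1)]) (use x(4) in "auto simp: veq_def mv_def")
    thus False using x by (simp add: veq_def)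
  qed
  moreover have "e \<le> d"
  proof (rule ccontr)
    assume "\<not> e \<le> d"
    hence "d < e" by simp
    then obtain x j where x: "x \<in> vecs R" "j < e" "x j ~= \<zero>" "!!i. i < d ==> S e (%j. B i j \<otimes> x j) = \<zero>"
      using kernel_vector[OF B] by metis
    have "veq e (mv R e (uvec R) x) (mv R e (mm R d A B) x)"
      by (rule mv_cong[OF meq_sym[OF AB]]) simp
    moreover have "mv R e (mm R d A B) x = mv R d A (mv R e B x)" by (rule mv_mm[OF A B x(1)])
    moreover have "mv R d A (mv R e B x) j = \<zero>" by (rule mv_zero[OF A]) (use x(4) in "auto simp: mv_def")
    ultimately show False using x mv_unit_mat[OF x(1), of e] by (simp add: veq_def)
  qed
  ultimately have de: "d = e" by simp
  have BA: "meq d d (mm R d B A) (uvec R)"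
    unfolding meq_def
  proof (intro allI impI)
    fix i j assume i: "i < d" and j: "j < d"
    let ?x = "%i. mm R d B A i j \<ominus> uvec R i j"
    have x: "?x \<in> vecs R" using A B by (auto intro!: vecsI)
    have "mv R d A ?x a = \<zero>" if "a < d" for a
    proof -
      have "mv R d A ?x a = mm R d A (mm R d B A) a j \<ominus> mm R d A (uvec R) a j"
        unfolding mv_def mm_def[of R d A] using A B
        by (subst S_minus[symmetric]) (auto simp: a_minus_def r_distr r_minus intro!: gsum_cong)
      also have "mm R d A (mm R d B A) a j = mm R d (mm R d A B) A a j" by (simp add: mm_assoc A B)
      also have "\<dots> = mm R d (uvec R) A a j"
        using mm_cong[where R = R, OF AB[folded de] meq_refl[of d d A]] that j by (simp add: meq_def)
      also have "\<dots> = A a j" using mm_unit_left[OF A] that j by (simp add: meq_def)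
      also have "mm R d A (uvec R) a j = A a j" using mm_unit_right[OF A, of d d] that j by (simp add: meq_def)
      finally show ?thesis using A by (simp add: a_minus_def r_neg)
    qed
    hence "?x i = \<zero>" using inj[OF x] i de by (simp add: veq_def)
    moreover have "mm R d B A i j \<in> carrier R" "uvec R i j \<in> carrier R" using mm_mats[OF B A] by auto
    ultimately show "mm R d B A i j = uvec R i j" by (simp only: r_right_minus_eq)
  qed
  have "meq d d (mm R d A B) (uvec R)" using AB unfolding de .
  with BA have "\<exists>B \<in> mats R. meq d d (mm R d A B) (uvec R) \<and> meq d d (mm R d B A) (uvec R)"
    using B by auto
  with de show ?thesis by simp
qed

end

section \<open>Representations of a finite group given by its multiplication table\<close>

locale fin_group =
  fixes n :: nat and mt :: "nat => nat => nat"
  assumes n_pos: "0 < n"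
    and mt_closed: "k < n ==> k' < n ==> mt k k' < n"
    and mt_assoc: "a < n ==> b < n ==> c < n ==> mt (mt a b) c = mt a (mt b c)"
    and mt_unit: "k < n ==> mt 0 k = k" "k < n ==> mt k 0 = k"
    and mt_bij: "k < n ==> bij_betw (mt k) {..<n} {..<n}"
begin

definition li :: "nat => nat => nat" where "li k = inv_into {..<n} (mt k)"

lemma li_mt [simp]: "k < n ==> k' < n ==> li k (mt k k') = k'"
  unfolding li_def using mt_bij[of k] by (simp add: bij_betw_def)

end

definition rep :: "('a, 'b) ring_scheme => nat => (nat => nat => nat) => nat => (nat => nat => nat => 'a) => bool" where
  "rep R n mt d N \<longleftrightarrow> (\<forall>k. N k \<in> mats R) \<and> meq d d (N 0) (uvec R) \<and>
    (\<forall>k < n. \<forall>k' < n. meq d d (N (mt k k')) (mm R d (N k) (N k')))"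

text \<open>Irreducibility, in the form that every nonzero vector generates the module.\<close>

definition irr :: "('a, 'b) ring_scheme => nat => nat => (nat => nat => nat => 'a) => bool" where
  "irr R n d N \<longleftrightarrow> 0 < d \<and>
    (\<forall>v \<in> vecs R. (\<exists>i < d. v i ~= \<zero>\<^bsub>R\<^esub>) --> (\<forall>t \<in> vecs R. in_span R d (%k. mv R d (N k) v) n t))"

text \<open>Expressions for the matrix units as combinations of the representing matrices. They form a finite
  certificate of irreducibility which stays valid over every extension field.\<close>

definition unit_mat_combs :: "('a, 'b) ring_scheme => nat => nat => (nat => nat => nat => 'a) => (nat => nat => nat => 'a) => bool" where
  "unit_mat_combs R n d N c \<longleftrightarrow> (\<forall>a < d. \<forall>b < d. c a b \<in> vecs R \<and>
    (\<forall>i < d. \<forall>j < d. rsum R n (%k. c a b k \<otimes>\<^bsub>R\<^esub> N k i j) = (if i = a \<and> j = b then \<one>\<^bsub>R\<^esub> else \<zero>\<^bsub>R\<^esub>)))"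

definition eqv :: "('a, 'b) ring_scheme => nat => nat => (nat => nat => nat => 'a) => (nat => nat => nat => 'a) => bool" where
  "eqv R n d N M \<longleftrightarrow> (\<exists>T \<in> mats R. \<exists>T' \<in> mats R. meq d d (mm R d T T') (uvec R) \<and> meq d d (mm R d T' T) (uvec R) \<and>
    (\<forall>k < n. meq d d (mm R d T (N k)) (mm R d (M k) T)))"

text \<open>The action of an element of the group algebra.\<close>

definition act :: "('a, 'b) ring_scheme => nat => nat => (nat => nat => nat => 'a) => (nat => 'a) => (nat => 'a) => nat => 'a" where
  "act R n d N c v = (%i. rsum R n (%k. c k \<otimes>\<^bsub>R\<^esub> mv R d (N k) v i))"

lemma irrD:
  assumes "irr R n d N" "v \<in> vecs R" "i < d" "v i ~= \<zero>\<^bsub>R\<^esub>" "t \<in> vecs R"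
  obtains c where "c \<in> vecs R" "!!i. i < d ==> t i = act R n d N c v i"
proof -
  have "\<exists>i < d. v i ~= \<zero>\<^bsub>R\<^esub>" using assms(3,4) by auto
  hence "in_span R d (%k. mv R d (N k) v) n t" using assms(1,2,5) unfolding irr_def by simp
  then obtain c where c: "c \<in> vecs R" "\<forall>i < d. t i = act R n d N c v i"
    unfolding in_span_def act_def by auto
  show ?thesis by (rule that[OF c(1)]) (use c(2) in simp)
qed

lemma irrI:
  assumes "0 < d" "!!v i t. v \<in> vecs R ==> i < d ==> v i ~= \<zero>\<^bsub>R\<^esub> ==> t \<in> vecs R ==> in_span R d (%k. mv R d (N k) v) n t"
  shows "irr R n d N"
  unfolding irr_def
proof (intro conjI ballI impI)
  fix v t assume "v \<in> vecs R" "\<exists>i < d. v i ~= \<zero>\<^bsub>R\<^esub>" "t \<in> vecs R"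
  then obtain i where i: "i < d" "v i ~= \<zero>\<^bsub>R\<^esub>" by auto
  show "in_span R d (%k. mv R d (N k) v) n t" by (rule assms(2)[OF \<open>v \<in> vecs R\<close> i \<open>t \<in> vecs R\<close>])
qed (rule assms(1))

lemma repD:
  assumes "rep R n mt d N"
  shows "N k \<in> mats R" "meq d d (N 0) (uvec R)" "k < n ==> k' < n ==> meq d d (N (mt k k')) (mm R d (N k) (N k'))"
  using assms unfolding rep_def by auto

context cring
begin

lemma act_vecs: "(!!k. N k \<in> mats R) ==> c \<in> vecs R ==> v \<in> vecs R ==> act R n d N c v \<in> vecs R"
  unfolding act_def by (intro vecsI S_closed m_closed) auto

lemma act_cong: "veq d v w ==> act R n d N c v = act R n d N c w"
  unfolding act_def mv_def veq_def by (auto intro!: gsum_cong ext arg_cong2[where f = "(\<otimes>)"])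

lemma act_lincomb:
  assumes "!!k. N k \<in> mats R" "v \<in> vecs R" "x \<in> vecs R" "!!b. b < m ==> c b \<in> vecs R"
  shows "act R n d N (%k. S m (%b. x b \<otimes> c b k)) v i = S m (%b. x b \<otimes> act R n d N (c b) v i)"
  unfolding act_def by (rule S_assoc[symmetric]) (use assms in auto)

lemma act_smult:
  assumes "!!k. N k \<in> mats R" "v \<in> vecs R" "a \<in> carrier R" "c \<in> vecs R"
  shows "act R n d N c (%i. a \<otimes> v i) i = a \<otimes> act R n d N c v i"
  unfolding act_def using assms by (subst S_lmult) (auto simp: mv_smult m_lcomm intro!: gsum_cong)

lemma act_diff:
  assumes "!!k. N k \<in> mats R" "v \<in> vecs R" "c \<in> vecs R" "c' \<in> vecs R"
  shows "act R n d N (%k. c k \<ominus> c' k) v i = act R n d N c v i \<ominus> act R n d N c' v i"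
  unfolding act_def using assms
  by (subst S_minus[symmetric]) (auto simp: a_minus_def l_distr l_minus intro!: gsum_cong)

lemma mv_act:
  assumes "!!k. N k \<in> mats R" "v \<in> vecs R" "c \<in> vecs R" "A \<in> mats R"
  shows "mv R d A (act R n d N c v) = (%i. S n (%k. c k \<otimes> mv R d A (mv R d (N k) v) i))"
  unfolding act_def by (rule mv_comb) (use assms in auto)

end

locale rep_setting = field R + fin_group n mt for R (structure) and n mt
begin

lemma act_unit:
  assumes "rep R n mt d N" "v \<in> vecs R" "i < d"
  shows "act R n d N (uvec R 0) v i = v i"
proof -
  have N: "N k \<in> mats R" for k using repD(1)[OF assms(1)] .
  have "act R n d N (uvec R 0) v i = mv R d (N 0) v i"
    unfolding act_def uvec_def by (rule S_mult_delta(2)[where k = 0]) (use N assms n_pos in auto)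
  also have "\<dots> = mv R d (uvec R) v i"
    using mv_cong[OF repD(2)[OF assms(1)] veq_refl, of R v] assms(3) by (simp add: veq_def)
  also have "\<dots> = v i" using mv_unit_mat[OF assms(2), of d] assms(3) by (simp add: veq_def)
  finally show ?thesis .
qed

lemma mv_rep_mt:
  assumes "rep R n mt d N" "v \<in> vecs R" "k < n" "k' < n" "i < d"
  shows "mv R d (N k) (mv R d (N k') v) i = mv R d (N (mt k k')) v i"
proof -
  have "mv R d (N k) (mv R d (N k') v) = mv R d (mm R d (N k) (N k')) v"
    by (rule mv_mm[symmetric]) (use repD(1)[OF assms(1)] assms in auto)
  thus ?thesis using mv_cong[OF repD(3)[OF assms(1,3,4)] veq_refl, of R v] assms(5) by (simp add: veq_def)
qed

definition shift :: "nat => (nat => 'a) => nat => 'a" where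
  "shift k c = (%k'. c (li k k'))"

lemma shift_sum:
  assumes "k < n" "c \<in> vecs R" "f \<in> vecs R"
  shows "S n (%k'. c k' \<otimes> f (mt k k')) = S n (%k'. shift k c k' \<otimes> f k')"
proof -
  have "S n (%k'. c k' \<otimes> f (mt k k')) = S n (%k'. shift k c (mt k k') \<otimes> f (mt k k'))"
    by (rule gsum_cong) (use assms in "simp add: shift_def")
  also have "\<dots> = S n (%k'. shift k c k' \<otimes> f k')"
    by (rule S_reindex[OF mt_bij]) (use assms in "auto simp: shift_def")
  finally show ?thesis .
qed

lemma shift_vecs: "c \<in> vecs R ==> shift k c \<in> vecs R"
  by (auto simp: shift_def intro!: vecsI)

lemma mv_rep_act:
  assumes "rep R n mt d N" "v \<in> vecs R" "c \<in> vecs R" "k < n" "i < d"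
  shows "mv R d (N k) (act R n d N c v) i = act R n d N (shift k c) v i"
proof -
  have N: "N k \<in> mats R" for k using repD(1)[OF assms(1)] .
  have "mv R d (N k) (act R n d N c v) i = S n (%k'. c k' \<otimes> mv R d (N (mt k k')) v i)"
    using mv_act[OF N assms(2,3) N] mv_rep_mt[OF assms(1,2,4) _ assms(5)] by (auto intro!: gsum_cong)
  also have "\<dots> = S n (%k'. shift k c k' \<otimes> mv R d (N k') v i)"
    by (rule shift_sum) (use assms N in "auto intro!: vecsI")
  finally show ?thesis by (simp add: act_def)
qed

lemma act_act:
  assumes N: "rep R n mt d N" and c: "c \<in> vecs R" "c' \<in> vecs R"
  obtains c'' where "c'' \<in> vecs R"
    "!!v i. v \<in> vecs R ==> i < d ==> act R n d N c (act R n d N c' v) i = act R n d N c'' v i"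
proof
  show "(%k'. S n (%k. c k \<otimes> shift k c' k')) \<in> vecs R" by (intro vecsI) (use c shift_vecs in auto)
  fix v i assume v: "v \<in> vecs R" and i: "i < d"
  have "act R n d N c (act R n d N c' v) i = S n (%k. c k \<otimes> act R n d N (shift k c') v i)"
    unfolding act_def[of R n d N c] by (rule gsum_cong) (use mv_rep_act[OF N v c(2) _ i] in simp)
  also have "\<dots> = act R n d N (%k'. S n (%k. c k \<otimes> shift k c' k')) v i"
    by (rule act_lincomb[symmetric]) (use repD(1)[OF N] v c shift_vecs in auto)
  finally show "act R n d N c (act R n d N c' v) i = act R n d N (%k'. S n (%k. c k \<otimes> shift k c' k')) v i" .
qed

lemma unit_mat_combs_act:
  assumes "!!k. N k \<in> mats R" "unit_mat_combs R n d N c" "v \<in> vecs R" "a < d" "b < d" "i < d"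
  shows "act R n d N (c a b) v i = (if i = a then v b else \<zero>)"
proof -
  have c: "c a b \<in> vecs R" "!!i j. i < d ==> j < d ==> S n (%k. c a b k \<otimes> N k i j) = (if i = a \<and> j = b then \<one> else \<zero>)"
    using assms unfolding unit_mat_combs_def by auto
  have "act R n d N (c a b) v i = S d (%j. S n (%k. c a b k \<otimes> N k i j) \<otimes> v j)"
    unfolding act_def mv_def by (rule S_assoc) (use assms c in auto)
  also have "\<dots> = S d (%j. (if j = b then if i = a then \<one> else \<zero> else \<zero>) \<otimes> v j)"
    by (rule gsum_cong) (use c assms in auto)
  also have "\<dots> = S d (%j. if j = b then (if i = a then \<one> else \<zero>) \<otimes> v j else \<zero>)"
    by (rule gsum_cong) (use assms in auto)
  also have "\<dots> = (if i = a then \<one> else \<zero>) \<otimes> v b" by (rule S_delta) (use assms in auto)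
  finally show ?thesis using assms by auto
qed

lemma unit_mat_combs_irr:
  assumes N: "!!k. N k \<in> mats R" and c: "unit_mat_combs R n d N c" and d: "0 < d"
  shows "irr R n d N"
proof (rule irrI[OF d])
  fix v b t assume v: "v \<in> vecs R" "b < d" "v b ~= \<zero>" and t: "t \<in> vecs R"
  obtain \<beta> where \<beta>: "\<beta> \<in> carrier R" "\<beta> \<otimes> v b = \<one>" using field_inverse[of "v b"] v by auto
  have "in_span R d (%k. mv R d (N k) v) n (act R n d N (c a b) v)" if "a < d" for a
    unfolding in_span_def act_def by (rule bexI[of _ "c a b"]) (use c that v in "auto simp: unit_mat_combs_def")
  moreover have "(%k. mv R d (N k) v) \<in> mats R" by (rule matsI, rule vecsD, rule mv_vecs, rule N, rule v(1))
  moreover have "(%a. t a \<otimes> \<beta>) \<in> vecs R" using t \<beta> by (auto intro!: vecsI)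
  ultimately have "in_span R d (%k. mv R d (N k) v) n (%i. S d (%a. (t a \<otimes> \<beta>) \<otimes> act R n d N (c a b) v i))"
    by (intro in_span_comb)
  moreover have "S d (%a. (t a \<otimes> \<beta>) \<otimes> act R n d N (c a b) v i) = t i" if "i < d" for i
  proof -
    have "S d (%a. (t a \<otimes> \<beta>) \<otimes> act R n d N (c a b) v i) = S d (%a. if a = i then (t a \<otimes> \<beta>) \<otimes> v b else \<zero>)"
      by (rule gsum_cong) (use t \<beta> v that unit_mat_combs_act[OF N c v(1) _ v(2) that] in auto)
    also have "\<dots> = t i \<otimes> \<beta> \<otimes> v b" by (rule S_delta) (use that t \<beta> v in auto)
    finally show ?thesis using t \<beta> v by (simp add: m_assoc)
  qed
  ultimately show "in_span R d (%k. mv R d (N k) v) n t" by (subst in_span_cong) auto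
qed

subsection \<open>Schur's lemma\<close>

lemma mv_intertwine:
  assumes "T \<in> mats R" "N k \<in> mats R" "M k \<in> mats R" "v \<in> vecs R"
    "meq e d (mm R d T (N k)) (mm R e (M k) T)" "i < e"
  shows "mv R d T (mv R d (N k) v) i = mv R e (M k) (mv R d T v) i"
  using mv_cong[OF assms(5) veq_refl, of R v] assms mv_mm[of T "N k" v d d] mv_mm[of "M k" T v d e]
  by (simp add: veq_def)

lemma act_intertwine:
  assumes T: "T \<in> mats R" and N: "!!k. N k \<in> mats R" and M: "!!k. M k \<in> mats R"
    and I: "!!k. k < n ==> meq e d (mm R d T (N k)) (mm R e (M k) T)"
    and v: "v \<in> vecs R" and c: "c \<in> vecs R" and i: "i < e"
  shows "mv R d T (act R n d N c v) i = act R n e M c (mv R d T v) i"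
proof -
  have "mv R d T (act R n d N c v) i = S n (%k. c k \<otimes> mv R d T (mv R d (N k) v) i)"
    using mv_act[OF N v c T] by simp
  also have "\<dots> = S n (%k. c k \<otimes> mv R e (M k) (mv R d T v) i)"
  proof (rule gsum_cong)
    fix k assume "k < n"
    from mv_intertwine[where N = N and M = M, OF T N M v I[OF this] i]
    show "c k \<otimes> mv R d T (mv R d (N k) v) i = c k \<otimes> mv R e (M k) (mv R d T v) i" by simp
  qed
  finally show ?thesis by (simp add: act_def)
qed

text \<open>The image of a vector generates the target, so \<open>T\<close> is surjective; every nonzero vector generates the
  source, so a nonzero kernel would make \<open>T\<close> vanish.\<close>

lemma schur_iso:
  assumes N: "!!k. N k \<in> mats R" "irr R n d N" and M: "!!k. M k \<in> mats R" "irr R n e M"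
    and T: "T \<in> mats R" "!!k. k < n ==> meq e d (mm R d T (N k)) (mm R e (M k) T)"
    and nz: "i0 < e" "j0 < d" "T i0 j0 ~= \<zero>"
  shows "d = e \<and> eqv R n d N M"
proof -
  have col: "mv R d T (uvec R j0) = (%i. T i j0)" by (rule mv_uvec[OF T(1) nz(2)])
  have "d = e \<and> (\<exists>B \<in> mats R. meq d d (mm R d T B) (uvec R) \<and> meq d d (mm R d B T) (uvec R))"
  proof (rule square_inverse[OF T(1)])
    fix x assume x: "x \<in> vecs R" "veq e (mv R d T x) (%_. \<zero>)"
    show "veq d x (%_. \<zero>)"
    proof (rule ccontr)
      assume "\<not> veq d x (%_. \<zero>)"
      then obtain i where i: "i < d" "x i ~= \<zero>" by (auto simp: veq_def)
      obtain c where c: "c \<in> vecs R" "!!i. i < d ==> uvec R j0 i = act R n d N c x i"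
        using irrD[OF N(2) x(1) i uvec_vecs] by metis
      have "T i0 j0 = mv R d T (act R n d N c x) i0"
        using mv_cong[OF meq_refl, of d "uvec R j0" "act R n d N c x" e R T] c(2) nz(1) col
        by (auto simp: veq_def)
      also have "\<dots> = act R n e M c (mv R d T x) i0"
        by (rule act_intertwine[where N = N and M = M, OF T(1) N(1) M(1) T(2) x(1) c(1) nz(1)])
      also have "\<dots> = act R n e M c (%_. \<zero>) i0" using act_cong[OF x(2)] by metis
      also have "\<dots> = \<zero>" unfolding act_def by (rule S_eq_zero) (use c M in "auto simp: mv_zero")
      finally show False using nz by simp
    qed
  next
    fix t assume t: "t \<in> vecs R"
    have y: "(%i. T i j0) \<in> vecs R" using T by (auto intro!: vecsI)
    obtain c where c: "c \<in> vecs R" "!!i. i < e ==> t i = act R n e M c (%i. T i j0) i"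
      using irrD[OF M(2) y nz(1) nz(3) t] by metis
    have "mv R d T (act R n d N c (uvec R j0)) i = t i" if "i < e" for i
      using act_intertwine[where N = N and M = M and v = "uvec R j0", OF T(1) N(1) M(1) T(2) uvec_vecs c(1) that] c(2)[OF that] col by simp
    hence "veq e (mv R d T (act R n d N c (uvec R j0))) t" by (simp add: veq_def)
    moreover have "act R n d N c (uvec R j0) \<in> vecs R" by (rule act_vecs[OF N(1) c(1) uvec_vecs])
    ultimately show "\<exists>x \<in> vecs R. veq e (mv R d T x) t" by blast
  qed
  thus ?thesis unfolding eqv_def using T by blast
qed

lemma eqv_refl: "(!!k. N k \<in> mats R) ==> eqv R n d N N"
  unfolding eqv_def
proof (intro bexI[of _ "uvec R"] conjI allI impI)
  assume N: "!!k. N k \<in> mats R"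
  show "meq d d (mm R d (uvec R) (uvec R)) (uvec R)" "meq d d (mm R d (uvec R) (uvec R)) (uvec R)"
    by (rule mm_unit_left, simp)+
  fix k
  have "meq d d (mm R d (uvec R) (N k)) (N k)" by (rule mm_unit_left[OF N])
  also have "meq d d (N k) (mm R d (N k) (uvec R))" by (rule meq_sym[OF mm_unit_right[OF N]])
  finally show "meq d d (mm R d (uvec R) (N k)) (mm R d (N k) (uvec R))" .
qed simp_all

lemma eqv_sym:
  assumes N: "!!k. N k \<in> mats R" "!!k. M k \<in> mats R" and E: "eqv R n d N M"
  shows "eqv R n d M N"
proof -
  obtain T T' where T: "T \<in> mats R" "T' \<in> mats R" "meq d d (mm R d T T') (uvec R)" "meq d d (mm R d T' T) (uvec R)"
    "!!k. k < n ==> meq d d (mm R d T (N k)) (mm R d (M k) T)"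
    using E unfolding eqv_def by blast
  have "meq d d (mm R d T' (M k)) (mm R d (N k) T')" if "k < n" for k
  proof -
    have "meq d d (mm R d T' (M k)) (mm R d T' (mm R d (M k) (mm R d T T')))"
      by (intro mm_cong[OF meq_refl] meq_trans[OF meq_sym[OF mm_unit_right] mm_cong[OF meq_refl meq_sym]] T N)
    also have "mm R d T' (mm R d (M k) (mm R d T T')) = mm R d T' (mm R d (mm R d (M k) T) T')"
      using T N by (simp add: mm_assoc)
    also have "meq d d \<dots> (mm R d T' (mm R d (mm R d T (N k)) T'))"
      by (intro mm_cong[OF meq_refl mm_cong[OF meq_sym meq_refl]] T that)
    also have "mm R d T' (mm R d (mm R d T (N k)) T') = mm R d (mm R d T' T) (mm R d (N k) T')"
      using T N by (simp add: mm_assoc)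
    also have "meq d d \<dots> (mm R d (uvec R) (mm R d (N k) T'))" by (intro mm_cong[OF _ meq_refl] T)
    also have "meq d d \<dots> (mm R d (N k) T')" by (rule mm_unit_left) (use T N in auto)
    finally show ?thesis .
  qed
  thus ?thesis using T unfolding eqv_def by blast
qed

lemma eqv_trans:
  assumes N: "!!k. N k \<in> mats R" "!!k. M k \<in> mats R" "!!k. L k \<in> mats R"
    and E: "eqv R n d N M" "eqv R n d M L"
  shows "eqv R n d N L"
proof -
  obtain T T' where T: "T \<in> mats R" "T' \<in> mats R" "meq d d (mm R d T T') (uvec R)" "meq d d (mm R d T' T) (uvec R)"
    "!!k. k < n ==> meq d d (mm R d T (N k)) (mm R d (M k) T)"
    using E(1) unfolding eqv_def by blast
  obtain Q Q' where Q: "Q \<in> mats R" "Q' \<in> mats R" "meq d d (mm R d Q Q') (uvec R)" "meq d d (mm R d Q' Q) (uvec R)"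
    "!!k. k < n ==> meq d d (mm R d Q (M k)) (mm R d (L k) Q)"
    using E(2) unfolding eqv_def by blast
  have inv: "meq d d (mm R d (mm R d A B) (mm R d B' A')) (uvec R)"
    if "A \<in> mats R" "A' \<in> mats R" "B \<in> mats R" "B' \<in> mats R" "meq d d (mm R d B B') (uvec R)" "meq d d (mm R d A A') (uvec R)" for A A' B B'
  proof -
    have "mm R d (mm R d A B) (mm R d B' A') = mm R d A (mm R d (mm R d B B') A')"
      using that by (simp add: mm_assoc)
    also have "meq d d \<dots> (mm R d A (mm R d (uvec R) A'))" by (rule mm_cong[OF meq_refl mm_cong[OF that(5) meq_refl]])
    also have "meq d d \<dots> (mm R d A A')" by (rule mm_cong[OF meq_refl mm_unit_left[OF that(2)]])
    also note that(6)
    finally show ?thesis .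
  qed
  have "meq d d (mm R d (mm R d Q T) (N k)) (mm R d (L k) (mm R d Q T))" if "k < n" for k
  proof -
    have "mm R d (mm R d Q T) (N k) = mm R d Q (mm R d T (N k))" using T Q N by (simp add: mm_assoc)
    also have "meq d d \<dots> (mm R d Q (mm R d (M k) T))" by (rule mm_cong[OF meq_refl T(5)[OF that]])
    also have "mm R d Q (mm R d (M k) T) = mm R d (mm R d Q (M k)) T" using T Q N by (simp add: mm_assoc)
    also have "meq d d \<dots> (mm R d (mm R d (L k) Q) T)" by (rule mm_cong[OF Q(5)[OF that] meq_refl])
    also have "mm R d (mm R d (L k) Q) T = mm R d (L k) (mm R d Q T)" using T Q N by (simp add: mm_assoc)
    finally show ?thesis .
  qed
  moreover have "meq d d (mm R d (mm R d Q T) (mm R d T' Q')) (uvec R)"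
    by (rule inv[OF Q(1,2) T(1,2) T(3) Q(3)])
  moreover have "meq d d (mm R d (mm R d T' Q') (mm R d Q T)) (uvec R)"
    by (rule inv[OF T(2,1) Q(2,1) Q(4) T(4)])
  ultimately show ?thesis unfolding eqv_def
    by (intro bexI[OF _ mm_mats[OF Q(1) T(1)]] bexI[OF _ mm_mats[OF T(2) Q(2)]]) blast
qed

text \<open>If \<open>\<tau>\<close> vanishes on the kernel of \<open>\<sigma>\<close> in the group algebra, choose an element \<open>a\<close> that \<open>\<sigma>\<close> maps
  to a diagonal matrix unit and \<open>\<tau>\<close> does not map to zero; then \<open>\<sigma>(x) e \<mapsto> \<tau>(x a) v\<close> is an isomorphism.\<close>

lemma kernel_inclusion_eqv:
  assumes N: "rep R n mt d N" "unit_mat_combs R n d N c" and M: "rep R n mt d M" "irr R n d M"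
    and ker: "!!x. x \<in> vecs R ==> (!!i j. i < d ==> j < d ==> S n (%k. x k \<otimes> N k i j) = \<zero>) ==>
      (!!i j. i < d ==> j < d ==> S n (%k. x k \<otimes> M k i j) = \<zero>)"
  shows "eqv R n d N M"
proof -
  have d: "0 < d" using M(2) by (simp add: irr_def)
  have Nm: "N k \<in> mats R" and Mm: "M k \<in> mats R" for k using repD(1)[OF N(1)] repD(1)[OF M(1)] by auto
  have c: "c a b \<in> vecs R" "!!i j. i < d ==> j < d ==> S n (%k. c a b k \<otimes> N k i j) = (if i = a \<and> j = b then \<one> else \<zero>)"
    if "a < d" "b < d" for a b using N(2) that unfolding unit_mat_combs_def by auto
  have same: "S n (%k. x k \<otimes> M k i j) = S n (%k. y k \<otimes> M k i j)"
    if "x \<in> vecs R" "y \<in> vecs R" "!!i j. i < d ==> j < d ==> S n (%k. x k \<otimes> N k i j) = S n (%k. y k \<otimes> N k i j)" "i < d" "j < d"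
    for x y i j
  proof -
    have diff: "S n (%k. (x k \<ominus> y k) \<otimes> L k i j) = S n (%k. x k \<otimes> L k i j) \<ominus> S n (%k. y k \<otimes> L k i j)"
      if "!!k. L k \<in> mats R" for L i j
    proof -
      have "S n (%k. (x k \<ominus> y k) \<otimes> L k i j) = S n (%k. x k \<otimes> L k i j \<ominus> y k \<otimes> L k i j)"
        by (rule gsum_cong) (use \<open>x \<in> vecs R\<close> \<open>y \<in> vecs R\<close> that in "simp add: a_minus_def l_distr l_minus")
      also have "\<dots> = S n (%k. x k \<otimes> L k i j) \<ominus> S n (%k. y k \<otimes> L k i j)"
        by (rule S_minus) (use \<open>x \<in> vecs R\<close> \<open>y \<in> vecs R\<close> that in auto)
      finally show ?thesis .
    qed
    have "S n (%k. (x k \<ominus> y k) \<otimes> M k i j) = \<zero>"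
    proof (rule ker)
      show "(%k. x k \<ominus> y k) \<in> vecs R" using that by (auto intro!: vecsI)
      show "S n (%k. (x k \<ominus> y k) \<otimes> N k i j) = \<zero>" if "i < d" "j < d" for i j
        using diff[of N i j, OF Nm] \<open>!!i j. i < d ==> j < d ==> S n (%k. x k \<otimes> N k i j) = S n (%k. y k \<otimes> N k i j)\<close>[OF that]
          \<open>y \<in> vecs R\<close> Nm by (simp add: a_minus_def r_neg)
    qed (use that in auto)
    thus ?thesis using diff[of M i j, OF Mm] that(1,2) Mm by simp
  qed
  \<comment> \<open>some diagonal matrix unit has nonzero image, as their sum has image \<open>1\<close>\<close>
  have "\<exists>\<beta> i j. \<beta> < d \<and> i < d \<and> j < d \<and> S n (%k. c \<beta> \<beta> k \<otimes> M k i j) ~= \<zero>"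
  proof (rule ccontr)
    assume "\<not> ?thesis"
    hence zero: "S n (%k. c \<beta> \<beta> k \<otimes> M k i j) = \<zero>" if "\<beta> < d" "i < d" "j < d" for \<beta> i j using that by blast
    let ?x = "%k. S d (%b. \<one> \<otimes> (if b < d then c b b k else \<zero>))"
    have x: "?x \<in> vecs R" by (intro vecsI S_closed m_closed one_closed) (use c in auto)
    have sum: "S n (%k. ?x k \<otimes> L k i j) = S d (%b. \<one> \<otimes> S n (%k. (if b < d then c b b k else \<zero>) \<otimes> L k i j))"
      if "!!k. L k \<in> mats R" for L i j
      by (rule S_assoc[symmetric]) (use c that in auto)
    have "S n (%k. ?x k \<otimes> M k 0 0) = S n (%k. uvec R 0 k \<otimes> M k 0 0)"
    proof (rule same[OF x uvec_vecs _ d d])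
      fix i j assume ij: "i < d" "j < d"
      have "S n (%k. ?x k \<otimes> N k i j) = S d (%b. if b = i then (if i = j then \<one> else \<zero>) else \<zero>)"
        unfolding sum[OF Nm] by (rule gsum_cong) (use c ij in auto)
      also have "\<dots> = (if i = j then \<one> else \<zero>)" by (rule S_delta) (use ij in auto)
      also have "\<dots> = N 0 i j" using repD(2)[OF N(1)] ij by (auto simp: meq_def uvec_def)
      also have "\<dots> = S n (%k. uvec R 0 k \<otimes> N k i j)"
        unfolding uvec_def by (rule S_mult_delta(2)[symmetric]) (use Nm n_pos in auto)
      finally show "S n (%k. ?x k \<otimes> N k i j) = S n (%k. uvec R 0 k \<otimes> N k i j)" .
    qed
    also have "\<dots> = M 0 0 0"
      unfolding uvec_def by (rule S_mult_delta(2)) (use Mm n_pos in auto)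
    also have "\<dots> = \<one>" using repD(2)[OF M(1)] d by (auto simp: meq_def uvec_def)
    finally have "S n (%k. ?x k \<otimes> M k 0 0) = \<one>" .
    moreover have "S n (%k. ?x k \<otimes> M k 0 0) = \<zero>"
      unfolding sum[OF Mm] by (rule S_eq_zero) (use zero d in auto)
    ultimately show False by simp
  qed
  then obtain \<beta> i0 j0 where \<beta>: "\<beta> < d" "i0 < d" "j0 < d" "S n (%k. c \<beta> \<beta> k \<otimes> M k i0 j0) ~= \<zero>" by blast
  define T where "T i a = (if a < d then S n (%k. c a \<beta> k \<otimes> M k i j0) else \<zero>)" for i a
  have T: "T \<in> mats R" unfolding T_def by (intro matsI) (use c \<beta> Mm in auto)
  have "meq d d (mm R d T (N g)) (mm R d (M g) T)" if g: "g < n" for g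
    unfolding meq_def
  proof (intro allI impI)
    fix i a assume ia: "i < d" "a < d"
    let ?c1 = "%k. S d (%b. N g b a \<otimes> (if b < d then c b \<beta> k else \<zero>))"
    have c1: "?c1 \<in> vecs R" by (intro vecsI S_closed) (use c \<beta> Nm in auto)
    have c1_sum: "S n (%k. ?c1 k \<otimes> L k i j) = S d (%b. N g b a \<otimes> S n (%k. c b \<beta> k \<otimes> L k i j))"
      if "!!k. L k \<in> mats R" for L i j
    proof -
      have "S n (%k. ?c1 k \<otimes> L k i j) = S d (%b. N g b a \<otimes> S n (%k. (if b < d then c b \<beta> k else \<zero>) \<otimes> L k i j))"
        by (rule S_assoc[symmetric]) (use c \<beta> Nm that in auto)
      also have "\<dots> = S d (%b. N g b a \<otimes> S n (%k. c b \<beta> k \<otimes> L k i j))"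
        by (intro gsum_cong arg_cong2[where f = "(\<otimes>)"] refl) auto
      finally show ?thesis .
    qed
    have "mm R d T (N g) i a = S d (%b. N g b a \<otimes> S n (%k. c b \<beta> k \<otimes> M k i j0))"
      unfolding mm_def by (rule gsum_cong) (use c \<beta> Nm Mm in "auto simp: T_def m_comm")
    also have "\<dots> = S n (%k. ?c1 k \<otimes> M k i j0)" by (rule c1_sum[OF Mm, symmetric])
    also have "\<dots> = S n (%k. shift g (c a \<beta>) k \<otimes> M k i j0)"
    proof (rule same[OF c1 shift_vecs _ ia(1) \<beta>(3)])
      show "c a \<beta> \<in> vecs R" using c ia \<beta> by blast
      fix i' j' assume ij: "i' < d" "j' < d"
      have "S n (%k. ?c1 k \<otimes> N k i' j') = S d (%b. if b = i' then N g b a \<otimes> (if j' = \<beta> then \<one> else \<zero>) else \<zero>)"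
        unfolding c1_sum[OF Nm] by (rule gsum_cong) (use c ij \<beta> Nm in auto)
      also have "\<dots> = N g i' a \<otimes> (if j' = \<beta> then \<one> else \<zero>)" by (rule S_delta) (use ij Nm in auto)
      also have "\<dots> = S d (%e. if e = a then N g i' e \<otimes> (if j' = \<beta> then \<one> else \<zero>) else \<zero>)"
        by (rule S_delta[symmetric]) (use ia Nm in auto)
      also have "\<dots> = S d (%e. N g i' e \<otimes> S n (%k. N k e j' \<otimes> c a \<beta> k))"
      proof (rule gsum_cong)
        fix e assume e: "e < d"
        have "S n (%k. N k e j' \<otimes> c a \<beta> k) = S n (%k. c a \<beta> k \<otimes> N k e j')"
          by (rule gsum_cong) (use c ia \<beta> Nm in "simp add: m_comm")
        thus "(if e = a then N g i' e \<otimes> (if j' = \<beta> then \<one> else \<zero>) else \<zero>) = N g i' e \<otimes> S n (%k. N k e j' \<otimes> c a \<beta> k)"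
          using c ia \<beta> e ij Nm by auto
      qed
      also have "\<dots> = S n (%k. S d (%e. N g i' e \<otimes> N k e j') \<otimes> c a \<beta> k)"
        by (rule S_assoc) (use c ia \<beta> Nm in auto)
      also have "\<dots> = S n (%k. c a \<beta> k \<otimes> N (mt g k) i' j')"
        by (rule gsum_cong) (use c ia \<beta> Nm repD(3)[OF N(1) g] ij in "auto simp: meq_def mm_def m_comm")
      also have "\<dots> = S n (%k. shift g (c a \<beta>) k \<otimes> N k i' j')"
        by (rule shift_sum[OF g]) (use c ia \<beta> Nm in "auto intro!: vecsI")
      finally show "S n (%k. ?c1 k \<otimes> N k i' j') = S n (%k. shift g (c a \<beta>) k \<otimes> N k i' j')" .
    qed
    also have "\<dots> = S n (%k. c a \<beta> k \<otimes> M (mt g k) i j0)"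
      by (rule shift_sum[OF g, symmetric]) (use c ia \<beta> Mm in "auto intro!: vecsI")
    also have "\<dots> = S n (%k. S d (%e. M g i e \<otimes> M k e j0) \<otimes> c a \<beta> k)"
      by (rule gsum_cong) (use c ia \<beta> Mm repD(3)[OF M(1) g] in "auto simp: meq_def mm_def m_comm")
    also have "\<dots> = S d (%e. M g i e \<otimes> S n (%k. M k e j0 \<otimes> c a \<beta> k))"
      by (rule S_assoc[symmetric]) (use c ia \<beta> Mm in auto)
    also have "\<dots> = mm R d (M g) T i a"
      unfolding mm_def T_def using ia c \<beta> Mm
      by (intro gsum_cong arg_cong2[where f = "(\<otimes>)"] refl) (auto simp: m_comm intro!: gsum_cong)
    finally show "mm R d T (N g) i a = mm R d (M g) T i a" .
  qed
  moreover have "T i0 \<beta> ~= \<zero>" using \<beta> by (simp add: T_def)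
  ultimately show ?thesis
    using schur_iso[OF Nm unit_mat_combs_irr[OF Nm N(2) d] Mm M(2) T] \<beta> by blast
qed

end

subsection \<open>Eigenvectors and fixed vectors\<close>

definition has_roots :: "('a, 'b) ring_scheme => bool" where
  "has_roots R \<longleftrightarrow> (\<forall>x \<in> vecs R. \<forall>k > 0. x k ~= \<zero>\<^bsub>R\<^esub> -->
    (\<exists>t \<in> carrier R. rsum R (Suc k) (%i. x i \<otimes>\<^bsub>R\<^esub> t [^]\<^bsub>R\<^esub> i) = \<zero>\<^bsub>R\<^esub>))"

context field
begin

lemma cyclic_family:
  assumes u: "u \<in> mats R" "i < d" "u 0 i ~= \<zero>"
  obtains k a where "indep R d u (Suc k)" "a \<in> vecs R" "!!i. i < d ==> u (Suc k) i = S (Suc k) (%p. a p \<otimes> u p i)"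
proof -
  have step: "indep R d u (Suc k)" if "indep R d u k" "\<not> in_span R d u k (u k)" for k
    using indep_extend[OF u(1) that(1) _ that(2)] u(1) by simp
  have base: "indep R d u 0" by (simp add: indep_def)
  have ex: "\<exists>k. in_span R d u k (u k)"
  proof (rule ccontr)
    assume "\<not> ?thesis"
    hence "indep R d u k" for k by (induction k) (use base step in auto)
    from steinitz[OF unit_mats u(1) this[of "Suc d"], of d] show False
      using in_span_uvecs u(1) by simp
  qed
  define K where "K = (LEAST k. in_span R d u k (u k))"
  have K: "in_span R d u K (u K)" unfolding K_def by (rule LeastI_ex[OF ex])
  have ind: "indep R d u k" if "k \<le> K" for k
    using that
  proof (induction k)
    case (Suc k)
    hence "\<not> in_span R d u k (u k)" using not_less_Least[of k "%k. in_span R d u k (u k)"] by (simp add: K_def)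
    thus ?case using step Suc by simp
  qed (rule base)
  have "K ~= 0"
  proof
    assume "K = 0"
    hence "u 0 i = \<zero>" using K u(2) by (auto simp: in_span_def)
    thus False using u(3) by simp
  qed
  then obtain k where k: "K = Suc k" by (cases K) auto
  obtain a where "a \<in> vecs R" "\<forall>i < d. u (Suc k) i = S (Suc k) (%p. a p \<otimes> u p i)"
    using K unfolding k in_span_def by blast
  thus ?thesis using that[of k a] ind[of K] k by simp
qed

lemma shift_comb:
  assumes u: "u \<in> mats R" and a: "a \<in> vecs R" and y: "y \<in> vecs R" and z: "z \<in> vecs R"
    and uk: "u (Suc k) i = S (Suc k) (%p. a p \<otimes> u p i)"
    and z0: "z 0 = y k \<otimes> a 0" and zS: "!!p. p < k ==> z (Suc p) = y p \<oplus> y k \<otimes> a (Suc p)"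
  shows "S (Suc k) (%p. y p \<otimes> u (Suc p) i) = S (Suc k) (%p. z p \<otimes> u p i)"
proof -
  have "S (Suc k) (%p. y p \<otimes> u (Suc p) i) = S k (%p. y p \<otimes> u (Suc p) i) \<oplus> y k \<otimes> u (Suc k) i" by simp
  also have "u (Suc k) i = a 0 \<otimes> u 0 i \<oplus> S k (%p. a (Suc p) \<otimes> u (Suc p) i)"
    unfolding uk by (rule S_Suc_shift) (use u a in auto)
  also have "S k (%p. y p \<otimes> u (Suc p) i) \<oplus> y k \<otimes> (a 0 \<otimes> u 0 i \<oplus> S k (%p. a (Suc p) \<otimes> u (Suc p) i))
      = y k \<otimes> (a 0 \<otimes> u 0 i) \<oplus> (S k (%p. y p \<otimes> u (Suc p) i) \<oplus> y k \<otimes> S k (%p. a (Suc p) \<otimes> u (Suc p) i))"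
    using u a y by (simp add: r_distr a_lcomm)
  also have "S k (%p. y p \<otimes> u (Suc p) i) \<oplus> y k \<otimes> S k (%p. a (Suc p) \<otimes> u (Suc p) i)
      = S k (%p. y p \<otimes> u (Suc p) i \<oplus> y k \<otimes> (a (Suc p) \<otimes> u (Suc p) i))"
    using u a y by (simp add: S_add S_lmult)
  also have "\<dots> = S k (%p. z (Suc p) \<otimes> u (Suc p) i)"
    by (rule gsum_cong) (use u a y zS in "simp add: l_distr m_assoc")
  also have "y k \<otimes> (a 0 \<otimes> u 0 i) = z 0 \<otimes> u 0 i" using u a y z0 by (simp add: m_assoc)
  also have "z 0 \<otimes> u 0 i \<oplus> S k (%p. z (Suc p) \<otimes> u (Suc p) i) = S (Suc k) (%p. z p \<otimes> u p i)"
    by (rule S_Suc_shift[symmetric]) (use u z in auto)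
  finally show ?thesis .
qed

text \<open>With \<open>T\<^sup>k v = a\<^sub>0 v + \<dots> + a\<^bsub>k-1\<^esub> T\<^bsup>k-1\<^esup> v\<close> and \<open>t\<close> a root of \<open>X\<^sup>k - a\<^bsub>k-1\<^esub> X\<^bsup>k-1\<^esup> - \<dots> - a\<^sub>0\<close>, the
  quotient of this polynomial by \<open>X - t\<close>, evaluated at \<open>T\<close>, sends \<open>v\<close> to an eigenvector.\<close>

lemma eigenvector:
  assumes roots: "has_roots R" and T: "T \<in> mats R" and d: "0 < d"
  obtains w t i where "w \<in> vecs R" "t \<in> carrier R" "i < d" "w i ~= \<zero>" "!!i. i < d ==> mv R d T w i = t \<otimes> w i"
proof -
  define u where "u p = (mv R d T ^^ p) (uvec R 0)" for p
  have uv: "u p \<in> vecs R" for p by (induction p) (auto simp: u_def T)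
  have u: "u \<in> mats R" using uv by (auto intro!: matsI)
  have uS: "u (Suc p) = mv R d T (u p)" for p by (simp add: u_def)
  have u0: "u 0 0 ~= \<zero>" by (simp add: u_def uvec_def)
  obtain k a where ka: "indep R d u (Suc k)" "a \<in> vecs R" "!!i. i < d ==> u (Suc k) i = S (Suc k) (%p. a p \<otimes> u p i)"
    by (rule cyclic_family[OF u d u0]) blast
  define x where "x i = (if i < Suc k then \<ominus> a i else if i = Suc k then \<one> else \<zero>)" for i
  have x: "x \<in> vecs R" by (rule vecsI) (use ka(2) in "simp add: x_def")
  have "x (Suc k) ~= \<zero>" by (simp add: x_def)
  then obtain t where t: "t \<in> carrier R" "S (Suc (Suc k)) (%i. x i \<otimes> t [^] i) = \<zero>"
    using roots x unfolding has_roots_def by blast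
  define r where "r = rec_nat \<one> (%j y. t \<otimes> y \<ominus> a (k - j))"
  have r0: "r 0 = \<one>" and rS: "r (Suc j) = t \<otimes> r j \<ominus> a (k - j)" for j by (simp_all add: r_def)
  have r: "r j \<in> carrier R" for j by (induction j) (use t ka(2) in "auto simp: r0 rS")
  have r_sum: "r j = S (Suc j) (%i. x (Suc k - j + i) \<otimes> t [^] i)" if "j \<le> Suc k" for j
    using that
  proof (induction j)
    case 0
    show ?case by (simp add: r0 x_def)
  next
    case (Suc j)
    hence IH: "r j = S (Suc j) (%i. x (Suc k - j + i) \<otimes> t [^] i)" and j: "j \<le> k" by simp_all
    have "S (Suc (Suc j)) (%i. x (Suc k - Suc j + i) \<otimes> t [^] i)
        = x (Suc k - Suc j + 0) \<otimes> t [^] (0::nat) \<oplus> S (Suc j) (%i. x (Suc k - Suc j + Suc i) \<otimes> t [^] Suc i)"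
      by (rule S_Suc_shift) (use x t in auto)
    also have "S (Suc j) (%i. x (Suc k - Suc j + Suc i) \<otimes> t [^] Suc i) = S (Suc j) (%i. t \<otimes> (x (Suc k - j + i) \<otimes> t [^] i))"
    proof (rule gsum_cong)
      fix i
      have "Suc k - Suc j + Suc i = Suc k - j + i" using j by simp
      thus "x (Suc k - Suc j + Suc i) \<otimes> t [^] Suc i = t \<otimes> (x (Suc k - j + i) \<otimes> t [^] i)"
        using vecsD[OF x] t(1) by (simp only: nat_pow_Suc m_ac nat_pow_closed m_closed)
    qed
    also have "\<dots> = t \<otimes> r j" unfolding IH by (rule S_lmult[symmetric]) (use x t in auto)
    also have "x (Suc k - Suc j + 0) \<otimes> t [^] (0::nat) = \<ominus> a (k - j)" using j ka(2) by (simp add: x_def less_Suc_eq_le)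
    also have "\<ominus> a (k - j) \<oplus> t \<otimes> r j = r (Suc j)" using r t ka(2) by (simp add: rS a_minus_def a_comm)
    finally show ?case by simp
  qed
  have rk: "r (Suc k) = \<zero>" using r_sum[of "Suc k"] t by simp
  define b where "b p = (if p \<le> k then r (k - p) else \<zero>)" for p
  have b: "b \<in> vecs R" by (rule vecsI) (simp add: b_def r)
  define w where "w = (%i. S (Suc k) (%p. b p \<otimes> u p i))"
  have w: "w \<in> vecs R" unfolding w_def by (intro vecsI) (use b u in auto)
  have eig: "mv R d T w i = t \<otimes> w i" if i: "i < d" for i
  proof -
    have "mv R d T w = (%i. S (Suc k) (%p. b p \<otimes> mv R d T (u p) i))"
      unfolding w_def by (rule mv_comb) (use T b uv in auto)
    hence "mv R d T w i = S (Suc k) (%p. b p \<otimes> u (Suc p) i)" by (simp add: uS)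
    also have "\<dots> = S (Suc k) (%p. (t \<otimes> b p) \<otimes> u p i)"
    proof (rule shift_comb[OF u ka(2) b _ ka(3)[OF i]])
      show "(%p. t \<otimes> b p) \<in> vecs R" using t b by (auto intro!: vecsI)
      have "t \<otimes> r k = a 0" using rk rS[of k] t r ka(2) by simp
      thus "t \<otimes> b 0 = b k \<otimes> a 0" using ka(2) by (simp add: b_def r0)
      fix p assume p: "p < k"
      have "r (k - p) = t \<otimes> r (k - Suc p) \<ominus> a (Suc p)"
        using rS[of "k - Suc p"] p by (simp add: Suc_diff_Suc)
      thus "t \<otimes> b (Suc p) = b p \<oplus> b k \<otimes> a (Suc p)"
        using p t r ka(2) by (simp add: b_def r0 a_minus_def a_assoc l_neg)
    qed
    also have "\<dots> = S (Suc k) (%p. t \<otimes> (b p \<otimes> u p i))"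
      by (rule gsum_cong) (use t(1) b u in "simp add: m_assoc")
    also have "\<dots> = t \<otimes> S (Suc k) (%p. b p \<otimes> u p i)" by (rule S_lmult[symmetric]) (use t(1) b u in auto)
    finally show ?thesis by (simp only: w_def)
  qed
  have "\<exists>i < d. w i ~= \<zero>"
  proof (rule ccontr)
    assume "\<not> ?thesis"
    hence "S (Suc k) (%p. b p \<otimes> u p i) = \<zero>" if "i < d" for i using that by (simp add: w_def)
    from indepD[OF ka(1) b this, of k] show False by (simp add: b_def r0)
  qed
  thus ?thesis using that w t eig by blast
qed

end

context rep_setting
begin

text \<open>The map \<open>c y \<mapsto> c z\<close> is then a well-defined endomorphism, and it is multiplication by its
  eigenvalue.\<close>

lemma schur_scalar:
  assumes roots: "has_roots R" and N: "rep R n mt d N" "irr R n d N"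
    and y: "y \<in> vecs R" "i0 < d" "y i0 ~= \<zero>" and z: "z \<in> vecs R"
    and ann: "!!c. c \<in> vecs R ==> (!!i. i < d ==> act R n d N c y i = \<zero>) ==> (!!i. i < d ==> act R n d N c z i = \<zero>)"
  obtains t where "t \<in> carrier R" "!!i. i < d ==> z i = t \<otimes> y i"
proof -
  have Nm: "N k \<in> mats R" for k using repD(1)[OF N(1)] .
  have d: "0 < d" using N(2) by (simp add: irr_def)
  have "\<exists>c. c \<in> vecs R \<and> (\<forall>i < d. uvec R b i = act R n d N c y i)" for b
    by (rule irrD[OF N(2) y uvec_vecs[of b]]) blast
  then obtain c where c: "!!b. c b \<in> vecs R" "!!b i. i < d ==> uvec R b i = act R n d N (c b) y i" by metis
  define T where "T i b = act R n d N (c b) z i" for i b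
  have T: "T \<in> mats R" unfolding T_def by (intro matsI vecsD act_vecs[where N = N, OF Nm c(1) z])
  obtain w t i1 where w: "w \<in> vecs R" "t \<in> carrier R" "i1 < d" "w i1 ~= \<zero>" "!!i. i < d ==> mv R d T w i = t \<otimes> w i"
    by (rule eigenvector[OF roots T d]) blast
  define c0 where "c0 = (%k. S d (%b. w b \<otimes> c b k))"
  have c0: "c0 \<in> vecs R" unfolding c0_def by (intro vecsI) (use w c in auto)
  have c0y: "act R n d N c0 y i = w i" if "i < d" for i
  proof -
    have "act R n d N c0 y i = S d (%b. w b \<otimes> act R n d N (c b) y i)"
      unfolding c0_def by (rule act_lincomb[OF Nm y(1) w(1) c(1)])
    also have "\<dots> = S d (%b. w b \<otimes> (if i = b then \<one> else \<zero>))"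
      by (rule gsum_cong) (use c(2)[OF that] in "simp add: uvec_def")
    also have "\<dots> = w i" by (rule S_mult_delta') (use w that in auto)
    finally show ?thesis .
  qed
  have c0z: "act R n d N c0 z i = t \<otimes> w i" if "i < d" for i
  proof -
    have "act R n d N c0 z i = S d (%b. w b \<otimes> act R n d N (c b) z i)"
      unfolding c0_def by (rule act_lincomb[OF Nm z w(1) c(1)])
    also have "\<dots> = mv R d T w i"
      unfolding mv_def T_def by (rule gsum_cong) (use w c z Nm act_vecs in "simp add: m_comm")
    finally show ?thesis using w(5)[OF that] by simp
  qed
  obtain c1 where c1: "c1 \<in> vecs R" "!!i. i < d ==> y i = act R n d N c1 w i"
    by (rule irrD[OF N(2) w(1,3,4) y(1)]) blast
  obtain c2 where c2: "c2 \<in> vecs R" "!!v i. v \<in> vecs R ==> i < d ==> act R n d N c1 (act R n d N c0 v) i = act R n d N c2 v i"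
    by (rule act_act[OF N(1) c1(1) c0]) blast
  let ?c = "%k. c2 k \<ominus> uvec R 0 k"
  have c: "?c \<in> vecs R" using c2 by (auto intro!: vecsI)
  have "act R n d N ?c y i = \<zero>" if "i < d" for i
  proof -
    have "act R n d N c2 y i = act R n d N c1 w i"
      using c2(2)[OF y(1) that] act_cong[of d "act R n d N c0 y" w n N c1] c0y by (simp add: veq_def)
    also have "\<dots> = y i" by (rule c1(2)[OF that, symmetric])
    finally have "act R n d N c2 y i = y i" .
    hence "act R n d N ?c y i = y i \<ominus> y i"
      using act_diff[where N = N, OF Nm y(1) c2(1) uvec_vecs] act_unit[OF N(1) y(1) that] by simp
    thus ?thesis using y(1) by (simp add: a_minus_def r_neg)
  qed
  hence "act R n d N ?c z i = \<zero>" if "i < d" for i using ann[OF c] that by blast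
  hence c2z: "act R n d N c2 z i = z i" if "i < d" for i
  proof -
    have "act R n d N c2 z i \<ominus> z i = \<zero>"
      using that act_diff[where N = N, OF Nm z c2(1) uvec_vecs] act_unit[OF N(1) z that] \<open>!!i. i < d ==> act R n d N ?c z i = \<zero>\<close>[OF that] by simp
    moreover have "act R n d N c2 z i \<in> carrier R" by (rule vecsD[OF act_vecs[where N = N, OF Nm c2(1) z]])
    ultimately show ?thesis using z by simp
  qed
  have "z i = t \<otimes> y i" if "i < d" for i
  proof -
    have "z i = act R n d N c1 (act R n d N c0 z) i" using c2(2)[OF z that] c2z[OF that] by simp
    also have "\<dots> = act R n d N c1 (%i. t \<otimes> w i) i"
      using act_cong[of d "act R n d N c0 z" "%i. t \<otimes> w i" n N c1] c0z by (simp add: veq_def)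
    also have "\<dots> = t \<otimes> y i" using act_smult[where N = N, OF Nm w(1,2) c1(1)] c1(2)[OF that] by simp
    finally show ?thesis .
  qed
  thus ?thesis using that w(2) by blast
qed

text \<open>A nonzero linear form on matrices that vanishes on a representation is a family \<open>y\<close> of vectors.
  In one with the fewest nonzero members all members are proportional, by Schur's lemma, so the form is
  given by a matrix of rank one, which cannot vanish on an irreducible representation.\<close>

lemma annihilator_zero:
  assumes roots: "has_roots R" and N: "rep R n mt d N" "irr R n d N"
  shows "y \<in> mats R ==> (!!k. k < n ==> S d (%j. mv R d (N k) (y j) j) = \<zero>) ==> j < d ==> i < d ==> y j i = \<zero>"
proof (induction "card {j. j < d \<and> (\<exists>i < d. y j i ~= \<zero>)}" arbitrary: y j i rule: less_induct)
  case (less y j1 i1)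
  have Nm: "N k \<in> mats R" for k using repD(1)[OF N(1)] .
  note y = less.prems(1)
  have yv: "y j \<in> vecs R" for j using y by simp
  let ?supp = "%y. {j. j < d \<and> (\<exists>i < d. y j i ~= \<zero>)}"
  show ?case
  proof (rule ccontr)
    assume nz: "y j1 i1 ~= \<zero>"
    have closed: "S d (%j. mv R d (N k) (act R n d N c (y j)) j) = \<zero>" if "k < n" "c \<in> vecs R" for k c
    proof -
      have "S d (%j. mv R d (N k) (act R n d N c (y j)) j) = S d (%j. S n (%k'. shift k c k' \<otimes> mv R d (N k') (y j) j))"
        by (rule gsum_cong) (use mv_rep_act[OF N(1) yv that(2,1)] in "simp add: act_def")
      also have "\<dots> = S n (%k'. S d (%j. shift k c k' \<otimes> mv R d (N k') (y j) j))"
        by (rule S_swap) (use Nm yv shift_vecs that in auto)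
      also have "\<dots> = S n (%k'. shift k c k' \<otimes> S d (%j. mv R d (N k') (y j) j))"
        by (rule gsum_cong, rule S_lmult[symmetric]) (use Nm yv shift_vecs that in auto)
      also have "\<dots> = \<zero>" by (rule S_eq_zero) (use less.prems(2) shift_vecs that in auto)
      finally show ?thesis .
    qed
    have "\<exists>t. t \<in> carrier R \<and> (\<forall>i < d. y j i = t \<otimes> y j1 i)" if j: "j < d" for j
    proof (rule schur_scalar[OF roots N yv less.prems(4) nz yv[of j]])
      fix c i assume c: "c \<in> vecs R" "!!i. i < d ==> act R n d N c (y j1) i = \<zero>" and i: "i < d"
      define y' where "y' j = act R n d N c (y j)" for j
      have zero: "y' j' i = \<zero>" if "!!i. i < d ==> y j' i = \<zero>" for j' i
        unfolding y'_def act_def by (rule S_eq_zero) (use that c Nm in "simp add: mv_zero")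
      have "j' \<in> ?supp y - {j1}" if j': "j' \<in> ?supp y'" for j'
      proof -
        obtain i' where i': "j' < d" "i' < d" "y' j' i' ~= \<zero>" using j' by auto
        have "\<not> (\<forall>i < d. y j' i = \<zero>)" using zero[of j' i'] i'(3) by auto
        moreover have "j' ~= j1" using c(2)[OF i'(2)] i'(3) by (auto simp: y'_def)
        ultimately show ?thesis using i'(1) by simp
      qed
      hence sub: "?supp y' \<subseteq> ?supp y - {j1}" by (rule subsetI)
      have "j1 \<in> ?supp y" using less.prems(3,4) nz by auto
      hence "?supp y' \<subset> ?supp y" using sub by (rule_tac psubsetI) auto
      hence "card (?supp y') < card (?supp y)" by (intro psubset_card_mono) auto
      hence "y' j i = \<zero>"
      proof (rule less.hyps)
        show "y' \<in> mats R" unfolding y'_def by (intro matsI vecsD act_vecs[where N = N, OF Nm c(1) yv])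
      qed (use closed c j i in "simp_all add: y'_def")
      thus "act R n d N c (y j) i = \<zero>" by (simp add: y'_def)
    qed blast
    hence "\<forall>j. \<exists>t. j < d --> t \<in> carrier R \<and> (\<forall>i < d. y j i = t \<otimes> y j1 i)" by simp
    from choice[OF this] obtain t where "\<forall>j. j < d --> t j \<in> carrier R \<and> (\<forall>i < d. y j i = t j \<otimes> y j1 i)" ..
    hence t: "!!j. j < d ==> t j \<in> carrier R" "!!j i. j < d ==> i < d ==> y j i = t j \<otimes> y j1 i" by simp_all
    obtain c where c: "c \<in> vecs R" "!!i. i < d ==> uvec R j1 i = act R n d N c (y j1) i"
      by (rule irrD[OF N(2) yv less.prems(4) nz uvec_vecs]) blast
    have "S d (%j. act R n d N c (y j) j) = S d (%j. t j \<otimes> act R n d N c (y j1) j)"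
    proof (rule gsum_cong)
      fix j assume j: "j < d"
      have "act R n d N c (y j) j = act R n d N c (%i. if i < d then t j \<otimes> y j1 i else \<zero>) j"
        using act_cong[of d "y j" "%i. if i < d then t j \<otimes> y j1 i else \<zero>" n N c] t j by (simp add: veq_def)
      also have "\<dots> = act R n d N c (%i. t j \<otimes> y j1 i) j"
        using act_cong[of d "%i. t j \<otimes> y j1 i" "%i. if i < d then t j \<otimes> y j1 i else \<zero>" n N c] by (simp add: veq_def)
      also have "\<dots> = t j \<otimes> act R n d N c (y j1) j" by (rule act_smult) (use Nm yv t j c in auto)
      finally show "act R n d N c (y j) j = t j \<otimes> act R n d N c (y j1) j" .
    qed
    also have "\<dots> = S d (%j. if j = j1 then t j else \<zero>)"
      by (rule gsum_cong) (use c(2)[symmetric] t in "simp add: uvec_def")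
    also have "\<dots> = t j1" by (rule S_delta) (use less.prems t in auto)
    finally have "t j1 = S d (%j. act R n d N c (y j) j)" by simp
    also have "\<dots> = S d (%j. mv R d (N 0) (act R n d N c (y j)) j)"
    proof (rule gsum_cong)
      fix j assume "j < d"
      have a: "act R n d N c (y j) \<in> vecs R" by (rule act_vecs[where N = N, OF Nm c(1) yv])
      show "act R n d N c (y j) j = mv R d (N 0) (act R n d N c (y j)) j"
        using mv_cong[OF repD(2)[OF N(1)] veq_refl, of R "act R n d N c (y j)"] mv_unit_mat[OF a, of d] \<open>j < d\<close>
        by (simp add: veq_def)
    qed
    also have "\<dots> = \<zero>" by (rule closed) (use n_pos c in auto)
    finally have "t j1 = \<zero>" .
    thus False using t(2)[of j1 i1] less.prems nz yv by simp
  qed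
qed

lemma S_prod:
  assumes "!!i. f i \<in> carrier R"
  shows "S (d * e) f = S d (%a. S e (%b. f (a * e + b)))"
proof (induction d)
  case (Suc d)
  have "S (Suc d * e) f = S (d * e + e) f" by (simp add: add.commute)
  also have "\<dots> = S (d * e) f \<oplus> S e (%b. f (d * e + b))" by (rule S_split) (use assms in auto)
  finally show ?case using Suc by simp
qed simp

text \<open>No nonzero linear form vanishes on the representation, so every matrix unit lies in its span.\<close>

lemma burnside:
  assumes roots: "has_roots R" and N: "rep R n mt d N" "irr R n d N"
  obtains c where "unit_mat_combs R n d N c"
proof -
  have Nm: "N k \<in> mats R" for k using repD(1)[OF N(1)] .
  have d: "0 < d" using N(2) by (simp add: irr_def)
  have "\<exists>c \<in> vecs R. \<forall>i < d. \<forall>j < d. S n (%k. c k \<otimes> N k i j) = (if i = a \<and> j = b then \<one> else \<zero>)"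
    if ab: "a < d" "b < d" for a b
  proof -
    let ?u = "%k i. N k (i div d) (i mod d)"
    let ?t = "uvec R (a * d + b)"
    have u: "?u \<in> mats R" using Nm by (auto intro!: matsI)
    have lt: "i * d + j < d * d" if "i < d" "j < d" for i j
    proof -
      have "i * d + j < i * d + d" using that by simp
      also have "i * d + d = Suc i * d" by simp
      also have "Suc i * d \<le> d * d" using that by (intro mult_right_mono) auto
      finally show ?thesis .
    qed
    have eq: "i * d + j = a * d + b \<longleftrightarrow> i = a \<and> j = b" if "j < d" for i j
    proof
      assume "i * d + j = a * d + b"
      hence "(i * d + j) div d = (a * d + b) div d" "(i * d + j) mod d = (a * d + b) mod d" by simp_all
      thus "i = a \<and> j = b" using that ab by simp
    qed simp
    have "in_span R (d * d) ?u n ?t"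
    proof (rule ccontr)
      assume "\<not> in_span R (d * d) ?u n ?t"
      then obtain Y where Y: "Y \<in> vecs R" "\<forall>k < n. S (d * d) (%i. Y i \<otimes> ?u k i) = \<zero>" "S (d * d) (%i. Y i \<otimes> ?t i) = \<one>"
        using separation[OF u uvec_vecs] by blast
      define y where "y j i = Y (j * d + i)" for j i
      have y: "y \<in> mats R" using Y by (auto simp: y_def intro!: matsI)
      have "S d (%j. mv R d (N k) (y j) j) = \<zero>" if k: "k < n" for k
      proof -
        have "S (d * d) (%i. Y i \<otimes> ?u k i) = S d (%j. S d (%i. Y (j * d + i) \<otimes> ?u k (j * d + i)))"
          by (rule S_prod) (use Y Nm in auto)
        also have "\<dots> = S d (%j. mv R d (N k) (y j) j)"
          unfolding mv_def by (intro gsum_cong) (use Y Nm in "simp add: y_def m_comm")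
        finally show ?thesis using Y(2) k by simp
      qed
      from annihilator_zero[OF roots N y this ab] have "Y (a * d + b) = \<zero>" by (simp add: y_def)
      moreover have "S (d * d) (%i. Y i \<otimes> ?t i) = Y (a * d + b)"
        unfolding uvec_def by (rule S_mult_delta(1)) (use Y lt ab in auto)
      ultimately show False using Y(3) by simp
    qed
    then obtain c where c: "c \<in> vecs R" "\<forall>i < d * d. ?t i = S n (%k. c k \<otimes> ?u k i)" unfolding in_span_def by blast
    have "S n (%k. c k \<otimes> N k i j) = (if i = a \<and> j = b then \<one> else \<zero>)" if "i < d" "j < d" for i j
      using c(2)[rule_format, OF lt[OF that]] eq[of j i] that by (simp add: uvec_def)
    thus ?thesis using c(1) by blast
  qed
  hence ex: "\<exists>c. c \<in> vecs R \<and> (\<forall>i < d. \<forall>j < d. S n (%k. c k \<otimes> N k i j) = (if i = a \<and> j = b then \<one> else \<zero>))"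
    if "a < d" "b < d" for a b using that by (simp add: Bex_def)
  show ?thesis
    by (rule that[of "%a b. SOME c. c \<in> vecs R \<and> (\<forall>i < d. \<forall>j < d. S n (%k. c k \<otimes> N k i j) = (if i = a \<and> j = b then \<one> else \<zero>))"])
      (unfold unit_mat_combs_def, intro allI impI, rule someI_ex[OF ex])
qed

end

subsection \<open>Descent along a Frobenius map\<close>

definition frob_hom :: "('a, 'b) ring_scheme => nat => bool" where
  "frob_hom R q \<longleftrightarrow> 1 < q \<and> (\<forall>x \<in> carrier R. \<forall>y \<in> carrier R. (x \<oplus>\<^bsub>R\<^esub> y) [^]\<^bsub>R\<^esub> q = x [^]\<^bsub>R\<^esub> q \<oplus>\<^bsub>R\<^esub> y [^]\<^bsub>R\<^esub> q)"

definition fr :: "('a, 'b) ring_scheme => nat => (nat => 'a) => nat => 'a" where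
  "fr R q v = (%i. v i [^]\<^bsub>R\<^esub> q)"

definition frm :: "('a, 'b) ring_scheme => nat => (nat => nat => 'a) => nat => nat => 'a" where
  "frm R q A = (%i j. A i j [^]\<^bsub>R\<^esub> q)"

lemma mm_congL: "meq d c A A' ==> meq d e (mm R c A B) (mm R c A' B)"
  by (rule mm_cong) simp_all

lemma mm_congR: "meq c e B B' ==> meq d e (mm R c A B) (mm R c A B')"
  by (rule mm_cong) simp_all

lemma meq_frm: "meq d e A B ==> meq d e (frm R q A) (frm R q B)"
  by (simp add: meq_def frm_def)

context field
begin

lemma fr_vecs [simp]: "v \<in> vecs R ==> fr R q v \<in> vecs R"
  unfolding fr_def by (rule vecsI) simp

lemma frm_mats [simp]: "A \<in> mats R ==> frm R q A \<in> mats R"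
  unfolding frm_def by (rule matsI) simp

lemma zero_pow: "0 < m ==> \<zero> [^] (m :: nat) = \<zero>"
  by (cases m) auto

lemma pow_nonzero: "x \<in> carrier R ==> x ~= \<zero> ==> x [^] (m :: nat) ~= \<zero>"
  by (induction m) (auto simp: integral_iff)

lemma frob_S:
  assumes "frob_hom R q"
  shows "(!!i. i < m ==> f i \<in> carrier R) ==> S m f [^] q = S m (%i. f i [^] q)"
proof (induction m)
  case 0
  show ?case using assms zero_pow[of q] by (simp add: frob_hom_def)
next
  case (Suc m)
  have "S m f \<in> carrier R" "f m \<in> carrier R" using Suc.prems by auto
  thus ?case using Suc assms by (simp add: frob_hom_def)
qed

lemma frob_mv:
  "frob_hom R q ==> A \<in> mats R ==> v \<in> vecs R ==> fr R q (mv R d A v) = mv R d (frm R q A) (fr R q v)"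
  unfolding fr_def frm_def mv_def by (simp add: frob_S nat_pow_distrib)

lemma frob_mm:
  "frob_hom R q ==> A \<in> mats R ==> B \<in> mats R ==> frm R q (mm R d A B) = mm R d (frm R q A) (frm R q B)"
  unfolding frm_def mm_def by (simp add: frob_S nat_pow_distrib)

text \<open>A nonzero additive polynomial \<open>\<Sum>\<^sub>j b\<^sub>j X\<^bsup>q^(j+1)\<^esup>\<close> takes the value \<open>t\<close> at some \<open>t \<noteq> 0\<close>: divide by \<open>X\<close>.\<close>

lemma additive_poly_fixed:
  fixes q :: nat
  assumes roots: "has_roots R" and q: "1 < q" and b: "b \<in> vecs R" "j0 < m" "b j0 ~= \<zero>"
  obtains t where "t \<in> carrier R" "t ~= \<zero>" "S m (%j. b j \<otimes> t [^] (q ^ Suc j)) = t"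
proof -
  define J where "J = Max {j. j < m \<and> b j ~= \<zero>}"
  have fin: "finite {j. j < m \<and> b j ~= \<zero>}" by simp
  have "J \<in> {j. j < m \<and> b j ~= \<zero>}" unfolding J_def by (rule Max_in[OF fin]) (use b in auto)
  hence J: "J < m" "b J ~= \<zero>" by auto
  have J_max: "b j = \<zero>" if "j < m" "J < j" for j
  proof (rule ccontr)
    assume "b j ~= \<zero>"
    hence "j \<le> J" unfolding J_def using that by (intro Max_ge[OF fin]) simp
    thus False using that by simp
  qed
  define e where "e j = q ^ Suc j - 1" for j
  have e_pos: "0 < e j" for j using one_less_power[OF q, of "Suc j"] by (simp add: e_def)
  have e_le: "e i \<le> e j \<longleftrightarrow> i \<le> j" for i j
  proof -
    have "0 < q ^ Suc i" "0 < q ^ Suc j" using q by auto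
    hence "e i \<le> e j \<longleftrightarrow> q ^ Suc i \<le> q ^ Suc j" unfolding e_def by linarith
    thus ?thesis using power_increasing_iff[of q "Suc i" "Suc j"] q by simp
  qed
  have e_eq: "e i = e j \<longleftrightarrow> i = j" for i j using e_le[of i j] e_le[of j i] by auto
  define x where "x i = \<ominus> (if i = 0 then \<one> else \<zero>) \<oplus> S m (%j. if i = e j then b j else \<zero>)" for i
  have x: "x \<in> vecs R" unfolding x_def by (rule vecsI) (use b in auto)
  have "S m (%j. if e J = e j then b j else \<zero>) = S m (%j. if j = J then b j else \<zero>)"
    by (rule gsum_cong) (use e_eq in auto)
  also have "\<dots> = b J" by (rule S_delta) (use J b in auto)
  finally have "x (e J) ~= \<zero>" using J b e_pos[of J] by (simp add: x_def)
  then obtain t where t: "t \<in> carrier R" "S (Suc (e J)) (%i. x i \<otimes> t [^] i) = \<zero>"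
    using roots x e_pos[of J] unfolding has_roots_def by blast
  have "S (Suc (e J)) (%i. x i \<otimes> t [^] i)
      = S (Suc (e J)) (%i. (if i = 0 then \<ominus> \<one> else \<zero>) \<oplus> S m (%j. if i = e j then b j \<otimes> t [^] i else \<zero>))"
  proof (rule gsum_cong)
    fix i
    have "S m (%j. if i = e j then b j else \<zero>) \<otimes> t [^] i = S m (%j. (if i = e j then b j else \<zero>) \<otimes> t [^] i)"
      by (rule S_rmult) (use b t in auto)
    also have "\<dots> = S m (%j. if i = e j then b j \<otimes> t [^] i else \<zero>)"
      by (rule gsum_cong) (use t in auto)
    finally have *: "S m (%j. if i = e j then b j else \<zero>) \<otimes> t [^] i = S m (%j. if i = e j then b j \<otimes> t [^] i else \<zero>)" .
    have "S m (%j. if i = e j then b j else \<zero>) \<in> carrier R" using b by auto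
    thus "x i \<otimes> t [^] i = (if i = 0 then \<ominus> \<one> else \<zero>) \<oplus> S m (%j. if i = e j then b j \<otimes> t [^] i else \<zero>)"
      unfolding x_def *[symmetric] using t by (auto simp: l_distr)
  qed
  also have "\<dots> = S (Suc (e J)) (%i. if i = 0 then \<ominus> \<one> else \<zero>) \<oplus> S (Suc (e J)) (%i. S m (%j. if i = e j then b j \<otimes> t [^] i else \<zero>))"
    by (rule S_add) (use b t in auto)
  also have "S (Suc (e J)) (%i. if i = 0 then \<ominus> \<one> else \<zero>) = \<ominus> \<one>" using S_delta[of 0 "Suc (e J)" "%_. \<ominus> \<one>"] by simp
  also have "S (Suc (e J)) (%i. S m (%j. if i = e j then b j \<otimes> t [^] i else \<zero>)) = S m (%j. S (Suc (e J)) (%i. if i = e j then b j \<otimes> t [^] i else \<zero>))"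
    by (rule S_swap) (use b t in auto)
  also have "\<dots> = S m (%j. b j \<otimes> t [^] e j)"
  proof (rule gsum_cong)
    fix j assume j: "j < m"
    show "S (Suc (e J)) (%i. if i = e j then b j \<otimes> t [^] i else \<zero>) = b j \<otimes> t [^] e j"
    proof (cases "j \<le> J")
      case True
      thus ?thesis by (intro S_delta) (use e_le b t in "auto simp: less_Suc_eq_le")
    next
      case False
      hence "b j = \<zero>" using J_max j by simp
      thus ?thesis using t by (auto intro!: S_eq_zero)
    qed
  qed
  finally have "\<ominus> \<one> \<oplus> S m (%j. b j \<otimes> t [^] e j) = \<zero>" using t by simp
  moreover have c: "S m (%j. b j \<otimes> t [^] e j) \<in> carrier R" using b t by auto
  ultimately have "\<ominus> S m (%j. b j \<otimes> t [^] e j) = \<ominus> \<one>" by (intro minus_equality) simp_all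
  hence "\<ominus> (\<ominus> S m (%j. b j \<otimes> t [^] e j)) = \<ominus> (\<ominus> \<one>)" by simp
  hence one: "S m (%j. b j \<otimes> t [^] e j) = \<one>" using c by (simp only: minus_minus one_closed)
  have "t ~= \<zero>"
  proof
    assume "t = \<zero>"
    hence "S m (%j. b j \<otimes> t [^] e j) = \<zero>" using b e_pos by (intro S_eq_zero) (simp add: zero_pow)
    thus False using one by simp
  qed
  moreover have "S m (%j. b j \<otimes> t [^] (q ^ Suc j)) = t"
  proof -
    have "S m (%j. b j \<otimes> t [^] (q ^ Suc j)) = S m (%j. b j \<otimes> t [^] e j \<otimes> t)"
    proof (rule gsum_cong)
      fix j
      have "q ^ Suc j = Suc (e j)" using q by (simp add: e_def)
      thus "b j \<otimes> t [^] (q ^ Suc j) = b j \<otimes> t [^] e j \<otimes> t" using b t by (simp only: nat_pow_Suc) (simp add: m_assoc)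
    qed
    also have "\<dots> = S m (%j. b j \<otimes> t [^] e j) \<otimes> t" by (rule S_rmult[symmetric]) (use b t in auto)
    finally show ?thesis using one t by simp
  qed
  ultimately show ?thesis using that t by blast
qed

text \<open>Let \<open>B\<close> be the semilinear map and \<open>B\<^sup>k\<^sup>+\<^sup>1 v\<close> the first iterate that depends on its predecessors. The condition that
  \<open>\<Sum>\<^sub>i x\<^sub>i B\<^sup>i v\<close> be fixed determines all coefficients from \<open>t = x\<^sub>k\<close> and leaves one additive polynomial
  equation for \<open>t\<close>.\<close>

lemma fixed_vector:
  assumes roots: "has_roots R" and q: "frob_hom R q" and A: "A \<in> mats R" "A' \<in> mats R"
    and inv: "meq d d (mm R d A' A) (uvec R)" and d: "0 < d"
  obtains w i where "w \<in> vecs R" "i < d" "w i ~= \<zero>" "veq d (mv R d A (fr R q w)) w"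
proof -
  have q1: "1 < q" using q by (simp add: frob_hom_def)
  define B where "B v = mv R d A (fr R q v)" for v
  have Bv: "B v \<in> vecs R" if "v \<in> vecs R" for v using that A by (simp add: B_def mv_vecs)
  define u where "u p = (B ^^ p) (uvec R 0)" for p
  have uv: "u p \<in> vecs R" for p by (induction p) (auto simp: u_def Bv)
  have u: "u \<in> mats R" using uv by (auto intro!: matsI)
  have uS: "u (Suc p) = B (u p)" for p by (simp add: u_def)
  have inj: "\<exists>i < d. B v i ~= \<zero>" if v: "v \<in> vecs R" "i < d" "v i ~= \<zero>" for v i
  proof (rule ccontr)
    assume "\<not> ?thesis"
    hence "mv R d A' (B v) i = \<zero>" by (intro mv_zero A) auto
    moreover have "mv R d A' (B v) = mv R d (mm R d A' A) (fr R q v)"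
      unfolding B_def by (rule mv_mm[symmetric]) (use A v in auto)
    moreover have "mv R d (mm R d A' A) (fr R q v) i = mv R d (uvec R) (fr R q v) i"
      using mv_cong[where R = R, OF inv veq_refl[of d "fr R q v"]] v by (simp add: veq_def)
    moreover have "mv R d (uvec R) (fr R q v) i = v i [^] q"
      using mv_unit_mat[OF fr_vecs[OF v(1)], of d q] v(2) by (simp add: veq_def fr_def)
    ultimately show False using pow_nonzero[of "v i" q] v by simp
  qed
  have nz: "\<exists>i < d. u p i ~= \<zero>" for p
  proof (induction p)
    case 0
    show ?case using d by (intro exI[of _ 0]) (simp add: u_def uvec_def)
  next
    case (Suc p)
    thus ?case using inj[OF uv] uS by auto
  qed
  have u0: "u 0 0 ~= \<zero>" by (simp add: u_def uvec_def)
  obtain k a where ka: "indep R d u (Suc k)" "a \<in> vecs R" "!!i. i < d ==> u (Suc k) i = S (Suc k) (%p. a p \<otimes> u p i)"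
    by (rule cyclic_family[OF u d u0]) blast
  have "\<exists>p < Suc k. a p ~= \<zero>"
  proof (rule ccontr)
    assume "\<not> ?thesis"
    hence a0: "a p = \<zero>" if "p < Suc k" for p using that by blast
    have "u (Suc k) i = \<zero>" if "i < d" for i
      unfolding ka(3)[OF that] by (rule S_eq_zero) (use a0 u in simp)
    thus False using nz[of "Suc k"] by auto
  qed
  then obtain p0 where p0: "p0 < Suc k" "a p0 ~= \<zero>" by auto
  define b where "b j = a (k - j) [^] (q ^ j)" for j
  have b: "b \<in> vecs R" unfolding b_def by (rule vecsI) (use ka(2) in simp)
  have "k - p0 < Suc k" by simp
  moreover have "b (k - p0) ~= \<zero>" unfolding b_def using p0 ka(2) by (intro pow_nonzero) auto
  ultimately obtain t where t: "t \<in> carrier R" "t ~= \<zero>" "S (Suc k) (%j. b j \<otimes> t [^] (q ^ Suc j)) = t"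
    by (rule additive_poly_fixed[OF roots q1 b])
  define x where "x i = S (Suc i) (%j. a (i - j) [^] (q ^ j) \<otimes> t [^] (q ^ Suc j))" for i
  have x: "x \<in> vecs R" unfolding x_def by (rule vecsI, rule S_closed) (use ka(2) t in simp)
  have xk: "x k = t" using t(3) by (simp only: x_def b_def)
  have x0: "x 0 = t [^] q \<otimes> a 0" using ka(2) t by (simp add: x_def m_comm)
  have xS: "x (Suc i) = x i [^] q \<oplus> t [^] q \<otimes> a (Suc i)" for i
  proof -
    have "x (Suc i) = a (Suc i - 0) [^] (q ^ 0) \<otimes> t [^] (q ^ Suc 0) \<oplus> S (Suc i) (%j. a (Suc i - Suc j) [^] (q ^ Suc j) \<otimes> t [^] (q ^ Suc (Suc j)))"
      unfolding x_def by (rule S_Suc_shift) (use ka(2) t in simp)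
    also have "S (Suc i) (%j. a (Suc i - Suc j) [^] (q ^ Suc j) \<otimes> t [^] (q ^ Suc (Suc j))) = x i [^] q"
      unfolding x_def
    proof (subst frob_S[OF q])
      show "S (Suc i) (%j. a (Suc i - Suc j) [^] (q ^ Suc j) \<otimes> t [^] (q ^ Suc (Suc j))) =
          S (Suc i) (%j. (a (i - j) [^] (q ^ j) \<otimes> t [^] (q ^ Suc j)) [^] q)"
        by (rule gsum_cong) (use ka(2) t in "simp add: nat_pow_distrib nat_pow_pow mult.commute mult.left_commute")
    qed (use ka(2) t in simp)
    finally show ?thesis using ka(2) t vecsD[OF x, of i] by (simp add: a_comm m_comm)
  qed
  define w where "w = (%i. S (Suc k) (%p. x p \<otimes> u p i))"
  have w: "w \<in> vecs R" unfolding w_def by (rule vecsI, rule S_closed) (use x u in simp)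
  have "mv R d A (fr R q w) i = w i" if i: "i < d" for i
  proof -
    have "fr R q w = (%i. S (Suc k) (%p. x p [^] q \<otimes> fr R q (u p) i))"
    proof
      fix i
      have "fr R q w i = S (Suc k) (%p. (x p \<otimes> u p i) [^] q)"
        unfolding fr_def w_def by (rule frob_S[OF q]) (use x u in simp)
      thus "fr R q w i = S (Suc k) (%p. x p [^] q \<otimes> fr R q (u p) i)"
        unfolding fr_def using x u by (simp only: nat_pow_distrib vecsD matsD)
    qed
    hence "mv R d A (fr R q w) = (%i. S (Suc k) (%p. x p [^] q \<otimes> mv R d A (fr R q (u p)) i))"
      by (simp only:) (rule mv_comb, use A x uv in "auto intro!: vecsI")
    hence "mv R d A (fr R q w) i = S (Suc k) (%p. x p [^] q \<otimes> u (Suc p) i)"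
      unfolding uS B_def by (simp only:)
    also have "\<dots> = S (Suc k) (%p. x p \<otimes> u p i)"
    proof (rule shift_comb[OF u ka(2) _ x ka(3)[OF i]])
      show "(%p. x p [^] q) \<in> vecs R" by (rule vecsI) (use x in simp)
    qed (simp_all add: xk x0 xS)
    finally show ?thesis by (simp only: w_def)
  qed
  hence fixed: "veq d (mv R d A (fr R q w)) w" by (simp add: veq_def)
  have "\<exists>i < d. w i ~= \<zero>"
  proof (rule ccontr)
    assume "\<not> ?thesis"
    hence "S (Suc k) (%p. x p \<otimes> u p i) = \<zero>" if "i < d" for i using that by (auto simp only: w_def)
    from indepD[OF ka(1) x this, of k] show False using t by (simp add: xk)
  qed
  then obtain i where "i < d" "w i ~= \<zero>" by auto
  thus ?thesis using that w fixed by blast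
qed

end

context rep_setting
begin

text \<open>If \<open>\<sigma>\<close> is equivalent to its Frobenius twist, the intertwiner turns Frobenius into a semilinear map
  that commutes with \<open>\<sigma>\<close>. The orbit of a fixed vector contains a basis, and in a basis of fixed vectors
  the matrices have entries in the fixed field.\<close>

lemma frobenius_descent:
  assumes roots: "has_roots R" and q: "frob_hom R q" and N: "rep R n mt d N" "irr R n d N"
    and E: "eqv R n d (%k. frm R q (N k)) N"
  obtains M where "rep R n mt d M" "eqv R n d N M" "!!k i j. k < n ==> i < d ==> j < d ==> M k i j [^] q = M k i j"
proof -
  have Nm: "N k \<in> mats R" for k using repD(1)[OF N(1)] .
  have d: "0 < d" using N(2) by (simp add: irr_def)
  obtain A A' where A: "A \<in> mats R" "A' \<in> mats R" "meq d d (mm R d A A') (uvec R)" "meq d d (mm R d A' A) (uvec R)"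
    "!!k. k < n ==> meq d d (mm R d A (frm R q (N k))) (mm R d (N k) A)"
    using E unfolding eqv_def by blast
  obtain v i0 where v: "v \<in> vecs R" "i0 < d" "v i0 ~= \<zero>" "veq d (mv R d A (fr R q v)) v"
    by (rule fixed_vector[OF roots q A(1,2,4) d])
  define w where "w k = mv R d (N k) v" for k
  have wm: "w \<in> mats R" unfolding w_def by (intro matsI vecsD mv_vecs[OF Nm v(1)])
  have w_fixed: "veq d (mv R d A (fr R q (w k))) (w k)" if k: "k < n" for k
  proof -
    have "mv R d A (fr R q (w k)) = mv R d A (mv R d (frm R q (N k)) (fr R q v))"
      by (simp add: w_def frob_mv q Nm v)
    also have "\<dots> = mv R d (mm R d A (frm R q (N k))) (fr R q v)"
      by (rule mv_mm[symmetric]) (use A Nm v in auto)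
    also have "veq d \<dots> (mv R d (mm R d (N k) A) (fr R q v))"
      by (rule mv_cong[OF A(5)[OF k] veq_refl])
    also have "mv R d (mm R d (N k) A) (fr R q v) = mv R d (N k) (mv R d A (fr R q v))"
      by (rule mv_mm) (use A Nm v in auto)
    also have "veq d \<dots> (mv R d (N k) v)" by (rule mv_cong[OF meq_refl v(4)])
    finally show ?thesis by (simp add: w_def)
  qed
  have "indep R d w 0" by (simp add: indep_def)
  from basis_extension[OF wm this wm, of n] obtain u m where
    u: "u \<in> mats R" "\<forall>p < m. \<exists>k < n. u p = w k" "indep R d u m" "\<forall>k < n. in_span R d u m (w k)"
    by auto
  have span: "in_span R d u m t" if "t \<in> vecs R" for t
  proof (rule in_span_trans[OF u(1)])
    have "\<exists>i < d. v i ~= \<zero>" using v by auto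
    thus "in_span R d w n t" using N(2) v(1) that unfolding irr_def w_def by simp
  qed (use u(4) in simp)
  define Q where "Q i p = (if p < m then u p i else \<zero>)" for i p
  have Q: "Q \<in> mats R" unfolding Q_def by (rule matsI) (use u in simp)
  have Qv: "mv R m Q x i = S m (%p. x p \<otimes> u p i)" if "x \<in> vecs R" for x i
    unfolding mv_def Q_def by (rule gsum_cong) (use that u in "simp add: m_comm")
  have "m = d \<and> (\<exists>B \<in> mats R. meq m m (mm R m Q B) (uvec R) \<and> meq m m (mm R m B Q) (uvec R))"
  proof (rule square_inverse[OF Q])
    fix x assume x: "x \<in> vecs R" "veq d (mv R m Q x) (%_. \<zero>)"
    have "S m (%p. x p \<otimes> u p i) = \<zero>" if "i < d" for i using x(2) that Qv[OF x(1)] by (simp add: veq_def)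
    from indepD[OF u(3) x(1) this] show "veq m x (%_. \<zero>)" by (simp add: veq_def)
  next
    fix t assume "t \<in> vecs R"
    then obtain c where c: "c \<in> vecs R" "\<forall>i < d. t i = S m (%p. c p \<otimes> u p i)" using span unfolding in_span_def by blast
    hence "veq d (mv R m Q c) t" using Qv[OF c(1)] by (simp add: veq_def)
    thus "\<exists>x \<in> vecs R. veq d (mv R m Q x) t" using c(1) by blast
  qed
  then obtain Q' where md: "m = d" and Q': "Q' \<in> mats R" "meq d d (mm R d Q Q') (uvec R)" "meq d d (mm R d Q' Q) (uvec R)" by blast
  have AQ: "meq d d (mm R d A (frm R q Q)) Q"
    unfolding meq_def
  proof (intro allI impI)
    fix i p assume i: "i < d" and p: "p < d"
    then obtain k where k: "k < n" "u p = w k" using u(2) md by blast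
    have "mm R d A (frm R q Q) i p = mv R d A (fr R q (w k)) i"
      using p md k by (simp add: mm_def mv_def frm_def fr_def Q_def)
    thus "mm R d A (frm R q Q) i p = Q i p" using w_fixed[OF k(1)] i p md k by (simp add: veq_def Q_def)
  qed
  define M where "M k = mm R d Q' (mm R d (N k) Q)" for k
  have Mm: "M k \<in> mats R" for k unfolding M_def by (intro mm_mats Nm Q Q')
  have QM: "meq d d (mm R d Q (M k)) (mm R d (N k) Q)" for k
  proof -
    have "mm R d Q (M k) = mm R d (mm R d Q Q') (mm R d (N k) Q)"
      unfolding M_def by (rule mm_assoc) (use Q Q' Nm in auto)
    also have "meq d d \<dots> (mm R d (uvec R) (mm R d (N k) Q))" by (rule mm_congL[OF Q'(2)])
    also have "meq d d \<dots> (mm R d (N k) Q)" by (rule mm_unit_left) (use Q Nm in auto)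
    finally show ?thesis .
  qed
  have cancelQ: "meq d d V W" if VW: "V \<in> mats R" "W \<in> mats R" and eq: "meq d d (mm R d Q V) (mm R d Q W)" for V W
  proof -
    have *: "meq d d (mm R d Q' (mm R d Q Z)) Z" if "Z \<in> mats R" for Z
    proof -
      have "mm R d Q' (mm R d Q Z) = mm R d (mm R d Q' Q) Z" by (rule mm_assoc) (use Q Q' that in auto)
      also have "meq d d \<dots> (mm R d (uvec R) Z)" by (rule mm_congL[OF Q'(3)])
      also have "meq d d \<dots> Z" by (rule mm_unit_left[OF that])
      finally show ?thesis .
    qed
    show ?thesis by (rule meq_trans[OF meq_sym[OF *[OF VW(1)]] meq_trans[OF mm_congR[OF eq] *[OF VW(2)]]])
  qed
  have "meq d d (M 0) (uvec R)"
  proof (rule cancelQ[OF Mm unit_mats])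
    have "meq d d (mm R d (N 0) Q) (mm R d (uvec R) Q)" by (rule mm_congL[OF repD(2)[OF N(1)]])
    also have "meq d d \<dots> Q" by (rule mm_unit_left[OF Q])
    also have "meq d d Q (mm R d Q (uvec R))" by (rule meq_sym[OF mm_unit_right[OF Q]])
    finally show "meq d d (mm R d Q (M 0)) (mm R d Q (uvec R))" using QM meq_trans by blast
  qed
  moreover have "meq d d (M (mt k k')) (mm R d (M k) (M k'))" if k: "k < n" "k' < n" for k k'
  proof (rule cancelQ[OF Mm mm_mats[OF Mm Mm]])
    have "meq d d (mm R d Q (M (mt k k'))) (mm R d (N (mt k k')) Q)" by (rule QM)
    also have "meq d d \<dots> (mm R d (mm R d (N k) (N k')) Q)" by (rule mm_congL[OF repD(3)[OF N(1) k]])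
    also have "\<dots> = mm R d (N k) (mm R d (N k') Q)" by (rule mm_assoc[symmetric]) (use Q Nm in auto)
    also have "meq d d \<dots> (mm R d (N k) (mm R d Q (M k')))" by (rule mm_congR[OF meq_sym[OF QM]])
    also have "mm R d (N k) (mm R d Q (M k')) = mm R d (mm R d (N k) Q) (M k')" by (rule mm_assoc) (use Q Nm Mm in auto)
    also have "meq d d \<dots> (mm R d (mm R d Q (M k)) (M k'))" by (rule mm_congL[OF meq_sym[OF QM]])
    also have "mm R d (mm R d Q (M k)) (M k') = mm R d Q (mm R d (M k) (M k'))" by (rule mm_assoc[symmetric]) (use Q Mm in auto)
    finally show "meq d d (mm R d Q (M (mt k k'))) (mm R d Q (mm R d (M k) (M k')))" .
  qed
  ultimately have repM: "rep R n mt d M" unfolding rep_def using Mm by blast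
  have "eqv R n d M N" unfolding eqv_def using Q Q' QM by blast
  hence eqvM: "eqv R n d N M" by (rule eqv_sym[where N = M and M = N, OF Mm Nm])
  have "meq d d (frm R q (M k)) (M k)" if k: "k < n" for k
  proof (rule cancelQ[OF frm_mats[OF Mm] Mm])
    have "meq d d (mm R d Q (frm R q (M k))) (mm R d (mm R d A (frm R q Q)) (frm R q (M k)))"
      by (rule mm_congL[OF meq_sym[OF AQ]])
    also have "mm R d (mm R d A (frm R q Q)) (frm R q (M k)) = mm R d A (mm R d (frm R q Q) (frm R q (M k)))"
      by (rule mm_assoc[symmetric]) (use A Q Mm in auto)
    also have "mm R d (frm R q Q) (frm R q (M k)) = frm R q (mm R d Q (M k))"
      by (rule frob_mm[OF q Q Mm, symmetric])
    also have "meq d d (mm R d A (frm R q (mm R d Q (M k)))) (mm R d A (frm R q (mm R d (N k) Q)))"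
      by (rule mm_congR[OF meq_frm[OF QM]])
    also have "frm R q (mm R d (N k) Q) = mm R d (frm R q (N k)) (frm R q Q)" by (rule frob_mm[OF q Nm Q])
    also have "mm R d A (mm R d (frm R q (N k)) (frm R q Q)) = mm R d (mm R d A (frm R q (N k))) (frm R q Q)"
      by (rule mm_assoc) (use A Q Nm in auto)
    also have "meq d d \<dots> (mm R d (mm R d (N k) A) (frm R q Q))" by (rule mm_congL[OF A(5)[OF k]])
    also have "mm R d (mm R d (N k) A) (frm R q Q) = mm R d (N k) (mm R d A (frm R q Q))"
      by (rule mm_assoc[symmetric]) (use A Q Nm in auto)
    also have "meq d d \<dots> (mm R d (N k) Q)" by (rule mm_congR[OF AQ])
    also have "meq d d \<dots> (mm R d Q (M k))" by (rule meq_sym[OF QM])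
    finally show "meq d d (mm R d Q (frm R q (M k))) (mm R d Q (M k))" .
  qed
  hence "M k i j [^] q = M k i j" if "k < n" "i < d" "j < d" for k i j using that by (simp add: meq_def frm_def)
  thus ?thesis using that[OF repM eqvM] by blast
qed

end

subsection \<open>Composition series\<close>

text \<open>The vector \<open>u p\<close> lies, modulo earlier vectors, in the span of a family \<open>z\<close> on which the
  group acts, modulo earlier vectors, by the representation \<open>N\<close>.\<close>

definition comp_step where
  "comp_step R D n M u p d N \<longleftrightarrow> (\<exists>s \<le> p. \<exists>z \<in> mats R. \<exists>g \<in> vecs R.
    (\<forall>k < n. \<forall>a < d. in_span R D u s (%i. mv R D (M k) (z a) i \<ominus>\<^bsub>R\<^esub> rsum R d (%b. N k b a \<otimes>\<^bsub>R\<^esub> z b i))) \<and>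
    in_span R D u s (%i. u p i \<ominus>\<^bsub>R\<^esub> rsum R d (%a. g a \<otimes>\<^bsub>R\<^esub> z a i)))"

definition comp_chain where
  "comp_chain R D n M Q u m \<longleftrightarrow> (\<forall>p < m. \<exists>(d, N) \<in> Q. comp_step R D n M u p d N)"

definition invariant where
  "invariant R D n M u m \<longleftrightarrow> (\<forall>k < n. \<forall>p < m. in_span R D u m (mv R D (M k) (u p)))"

context cring
begin

lemma in_span_agree:
  assumes "u' \<in> mats R" "!!p. p < m ==> u' p = u p" "s \<le> m" "in_span R N u s t"
  shows "in_span R N u' s t"
  by (rule in_span_mono[OF assms(1,4)]) (use assms(2,3) in auto)

lemma comp_step_agree:
  assumes "u' \<in> mats R" "!!p. p < m ==> u' p = u p" "p < m" "comp_step R D n M u p d N"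
  shows "comp_step R D n M u' p d N"
proof -
  obtain s z g where *: "s \<le> p" "z \<in> mats R" "g \<in> vecs R"
    "\<forall>k < n. \<forall>a < d. in_span R D u s (%i. mv R D (M k) (z a) i \<ominus> S d (%b. N k b a \<otimes> z b i))"
    "in_span R D u s (%i. u p i \<ominus> S d (%a. g a \<otimes> z a i))"
    using assms(4) unfolding comp_step_def by (elim exE bexE conjE)
  have "s \<le> m" using *(1) assms(3) by simp
  note agree = in_span_agree[where u = u, OF assms(1,2) this]
  show ?thesis
    unfolding comp_step_def
    by (rule exI[of _ s], rule conjI[OF *(1)], rule bexI[OF _ *(2)], rule bexI[OF _ *(3)])
      (use agree *(4,5) assms(2,3) in simp)
qed

lemma in_span_eq: "in_span R N u m t ==> (!!i. i < N ==> t i = t' i) ==> in_span R N u m t'"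
  unfolding in_span_def by simp

end

context rep_setting
begin

lemma invariant_span:
  assumes "invariant R D n M u m" "M k \<in> mats R" "u \<in> mats R" "k < n" "in_span R D u m t"
  shows "in_span R D u m (mv R D (M k) t)"
  by (rule in_span_mv[OF assms(2,3,3,5)]) (use assms(1,4) in "simp add: invariant_def")

text \<open>In a quotient of smallest positive dimension the orbit of any nonzero vector spans everything, since
  its span is again invariant. The matrices are read off with a dual basis.\<close>

lemma minimal_extension_irr:
  assumes M: "rep R n mt D M" and u: "u \<in> mats R" "indep R D u m" "invariant R D n M u m"
    and u': "u' \<in> mats R" "!!p. p < m ==> u' p = u p" "indep R D u' (m + d)" "invariant R D n M u' (m + d)" and d: "0 < d"
    and minimal: "!!v l. v \<in> mats R ==> (!!p. p < m ==> v p = u p) ==> indep R D v l ==> invariant R D n M v l ==> m < l ==> m + d \<le> l"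
  obtains N where "rep R n mt d N" "irr R n d N"
    "!!k a. k < n ==> a < d ==> in_span R D u' m (%i. mv R D (M k) (u' (m + a)) i \<ominus> S d (%b. N k b a \<otimes> u' (m + b) i))"
proof -
  have Mm: "M k \<in> mats R" for k using repD(1)[OF M] .
  have uv: "u' p \<in> vecs R" for p using u'(1) by simp
  obtain y where y: "y \<in> mats R" "!!p q. p < m + d ==> q < m + d ==> S D (%i. y p i \<otimes> u' q i) = (if p = q then \<one> else \<zero>)"
    using dual_basis[OF u'(1,3)] by blast
  have y2: "mv R D y (u' q) p = (if p = q then \<one> else \<zero>)" if "p < m + d" "q < m + d" for p q
    unfolding mv_def by (rule y(2)[OF that])
  have coord: "mv R D y (%i. S l (%p. c p \<otimes> t p i)) q = S l (%p. c p \<otimes> mv R D y (t p) q)"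
    if "c \<in> vecs R" "!!p. p < l ==> t p \<in> vecs R" for l c t q
    by (rule fun_cong[OF mv_comb[OF y(1)]]) (use that in auto)
  have ycong: "mv R D y s q = mv R D y t q" if "!!i. i < D ==> s i = t i" for s t q
    unfolding mv_def by (rule gsum_cong) (use that in simp)
  have expand: "t i = S (m + d) (%p. mv R D y t p \<otimes> u' p i)" if t: "in_span R D u' (m + d) t" and i: "i < D" for t i
  proof -
    obtain c where c: "c \<in> vecs R" "\<forall>i < D. t i = S (m + d) (%p. c p \<otimes> u' p i)" using t unfolding in_span_def by auto
    have "mv R D y t q = c q" if q: "q < m + d" for q
    proof -
      have "mv R D y t q = S (m + d) (%p. c p \<otimes> mv R D y (u' p) q)"
        using ycong[of t "%i. S (m + d) (%p. c p \<otimes> u' p i)"] c(2) coord[OF c(1) uv] by simp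
      also have "\<dots> = S (m + d) (%p. c p \<otimes> (if q = p then \<one> else \<zero>))"
        by (rule gsum_cong) (use y2 q in simp)
      also have "\<dots> = c q" by (rule S_mult_delta'(1)) (use c q in auto)
      finally show ?thesis .
    qed
    hence "S (m + d) (%p. mv R D y t p \<otimes> u' p i) = S (m + d) (%p. c p \<otimes> u' p i)" by (intro gsum_cong) simp
    thus ?thesis using c(2) i by simp
  qed
  have low: "mv R D y t (m + b) = \<zero>" if t: "in_span R D u' m t" and b: "b < d" for t b
  proof -
    obtain c where c: "c \<in> vecs R" "\<forall>i < D. t i = S m (%p. c p \<otimes> u' p i)" using t unfolding in_span_def by auto
    have "mv R D y t (m + b) = S m (%p. c p \<otimes> mv R D y (u' p) (m + b))"
      using ycong[of t "%i. S m (%p. c p \<otimes> u' p i)"] c(2) coord[OF c(1) uv] by simp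
    also have "\<dots> = \<zero>" by (rule S_eq_zero) (use y2 b c in simp)
    finally show ?thesis .
  qed
  have inv_low: "in_span R D u' m (mv R D (M k) (u' p))" if "k < n" "p < m" for k p
  proof (rule in_span_agree[OF u'(1,2) order_refl])
    show "in_span R D u m (mv R D (M k) (u' p))" using u(3) that u'(2) by (simp add: invariant_def)
  qed
  have inv': "in_span R D u' (m + d) (mv R D (M k) (u' p))" if "k < n" "p < m + d" for k p
    using u'(4) that by (simp add: invariant_def)
  define N where "N k b a = mv R D y (mv R D (M k) (u' (m + a))) (m + b)" for k b a
  have Nm: "N k \<in> mats R" for k unfolding N_def by (intro matsI vecsD mv_vecs y(1) Mm uv)
  have act_mod: "in_span R D u' m (%i. mv R D (M k) (u' (m + a)) i \<ominus> S d (%b. N k b a \<otimes> u' (m + b) i))"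
    if k: "k < n" and a: "a < d" for k a
  proof -
    let ?t = "mv R D (M k) (u' (m + a))"
    have tv: "?t \<in> vecs R" by (rule mv_vecs[OF Mm uv])
    have yt: "mv R D y ?t \<in> vecs R" by (rule mv_vecs[OF y(1) tv])
    have "in_span R D u' m (%i. S m (%p. mv R D y ?t p \<otimes> u' p i))"
      unfolding in_span_def by (rule bexI[OF _ yt]) simp
    moreover have "S m (%p. mv R D y ?t p \<otimes> u' p i) = ?t i \<ominus> S d (%b. N k b a \<otimes> u' (m + b) i)" if i: "i < D" for i
    proof -
      have c: "S m (%p. mv R D y ?t p \<otimes> u' p i) \<in> carrier R" "S d (%b. N k b a \<otimes> u' (m + b) i) \<in> carrier R"
        using u'(1) yt Nm by auto
      have "?t i = S (m + d) (%p. mv R D y ?t p \<otimes> u' p i)"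
        by (rule expand[OF inv' i]) (use k a in auto)
      also have "\<dots> = S m (%p. mv R D y ?t p \<otimes> u' p i) \<oplus> S d (%b. mv R D y ?t (m + b) \<otimes> u' (m + b) i)"
        by (rule S_split) (use u'(1) yt in auto)
      finally show ?thesis using c by (simp add: N_def a_minus_def a_assoc r_neg)
    qed
    ultimately show ?thesis by (rule in_span_eq)
  qed
  have repN: "rep R n mt d N"
    unfolding rep_def
  proof (intro conjI allI impI)
    show "meq d d (N 0) (uvec R)"
      unfolding meq_def
    proof (intro allI impI)
      fix b a assume ba: "b < d" "a < d"
      have "N 0 b a = mv R D y (u' (m + a)) (m + b)" unfolding N_def
      proof (rule ycong)
        fix i assume i: "i < D"
        show "mv R D (M 0) (u' (m + a)) i = u' (m + a) i"
          using mv_cong[where R = R, OF repD(2)[OF M] veq_refl[of D "u' (m + a)"]] mv_unit_mat[OF uv, of D "m + a"] i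
          by (simp add: veq_def)
      qed
      thus "N 0 b a = uvec R b a" using y2[of "m + b" "m + a"] ba by (simp add: uvec_def)
    qed
  next
    fix k k' assume k: "k < n" "k' < n"
    show "meq d d (N (mt k k')) (mm R d (N k) (N k'))"
      unfolding meq_def
    proof (intro allI impI)
      fix b a assume ba: "b < d" "a < d"
      let ?t = "mv R D (M k') (u' (m + a))"
      have tv: "?t \<in> vecs R" by (rule mv_vecs[OF Mm uv])
      have yt: "mv R D y ?t \<in> vecs R" by (rule mv_vecs[OF y(1) tv])
      let ?f = "%p. mv R D y ?t p \<otimes> mv R D y (mv R D (M k) (u' p)) (m + b)"
      have f: "?f p \<in> carrier R" for p by (intro m_closed vecsD[OF yt] vecsD[OF mv_vecs] y Mm mv_vecs uv)
      have "N (mt k k') b a = mv R D y (mv R D (M k) ?t) (m + b)"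
        unfolding N_def by (rule ycong) (rule mv_rep_mt[OF M uv k, symmetric])
      also have "\<dots> = mv R D y (mv R D (M k) (%i. S (m + d) (%p. mv R D y ?t p \<otimes> u' p i))) (m + b)"
      proof (rule ycong)
        fix i assume i: "i < D"
        have "veq D ?t (%i. S (m + d) (%p. mv R D y ?t p \<otimes> u' p i))"
          unfolding veq_def using expand[OF inv'[OF k(2)], of "m + a"] ba by simp
        from mv_cong[where R = R, OF meq_refl[of D D "M k"] this] i
        show "mv R D (M k) ?t i = mv R D (M k) (%i. S (m + d) (%p. mv R D y ?t p \<otimes> u' p i)) i" by (simp add: veq_def)
      qed
      also have "mv R D (M k) (%i. S (m + d) (%p. mv R D y ?t p \<otimes> u' p i)) = (%i. S (m + d) (%p. mv R D y ?t p \<otimes> mv R D (M k) (u' p) i))"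
        by (rule mv_comb[OF Mm yt uv])
      also have "mv R D y (%i. S (m + d) (%p. mv R D y ?t p \<otimes> mv R D (M k) (u' p) i)) (m + b) = S (m + d) ?f"
        by (rule coord[OF yt mv_vecs[OF Mm uv]])
      also have "\<dots> = S m ?f \<oplus> S d (%c. ?f (m + c))" by (rule S_split) (rule f)
      also have "S m ?f = \<zero>" by (rule S_eq_zero) (use low[OF inv_low[OF k(1)] ba(1)] yt in simp)
      also have "S d (%c. ?f (m + c)) = mm R d (N k) (N k') b a"
        unfolding mm_def N_def by (rule gsum_cong, rule m_comm) (intro vecsD[OF yt] vecsD[OF mv_vecs] y Mm mv_vecs uv)+
      finally show "N (mt k k') b a = mm R d (N k) (N k') b a" using mm_mats[OF Nm Nm] by simp
    qed
  qed (rule Nm)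
  have irrN: "irr R n d N"
  proof (rule irrI[OF d])
    fix x a0 t assume x: "x \<in> vecs R" "a0 < d" "x a0 ~= \<zero>" and t: "t \<in> vecs R"
    define w where "w = (%i. S d (%a. x a \<otimes> u' (m + a) i))"
    have wv: "w \<in> vecs R" unfolding w_def by (rule vecsI, rule S_closed) (use x u' in auto)
    have yw: "mv R D y (%i. S d (%a. c a \<otimes> u' (m + a) i)) (m + b) = c b" if "c \<in> vecs R" "b < d" for c b
    proof -
      have "mv R D y (%i. S d (%a. c a \<otimes> u' (m + a) i)) (m + b) = S d (%a. c a \<otimes> mv R D y (u' (m + a)) (m + b))"
        by (rule coord[OF that(1) uv])
      also have "\<dots> = S d (%a. c a \<otimes> (if b = a then \<one> else \<zero>))"
        by (rule gsum_cong) (use y2 that in simp)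
      also have "\<dots> = c b" by (rule S_mult_delta'(1)) (use that in auto)
      finally show ?thesis .
    qed
    have w_span: "in_span R D u' (m + d) w" unfolding w_def
      by (rule in_span_comb[OF u'(1) x(1)]) (use in_span_member[OF u'(1)] in simp)
    have w_new: "\<not> in_span R D u m w"
    proof
      assume "in_span R D u m w"
      have "in_span R D u' m w" by (rule in_span_agree[where u = u, OF u'(1,2) order_refl]) (assumption, fact)
      thus False using low[OF _ x(2)] yw[OF x(1,2)] x(3) by (simp add: w_def)
    qed
    define ws where "ws k = mv R D (M k) w" for k
    have ws: "ws \<in> mats R" unfolding ws_def by (intro matsI vecsD mv_vecs[OF Mm wv])
    from basis_extension[OF u(1,2) ws, of n] obtain v l where v: "v \<in> mats R" "m \<le> l" "\<forall>p < m. v p = u p"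
      "\<forall>p. m \<le> p \<and> p < l --> (\<exists>k < n. v p = ws k)" "indep R D v l" "\<forall>k < n. in_span R D v l (ws k)" by auto
    have "invariant R D n M v l"
      unfolding invariant_def
    proof (intro allI impI)
      fix k p assume k: "k < n" and p: "p < l"
      show "in_span R D v l (mv R D (M k) (v p))"
      proof (cases "p < m")
        case True
        hence "in_span R D u m (mv R D (M k) (v p))" using u(3) k v(3) by (simp add: invariant_def)
        thus ?thesis by (rule in_span_mono[OF v(1)]) (use v(2,3) in auto)
      next
        case False
        hence "\<exists>k < n. v p = ws k" using v(4) p by simp
        then obtain k' where k': "k' < n" "v p = ws k'" by blast
        have "mv R D (M k) (v p) i = ws (mt k k') i" if "i < D" for i
          using mv_rep_mt[OF M wv k k'(1) that] k'(2) by (simp add: ws_def)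
        moreover have "in_span R D v l (ws (mt k k'))" using v(6) mt_closed[OF k k'(1)] by simp
        ultimately show ?thesis using in_span_cong[of D "mv R D (M k) (v p)" "ws (mt k k')" v l] by simp
      qed
    qed
    moreover have "m < l"
    proof (rule ccontr)
      assume "\<not> m < l"
      hence "l = m" using v(2) by simp
      have "in_span R D v m (ws 0)" using v(6) n_pos \<open>l = m\<close> by simp
      moreover have "ws 0 i = w i" if "i < D" for i
        using mv_cong[where R = R, OF repD(2)[OF M] veq_refl[of D w]] mv_unit_mat[OF wv, of D] that
        by (simp add: veq_def ws_def)
      ultimately have "in_span R D v m w" by (rule in_span_eq)
      from in_span_agree[OF u(1) _ order_refl this] have "in_span R D u m w" using v(3) by simp
      thus False using w_new by blast
    qed
    ultimately have ml: "m + d \<le> l" using minimal[of v l] v by blast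
    have v_in: "in_span R D u' (m + d) (v p)" if p: "p < l" for p
    proof (cases "p < m")
      case True
      thus ?thesis using in_span_member[OF u'(1), of p "m + d" D] v(3) u'(2) by simp
    next
      case False
      hence "\<exists>k < n. v p = ws k" using v(4) p by simp
      then obtain k where k: "k < n" "v p = ws k" by blast
      show ?thesis unfolding k(2) ws_def by (rule invariant_span[OF u'(4) Mm u'(1) k(1) w_span])
    qed
    have u_in: "in_span R D v l (u' q)" if q: "q < m + d" for q
    proof (rule ccontr)
      assume new: "\<not> in_span R D v l (u' q)"
      have v': "v(l := u' q) \<in> mats R" by (rule matsI) (use v(1) u'(1) in simp)
      have "Suc l \<le> m + d"
      proof (rule steinitz[OF u'(1) v' indep_extend[OF v(1,5) uv new]])
        fix p assume "p < Suc l"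
        thus "in_span R D u' (m + d) ((v(l := u' q)) p)"
          using v_in in_span_member[OF u'(1) q] by (cases "p = l") auto
      qed
      thus False using ml by simp
    qed
    have "in_span R D v l (%i. S d (%b. t b \<otimes> u' (m + b) i))"
      by (rule in_span_comb[OF v(1) t]) (use u_in in simp)
    then obtain c where c: "c \<in> vecs R" "\<forall>i < D. S d (%b. t b \<otimes> u' (m + b) i) = S l (%p. c p \<otimes> v p i)"
      unfolding in_span_def by blast
    have vv: "v p \<in> vecs R" for p using v(1) by simp
    have Nx: "(%k. mv R d (N k) x) \<in> mats R" by (intro matsI vecsD mv_vecs[OF Nm x(1)])
    have comp: "in_span R d (%k. mv R d (N k) x) n (%b. mv R D y (v p) (m + b))" if p: "p < l" for p
    proof (cases "p < m")
      case True
      have "in_span R D u' m (v p)" using in_span_member[OF u'(1) True] u'(2) v(3) True by simp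
      thus ?thesis by (intro in_span_zero[OF Nx] low)
    next
      case False
      hence "\<exists>k < n. v p = ws k" using v(4) p by simp
      then obtain k where k: "k < n" "v p = ws k" by blast
      have "mv R D y (v p) (m + b) = mv R d (N k) x b" if "b < d" for b
      proof -
        have "ws k = (%i. S d (%a. x a \<otimes> mv R D (M k) (u' (m + a)) i))"
          unfolding ws_def w_def by (rule mv_comb[OF Mm x(1) uv])
        hence "mv R D y (v p) (m + b) = S d (%a. x a \<otimes> N k b a)"
          unfolding k(2) N_def by (simp only:) (rule coord[OF x(1) mv_vecs[OF Mm uv]])
        also have "\<dots> = mv R d (N k) x b" unfolding mv_def by (rule gsum_cong) (use x Nm in "simp add: m_comm")
        finally show ?thesis .
      qed
      thus ?thesis by (intro in_span_eq[OF in_span_member[OF Nx k(1), of d]]) simp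
    qed
    have "in_span R d (%k. mv R d (N k) x) n (%b. S l (%p. c p \<otimes> mv R D y (v p) (m + b)))"
      by (rule in_span_comb[OF Nx c(1) comp])
    moreover have "S l (%p. c p \<otimes> mv R D y (v p) (m + b)) = t b" if b: "b < d" for b
    proof -
      have "S l (%p. c p \<otimes> mv R D y (v p) (m + b)) = mv R D y (%i. S l (%p. c p \<otimes> v p i)) (m + b)"
        by (rule coord[OF c(1) vv, symmetric])
      also have "\<dots> = mv R D y (%i. S d (%b. t b \<otimes> u' (m + b) i)) (m + b)" by (rule ycong) (use c(2) in simp)
      finally show ?thesis using yw[OF t b] by simp
    qed
    ultimately show "in_span R d (%k. mv R d (N k) x) n t" by (rule in_span_eq)
  qed
  show ?thesis by (rule that[OF repN irrN act_mod])
qed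

text \<open>Starting from the zero subspace, the invariant subspace is enlarged by a smallest possible
  dimension until it is the whole space.\<close>

lemma composition_series:
  assumes M: "rep R n mt D M"
    and Q: "!!d N. rep R n mt d N ==> irr R n d N ==> \<exists>N'. (d, N') \<in> Q \<and> (\<forall>k. N' k \<in> mats R) \<and> eqv R n d N' N"
  obtains u m where "u \<in> mats R" "comp_chain R D n M Q u m" "!!t. t \<in> vecs R ==> in_span R D u m t"
proof -
  have Mm: "M k \<in> mats R" for k using repD(1)[OF M] .
  define P where "P m \<longleftrightarrow> (\<exists>u. u \<in> mats R \<and> indep R D u m \<and> invariant R D n M u m \<and> comp_chain R D n M Q u m)" for m
  have "P 0" unfolding P_def by (rule exI[of _ "uvec R"]) (auto simp: indep_def invariant_def comp_chain_def)
  have bound: "m \<le> D" if ind: "indep R D u m" "u \<in> mats R" for u m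
    by (rule steinitz[OF unit_mats ind(2,1)]) (use ind(2) in_span_uvecs in simp)
  define m where "m = (GREATEST m. P m)"
  have m: "P m" unfolding m_def by (rule GreatestI_nat[where P = P and k = 0 and b = D, OF \<open>P 0\<close>]) (auto simp: P_def intro: bound)
  have greatest: "l \<le> m" if "P l" for l
    unfolding m_def by (rule Greatest_le_nat[where P = P and b = D, OF that]) (auto simp: P_def intro: bound)
  obtain u where u: "u \<in> mats R" "indep R D u m" "invariant R D n M u m" "comp_chain R D n M Q u m"
    using m unfolding P_def by blast
  have "in_span R D u m t" if t: "t \<in> vecs R" for t
  proof (rule ccontr)
    assume new: "\<not> in_span R D u m t"
    define E where "E l \<longleftrightarrow> m < l \<and> (\<exists>v. v \<in> mats R \<and> (\<forall>p < m. v p = u p) \<and> indep R D v l \<and> invariant R D n M v l)" for l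
    from basis_extension[OF u(1,2) unit_mats, of D] obtain v l where v: "v \<in> mats R" "m \<le> l" "\<forall>p < m. v p = u p"
      "indep R D v l" "\<forall>k < D. in_span R D v l (uvec R k)" by auto
    have all: "in_span R D v l s" if "s \<in> vecs R" for s
      by (rule in_span_trans[OF v(1) in_span_uvecs[OF that]]) (use v(5) in simp)
    have "l ~= m"
    proof
      assume "l = m"
      have "in_span R D v m t" using all[OF t] \<open>l = m\<close> by simp
      from in_span_agree[OF u(1) _ order_refl this] have "in_span R D u m t" using v(3) by simp
      thus False using new by blast
    qed
    moreover have "invariant R D n M v l" unfolding invariant_def using all v(1) Mm by simp
    ultimately have "E l" unfolding E_def using v by auto
    define l' where "l' = (LEAST l. E l)"
    have l': "E l'" unfolding l'_def by (rule LeastI[where P = E, OF \<open>E l\<close>])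
    have least: "l' \<le> l" if "E l" for l unfolding l'_def by (rule Least_le[where P = E, OF that])
    define d where "d = l' - m"
    have ld: "l' = m + d" "0 < d" using l' by (auto simp: d_def E_def)
    obtain u' where u': "u' \<in> mats R" "!!p. p < m ==> u' p = u p" "indep R D u' (m + d)" "invariant R D n M u' (m + d)"
      using l' ld unfolding E_def by auto
    have "\<exists>N. rep R n mt d N \<and> irr R n d N \<and>
      (\<forall>k < n. \<forall>a < d. in_span R D u' m (%i. mv R D (M k) (u' (m + a)) i \<ominus> S d (%b. N k b a \<otimes> u' (m + b) i)))"
    proof (rule minimal_extension_irr[OF M u(1-3) u'(1) _ u'(3,4) ld(2)])
      show "u' p = u p" if "p < m" for p by (rule u'(2)[OF that])
      show "m + d \<le> l" if "v \<in> mats R" "!!p. p < m ==> v p = u p" "indep R D v l" "invariant R D n M v l" "m < l" for v l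
        using least[of l] that ld unfolding E_def by auto
    qed blast
    then obtain N where N: "rep R n mt d N" "irr R n d N"
      "\<forall>k < n. \<forall>a < d. in_span R D u' m (%i. mv R D (M k) (u' (m + a)) i \<ominus> S d (%b. N k b a \<otimes> u' (m + b) i))"
      by (elim exE conjE)
    have Nm: "N k \<in> mats R" for k using repD(1)[OF N(1)] .
    obtain N' where N': "(d, N') \<in> Q" "!!k. N' k \<in> mats R" "eqv R n d N' N" using Q[OF N(1,2)] by blast
    obtain T T' where T: "T \<in> mats R" "T' \<in> mats R" "meq d d (mm R d T T') (uvec R)"
      "!!k. k < n ==> meq d d (mm R d T (N' k)) (mm R d (N k) T)" using N'(3) unfolding eqv_def by blast
    define z where "z a = (%i. S d (%b. T b a \<otimes> u' (m + b) i))" for a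
    have zv: "z a \<in> vecs R" for a unfolding z_def by (rule vecsI, rule S_closed) (use T u' in auto)
    have z: "z \<in> mats R" using zv by (auto intro!: matsI)
    have uv: "u' p \<in> vecs R" for p using u'(1) by simp
    have z_comb: "S d (%e. c e \<otimes> z e i) = S d (%b. S d (%e. c e \<otimes> T b e) \<otimes> u' (m + b) i)" if c: "c \<in> vecs R" for c i
      unfolding z_def by (rule S_assoc[where b = "%e b. T b e"]) (use c T u' in auto)
    have "comp_chain R D n M Q u' (m + d)"
      unfolding comp_chain_def
    proof (intro allI impI)
      fix p assume p: "p < m + d"
      show "\<exists>(d, N) \<in> Q. comp_step R D n M u' p d N"
      proof (cases "p < m")
        case True
        then obtain e L where L: "(e, L) \<in> Q" "comp_step R D n M u p e L"
          using u(4) unfolding comp_chain_def by auto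
        have "comp_step R D n M u' p e L" by (rule comp_step_agree[where u = u, OF u'(1) _ True L(2)]) (rule u'(2))
        thus ?thesis using L(1) by (intro bexI[of _ "(e, L)"]) simp_all
      next
        case False
        then obtain b0 where b0: "p = m + b0" "b0 < d" using p le_iff_add[of m p] by auto
        define g where "g a = T' a b0" for a
        have g: "g \<in> vecs R" unfolding g_def by (rule vecsI) (use T in simp)
        have "in_span R D u' m (%i. mv R D (M k) (z a) i \<ominus> S d (%b. N' k b a \<otimes> z b i))" if k: "k < n" and a: "a < d" for k a
        proof -
          let ?f = "%b i. mv R D (M k) (u' (m + b)) i \<ominus> S d (%c. N k c b \<otimes> u' (m + c) i)"
          have Ta: "(%b. T b a) \<in> vecs R" by (rule vecsI) (use T in simp)
          have mc: "mv R D (M k) (u' (m + b)) i \<in> carrier R" for b i by (rule vecsD[OF mv_vecs[OF Mm uv]])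
          have "in_span R D u' m (%i. S d (%b. T b a \<otimes> ?f b i))"
            by (rule in_span_comb[OF u'(1) Ta]) (use N(3) k in simp)
          moreover have "S d (%b. T b a \<otimes> ?f b i) = mv R D (M k) (z a) i \<ominus> S d (%b. N' k b a \<otimes> z b i)" for i
          proof -
            have "S d (%b. T b a \<otimes> ?f b i)
                = S d (%b. T b a \<otimes> mv R D (M k) (u' (m + b)) i \<ominus> T b a \<otimes> S d (%c. u' (m + c) i \<otimes> N k c b))"
            proof (rule gsum_cong)
              fix b
              have "S d (%c. N k c b \<otimes> u' (m + c) i) = S d (%c. u' (m + c) i \<otimes> N k c b)"
                by (rule gsum_cong) (use u' Nm in "simp add: m_comm")
              moreover have "S d (%c. u' (m + c) i \<otimes> N k c b) \<in> carrier R" using u' Nm by auto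
              ultimately show "T b a \<otimes> ?f b i = T b a \<otimes> mv R D (M k) (u' (m + b)) i \<ominus> T b a \<otimes> S d (%c. u' (m + c) i \<otimes> N k c b)"
                using T mc by (simp add: a_minus_def r_distr r_minus)
            qed
            also have "\<dots> = S d (%b. T b a \<otimes> mv R D (M k) (u' (m + b)) i) \<ominus> S d (%b. T b a \<otimes> S d (%c. u' (m + c) i \<otimes> N k c b))"
              by (rule S_minus) (use T mc u' Nm in auto)
            also have "S d (%b. T b a \<otimes> mv R D (M k) (u' (m + b)) i) = mv R D (M k) (z a) i"
              unfolding z_def by (rule fun_cong[OF mv_comb[OF Mm Ta uv], symmetric])
            also have "S d (%b. T b a \<otimes> S d (%c. u' (m + c) i \<otimes> N k c b)) = S d (%b. S d (%c. u' (m + c) i \<otimes> N k c b) \<otimes> T b a)"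
              by (rule gsum_cong, rule m_comm) (use T u' Nm in auto)
            also have "\<dots> = S d (%c. u' (m + c) i \<otimes> S d (%b. N k c b \<otimes> T b a))"
              by (rule S_assoc[symmetric]) (use T u' Nm in auto)
            also have "\<dots> = S d (%c. S d (%e. N' k e a \<otimes> T c e) \<otimes> u' (m + c) i)"
            proof (rule gsum_cong)
              fix c assume c: "c < d"
              have "S d (%b. N k c b \<otimes> T b a) = S d (%e. T c e \<otimes> N' k e a)"
                using T(4)[OF k] c a by (simp add: meq_def mm_def)
              also have "\<dots> = S d (%e. N' k e a \<otimes> T c e)" by (rule gsum_cong) (use T N' in "simp add: m_comm")
              finally show "u' (m + c) i \<otimes> S d (%b. N k c b \<otimes> T b a) = S d (%e. N' k e a \<otimes> T c e) \<otimes> u' (m + c) i"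
                by (simp only:) (rule m_comm, use T N' u' in auto)
            qed
            also have "\<dots> = S d (%b. N' k b a \<otimes> z b i)" by (rule z_comb[symmetric]) (rule vecsI, use N' in simp)
            finally show ?thesis .
          qed
          ultimately show ?thesis by simp
        qed
        hence 1: "\<forall>k < n. \<forall>a < d. in_span R D u' m (%i. mv R D (M k) (z a) i \<ominus> S d (%b. N' k b a \<otimes> z b i))" by simp
        have 2: "in_span R D u' m (%i. u' p i \<ominus> S d (%a. g a \<otimes> z a i))"
        proof (rule in_span_zero[OF u'(1)])
          fix i
          have "S d (%a. g a \<otimes> z a i) = S d (%b. S d (%e. g e \<otimes> T b e) \<otimes> u' (m + b) i)" by (rule z_comb[OF g])
          also have "\<dots> = S d (%b. (if b0 = b then \<one> else \<zero>) \<otimes> u' (m + b) i)"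
          proof (rule gsum_cong)
            fix b assume b: "b < d"
            have "S d (%e. g e \<otimes> T b e) = S d (%e. T b e \<otimes> T' e b0)" by (rule gsum_cong) (use T in "simp add: g_def m_comm")
            also have "\<dots> = (if b0 = b then \<one> else \<zero>)" using T(3) b b0 by (simp add: meq_def mm_def uvec_def)
            finally show "S d (%e. g e \<otimes> T b e) \<otimes> u' (m + b) i = (if b0 = b then \<one> else \<zero>) \<otimes> u' (m + b) i" by simp
          qed
          also have "\<dots> = u' (m + b0) i" by (rule S_mult_delta'(2)) (use b0 u' in auto)
          finally show "u' p i \<ominus> S d (%a. g a \<otimes> z a i) = \<zero>" using b0 u' by (simp add: a_minus_def r_neg)
        qed
        have "m \<le> p" using b0 by simp
        hence "comp_step R D n M u' p d N'" unfolding comp_step_def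
          by (rule_tac exI[of _ m], rule_tac conjI, assumption, rule_tac bexI[OF _ z], rule_tac bexI[OF _ g]) (rule conjI[OF 1 2])
        thus ?thesis using N'(1) by (intro bexI[of _ "(d, N')"]) simp_all
      qed
    qed
    hence "P (m + d)" unfolding P_def using u' by blast
    thus False using greatest[of "m + d"] ld by simp
  qed
  thus ?thesis using that u by blast
qed

end

section \<open>Algebraic closures of prime fields\<close>

context field
begin

lemma eval_map_rev: "(!!i. i < m ==> x i \<in> carrier R) ==> t \<in> carrier R ==>
    eval (map x (rev [0..<m])) t = S m (%i. x i \<otimes> t [^] i)"
proof (induction m)
  case (Suc m)
  have "S m (%i. x i \<otimes> t [^] i) \<in> carrier R" using Suc.prems by auto
  thus ?case using Suc by (auto simp: a_comm)
qed simp

lemma binomial: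
  assumes "x \<in> carrier R" "y \<in> carrier R"
  shows "(x \<oplus> y) [^] (m :: nat) = S (Suc m) (%i. [(m choose i)] \<cdot> (x [^] i \<otimes> y [^] (m - i)))"
proof (induction m)
  case 0
  show ?case by simp
next
  case (Suc m)
  let ?t = "%m i. [(m choose i)] \<cdot> (x [^] i \<otimes> y [^] (m - i))"
  have t: "?t m i \<in> carrier R" for m i using assms by simp
  have x: "S (Suc m) (?t m) \<otimes> x = S (Suc m) (%i. [(m choose i)] \<cdot> (x [^] Suc i \<otimes> y [^] (m - i)))"
  proof -
    have "S (Suc m) (?t m) \<otimes> x = S (Suc m) (%i. ?t m i \<otimes> x)" by (rule S_rmult) (use assms t in auto)
    also have "\<dots> = S (Suc m) (%i. [(m choose i)] \<cdot> (x [^] Suc i \<otimes> y [^] (m - i)))"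
    proof (rule gsum_cong)
      fix i
      have "x [^] i \<otimes> y [^] (m - i) \<otimes> x = x [^] Suc i \<otimes> y [^] (m - i)" using assms by (simp add: m_ac)
      thus "?t m i \<otimes> x = [(m choose i)] \<cdot> (x [^] Suc i \<otimes> y [^] (m - i))"
        using assms by (simp only: add_pow_ldistr m_closed nat_pow_closed)
    qed
    finally show ?thesis .
  qed
  have y: "S (Suc m) (?t m) \<otimes> y = S (Suc (Suc m)) (%i. [(m choose i)] \<cdot> (x [^] i \<otimes> y [^] (Suc m - i)))"
  proof -
    have "S (Suc m) (?t m) \<otimes> y = S (Suc m) (%i. ?t m i \<otimes> y)" by (rule S_rmult) (use assms t in auto)
    also have "\<dots> = S (Suc m) (%i. [(m choose i)] \<cdot> (x [^] i \<otimes> y [^] (Suc m - i)))"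
      by (rule gsum_cong) (use assms in "simp add: add_pow_ldistr m_assoc Suc_diff_le")
    finally show ?thesis using assms by (simp add: binomial_eq_0)
  qed
  have "(x \<oplus> y) [^] Suc m = S (Suc m) (?t m) \<otimes> x \<oplus> S (Suc m) (?t m) \<otimes> y"
    unfolding nat_pow_Suc Suc by (rule r_distr) (use assms t in auto)
  also have "S (Suc m) (?t m) \<otimes> y = y [^] Suc m \<oplus> S (Suc m) (%i. [(m choose Suc i)] \<cdot> (x [^] Suc i \<otimes> y [^] (m - i)))"
    unfolding y by (subst S_Suc_shift) (use assms in auto)
  also have "S (Suc m) (?t m) \<otimes> x \<oplus> (y [^] Suc m \<oplus> S (Suc m) (%i. [(m choose Suc i)] \<cdot> (x [^] Suc i \<otimes> y [^] (m - i))))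
      = y [^] Suc m \<oplus> (S (Suc m) (?t m) \<otimes> x \<oplus> S (Suc m) (%i. [(m choose Suc i)] \<cdot> (x [^] Suc i \<otimes> y [^] (m - i))))"
    by (rule a_lcomm) (use assms t in "auto simp del: gsum.simps")
  also have "S (Suc m) (?t m) \<otimes> x \<oplus> S (Suc m) (%i. [(m choose Suc i)] \<cdot> (x [^] Suc i \<otimes> y [^] (m - i)))
      = S (Suc m) (%i. ?t (Suc m) (Suc i))"
    unfolding x using assms by (subst S_add[symmetric]) (auto simp: add.nat_pow_mult intro!: gsum_cong simp del: gsum.simps)
  also have "y [^] Suc m \<oplus> S (Suc m) (%i. ?t (Suc m) (Suc i)) = S (Suc (Suc m)) (?t (Suc m))"
    by (subst S_Suc_shift[of "Suc m" "?t (Suc m)"]) (use assms t in auto)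
  finally show ?case .
qed

lemma finite_subfield_card:
  assumes "subfield k R" "finite k" "dimension m k E"
  shows "card E = card k ^ m" "finite E"
proof -
  obtain Vs where Vs: "set Vs \<subseteq> carrier R" "independent k Vs" "length Vs = m" "Span k Vs = E"
    using exists_base[OF assms(1,3)] by blast
  let ?A = "{Ks. set Ks \<subseteq> k \<and> length Ks = m}"
  have "bij_betw (%Ks. combine Ks Vs) ?A E"
    unfolding bij_betw_def
  proof
    show im: "(%Ks. combine Ks Vs) ` ?A = E"
      using Span_eq_combine_set_length_version[OF assms(1) Vs(1)] Vs(3,4) by auto
    show "inj_on (%Ks. combine Ks Vs) ?A"
    proof (rule inj_onI)
      fix Ks Ls assume *: "Ks \<in> ?A" "Ls \<in> ?A" "combine Ks Vs = combine Ls Vs"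
      hence "combine Ks Vs \<in> Span k Vs" using im Vs(4) by blast
      from unique_decomposition[OF assms(1) Vs(2) this] * Vs(3) show "Ks = Ls" by auto
    qed
  qed
  thus "card E = card k ^ m" "finite E"
    using card_lists_length_eq[OF assms(2), of m] finite_lists_length_eq[OF assms(2), of m]
    by (auto simp: bij_betw_same_card[symmetric] bij_betw_finite)
qed

lemma finite_subfield_pow_card:
  assumes "subfield E R" "finite E" "x \<in> E"
  shows "x [^] card E = x"
proof -
  interpret E: field "R\<lparr>carrier := E\<rparr>" by (rule subfield_iff(2)[OF assms(1)])
  have pos: "0 < card E" using assms by (auto simp: card_gt_0_iff)
  show ?thesis
  proof (cases "x = \<zero>")
    case True
    thus ?thesis using pos zero_pow by simp
  next
    case False
    have "x [^]\<^bsub>Multiplicative_Group.mult_of (R\<lparr>carrier := E\<rparr>)\<^esub> order (Multiplicative_Group.mult_of (R\<lparr>carrier := E\<rparr>)) = \<one>\<^bsub>Multiplicative_Group.mult_of (R\<lparr>carrier := E\<rparr>)\<^esub>"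
      by (rule group.pow_order_eq_1[OF E.field_mult_group]) (use False assms in simp)
    hence "x [^] (card E - 1) = \<one>"
      using E.order_mult_of assms(2) by (simp add: order_def Multiplicative_Group.nat_pow_mult_of nat_pow_consistent[symmetric])
    moreover have "x [^] card E = x [^] (card E - 1) \<otimes> x" using pos by (cases "card E") auto
    moreover have "x \<in> carrier R" using assms(3) subfieldE(3)[OF assms(1)] by blast
    ultimately show ?thesis by simp
  qed
qed

text \<open>The nonzero elements of \<open>E\<close> already account for all the roots that \<open>X\<^bsup>|E|-1\<^esup> - 1\<close> can have.\<close>

lemma fixed_in_subfield:
  assumes E: "subfield E R" "finite E" and F: "subfield F R" "finite F" "E \<subseteq> F" and x: "x \<in> F" "x [^] card E = x"
  shows "x \<in> E"
proof (cases "x = \<zero>")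
  case True
  thus ?thesis using subringE(2)[OF subfieldE(1)[OF E(1)]] by simp
next
  case False
  interpret F: field "R\<lparr>carrier := F\<rparr>" by (rule subfield_iff(2)[OF F(1)])
  have FR: "F \<subseteq> carrier R" by (rule subfieldE(3)[OF F(1)])
  have zE: "\<zero> \<in> E" "\<one> \<in> E" using subringE(2,3)[OF subfieldE(1)[OF E(1)]] by auto
  hence "card {\<zero>, \<one>} \<le> card E" by (intro card_mono E) auto
  hence c: "2 \<le> card E" by simp
  let ?q = "card E - 1"
  have root: "y [^] ?q = \<one>" if "y \<in> F" "y ~= \<zero>" "y [^] card E = y" for y
  proof -
    have y: "y \<in> carrier R" using that FR by blast
    have "y [^] card E = y [^] ?q \<otimes> y" using c by (cases "card E") auto
    hence "y [^] ?q \<otimes> y = \<one> \<otimes> y" using that y by simp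
    thus ?thesis using m_rcancel[OF that(2) y, of "y [^] ?q" \<one>] y by simp
  qed
  have fin: "finite {y \<in> F. y [^] ?q = \<one>}" using F(2) by simp
  have "card {y \<in> F. y [^] ?q = \<one>} \<le> ?q"
    using F.num_roots_le_deg[of ?q] F(2) c by (simp add: nat_pow_consistent[symmetric])
  moreover have "card (E - {\<zero>}) = ?q" using zE E(2) by simp
  moreover have "E - {\<zero>} \<subseteq> {y \<in> F. y [^] ?q = \<one>}"
    using root finite_subfield_pow_card[OF E] F(3) by auto
  ultimately have "E - {\<zero>} = {y \<in> F. y [^] ?q = \<one>}" by (intro card_seteq fin) auto
  thus ?thesis using root[OF x(1) False x(2)] x(1) by blast
qed

end

locale prime_closure = algebraic_closure L K for L (structure) and K +
  fixes l :: nat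
  assumes prime_l: "Factorial_Ring.prime l" and card_K: "card K = l"
begin

lemma subfield_K: "subfield K L" by (rule subfield_axioms)

lemma finite_K: "finite K"
  using card_K prime_l by (metis card.infinite not_prime_0)

definition nt :: "nat => 'a" where "nt c = [c] \<cdot> \<one>"

lemma nt_closed [simp]: "nt c \<in> carrier L"
  by (simp add: nt_def)

lemma nt_simps: "nt 0 = \<zero>" "nt (Suc c) = nt c \<oplus> \<one>" "nt 1 = \<one>" "nt (a + b) = nt a \<oplus> nt b"
  by (simp_all add: nt_def add.nat_pow_mult)

lemma nt_mult: "nt (a * b) = nt a \<otimes> nt b"
  by (induction a) (simp_all add: nt_simps l_distr a_comm)

lemma nt_l: "nt l = \<zero>"
proof -
  interpret K: field "L\<lparr>carrier := K\<rparr>" by (rule subfield_iff(2)[OF subfield_K])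
  have "\<one> [^]\<^bsub>add_monoid (L\<lparr>carrier := K\<rparr>)\<^esub> order (add_monoid (L\<lparr>carrier := K\<rparr>)) = \<one>\<^bsub>add_monoid (L\<lparr>carrier := K\<rparr>)\<^esub>"
    by (rule group.pow_order_eq_1[OF K.a_group]) (use K.one_closed in simp)
  moreover have "\<one> [^]\<^bsub>add_monoid (L\<lparr>carrier := K\<rparr>)\<^esub> c = nt c" for c :: nat
    by (simp add: nt_def add_pow_def nat_pow_def)
  ultimately show ?thesis by (simp add: order_def card_K)
qed

lemma nt_mod: "nt (c mod l) = nt c"
proof -
  have "nt c = nt (l * (c div l) + c mod l)" by simp
  also have "\<dots> = nt (c mod l)" unfolding nt_simps nt_mult nt_l by simp
  finally show ?thesis by simp
qed

lemma nt_K: "nt c \<in> K"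
proof (induction c)
  case 0
  show ?case using subringE(2)[OF subfieldE(1)[OF subfield_K]] by (simp add: nt_simps)
next
  case (Suc c)
  thus ?case using subringE(3,7)[OF subfieldE(1)[OF subfield_K]] by (simp add: nt_simps)
qed

lemma nt_inj:
  assumes "a < l" "b < l" "nt a = nt b"
  shows "a = b"
proof -
  have *: "a \<ge> b" if "a < l" "b < l" "nt a = nt b" for a b
  proof (rule ccontr)
    assume "\<not> a \<ge> b"
    define c where "c = b - a"
    have c: "0 < c" "c < l" "b = a + c" using \<open>\<not> a \<ge> b\<close> that by (auto simp: c_def)
    have "nt a \<oplus> nt c = nt a \<oplus> \<zero>" using that(3) c(3) by (simp add: nt_simps)
    hence z: "nt c = \<zero>" by (simp only: add.l_cancel nt_closed zero_closed)
    have "coprime c l" using c prime_l by (metis coprime_commute nat_dvd_not_less prime_imp_coprime)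
    then obtain x where "[c * x = Suc 0] (mod l)" using cong_solve_coprime_nat by blast
    hence "nt ((c * x) mod l) = nt (Suc 0 mod l)" by (simp add: cong_def)
    hence "nt c \<otimes> nt x = \<one>" unfolding nt_mod nt_mult by (simp add: nt_simps)
    thus False using z by simp
  qed
  show ?thesis using *[OF assms] *[OF assms(2,1) assms(3)[symmetric]] by simp
qed

lemma K_eq: "K = nt ` {..<l}"
proof -
  have "inj_on nt {..<l}" by (rule inj_onI) (use nt_inj in auto)
  hence "card (nt ` {..<l}) = l" by (simp add: card_image)
  thus ?thesis using card_seteq[OF finite_K, of "nt ` {..<l}"] nt_K card_K by (metis image_subsetI order_refl)
qed

lemma K_sub: "subfield F L ==> K \<subseteq> F"
proof -
  assume F: "subfield F L"
  have "nt c \<in> F" for c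
    by (induction c) (use subringE(2,3,7)[OF subfieldE(1)[OF F]] in "auto simp: nt_simps")
  thus ?thesis unfolding K_eq by blast
qed

lemma has_roots: "has_roots L"
  unfolding has_roots_def
proof (intro ballI allI impI)
  fix x and k :: nat assume x: "x \<in> vecs L" "0 < k" "x k ~= \<zero>"
  let ?p = "map x (rev [0..<Suc k])"
  have set: "set ?p \<subseteq> carrier L" using x(1) by auto
  have p: "?p \<in> carrier (poly_ring L)"
    unfolding univ_poly_carrier[symmetric] polynomial_def using x set by auto
  have "splitted ?p" by (rule roots_over_carrier[OF p])
  hence "size (roots ?p) = k" by (simp add: splitted_def)
  hence "roots ?p ~= {#}" using x(2) by auto
  then obtain a where "a \<in># roots ?p" by blast
  hence "is_root ?p a" using roots_mem_iff_is_root[OF p] by simp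
  hence "a \<in> carrier L" "eval ?p a = \<zero>" by (auto simp: is_root_def)
  thus "\<exists>t \<in> carrier L. S (Suc k) (%i. x i \<otimes> t [^] i) = \<zero>"
    using eval_map_rev[of "Suc k" x a] x(1) by (intro bexI[of _ a]) simp_all
qed

lemma frob_prime:
  assumes "x \<in> carrier L" "y \<in> carrier L"
  shows "(x \<oplus> y) [^] l = x [^] l \<oplus> y [^] l"
proof -
  obtain m where m: "l = Suc m" using prime_l by (metis not_prime_0 old.nat.exhaust)
  let ?t = "%i. [(l choose i)] \<cdot> (x [^] i \<otimes> y [^] (l - i))"
  have t: "?t i \<in> carrier L" for i using assms by simp
  have zero: "?t i = \<zero>" if "0 < i" "i < l" for i
  proof -
    have "l dvd l choose i" by (rule dvd_choose_prime) (use that prime_l in auto)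
    then obtain c where c: "l choose i = l * c" by (auto simp: dvd_def)
    have a: "x [^] i \<otimes> y [^] (l - i) \<in> carrier L" using assms by simp
    have "?t i = [(l choose i)] \<cdot> (\<one> \<otimes> (x [^] i \<otimes> y [^] (l - i)))" using a by simp
    also have "\<dots> = nt (l choose i) \<otimes> (x [^] i \<otimes> y [^] (l - i))"
      unfolding nt_def by (rule add_pow_ldistr[symmetric]) (use a in auto)
    finally show ?thesis unfolding c nt_mult nt_l using a by simp
  qed
  have "S m (%i. ?t (Suc i)) = \<zero>"
  proof (rule S_eq_zero)
    fix i assume "i < m"
    thus "?t (Suc i) = \<zero>" by (intro zero) (use m in auto)
  qed
  moreover have "S (Suc l) ?t = ?t 0 \<oplus> S l (%i. ?t (Suc i))" by (rule S_Suc_shift) (rule t)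
  moreover have "S l g = S m g \<oplus> g m" for g by (simp add: m)
  moreover have "?t (Suc m) = x [^] l" "?t 0 = y [^] l" using assms by (simp_all add: m[symmetric])
  ultimately have "S (Suc l) ?t = y [^] l \<oplus> x [^] l" using assms by simp
  thus ?thesis unfolding binomial[OF assms] using assms by (simp add: a_comm)
qed

lemma frob_hom_l: "0 < e ==> frob_hom L (l ^ e)"
proof -
  assume e: "0 < e"
  have "(x \<oplus> y) [^] (l ^ e) = x [^] (l ^ e) \<oplus> y [^] (l ^ e)" if "x \<in> carrier L" "y \<in> carrier L" for x y
    using that
  proof (induction e arbitrary: x y)
    case (Suc e)
    have "z [^] (l ^ Suc e) = (z [^] l) [^] (l ^ e)" if "z \<in> carrier L" for z
      using that by (simp add: nat_pow_pow)
    thus ?case using Suc frob_prime[OF Suc.prems] by simp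
  qed simp
  moreover have "1 < l ^ e" using e prime_gt_1_nat[OF prime_l] one_less_power by blast
  ultimately show ?thesis by (simp add: frob_hom_def)
qed

text \<open>Finitely many elements of a subfield lie in a finite subfield of it.\<close>

lemma finite_subfield:
  assumes F: "subfield F L" and Y: "finite Y" "Y \<subseteq> F"
  obtains E s where "subfield E L" "finite E" "Y \<subseteq> E" "E \<subseteq> F" "0 < s" "card E = l ^ s"
proof -
  obtain xs where xs: "set xs = Y" using finite_list[OF Y(1)] by blast
  have FL: "F \<subseteq> carrier L" by (rule subfieldE(3)[OF F])
  have xsL: "set xs \<subseteq> carrier L" using xs Y FL by blast
  have alg: "(algebraic over K) x" if "x \<in> set xs" for x using algebraic_extension xsL that by blast
  define E where "E = finite_extension K xs"
  have E: "subfield E L" unfolding E_def by (rule finite_extension_is_subfield[OF subfield_K xsL alg])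
  have "finite_dimension K E" unfolding E_def by (rule finite_extension_finite_dimension(1)[OF subfield_K xsL alg])
  then obtain s where s: "dimension s K E" unfolding finite_dimension_def by blast
  note card = finite_subfield_card[OF subfield_K finite_K s, unfolded card_K]
  have "\<zero> \<in> E" "\<one> \<in> E" using subringE(2,3)[OF subfieldE(1)[OF E]] by auto
  hence "card {\<zero>, \<one>} \<le> card E" by (intro card_mono card) auto
  hence "s ~= 0" using card(1) by (cases s) auto
  moreover have "Y \<subseteq> E" using finite_extension_mem[OF subfieldE(1)[OF subfield_K] xsL] xs by (simp add: E_def)
  moreover have "E \<subseteq> F" unfolding E_def
    by (rule finite_extension_subring_incl[OF subfieldE(1)[OF F] K_sub[OF F]]) (use xs Y in simp)
  ultimately show ?thesis using that E card by blast
qed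

lemma carrier_subfield: "subfield (carrier L) L"
  by (rule carrier_is_subfield)

lemma finite_fixed_subfield:
  assumes F: "subfield F L" and Y: "finite Y" "Y \<subseteq> F"
  obtains s where "0 < s" "!!y. y \<in> Y ==> y [^] (l ^ s) = y" "!!x. x \<in> carrier L ==> x [^] (l ^ s) = x ==> x \<in> F"
proof -
  obtain E s where E: "subfield E L" "finite E" "Y \<subseteq> E" "E \<subseteq> F" "0 < s" "card E = l ^ s"
    by (rule finite_subfield[OF F Y])
  have EL: "E \<subseteq> carrier L" by (rule subfieldE(3)[OF E(1)])
  show ?thesis
  proof (rule that[OF E(5)])
    show "y [^] (l ^ s) = y" if "y \<in> Y" for y
      using finite_subfield_pow_card[OF E(1,2), of y] that E by auto
    show "x \<in> F" if x: "x \<in> carrier L" "x [^] (l ^ s) = x" for x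
    proof -
      have fin: "finite (insert x E)" "insert x E \<subseteq> carrier L" using E x EL by auto
      obtain E' s' where E': "subfield E' L" "finite E'" "insert x E \<subseteq> E'"
        by (rule finite_subfield[OF carrier_subfield fin])
      have "x \<in> E" by (rule fixed_in_subfield[OF E(1,2) E'(1,2)]) (use E' E x in auto)
      thus ?thesis using E by blast
    qed
  qed
qed

lemma fixed_subfield:
  assumes "0 < e"
  shows "subfield {x \<in> carrier L. x [^] (l ^ e) = x} L"
proof (rule subfieldI')
  note f = frob_hom_l[OF assms]
  have pos: "0 < l ^ e" using prime_gt_0_nat[OF prime_l] by simp
  show "subring {x \<in> carrier L. x [^] (l ^ e) = x} L"
  proof (rule subringI)
    fix x y assume xy: "x \<in> {x \<in> carrier L. x [^] (l ^ e) = x}" "y \<in> {x \<in> carrier L. x [^] (l ^ e) = x}"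
    show "x \<otimes> y \<in> {x \<in> carrier L. x [^] (l ^ e) = x}" using xy by (auto simp: nat_pow_distrib)
    show "x \<oplus> y \<in> {x \<in> carrier L. x [^] (l ^ e) = x}" using xy f by (auto simp: frob_hom_def)
    have "(x \<oplus> \<ominus> x) [^] (l ^ e) = x [^] (l ^ e) \<oplus> (\<ominus> x) [^] (l ^ e)" using xy f unfolding frob_hom_def by blast
    hence "x \<oplus> (\<ominus> x) [^] (l ^ e) = \<zero>" using xy zero_pow[OF pos] by (simp add: r_neg)
    hence z: "(\<ominus> x) [^] (l ^ e) \<oplus> x = \<zero>" using xy by (simp add: a_comm)
    have "\<ominus> x = (\<ominus> x) [^] (l ^ e)" by (rule minus_equality[OF z]) (use xy in auto)
    hence "(\<ominus> x) [^] (l ^ e) = \<ominus> x" by (rule HOL.sym)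
    thus "\<ominus> x \<in> {x \<in> carrier L. x [^] (l ^ e) = x}" using xy by auto
  qed auto
next
  fix x assume x: "x \<in> {x \<in> carrier L. x [^] (l ^ e) = x} - {\<zero>}"
  hence u: "x \<in> Units L" by (simp add: field_Units)
  hence i: "inv x \<in> carrier L" by simp
  have "inv x [^] (l ^ e) \<otimes> x [^] (l ^ e) = (inv x \<otimes> x) [^] (l ^ e)" by (rule nat_pow_distrib[symmetric]) (use x i in auto)
  hence "inv x [^] (l ^ e) \<otimes> x = inv x \<otimes> x" using x u by simp
  hence "inv x [^] (l ^ e) = inv x" using m_rcancel[of x "inv x [^] (l ^ e)" "inv x"] x i by simp
  thus "inv x \<in> {x \<in> carrier L. x [^] (l ^ e) = x}" using i by simp
qed

end

section \<open>Certificates for a full set of irreducible representations\<close>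

text \<open>A combination that vanishes for \<open>N\<close> and not for \<open>M\<close> shows that the two are not equivalent. Inequivalence is thus
  certified by finitely many equations and one inequality.\<close>

definition distinguishes :: "('a, 'b) ring_scheme => nat => nat => (nat => nat => nat => 'a) => (nat => nat => nat => 'a) => (nat => 'a) => bool" where
  "distinguishes R n d N M c \<longleftrightarrow>
    (\<forall>a < d. \<forall>b < d. rsum R n (%k. c k \<otimes>\<^bsub>R\<^esub> N k a b) = \<zero>\<^bsub>R\<^esub>) \<and>
    (\<exists>a < d. \<exists>b < d. rsum R n (%k. c k \<otimes>\<^bsub>R\<^esub> M k a b) ~= \<zero>\<^bsub>R\<^esub>)"

text \<open>The last two clauses say that \<open>N\<close> is fixed entrywise by the Frobenius map \<open>x \<mapsto> x\<^bsup>l^e\<^esup>\<close> and that it is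
  not equivalent to its twists by smaller Frobenius maps, so that the fixed field of \<open>x \<mapsto> x\<^bsup>l^e\<^esup>\<close> is the
  minimal field.\<close>

definition irr_cert where
  "irr_cert R l n mt d e N c t \<longleftrightarrow> 0 < d \<and> 0 < e \<and> meq d d (N 0) (uvec R) \<and>
    (\<forall>k < n. \<forall>k' < n. meq d d (N (mt k k')) (mm R d (N k) (N k'))) \<and>
    (\<forall>a < d. \<forall>b < d. \<forall>i < d. \<forall>j < d.
      rsum R n (%k. c a b k \<otimes>\<^bsub>R\<^esub> N k i j) = (if i = a \<and> j = b then \<one>\<^bsub>R\<^esub> else \<zero>\<^bsub>R\<^esub>)) \<and>
    (\<forall>k < n. \<forall>i < d. \<forall>j < d. N k i j [^]\<^bsub>R\<^esub> (l ^ e :: nat) = N k i j) \<and>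
    (\<forall>e' < e. 0 < e' --> distinguishes R n d N (%k. frm R (l ^ e') (N k)) (t e'))"

text \<open>A composition series of the regular module: vectors \<open>U p\<close> that span all functions on the group, each of which
  is combined, modulo its predecessors, from a family \<open>z p\<close> that transforms by the representation with
  number \<open>bi p\<close>. It shows that no irreducible representation is missing.\<close>

definition chain_cert where
  "chain_cert R n mt m s dg N bi bs z C U g D t \<longleftrightarrow>
    (\<forall>p < m. bi p < s \<and> bs p \<le> p \<and>
      (\<forall>k < n. \<forall>a < dg (bi p). \<forall>k' < n. z p a k' =
        rsum R (dg (bi p)) (%b. N (bi p) k b a \<otimes>\<^bsub>R\<^esub> z p b (mt k k')) \<oplus>\<^bsub>R\<^esub>
        rsum R (bs p) (%q. C p k a q \<otimes>\<^bsub>R\<^esub> U q (mt k k'))) \<and>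
      (\<forall>k' < n. U p k' = rsum R (dg (bi p)) (%a. g p a \<otimes>\<^bsub>R\<^esub> z p a k') \<oplus>\<^bsub>R\<^esub>
        rsum R (bs p) (%q. D p q \<otimes>\<^bsub>R\<^esub> U q k'))) \<and>
    (\<forall>k' < n. rsum R m (%p. t p \<otimes>\<^bsub>R\<^esub> U p k') = uvec R 0 k')"

text \<open>A certificate consists of a function \<open>J\<close> for its natural numbers and a function \<open>V\<close> for its
  field elements. The first index tells the components apart.\<close>

definition good :: "('a, 'b) ring_scheme => nat => nat => (nat => nat => nat) => (nat list => nat) => (nat list => 'a) => bool" where
  "good R l n mt J V \<longleftrightarrow>
    (\<forall>i < J [0]. irr_cert R l n mt (J [2, i]) (J [3, i]) (%k a b. V [0, i, k, a, b])
      (%a b k. V [1, i, a, b, k]) (%e' k. V [2, i, e', k]) \<and>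
      (\<forall>i' < J [0]. i ~= i' \<and> J [2, i] = J [2, i'] -->
        distinguishes R n (J [2, i]) (%k a b. V [0, i, k, a, b]) (%k a b. V [0, i', k, a, b]) (%k. V [3, i, i', k]))) \<and>
    chain_cert R n mt (J [1]) (J [0]) (%i. J [2, i]) (%i k a b. V [0, i, k, a, b]) (%p. J [4, p]) (%p. J [5, p])
      (%p a k'. V [4, p, a, k']) (%p k a q. V [5, p, k, a, q]) (%p k'. V [6, p, k'])
      (%p a. V [7, p, a]) (%p q. V [8, p, q]) (%p. V [9, p])"

context rep_setting
begin

lemma eqv_irr:
  assumes N: "rep R n mt d N" "irr R n d N" and M: "!!k. M k \<in> mats R" and E: "eqv R n d N M"
  shows "irr R n d M"
proof (rule irrI)
  show "0 < d" using N(2) by (simp add: irr_def)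
  fix v i t assume v: "v \<in> vecs R" "i < d" "v i ~= \<zero>" and t: "t \<in> vecs R"
  obtain T T' where T: "T \<in> mats R" "T' \<in> mats R" "meq d d (mm R d T T') (uvec R)" "meq d d (mm R d T' T) (uvec R)"
    "!!k. k < n ==> meq d d (mm R d T (N k)) (mm R d (M k) T)"
    using E unfolding eqv_def by blast
  have TT: "mv R d T (mv R d T' w) j = w j" if "w \<in> vecs R" "j < d" for w j
  proof -
    have "veq d (mv R d T (mv R d T' w)) (mv R d (mm R d T T') w)" by (simp add: mv_mm T that)
    also have "veq d \<dots> (mv R d (uvec R) w)" by (rule mv_cong[OF T(3) veq_refl])
    also have "veq d \<dots> w" by (rule mv_unit_mat[OF that(1)])
    finally show ?thesis using that(2) by (simp add: veq_def)
  qed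
  define v' where "v' = mv R d T' v"
  have v': "v' \<in> vecs R" by (simp add: v'_def T v)
  have "\<exists>i' < d. v' i' ~= \<zero>"
  proof (rule ccontr)
    assume "\<not> (\<exists>i' < d. v' i' ~= \<zero>)"
    hence "mv R d T v' i = \<zero>" by (intro mv_zero) (use T in auto)
    thus False using TT[OF v(1,2)] v(3) by (simp add: v'_def)
  qed
  then obtain i' where i': "i' < d" "v' i' ~= \<zero>" by blast
  obtain c where c: "c \<in> vecs R" "!!i. i < d ==> mv R d T' t i = act R n d N c v' i"
    by (rule irrD[OF N(2) v' i', of "mv R d T' t"]) (use T t in auto)
  have "t j = act R n d M c v j" if j: "j < d" for j
  proof -
    have "t j = mv R d T (mv R d T' t) j" using TT[OF t j] by simp
    also have "\<dots> = mv R d T (act R n d N c v') j"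
      using mv_cong[OF meq_refl, of d "mv R d T' t" "act R n d N c v'" d R T] c(2) j by (simp add: veq_def)
    also have "\<dots> = act R n d M c (mv R d T v') j"
      by (rule act_intertwine[OF T(1) repD(1)[OF N(1)] M T(5) v' c(1) j])
    also have "act R n d M c (mv R d T v') = act R n d M c v"
      by (rule act_cong) (simp add: veq_def v'_def TT v(1))
    finally show ?thesis .
  qed
  thus "in_span R d (%k. mv R d (M k) v) n t" unfolding in_span_def act_def using c(1) by blast
qed

lemma eqv_meq: "(!!k. N k \<in> mats R) ==> (!!k. M k \<in> mats R) ==> (!!k. k < n ==> meq d d (N k) (M k)) ==> eqv R n d N M"
  unfolding eqv_def
proof (intro bexI[of _ "uvec R"] conjI allI impI)
  assume N: "!!k. N k \<in> mats R" "!!k. M k \<in> mats R" "!!k. k < n ==> meq d d (N k) (M k)"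
  show "meq d d (mm R d (uvec R) (uvec R)) (uvec R)" "meq d d (mm R d (uvec R) (uvec R)) (uvec R)"
    by (rule mm_unit_left, simp)+
  fix k assume k: "k < n"
  have "meq d d (mm R d (uvec R) (N k)) (N k)" by (rule mm_unit_left[OF N(1)])
  also have "meq d d \<dots> (M k)" by (rule N(3)[OF k])
  also have "meq d d \<dots> (mm R d (M k) (uvec R))" by (rule meq_sym[OF mm_unit_right[OF N(2)]])
  finally show "meq d d (mm R d (uvec R) (N k)) (mm R d (M k) (uvec R))" .
qed auto

lemma act_zero_combs:
  assumes "!!k. N k \<in> mats R" "c \<in> vecs R" "v \<in> vecs R" "!!a b. a < d ==> b < d ==> S n (%k. c k \<otimes> N k a b) = \<zero>" "i < d"
  shows "act R n d N c v i = \<zero>"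
proof -
  have "act R n d N c v i = S d (%j. S n (%k. c k \<otimes> N k i j) \<otimes> v j)"
    unfolding act_def mv_def by (rule S_assoc) (use assms in auto)
  also have "\<dots> = \<zero>" by (rule S_eq_zero) (use assms in auto)
  finally show ?thesis .
qed

lemma distinguishes_not_eqv:
  assumes N: "!!k. N k \<in> mats R" "!!k. M k \<in> mats R" and c: "c \<in> vecs R" "distinguishes R n d N M c"
  shows "\<not> eqv R n d N M"
proof
  assume "eqv R n d N M"
  then obtain T T' where T: "T \<in> mats R" "T' \<in> mats R" "meq d d (mm R d T T') (uvec R)"
    "!!k. k < n ==> meq d d (mm R d T (N k)) (mm R d (M k) T)"
    unfolding eqv_def by blast
  obtain a b where ab: "a < d" "b < d" "S n (%k. c k \<otimes> M k a b) ~= \<zero>"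
    and z: "!!a b. a < d ==> b < d ==> S n (%k. c k \<otimes> N k a b) = \<zero>"
    using c(2) unfolding distinguishes_def by blast
  define v where "v = mv R d T' (uvec R b)"
  have v: "v \<in> vecs R" by (simp add: v_def T uvec_vecs)
  have "veq d (mv R d T v) (mv R d (mm R d T T') (uvec R b))" unfolding v_def by (subst mv_mm) (use T in auto)
  also have "veq d \<dots> (mv R d (uvec R) (uvec R b))" by (rule mv_cong[OF T(3) veq_refl])
  also have "veq d \<dots> (uvec R b)" by (rule mv_unit_mat) simp
  finally have Tv: "veq d (mv R d T v) (uvec R b)" .
  have "\<zero> = mv R d T (act R n d N c v) a"
    by (rule mv_zero[symmetric]) (use T act_zero_combs[OF N(1) c(1) v z] in auto)
  also have "\<dots> = act R n d M c (mv R d T v) a" by (rule act_intertwine[OF T(1) N T(4) v c(1) ab(1)])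
  also have "\<dots> = act R n d M c (uvec R b) a" by (simp add: act_cong[OF Tv])
  also have "\<dots> = S n (%k. c k \<otimes> M k a b)" unfolding act_def using mv_uvec[OF N(2) ab(2)] by simp
  finally show False using ab(3) by simp
qed

text \<open>Otherwise \<open>M\<close> would vanish on the kernel of \<open>N\<close> in the group algebra.\<close>

lemma distinguishes_exists:
  assumes N: "rep R n mt d N" "unit_mat_combs R n d N c" and M: "rep R n mt d M" "irr R n d M"
    and ne: "\<not> eqv R n d N M"
  shows "\<exists>x \<in> vecs R. distinguishes R n d N M x"
proof (rule ccontr)
  assume "\<not> ?thesis"
  hence *: "\<not> distinguishes R n d N M x" if "x \<in> vecs R" for x using that by blast
  have "eqv R n d N M"
  proof (rule kernel_inclusion_eqv[OF N M])
    fix x i j assume x: "x \<in> vecs R" "!!i j. i < d ==> j < d ==> S n (%k. x k \<otimes> N k i j) = \<zero>" and ij: "i < d" "j < d"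
    show "S n (%k. x k \<otimes> M k i j) = \<zero>"
    proof (rule ccontr)
      assume "S n (%k. x k \<otimes> M k i j) ~= \<zero>"
      hence "distinguishes R n d N M x" unfolding distinguishes_def using x(2) ij by blast
      thus False using *[OF x(1)] by simp
    qed
  qed
  thus False using ne by simp
qed

lemma frm_unit:
  assumes "frob_hom R q"
  shows "frm R q (uvec R) = uvec R"
  using assms zero_pow[of q] by (auto simp: frm_def uvec_def frob_hom_def intro!: ext)

lemma rep_frm:
  assumes q: "frob_hom R q" and N: "rep R n mt d N"
  shows "rep R n mt d (%k. frm R q (N k))"
  unfolding rep_def
proof (intro conjI allI impI)
  show "frm R q (N k) \<in> mats R" for k using repD(1)[OF N] by simp
  show "meq d d (frm R q (N 0)) (uvec R)" using meq_frm[OF repD(2)[OF N], of R q] frm_unit[OF q] by simp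
  fix k k' assume k: "k < n" "k' < n"
  have "meq d d (frm R q (N (mt k k'))) (frm R q (mm R d (N k) (N k')))" by (rule meq_frm[OF repD(3)[OF N k]])
  thus "meq d d (frm R q (N (mt k k'))) (mm R d (frm R q (N k)) (frm R q (N k')))"
    using frob_mm[OF q, of "N k" "N k'"] repD(1)[OF N] by simp
qed

lemma unit_mat_combs_frm:
  assumes q: "frob_hom R q" and N: "!!k. N k \<in> mats R" and c: "unit_mat_combs R n d N c"
  shows "unit_mat_combs R n d (%k. frm R q (N k)) (%a b k. c a b k [^] q)"
  unfolding unit_mat_combs_def
proof (intro allI impI conjI)
  fix a b assume ab: "a < d" "b < d"
  have cab: "c a b \<in> vecs R" using c ab unfolding unit_mat_combs_def by simp
  show "(%k. c a b k [^] q) \<in> vecs R" by (rule vecsI) (use cab in simp)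
  fix i j assume ij: "i < d" "j < d"
  have "S n (%k. c a b k [^] q \<otimes> frm R q (N k) i j) = S n (%k. (c a b k \<otimes> N k i j) [^] q)"
    using cab N by (simp add: frm_def nat_pow_distrib)
  also have "\<dots> = S n (%k. c a b k \<otimes> N k i j) [^] q" by (rule frob_S[symmetric, OF q]) (use cab N in simp)
  also have "S n (%k. c a b k \<otimes> N k i j) = (if i = a \<and> j = b then \<one> else \<zero>)" using c ab ij unfolding unit_mat_combs_def by simp
  finally show "S n (%k. c a b k [^] q \<otimes> frm R q (N k) i j) = (if i = a \<and> j = b then \<one> else \<zero>)"
    using zero_pow[of q] q by (simp add: frob_hom_def)
qed

lemma eqv_frm:
  assumes q: "frob_hom R q" and N: "!!k. N k \<in> mats R" "!!k. M k \<in> mats R" and E: "eqv R n d N M"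
  shows "eqv R n d (%k. frm R q (N k)) (%k. frm R q (M k))"
proof -
  obtain T T' where T: "T \<in> mats R" "T' \<in> mats R" "meq d d (mm R d T T') (uvec R)" "meq d d (mm R d T' T) (uvec R)"
    "!!k. k < n ==> meq d d (mm R d T (N k)) (mm R d (M k) T)"
    using E unfolding eqv_def by blast
  show ?thesis unfolding eqv_def
  proof (rule bexI[of _ "frm R q T"], rule bexI[of _ "frm R q T'"], intro conjI allI impI)
    show "meq d d (mm R d (frm R q T) (frm R q T')) (uvec R)"
      using meq_frm[OF T(3), of R q] frm_unit[OF q] frob_mm[OF q T(1,2)] by simp
    show "meq d d (mm R d (frm R q T') (frm R q T)) (uvec R)"
      using meq_frm[OF T(4), of R q] frm_unit[OF q] frob_mm[OF q T(2,1)] by simp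
    fix k assume "k < n"
    thus "meq d d (mm R d (frm R q T) (frm R q (N k))) (mm R d (frm R q (M k)) (frm R q T))"
      using meq_frm[OF T(5), of k R q] frob_mm[OF q T(1) N(1)] frob_mm[OF q N(2) T(1)] by simp
  qed (use T in auto)
qed

lemma irr_frm:
  assumes roots: "has_roots R" and q: "frob_hom R q" and N: "rep R n mt d N" "irr R n d N"
  shows "irr R n d (%k. frm R q (N k))"
proof -
  obtain c where c: "unit_mat_combs R n d N c" by (rule burnside[OF roots N])
  show ?thesis
    by (rule unit_mat_combs_irr[OF _ unit_mat_combs_frm[OF q repD(1)[OF N(1)] c]])
      (use N repD(1)[OF N(1)] in "auto simp: irr_def")
qed

text \<open>A nonzero vector \<open>v\<close> of \<open>M\<close> defines the homomorphism \<open>x \<mapsto> \<Sum>\<^sub>k x k \<cdot> M k v\<close> from the regular module. At the first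
  \<open>U p\<close> that it does not kill, the family \<open>z p\<close> is mapped by a nonzero intertwiner between
  \<open>N (bi p)\<close> and \<open>M\<close>.\<close>

lemma chain_complete:
  assumes cc: "chain_cert R n mt m s dg N bi bs z C U g D t"
    and N: "!!i k. N i k \<in> mats R" "!!i. i < s ==> irr R n (dg i) (N i)"
    and cl: "!!p. z p \<in> mats R" "U \<in> mats R" "!!p k. C p k \<in> mats R" "!!p. g p \<in> vecs R" "!!p. D p \<in> vecs R" "t \<in> vecs R"
    and M: "rep R n mt d M" "irr R n d M"
  shows "\<exists>i < s. dg i = d \<and> eqv R n d (N i) M"
proof -
  have Mm: "M k \<in> mats R" for k by (rule repD(1)[OF M(1)])
  have d: "0 < d" using M(2) by (simp add: irr_def)
  define v where "v = uvec R 0"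
  have v: "v \<in> vecs R" by (simp add: v_def uvec_vecs)
  define w where "w k = mv R d (M k) v" for k
  have w: "w k \<in> vecs R" for k by (simp add: w_def Mm v)
  define \<phi> where "\<phi> x i = S n (%k. x k \<otimes> w k i)" for x i
  have \<phi>V: "\<phi> x \<in> vecs R" if "x \<in> vecs R" for x unfolding \<phi>_def by (rule vecsI) (use that w in auto)
  have \<phi>_cong: "\<phi> x = \<phi> y" if "!!k. k < n ==> x k = y k" for x y
    unfolding \<phi>_def by (rule ext, rule gsum_cong) (simp add: that)
  have \<phi>_comb: "\<phi> (%k. S l (%q. a q \<otimes> y q k)) i = S l (%q. a q \<otimes> \<phi> (y q) i)" if "a \<in> vecs R" "!!q. y q \<in> vecs R" for a y l i
    unfolding \<phi>_def by (rule S_assoc[symmetric]) (use that w in auto)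
  have \<phi>_add: "\<phi> (%k. x k \<oplus> y k) i = \<phi> x i \<oplus> \<phi> y i" if "x \<in> vecs R" "y \<in> vecs R" for x y i
    unfolding \<phi>_def using that w by (subst S_add[symmetric]) (auto simp: l_distr intro!: gsum_cong)
  have \<phi>_shift: "mv R d (M k) (\<phi> (%k'. x (mt k k'))) i = \<phi> x i" if x: "x \<in> vecs R" and k: "k < n" and i: "i < d" for x k i
  proof -
    have xs: "(%k'. x (mt k k')) \<in> vecs R" by (rule vecsI) (use x in auto)
    have "mv R d (M k) (\<phi> (%k'. x (mt k k'))) i = S n (%k'. x (mt k k') \<otimes> mv R d (M k) (w k') i)"
      using fun_cong[OF mv_comb[OF Mm xs w]] unfolding \<phi>_def by simp
    also have "\<dots> = S n (%k'. x (mt k k') \<otimes> w (mt k k') i)"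
      by (rule gsum_cong) (simp add: w_def mv_rep_mt[OF M(1) v k _ i])
    also have "\<dots> = \<phi> x i" unfolding \<phi>_def by (rule S_reindex[OF mt_bij[OF k]]) (use x w in auto)
    finally show ?thesis .
  qed
  have "\<phi> (uvec R 0) 0 = w 0 0"
    unfolding \<phi>_def uvec_def by (rule S_mult_delta(2)) (use w n_pos in auto)
  also have "\<dots> = mv R d (uvec R) v 0"
    unfolding w_def using mv_cong[OF repD(2)[OF M(1)] veq_refl, of R v] d by (simp add: veq_def)
  also have "\<dots> = \<one>" using mv_unit_mat[OF v, of d] d by (simp add: veq_def v_def uvec_def)
  finally have one: "\<phi> (uvec R 0) 0 = \<one>" .
  have ex: "\<exists>p. p < m \<and> (\<exists>i < d. \<phi> (U p) i ~= \<zero>)"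
  proof (rule ccontr)
    assume "\<not> ?thesis"
    hence z0: "\<phi> (U p) 0 = \<zero>" if "p < m" for p using that d by blast
    have "\<phi> (uvec R 0) = \<phi> (%k'. S m (%p. t p \<otimes> U p k'))"
      using cc unfolding chain_cert_def by (intro \<phi>_cong) simp
    hence "\<phi> (uvec R 0) 0 = S m (%p. t p \<otimes> \<phi> (U p) 0)" using \<phi>_comb[of t U m 0] cl by simp
    also have "\<dots> = \<zero>" by (rule S_eq_zero) (use z0 cl in simp)
    finally show False using one by simp
  qed
  define p where "p = (LEAST p. p < m \<and> (\<exists>i < d. \<phi> (U p) i ~= \<zero>))"
  have p: "p < m" "\<exists>i < d. \<phi> (U p) i ~= \<zero>" using LeastI_ex[OF ex] by (auto simp: p_def)
  have below: "\<phi> (U q) i = \<zero>" if "q < p" "i < d" for q i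
    using not_less_Least[of q "%p. p < m \<and> (\<exists>i < d. \<phi> (U p) i ~= \<zero>)"] that p(1) unfolding p_def[symmetric] by (meson less_trans)
  let ?d = "dg (bi p)"
  have bp: "bi p < s" "bs p \<le> p"
    and zp: "!!k a k'. k < n ==> a < ?d ==> k' < n ==> z p a k' = S ?d (%b. N (bi p) k b a \<otimes> z p b (mt k k')) \<oplus> S (bs p) (%q. C p k a q \<otimes> U q (mt k k'))"
    and Up: "!!k'. k' < n ==> U p k' = S ?d (%a. g p a \<otimes> z p a k') \<oplus> S (bs p) (%q. D p q \<otimes> U q k')"
    using cc p(1) unfolding chain_cert_def by auto
  have low: "S (bs p) (%q. f q \<otimes> \<phi> (U q) i) = \<zero>" if "f \<in> vecs R" "i < d" for f i
    by (rule S_eq_zero) (use below that bp in simp)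
  define T where "T i a = \<phi> (z p a) i" for i a
  have T: "T \<in> mats R" unfolding T_def by (rule matsI) (use \<phi>V cl in simp)
  have "\<exists>i a. i < d \<and> a < ?d \<and> T i a ~= \<zero>"
  proof (rule ccontr)
    assume "\<not> ?thesis"
    hence z0: "\<phi> (z p a) i = \<zero>" if "i < d" "a < ?d" for i a using that unfolding T_def by blast
    obtain i where i: "i < d" "\<phi> (U p) i ~= \<zero>" using p(2) by blast
    have v1: "(%k'. S ?d (%a. g p a \<otimes> z p a k')) \<in> vecs R" "(%k'. S (bs p) (%q. D p q \<otimes> U q k')) \<in> vecs R"
      by (rule vecsI, use cl in auto)+
    have "\<phi> (U p) i = \<phi> (%k'. S ?d (%a. g p a \<otimes> z p a k') \<oplus> S (bs p) (%q. D p q \<otimes> U q k')) i"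
      using fun_cong[OF \<phi>_cong[OF Up]] by simp
    also have "\<dots> = S ?d (%a. g p a \<otimes> \<phi> (z p a) i) \<oplus> S (bs p) (%q. D p q \<otimes> \<phi> (U q) i)"
      unfolding \<phi>_add[OF v1] using \<phi>_comb[of "g p" "z p"] \<phi>_comb[of "D p" U] cl by simp
    also have "S ?d (%a. g p a \<otimes> \<phi> (z p a) i) = \<zero>" by (rule S_eq_zero) (use z0 i cl in simp)
    finally show False using low[of "D p" i] i cl by simp
  qed
  then obtain i0 j0 where nz: "i0 < d" "j0 < ?d" "T i0 j0 ~= \<zero>" by blast
  have inter: "meq d ?d (mm R ?d T (N (bi p) k)) (mm R d (M k) T)" if k: "k < n" for k
    unfolding meq_def
  proof (intro allI impI)
    fix i a assume i: "i < d" and a: "a < ?d"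
    have v1: "(%k'. S ?d (%b. N (bi p) k b a \<otimes> z p b k')) \<in> vecs R" "(%k'. S (bs p) (%q. C p k a q \<otimes> U q k')) \<in> vecs R"
      by (rule vecsI, use cl N in auto)+
    let ?x = "%k'. S ?d (%b. N (bi p) k b a \<otimes> z p b k') \<oplus> S (bs p) (%q. C p k a q \<otimes> U q k')"
    have Na: "(%b. N (bi p) k b a) \<in> vecs R" by (rule vecsI) (use N in simp)
    have xv: "?x \<in> vecs R" by (rule vecsI) (use v1 cl N in auto)
    have "mm R d (M k) T i a = mv R d (M k) (\<phi> (z p a)) i" by (simp add: mm_def mv_def T_def)
    also have "\<phi> (z p a) = \<phi> (%k'. ?x (mt k k'))" by (rule \<phi>_cong) (simp add: zp[OF k a])
    also have "mv R d (M k) (\<phi> (%k'. ?x (mt k k'))) i = \<phi> ?x i" by (rule \<phi>_shift[OF xv k i])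
    also have "\<dots> = S ?d (%b. N (bi p) k b a \<otimes> \<phi> (z p b) i) \<oplus> S (bs p) (%q. C p k a q \<otimes> \<phi> (U q) i)"
      unfolding \<phi>_add[OF v1] using \<phi>_comb[OF Na, of "z p"] \<phi>_comb[of "C p k a" U] cl by simp
    also have "\<dots> = S ?d (%b. N (bi p) k b a \<otimes> \<phi> (z p b) i)" using low[of "C p k a" i] i cl N \<phi>V by simp
    also have "\<dots> = mm R ?d T (N (bi p) k) i a"
      unfolding mm_def T_def by (rule gsum_cong) (use N cl \<phi>V in "simp add: m_comm")
    finally show "mm R ?d T (N (bi p) k) i a = mm R d (M k) T i a" by simp
  qed
  have "?d = d \<and> eqv R n ?d (N (bi p)) M"
    by (rule schur_iso[OF N(1) N(2)[OF bp(1)] Mm M(2) T inter nz])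
  thus ?thesis using bp(1) by auto
qed

end

locale prime_rep = prime_closure L K l + rep_setting L n mt
  for L (structure) and K l n mt
begin

text \<open>An irreducible representation over its minimal field, with \<open>l\<^sup>e\<close> the order of that field.\<close>

definition minrep :: "nat => nat => (nat => nat => nat => 'a) => bool" where
  "minrep d e M \<longleftrightarrow> rep L n mt d M \<and> irr L n d M \<and> 0 < e \<and>
    (\<forall>k < n. \<forall>i < d. \<forall>j < d. M k i j [^] (l ^ e) = M k i j) \<and>
    (\<forall>e' < e. 0 < e' --> \<not> eqv L n d M (%k. frm L (l ^ e') (M k)))"

lemma minrepD:
  assumes "minrep d e M"
  shows "rep L n mt d M" "irr L n d M" "0 < e" "k < n ==> i < d ==> j < d ==> M k i j [^] (l ^ e) = M k i j"
    "e' < e ==> 0 < e' ==> \<not> eqv L n d M (%k. frm L (l ^ e') (M k))" "M k \<in> mats L"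
  using assms repD(1) unfolding minrep_def by auto

lemma entries_fixed:
  assumes F: "subfield F L" and N: "!!k i j. k < n ==> i < d ==> j < d ==> N k i j \<in> F"
  obtains s where "0 < s" "!!k. k < n ==> meq d d (frm L (l ^ s) (N k)) (N k)"
    "!!x. x \<in> carrier L ==> x [^] (l ^ s) = x ==> x \<in> F"
proof -
  let ?A = "(%(k, i, j). N k i j) ` ({..<n} \<times> {..<d} \<times> {..<d})"
  have A: "finite ?A" "?A \<subseteq> F" using N by auto
  obtain s where s: "0 < s" "!!y. y \<in> ?A ==> y [^] (l ^ s) = y" "!!x. x \<in> carrier L ==> x [^] (l ^ s) = x ==> x \<in> F"
    by (rule finite_fixed_subfield[OF F A]) blast
  have "meq d d (frm L (l ^ s) (N k)) (N k)" if k: "k < n" for k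
    unfolding meq_def frm_def
  proof (intro allI impI)
    fix i j assume "i < d" "j < d"
    hence "N k i j \<in> ?A" using k by (intro image_eqI[of _ _ "(k, i, j)"]) auto
    thus "N k i j [^] (l ^ s) = N k i j" by (rule s(2))
  qed
  thus ?thesis using that s(1,3) by blast
qed

text \<open>Some power of the Frobenius map fixes all entries. For the smallest exponent whose twist is
  equivalent to \<open>N\<close>, descent makes the entries fixed.\<close>

lemma minrep_exists:
  assumes N: "rep L n mt d N" "irr L n d N"
  shows "\<exists>M. (\<exists>e. minrep d e M) \<and> eqv L n d N M"
proof -
  note Nm = repD(1)[OF N(1)]
  let ?P = "%e. 0 < e \<and> eqv L n d (%k. frm L (l ^ e) (N k)) N"
  obtain s where s: "0 < s" "!!k. k < n ==> meq d d (frm L (l ^ s) (N k)) (N k)"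
    by (rule entries_fixed[OF carrier_subfield, of d N]) (use Nm in auto)
  have "eqv L n d (%k. frm L (l ^ s) (N k)) N" by (rule eqv_meq) (use Nm s in auto)
  hence ex: "?P s" using s by simp
  define e where "e = (LEAST e. ?P e)"
  have e: "0 < e" "eqv L n d (%k. frm L (l ^ e) (N k)) N" using LeastI[of ?P, OF ex] by (auto simp: e_def)
  have least: "\<not> ?P e'" if "e' < e" for e' using not_less_Least[of e' ?P] that by (simp add: e_def)
  obtain M where M: "rep L n mt d M" "eqv L n d N M" "!!k i j. k < n ==> i < d ==> j < d ==> M k i j [^] (l ^ e) = M k i j"
    by (rule frobenius_descent[OF has_roots frob_hom_l[OF e(1)] N e(2)]) blast
  note Mm = repD(1)[OF M(1)]
  have "\<not> eqv L n d M (%k. frm L (l ^ e') (M k))" if e': "e' < e" "0 < e'" for e'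
  proof
    assume a: "eqv L n d M (%k. frm L (l ^ e') (M k))"
    have fM: "frm L (l ^ e') (M k) \<in> mats L" and fN: "frm L (l ^ e') (N k) \<in> mats L" for k using Mm Nm by auto
    have b: "eqv L n d (%k. frm L (l ^ e') (M k)) (%k. frm L (l ^ e') (N k))"
      by (rule eqv_frm[OF frob_hom_l[OF e'(2)] Mm Nm eqv_sym[OF Nm Mm M(2)]])
    have "eqv L n d N (%k. frm L (l ^ e') (M k))" by (rule eqv_trans[OF Nm Mm fM M(2) a])
    hence "eqv L n d N (%k. frm L (l ^ e') (N k))" by (rule eqv_trans[OF Nm fM fN _ b])
    hence "eqv L n d (%k. frm L (l ^ e') (N k)) N" by (rule eqv_sym[OF Nm fN])
    thus False using least[OF e'(1)] e'(2) by simp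
  qed
  hence "minrep d e M" unfolding minrep_def using M(1,3) e(1) eqv_irr[OF N Mm M(2)] by auto
  thus ?thesis using M(2) by blast
qed

text \<open>A choice that depends only on the equivalence class, so that different entries of the list of
  constituents are inequivalent.\<close>

definition canon :: "nat => (nat => nat => nat => 'a) => (nat => nat => nat => 'a)" where
  "canon d N = (SOME M. (\<exists>e. minrep d e M) \<and> eqv L n d N M)"

lemma canon:
  assumes N: "rep L n mt d N" "irr L n d N"
  shows "\<exists>e. minrep d e (canon d N)" "eqv L n d N (canon d N)"
  using someI_ex[OF minrep_exists[OF N], folded canon_def] by simp_all

lemma canon_eqv:
  assumes "rep L n mt d N" "rep L n mt d M" "eqv L n d N M"
  shows "canon d N = canon d M"
proof -
  note Nm = repD(1)[OF assms(1)] and Mm = repD(1)[OF assms(2)]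
  have "((\<exists>e. minrep d e A) \<and> eqv L n d N A) = ((\<exists>e. minrep d e A) \<and> eqv L n d M A)" for A
  proof (rule conj_cong[OF HOL.refl])
    assume "\<exists>e. minrep d e A"
    then obtain e where "minrep d e A" by blast
    hence Am: "!!k. A k \<in> mats L" by (rule minrepD(6))
    show "eqv L n d N A = eqv L n d M A"
    proof
      assume "eqv L n d N A"
      thus "eqv L n d M A" by (rule eqv_trans[OF Mm Nm Am eqv_sym[OF Nm Mm assms(3)]])
    next
      assume "eqv L n d M A"
      thus "eqv L n d N A" by (rule eqv_trans[OF Nm Mm Am assms(3)])
    qed
  qed
  thus ?thesis unfolding canon_def by simp
qed

lemma irr_cert_exists:
  assumes M: "minrep d e M"
  shows "\<exists>c t. (\<forall>a b. c a b \<in> vecs L) \<and> (\<forall>e'. t e' \<in> vecs L) \<and> irr_cert L l n mt d e M c t"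
proof -
  note r = minrepD[OF M]
  obtain c0 where c0: "unit_mat_combs L n d M c0" by (rule burnside[OF has_roots r(1,2)])
  define c where "c a b k = (if a < d \<and> b < d then c0 a b k else \<zero>)" for a b k
  have cv: "c a b \<in> vecs L" for a b
    by (rule vecsI) (use c0 in "auto simp: c_def unit_mat_combs_def")
  define P where "P e' x \<longleftrightarrow> x \<in> vecs L \<and> (e' < e --> 0 < e' --> distinguishes L n d M (%k. frm L (l ^ e') (M k)) x)" for e' x
  have "\<exists>x. P e' x" for e'
  proof (cases "e' < e \<and> 0 < e'")
    case True
    have "\<exists>x \<in> vecs L. distinguishes L n d M (%k. frm L (l ^ e') (M k)) x"
      by (rule distinguishes_exists[OF r(1) c0 rep_frm[OF frob_hom_l r(1)] irr_frm[OF has_roots frob_hom_l r(1,2)] r(5)])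
        (use True in auto)
    thus ?thesis unfolding P_def by blast
  next
    case False
    have "(%_. \<zero>) \<in> vecs L" by (rule vecsI) simp
    thus ?thesis using False unfolding P_def by blast
  qed
  hence t: "P e' (SOME x. P e' x)" for e' by (rule someI_ex)
  define t where "t e' = (SOME x. P e' x)" for e'
  have t': "P e' (t e')" for e' using t by (simp add: t_def)
  have "irr_cert L l n mt d e M c t"
    unfolding irr_cert_def
  proof (intro conjI allI impI)
    show "0 < d" using r(2) by (simp add: irr_def)
    show "0 < e" by (rule r(3))
    show "meq d d (M 0) (uvec L)" by (rule repD(2)[OF r(1)])
    show "meq d d (M (mt k k')) (mm L d (M k) (M k'))" if "k < n" "k' < n" for k k' by (rule repD(3)[OF r(1) that])
    show "S n (%k. c a b k \<otimes> M k i j) = (if i = a \<and> j = b then \<one> else \<zero>)" if "a < d" "b < d" "i < d" "j < d" for a b i j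
      using c0 that by (simp add: c_def unit_mat_combs_def)
    show "M k i j [^] l ^ e = M k i j" if "k < n" "i < d" "j < d" for k i j by (rule r(4)[OF that])
    show "distinguishes L n d M (%k. frm L (l ^ e') (M k)) (t e')" if "e' < e" "0 < e'" for e'
      using t'[of e'] that unfolding P_def by blast
  qed
  moreover have "t e' \<in> vecs L" for e' using t'[of e'] unfolding P_def by blast
  ultimately show ?thesis using cv by blast
qed

text \<open>The regular representation, acting on functions on the group.\<close>

definition Reg :: "nat => nat => nat => 'a" where
  "Reg k i j = (if i = mt k j then \<one> else \<zero>)"

lemma Reg_mats: "Reg k \<in> mats L"
  by (rule matsI) (simp add: Reg_def)

lemma Reg_rep: "rep L n mt n Reg"
  unfolding rep_def meq_def
proof (intro conjI allI impI)
  show "Reg k \<in> mats L" for k by (rule Reg_mats)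
  show "Reg 0 i j = uvec L i j" if "i < n" "j < n" for i j using that mt_unit by (auto simp: Reg_def uvec_def)
  fix k k' i j assume k: "k < n" "k' < n" and ij: "i < n" "j < n"
  have "mm L n (Reg k) (Reg k') i j = S n (%c. Reg k i c \<otimes> (if c = mt k' j then \<one> else \<zero>))"
    unfolding mm_def Reg_def ..
  also have "\<dots> = Reg k i (mt k' j)"
    by (rule S_mult_delta(1)) (use k ij mt_closed Reg_mats in auto)
  finally show "Reg (mt k k') i j = mm L n (Reg k) (Reg k') i j"
    using mt_assoc[OF k ij(2)] by (simp add: Reg_def)
qed

lemma mv_Reg:
  assumes "v \<in> vecs L" "k < n" "k' < n"
  shows "mv L n (Reg k) v (mt k k') = v k'"
proof -
  have "mt k k' = mt k j \<longleftrightarrow> j = k'" if "j < n" for j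
    using li_mt[OF assms(2,3)] li_mt[OF assms(2) that] by metis
  hence "mv L n (Reg k) v (mt k k') = S n (%j. (if j = k' then \<one> else \<zero>) \<otimes> v j)"
    unfolding mv_def Reg_def by (intro gsum_cong) simp
  also have "\<dots> = v k'" by (rule S_mult_delta(2)) (use assms in auto)
  finally show ?thesis .
qed

text \<open>The composition series of the regular module, with its constituents replaced by the canonical
  representatives of their classes.\<close>

lemma chain_cert_exists:
  obtains xs :: "(nat \<times> (nat => nat => nat => 'a)) list" and m bi bs z C U g D t where "distinct xs"
    "!!d N. (d, N) \<in> set xs ==> \<exists>e. minrep d e N" "!!d N. (d, N) \<in> set xs ==> canon d N = N"
    "!!p. z p \<in> mats L" "U \<in> mats L" "!!p k. C p k \<in> mats L" "!!p. g p \<in> vecs L" "!!p. D p \<in> vecs L" "t \<in> vecs L"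
    "chain_cert L n mt m (length xs) (%i. fst (xs ! i)) (%i. snd (xs ! i)) bi bs z C U g D t"
proof -
  define Q where "Q = {(d, N). (\<exists>e. minrep d e N) \<and> canon d N = N}"
  have Qex: "\<exists>N'. (d, N') \<in> Q \<and> (\<forall>k. N' k \<in> mats L) \<and> eqv L n d N' N" if N: "rep L n mt d N" "irr L n d N" for d N
  proof -
    note c = canon[OF N]
    obtain e where e: "minrep d e (canon d N)" using c(1) by blast
    have "canon d N = canon d (canon d N)" by (rule canon_eqv[OF N(1) minrepD(1)[OF e] c(2)])
    hence "(d, canon d N) \<in> Q" using e by (auto simp: Q_def)
    moreover have "eqv L n d (canon d N) N" by (rule eqv_sym[OF repD(1)[OF N(1)] minrepD(6)[OF e] c(2)])
    ultimately show ?thesis using minrepD(6)[OF e] by blast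
  qed
  obtain U m where U: "U \<in> mats L" "comp_chain L n n Reg Q U m" "!!t. t \<in> vecs L ==> in_span L n U m t"
  proof (rule composition_series[OF Reg_rep, of Q])
    fix d N assume "rep L n mt d N" "irr L n d N"
    thus "\<exists>N'. (d, N') \<in> Q \<and> (\<forall>k. N' k \<in> mats L) \<and> eqv L n d N' N" by (rule Qex)
  next
    fix u m assume u: "u \<in> mats L" "comp_chain L n n Reg Q u m" "!!t. t \<in> vecs L ==> in_span L n u m t"
    show ?thesis by (rule that[OF u])
  qed
  have "\<forall>p. \<exists>x. p < m --> x \<in> Q \<and> comp_step L n n Reg U p (fst x) (snd x)"
  proof
    fix p
    show "\<exists>x. p < m --> x \<in> Q \<and> comp_step L n n Reg U p (fst x) (snd x)"
    proof (cases "p < m")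
      case True
      hence "\<exists>x \<in> Q. case x of (d, N) => comp_step L n n Reg U p d N" using U(2) unfolding comp_chain_def by simp
      then obtain x where "x \<in> Q" "case x of (d, N) => comp_step L n n Reg U p d N" by (rule bexE)
      thus ?thesis by (intro exI[of _ x]) (simp add: case_prod_beta)
    qed simp
  qed
  from choice[OF this] obtain f where "\<forall>p. p < m --> f p \<in> Q \<and> comp_step L n n Reg U p (fst (f p)) (snd (f p))" ..
  hence f: "f p \<in> Q \<and> comp_step L n n Reg U p (fst (f p)) (snd (f p))" if "p < m" for p using that by simp
  obtain xs where xs: "set xs = f ` {..<m}" "distinct xs" using finite_distinct_list[of "f ` {..<m}"] by blast
  let ?N = "%i. snd (xs ! i)" and ?d = "%i. fst (xs ! i)"
  define P where "P p = (%(i, s, z, g, C, D). z \<in> mats L \<and> g \<in> vecs L \<and> (\<forall>k. C k \<in> mats L) \<and> D \<in> vecs L \<and>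
    (p < m --> i < length xs \<and> s \<le> p \<and>
      (\<forall>k < n. \<forall>a < ?d i. \<forall>k' < n. z a k' =
        S (?d i) (%b. ?N i k b a \<otimes> z b (mt k k')) \<oplus> S s (%q. C k a q \<otimes> U q (mt k k'))) \<and>
      (\<forall>k' < n. U p k' = S (?d i) (%a. g a \<otimes> z a k') \<oplus> S s (%q. D q \<otimes> U q k'))))" for p
  have move: "x = y \<oplus> w" if "x \<ominus> y = w" "x \<in> carrier L" "y \<in> carrier L" "w \<in> carrier L" for x y w
  proof -
    have "x = y \<oplus> (x \<ominus> y)" using that(2,3) by (simp add: a_minus_def a_lcomm r_neg)
    thus ?thesis using that(1) by simp
  qed
  have "\<exists>x. P p x" for p
  proof (cases "p < m")
    case False
    have "(%_ _. \<zero>) \<in> mats L" "(%_. \<zero>) \<in> vecs L" by (auto intro: matsI vecsI)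
    hence "P p (0, 0, (%_ _. \<zero>), (%_. \<zero>), (%_ _ _. \<zero>), (%_. \<zero>))" using False by (simp add: P_def)
    thus ?thesis ..
  next
    case True
    have "f p \<in> set xs" using xs True by auto
    then obtain i where i: "i < length xs" "xs ! i = f p" by (auto simp: in_set_conv_nth)
    have cs: "comp_step L n n Reg U p (?d i) (?N i)" "f p \<in> Q" using f[OF True] i by auto
    obtain e where "minrep (?d i) e (?N i)" using cs(2) i by (auto simp: Q_def)
    hence Nm: "!!k. ?N i k \<in> mats L" by (rule minrepD(6))
    obtain s z g where s: "s \<le> p" and z: "z \<in> mats L" and g: "g \<in> vecs L"
      and sp: "\<forall>k < n. \<forall>a < ?d i. in_span L n U s (%j. mv L n (Reg k) (z a) j \<ominus> S (?d i) (%b. ?N i k b a \<otimes> z b j))"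
      and su: "in_span L n U s (%j. U p j \<ominus> S (?d i) (%a. g a \<otimes> z a j))"
      using cs(1) unfolding comp_step_def by auto
    obtain D where D: "D \<in> vecs L" "!!j. j < n ==> U p j \<ominus> S (?d i) (%a. g a \<otimes> z a j) = S s (%q. D q \<otimes> U q j)"
      using su unfolding in_span_def by auto
    define R where "R k a c \<longleftrightarrow> c \<in> vecs L \<and> (k < n --> a < ?d i --> (\<forall>j < n. mv L n (Reg k) (z a) j \<ominus> S (?d i) (%b. ?N i k b a \<otimes> z b j)
      = S s (%q. c q \<otimes> U q j)))" for k a c
    have "\<exists>c. R k a c" for k a
    proof (cases "k < n \<and> a < ?d i")
      case True
      thus ?thesis using sp unfolding R_def in_span_def by blast
    next
      case False
      have "(%_. \<zero>) \<in> vecs L" by (auto intro: vecsI)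
      thus ?thesis using False unfolding R_def by blast
    qed
    hence R: "R k a (SOME c. R k a c)" for k a by (rule someI_ex)
    define C where "C k a = (SOME c. R k a c)" for k a
    have C: "R k a (C k a)" for k a using R by (simp add: C_def)
    have Cm: "C k \<in> mats L" for k by (rule matsI, rule vecsD) (use C in "simp add: R_def")
    have "P p (i, s, z, g, C, D)"
      unfolding P_def prod.case
    proof (intro conjI allI impI)
      show "z \<in> mats L" "g \<in> vecs L" "!!k. C k \<in> mats L" "D \<in> vecs L" "i < length xs" "s \<le> p"
        by (fact z g Cm D(1) i(1) s)+
      fix k' assume k': "k' < n"
      show "U p k' = S (?d i) (%a. g a \<otimes> z a k') \<oplus> S s (%q. D q \<otimes> U q k')"
        by (rule move[OF D(2)[OF k']]) (use U(1) g z D(1) in auto)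
      fix k a assume k: "k < n" and a: "a < ?d i"
      have "mv L n (Reg k) (z a) (mt k k') \<ominus> S (?d i) (%b. ?N i k b a \<otimes> z b (mt k k')) = S s (%q. C k a q \<otimes> U q (mt k k'))"
        using C[of k a] k a mt_closed[OF k k'] unfolding R_def by simp
      hence "z a k' \<ominus> S (?d i) (%b. ?N i k b a \<otimes> z b (mt k k')) = S s (%q. C k a q \<otimes> U q (mt k k'))"
        using mv_Reg[of "z a", OF _ k k'] z by simp
      thus "z a k' = S (?d i) (%b. ?N i k b a \<otimes> z b (mt k k')) \<oplus> S s (%q. C k a q \<otimes> U q (mt k k'))"
        by (rule move) (use Nm z Cm U(1) in auto)
    qed
    thus ?thesis ..
  qed
  hence Pf: "P p (SOME x. P p x)" for p by (rule someI_ex)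
  define h where "h p = (SOME x. P p x)" for p
  define bi where "bi p = fst (h p)" for p
  define bs where "bs p = fst (snd (h p))" for p
  define z where "z p = fst (snd (snd (h p)))" for p
  define g where "g p = fst (snd (snd (snd (h p))))" for p
  define C where "C p = fst (snd (snd (snd (snd (h p)))))" for p
  define D where "D p = snd (snd (snd (snd (snd (h p)))))" for p
  have Pp: "P p (bi p, bs p, z p, g p, C p, D p)" for p
    using Pf[of p] by (simp add: bi_def bs_def z_def g_def C_def D_def h_def[symmetric])
  obtain t where t: "t \<in> vecs L" "!!i. i < n ==> uvec L 0 i = S m (%p. t p \<otimes> U p i)"
    using U(3)[OF uvec_vecs[of 0]] unfolding in_span_def by auto
  have m1: "\<exists>e. minrep d e N" "canon d N = N" if "(d, N) \<in> set xs" for d N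
    using that xs(1) f by (force simp: Q_def)+
  have m2: "z p \<in> mats L" and m3: "C p k \<in> mats L" and m4: "g p \<in> vecs L" and m5: "D p \<in> vecs L" for p k
    using Pp[of p] by (simp_all add: P_def)
  have "chain_cert L n mt m (length xs) ?d ?N bi bs z C U g D t"
    unfolding chain_cert_def
  proof (intro conjI allI impI)
    fix p assume p: "p < m"
    note pp = Pp[of p, unfolded P_def prod.case]
    show "bi p < length xs" "bs p \<le> p" using pp p by simp_all
    show "z p a k' = S (?d (bi p)) (%b. ?N (bi p) k b a \<otimes> z p b (mt k k')) \<oplus> S (bs p) (%q. C p k a q \<otimes> U q (mt k k'))"
      if "k < n" "a < ?d (bi p)" "k' < n" for k a k' using pp p that by blast
    show "U p k' = S (?d (bi p)) (%a. g p a \<otimes> z p a k') \<oplus> S (bs p) (%q. D p q \<otimes> U q k')"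
      if "k' < n" for k' using pp p that by blast
  next
    fix k' assume "k' < n"
    thus "S m (%p. t p \<otimes> U p k') = uvec L 0 k'" using t(2) by simp
  qed
  from that[OF xs(2) m1 m2 U(1) m3 m4 m5 t(1) this] show ?thesis .
qed

lemma good_exists: "\<exists>J V. (\<forall>x. V x \<in> carrier L) \<and> good L l n mt J V"
proof -
  obtain xs :: "(nat \<times> (nat => nat => nat => 'a)) list" and m bi bs z C U g D t where xs: "distinct xs"
    "!!d N. (d, N) \<in> set xs ==> \<exists>e. minrep d e N" "!!d N. (d, N) \<in> set xs ==> canon d N = N"
    and cl: "!!p. z p \<in> mats L" "U \<in> mats L" "!!p k. C p k \<in> mats L" "!!p. g p \<in> vecs L" "!!p. D p \<in> vecs L" "t \<in> vecs L"
    and cc: "chain_cert L n mt m (length xs) (%i. fst (xs ! i)) (%i. snd (xs ! i)) bi bs z C U g D t"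
  proof (rule chain_cert_exists)
    fix xs :: "(nat \<times> (nat => nat => nat => 'a)) list" and m bi bs z C U g D t
    assume a: "distinct xs" "!!d N. (d, N) \<in> set xs ==> \<exists>e. minrep d e N" "!!d N. (d, N) \<in> set xs ==> canon d N = N"
      "!!p. z p \<in> mats L" "U \<in> mats L" "!!p k. C p k \<in> mats L" "!!p. g p \<in> vecs L" "!!p. D p \<in> vecs L" "t \<in> vecs L"
      "chain_cert L n mt m (length xs) (%i. fst (xs ! i)) (%i. snd (xs ! i)) bi bs z C U g D t"
    show ?thesis by (rule that[OF a])
  qed
  let ?s = "length xs" and ?d = "%i. fst (xs ! i)" and ?N = "%i. snd (xs ! i)"
  define e where "e i = (SOME e. minrep (?d i) e (?N i))" for i
  have mr: "minrep (?d i) (e i) (?N i)" if "i < ?s" for i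
    unfolding e_def by (rule someI_ex) (use xs(2)[of "?d i" "?N i"] that in simp)
  define P where "P i = (%(c, u). (\<forall>a b. c a b \<in> vecs L) \<and> (\<forall>e'. u e' \<in> vecs L) \<and> (i < ?s --> irr_cert L l n mt (?d i) (e i) (?N i) c u))" for i
  have zv: "(%_. \<zero>) \<in> vecs L" by (auto intro: vecsI)
  have "\<exists>x. P i x" for i
  proof (cases "i < ?s")
    case True
    thus ?thesis using irr_cert_exists[OF mr[OF True]] unfolding P_def by auto
  next
    case False
    have "P i ((%_ _ _. \<zero>), (%_ _. \<zero>))" using False zv by (simp add: P_def)
    thus ?thesis ..
  qed
  hence Pi: "P i (SOME x. P i x)" for i by (rule someI_ex)
  define c where "c i = fst (SOME x. P i x)" for i
  define u where "u i = snd (SOME x. P i x)" for i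
  have Pcu: "P i (c i, u i)" for i using Pi[of i] by (simp add: c_def u_def)
  define Q where "Q i i' y \<longleftrightarrow> y \<in> vecs L \<and> (i < ?s --> i' < ?s --> i ~= i' --> ?d i = ?d i' --> distinguishes L n (?d i) (?N i) (?N i') y)" for i i' y
  have "\<exists>y. Q i i' y" for i i'
  proof (cases "i < ?s \<and> i' < ?s \<and> i ~= i' \<and> ?d i = ?d i'")
    case True
    hence i: "i < ?s" "i' < ?s" "i ~= i'" "?d i' = ?d i" by auto
    note r = minrepD(1,2)[OF mr[OF i(1)]] and r' = minrepD(1,2)[OF mr[OF i(2)], unfolded i(4)]
    obtain b where b: "unit_mat_combs L n (?d i) (?N i) b" by (rule burnside[OF has_roots r])
    have "\<not> eqv L n (?d i) (?N i) (?N i')"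
    proof
      assume "eqv L n (?d i) (?N i) (?N i')"
      have mem: "(?d j, ?N j) \<in> set xs" if "j < ?s" for j using that by simp
      have "canon (?d i) (?N i) = canon (?d i) (?N i')" by (rule canon_eqv[OF r(1) r'(1)]) fact
      moreover have "canon (?d i) (?N i) = ?N i" by (rule xs(3)[OF mem[OF i(1)]])
      moreover have "canon (?d i) (?N i') = ?N i'" using xs(3)[OF mem[OF i(2)]] i(4) by simp
      ultimately have "?N i = ?N i'" by simp
      hence "xs ! i = xs ! i'" using i(4) by (simp add: prod_eq_iff)
      thus False using nth_eq_iff_index_eq[OF xs(1) i(1,2)] i(3) by simp
    qed
    from distinguishes_exists[OF r(1) b r' this] show ?thesis unfolding Q_def by blast
  next
    case False
    thus ?thesis using zv unfolding Q_def by blast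
  qed
  hence Qy: "Q i i' (SOME y. Q i i' y)" for i i' by (rule someI_ex)
  define y where "y i i' = (SOME y. Q i i' y)" for i i'
  have Qy: "Q i i' (y i i')" for i i' using Qy by (simp add: y_def)
  define N where "N i k a b = (if i < ?s then ?N i k a b else \<zero>)" for i k a b
  have Nm: "N i k a b \<in> carrier L" for i k a b using minrepD(6)[OF mr] by (simp add: N_def)
  define J where "J x = (if hd x = 0 then ?s else if hd x = 1 then m else if hd x = 2 then ?d (x ! 1) else if hd x = 3 then e (x ! 1)
    else if hd x = 4 then bi (x ! 1) else bs (x ! 1))" for x :: "nat list"
  have Jeq: "J [0] = ?s" "J [1] = m" "J [2, i] = ?d i" "J [3, i] = e i" "J [4, i] = bi i" "J [5, i] = bs i" for i
    by (simp_all add: J_def)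
  define V where "V x = (if hd x = 0 then N (x ! 1) (x ! 2) (x ! 3) (x ! 4) else if hd x = 1 then c (x ! 1) (x ! 2) (x ! 3) (x ! 4)
    else if hd x = 2 then u (x ! 1) (x ! 2) (x ! 3) else if hd x = 3 then y (x ! 1) (x ! 2) (x ! 3)
    else if hd x = 4 then z (x ! 1) (x ! 2) (x ! 3) else if hd x = 5 then C (x ! 1) (x ! 2) (x ! 3) (x ! 4)
    else if hd x = 6 then U (x ! 1) (x ! 2) else if hd x = 7 then g (x ! 1) (x ! 2) else if hd x = 8 then D (x ! 1) (x ! 2)
    else t (x ! 1))" for x :: "nat list"
  have Veq: "V [0, i, k, a, b] = N i k a b" "V [1, i, a, b, k] = c i a b k" "V [2, i, e', k] = u i e' k" "V [3, i, i', k] = y i i' k"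
    "V [4, p, a, k] = z p a k" "V [5, p, k, a, q] = C p k a q" "V [6, p, k] = U p k" "V [7, p, a] = g p a" "V [8, p, q] = D p q" "V [9, p] = t p"
    for i k a b e' i' p q
    by (simp_all add: V_def)
  have "V x \<in> carrier L" for x
  proof -
    have "c i a b \<in> vecs L" "u i a \<in> vecs L" for i a b using Pcu[of i] unfolding P_def by auto
    moreover have "y i i' \<in> vecs L" for i i' using Qy[of i i'] unfolding Q_def by auto
    ultimately show ?thesis using cl Nm by (simp add: V_def)
  qed
  moreover have "good L l n mt J V"
    unfolding good_def Jeq Veq
  proof (intro conjI allI impI)
    fix i assume i: "i < ?s"
    have Ni: "(%k a b. N i k a b) = ?N i" if "i < ?s" for i using that by (intro ext) (simp add: N_def)
    show "irr_cert L l n mt (?d i) (e i) (%k a b. N i k a b) (%a b k. c i a b k) (%e' k. u i e' k)"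
      using Pcu[of i] i unfolding P_def Ni[OF i] by simp
    fix i' assume i': "i' < ?s" and ne: "i ~= i' \<and> ?d i = ?d i'"
    show "distinguishes L n (?d i) (%k a b. N i k a b) (%k a b. N i' k a b) (%k. y i i' k)"
      using Qy[of i i'] i i' ne unfolding Q_def Ni[OF i] Ni[OF i'] by simp
  next
    note cc' = cc[unfolded chain_cert_def]
    have Neq: "N (bi p) k b a = ?N (bi p) k b a" if "p < m" for p k b a using cc' that by (simp add: N_def)
    show "chain_cert L n mt m ?s (%i. ?d i) (%i k a b. N i k a b) (%p. bi p) (%p. bs p) (%p a k'. z p a k')
      (%p k a q. C p k a q) (%p k'. U p k') (%p a. g p a) (%p q. D p q) (%p. t p)"
      unfolding chain_cert_def
    proof (intro conjI allI impI)
      fix p assume p: "p < m"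
      show "bi p < ?s" "bs p \<le> p" using cc' p by blast+
      show "z p a k' = S (?d (bi p)) (%b. N (bi p) k b a \<otimes> z p b (mt k k')) \<oplus> S (bs p) (%q. C p k a q \<otimes> U q (mt k k'))"
        if "k < n" "a < ?d (bi p)" "k' < n" for k a k' unfolding Neq[OF p] using cc' p that by blast
      show "U p k' = S (?d (bi p)) (%a. g p a \<otimes> z p a k') \<oplus> S (bs p) (%q. D p q \<otimes> U q k')"
        if "k' < n" for k' using cc' p that by blast
    qed (use cc' in blast)
  qed
  ultimately show ?thesis by (intro exI conjI allI)
qed

lemma good_rep:
  assumes V: "!!x. V x \<in> carrier L" and g: "good L l n mt J V" and i: "i < J [0]"
  shows "rep L n mt (J [2, i]) (%k a b. V [0, i, k, a, b])"
    "unit_mat_combs L n (J [2, i]) (%k a b. V [0, i, k, a, b]) (%a b k. V [1, i, a, b, k])"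
    "minrep (J [2, i]) (J [3, i]) (%k a b. V [0, i, k, a, b])"
proof -
  have ic: "irr_cert L l n mt (J [2, i]) (J [3, i]) (%k a b. V [0, i, k, a, b]) (%a b k. V [1, i, a, b, k]) (%e' k. V [2, i, e', k])"
    using g i unfolding good_def by simp
  have Nm: "(%a b. V [0, i, k, a, b]) \<in> mats L" for k by (rule matsI) (rule V)
  show r: "rep L n mt (J [2, i]) (%k a b. V [0, i, k, a, b])" using ic Nm unfolding irr_cert_def rep_def by simp
  show u: "unit_mat_combs L n (J [2, i]) (%k a b. V [0, i, k, a, b]) (%a b k. V [1, i, a, b, k])"
    using ic vecsI[OF V] unfolding irr_cert_def unit_mat_combs_def by simp
  have irr: "irr L n (J [2, i]) (%k a b. V [0, i, k, a, b])"
    by (rule unit_mat_combs_irr[OF Nm u]) (use ic in "simp add: irr_cert_def")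
  show "minrep (J [2, i]) (J [3, i]) (%k a b. V [0, i, k, a, b])"
    unfolding minrep_def
  proof (intro conjI allI impI)
    fix e' assume e': "e' < J [3, i]" "0 < e'"
    have "distinguishes L n (J [2, i]) (%k a b. V [0, i, k, a, b]) (%k. frm L (l ^ e') (%a b. V [0, i, k, a, b])) (%k. V [2, i, e', k])"
      using ic e' unfolding irr_cert_def by simp
    thus "\<not> eqv L n (J [2, i]) (%k a b. V [0, i, k, a, b]) (%k. frm L (l ^ e') (%a b. V [0, i, k, a, b]))"
      by (intro distinguishes_not_eqv[OF Nm _ vecsI]) (use Nm V in auto)
  qed (use ic r irr in "simp_all add: irr_cert_def")
qed

lemma good_distinct:
  assumes V: "!!x. V x \<in> carrier L" and g: "good L l n mt J V" and i: "i < J [0]" "i' < J [0]" "i ~= i'" "J [2, i] = J [2, i']"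
  shows "\<not> eqv L n (J [2, i]) (%k a b. V [0, i, k, a, b]) (%k a b. V [0, i', k, a, b])"
proof (rule distinguishes_not_eqv)
  show "(%k. V [3, i, i', k]) \<in> vecs L" by (rule vecsI) (rule V)
  show "distinguishes L n (J [2, i]) (%k a b. V [0, i, k, a, b]) (%k a b. V [0, i', k, a, b]) (%k. V [3, i, i', k])"
    using g i unfolding good_def by simp
qed (rule matsI, rule V)+

lemma good_complete:
  assumes V: "!!x. V x \<in> carrier L" and g: "good L l n mt J V" and M: "rep L n mt d M" "irr L n d M"
  shows "\<exists>i < J [0]. J [2, i] = d \<and> eqv L n d (%k a b. V [0, i, k, a, b]) M"
proof (rule chain_complete[OF _ _ _ _ _ _ _ _ _ M])
  show "chain_cert L n mt (J [1]) (J [0]) (%i. J [2, i]) (%i k a b. V [0, i, k, a, b]) (%p. J [4, p]) (%p. J [5, p])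
      (%p a k'. V [4, p, a, k']) (%p k a q. V [5, p, k, a, q]) (%p k'. V [6, p, k'])
      (%p a. V [7, p, a]) (%p q. V [8, p, q]) (%p. V [9, p])"
    using g unfolding good_def by simp
  show "irr L n (J [2, i]) (%k a b. V [0, i, k, a, b])" if "i < J [0]" for i
    by (rule minrepD(2)[OF good_rep(3)[OF V g that]])
qed (rule matsI, rule V | rule vecsI, rule V)+

text \<open>If an equivalent representation has entries in \<open>F\<close>, then a power of the Frobenius map that fixes
  them fixes the class of the representation, so its exponent is a multiple of \<open>e\<close>.\<close>

lemma minrep_field:
  assumes N: "minrep d e N" and M: "!!k. M k \<in> mats L" "eqv L n d N M"
    and F: "subfield F L" "!!k i j. k < n ==> i < d ==> j < d ==> M k i j \<in> F"
    and x: "x \<in> carrier L" "x [^] (l ^ e) = x"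
  shows "x \<in> F"
proof -
  note r = minrepD[OF N]
  note Nm = minrepD(6)[OF N]
  obtain s where s: "0 < s" "!!k. k < n ==> meq d d (frm L (l ^ s) (M k)) (M k)"
    "!!x. x \<in> carrier L ==> x [^] (l ^ s) = x ==> x \<in> F"
  proof (rule entries_fixed[OF F(1), of d M])
    show "M k i j \<in> F" if "k < n" "i < d" "j < d" for k i j by (rule F(2)[OF that])
    fix s assume a: "0 < s" "!!k. k < n ==> meq d d (frm L (l ^ s) (M k)) (M k)"
      "!!x. x \<in> carrier L ==> x [^] (l ^ s) = x ==> x \<in> F"
    show ?thesis by (rule that[OF a])
  qed
  have it: "y [^] (l ^ (e * m)) = y" if "y \<in> carrier L" "y [^] (l ^ e) = y" for y and m :: nat
  proof (induction m)
    case (Suc m)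
    have "y [^] (l ^ (e * Suc m)) = (y [^] (l ^ e)) [^] (l ^ (e * m))" using that(1) by (simp add: nat_pow_pow power_add)
    thus ?case using Suc that by simp
  qed (use that in simp)
  define q where "q = s mod e"
  have s_eq: "s = e * (s div e) + q" by (simp add: q_def)
  have split: "y [^] (l ^ s) = y [^] (l ^ q)" if "y \<in> carrier L" "y [^] (l ^ e) = y" for y
  proof -
    have "y [^] (l ^ s) = (y [^] (l ^ (e * (s div e)))) [^] (l ^ q)"
      using that(1) by (subst s_eq) (simp add: nat_pow_pow power_add)
    thus ?thesis using it[OF that] by simp
  qed
  have "q = 0"
  proof (rule ccontr)
    assume "q ~= 0"
    have fM: "frm L (l ^ s) (M k) \<in> mats L" and fN: "frm L (l ^ s) (N k) \<in> mats L" for k using M(1) Nm by auto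
    have a: "eqv L n d (%k. frm L (l ^ s) (N k)) (%k. frm L (l ^ s) (M k))"
      by (rule eqv_frm[OF frob_hom_l[OF s(1)] Nm M])
    have b: "eqv L n d (%k. frm L (l ^ s) (M k)) M" by (rule eqv_meq[OF fM M(1) s(2)])
    have c: "eqv L n d N (%k. frm L (l ^ s) (N k))"
      by (rule eqv_trans[OF Nm fM fN eqv_trans[OF Nm M(1) fM M(2) eqv_sym[OF fM M(1) b]]
        eqv_sym[OF fN fM a]])
    have gm: "frm L (l ^ q) (N k) \<in> mats L" for k using Nm by simp
    have "eqv L n d (%k. frm L (l ^ s) (N k)) (%k. frm L (l ^ q) (N k))"
      by (rule eqv_meq[OF fN gm]) (use split[OF matsD[OF Nm]] r(4) in "simp add: meq_def frm_def")
    hence "eqv L n d N (%k. frm L (l ^ q) (N k))" by (rule eqv_trans[OF Nm fN gm c])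
    thus False using r(3) r(5)[of q] \<open>q ~= 0\<close> by (simp add: q_def)
  qed
  hence "x [^] (l ^ s) = x" using split[OF x] x by simp
  thus ?thesis by (rule s(3)[OF x(1)])
qed

end

section \<open>Transfer of certificates along embeddings\<close>

text \<open>The digit structures below are known to be rings only through their embedding into a field, hence
  only closure and compatibility are assumed of \<open>D\<close>.\<close>

locale ring_embedding =
  fixes D :: "('d, 'm) ring_scheme" and R :: "('a, 'b) ring_scheme" and h :: "'d => 'a"
  assumes D_closed: "\<zero>\<^bsub>D\<^esub> \<in> carrier D" "\<one>\<^bsub>D\<^esub> \<in> carrier D"
      "x \<in> carrier D ==> y \<in> carrier D ==> x \<oplus>\<^bsub>D\<^esub> y \<in> carrier D"
      "x \<in> carrier D ==> y \<in> carrier D ==> x \<otimes>\<^bsub>D\<^esub> y \<in> carrier D"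
    and h_simps: "h \<zero>\<^bsub>D\<^esub> = \<zero>\<^bsub>R\<^esub>" "h \<one>\<^bsub>D\<^esub> = \<one>\<^bsub>R\<^esub>"
      "x \<in> carrier D ==> y \<in> carrier D ==> h (x \<oplus>\<^bsub>D\<^esub> y) = h x \<oplus>\<^bsub>R\<^esub> h y"
      "x \<in> carrier D ==> y \<in> carrier D ==> h (x \<otimes>\<^bsub>D\<^esub> y) = h x \<otimes>\<^bsub>R\<^esub> h y"
    and h_inj: "inj_on h (carrier D)"
begin

definition rel :: "'a => 'd => bool" where
  "rel y x \<longleftrightarrow> x \<in> carrier D \<and> y = h x"

lemma rel_zero: "rel \<zero>\<^bsub>R\<^esub> \<zero>\<^bsub>D\<^esub>" and rel_one: "rel \<one>\<^bsub>R\<^esub> \<one>\<^bsub>D\<^esub>"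
  by (simp_all add: rel_def D_closed h_simps)

lemma rel_add: "rel y x ==> rel y' x' ==> rel (y \<oplus>\<^bsub>R\<^esub> y') (x \<oplus>\<^bsub>D\<^esub> x')"
  and rel_mult: "rel y x ==> rel y' x' ==> rel (y \<otimes>\<^bsub>R\<^esub> y') (x \<otimes>\<^bsub>D\<^esub> x')"
  by (simp_all add: rel_def D_closed h_simps)

lemma rel_sum: "(!!i. i < m ==> rel (f i) (g i)) ==> rel (rsum R m f) (rsum D m g)"
  by (induction m) (simp_all add: rel_zero rel_add)

lemma rel_pow: "rel y x ==> rel (y [^]\<^bsub>R\<^esub> (m :: nat)) (x [^]\<^bsub>D\<^esub> m)"
  by (induction m) (simp_all add: nat_pow_def rel_one rel_mult)

lemma rel_uvec: "rel (uvec R i j) (uvec D i j)" and rel_if: "rel (if P then \<one>\<^bsub>R\<^esub> else \<zero>\<^bsub>R\<^esub>) (if P then \<one>\<^bsub>D\<^esub> else \<zero>\<^bsub>D\<^esub>)"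
  by (simp_all add: uvec_def rel_zero rel_one)

lemma rel_eq: "rel y x ==> rel y' x' ==> (y = y') = (x = x')"
  using h_inj by (auto simp: rel_def inj_on_def)

lemma all_less_cong: "(!!i. i < (m :: nat) ==> P i = Q i) ==> (\<forall>i < m. P i) = (\<forall>i < m. Q i)"
  and ex_less_cong: "(!!i. i < (m :: nat) ==> P i = Q i) ==> (\<exists>i < m. P i) = (\<exists>i < m. Q i)"
  by auto

lemma distinguishes_transfer:
  assumes "!!k a b. k < n ==> a < d ==> b < d ==> rel (N' k a b) (N k a b)"
    "!!k a b. k < n ==> a < d ==> b < d ==> rel (M' k a b) (M k a b)" "!!k. k < n ==> rel (c' k) (c k)"
  shows "distinguishes R n d N' M' c' = distinguishes D n d N M c"
  unfolding distinguishes_def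
  by (intro conj_cong all_less_cong ex_less_cong arg_cong[where f = Not] rel_eq rel_sum rel_mult rel_zero assms)

lemma irr_cert_transfer:
  assumes mt: "!!k k'. k < n ==> k' < n ==> mt k k' < n" and n: "0 < n"
    and N: "!!k a b. k < n ==> a < d ==> b < d ==> rel (N' k a b) (N k a b)"
    and c: "!!a b k. a < d ==> b < d ==> k < n ==> rel (c' a b k) (c a b k)"
    and t: "!!f k. f < e ==> k < n ==> rel (t' f k) (t f k)"
  shows "irr_cert R l n mt d e N' c' t' = irr_cert D l n mt d e N c t"
  unfolding irr_cert_def meq_def mm_def
  by (intro conj_cong HOL.refl all_less_cong imp_cong distinguishes_transfer rel_eq rel_sum rel_mult rel_uvec rel_if rel_pow
      N c t mt n | simp only: frm_def)+

lemma chain_cert_transfer: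
  assumes mt: "!!k k'. k < n ==> k' < n ==> mt k k' < n"
    and N: "!!i k a b. i < s ==> k < n ==> a < dg i ==> b < dg i ==> rel (N' i k a b) (N i k a b)"
    and z: "!!p a k. p < m ==> bi p < s ==> a < dg (bi p) ==> k < n ==> rel (z' p a k) (z p a k)"
    and C: "!!p k a q. p < m ==> bi p < s ==> bs p \<le> p ==> k < n ==> a < dg (bi p) ==> q < bs p ==> rel (C' p k a q) (C p k a q)"
    and U: "!!p k. p < m ==> k < n ==> rel (U' p k) (U p k)"
    and g: "!!p a. p < m ==> bi p < s ==> a < dg (bi p) ==> rel (g' p a) (g p a)"
    and E: "!!p q. p < m ==> bs p \<le> p ==> q < bs p ==> rel (E' p q) (E p q)"
    and t: "!!p. p < m ==> rel (t' p) (t p)"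
  shows "chain_cert R n mt m s dg N' bi bs z' C' U' g' E' t' = chain_cert D n mt m s dg N bi bs z C U g E t"
  unfolding chain_cert_def
proof (intro conj_cong all_less_cong HOL.refl)
  fix p k a k' assume p: "p < m" "bi p < s" "bs p \<le> p" and k: "k < n" "a < dg (bi p)" "k' < n"
  have q: "q < m" if "q < bs p" for q using that p by simp
  show "(z' p a k' = rsum R (dg (bi p)) (%b. N' (bi p) k b a \<otimes>\<^bsub>R\<^esub> z' p b (mt k k')) \<oplus>\<^bsub>R\<^esub> rsum R (bs p) (%q. C' p k a q \<otimes>\<^bsub>R\<^esub> U' q (mt k k'))) =
    (z p a k' = rsum D (dg (bi p)) (%b. N (bi p) k b a \<otimes>\<^bsub>D\<^esub> z p b (mt k k')) \<oplus>\<^bsub>D\<^esub> rsum D (bs p) (%q. C p k a q \<otimes>\<^bsub>D\<^esub> U q (mt k k')))"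
    by (intro rel_eq rel_add rel_sum rel_mult z N C U mt p k q)
next
  fix p k' assume p: "p < m" "bi p < s" "bs p \<le> p" and k: "k' < n"
  have q: "q < m" if "q < bs p" for q using that p by simp
  show "(U' p k' = rsum R (dg (bi p)) (%a. g' p a \<otimes>\<^bsub>R\<^esub> z' p a k') \<oplus>\<^bsub>R\<^esub> rsum R (bs p) (%q. E' p q \<otimes>\<^bsub>R\<^esub> U' q k')) =
    (U p k' = rsum D (dg (bi p)) (%a. g p a \<otimes>\<^bsub>D\<^esub> z p a k') \<oplus>\<^bsub>D\<^esub> rsum D (bs p) (%q. E p q \<otimes>\<^bsub>D\<^esub> U q k'))"
    by (intro rel_eq rel_add rel_sum rel_mult z g E U p k q)
next
  fix k' assume "k' < n"
  thus "(rsum R m (%p. t' p \<otimes>\<^bsub>R\<^esub> U' p k') = uvec R 0 k') = (rsum D m (%p. t p \<otimes>\<^bsub>D\<^esub> U p k') = uvec D 0 k')"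
    by (intro rel_eq rel_sum rel_mult rel_uvec t U)
qed

text \<open>All conditions are equations and inequalities between polynomial expressions in finitely many values
  of \<open>V\<close>; the bound \<open>B\<close> covers the indices at which \<open>V\<close> is evaluated.\<close>

lemma good_transfer:
  assumes mt: "!!k k'. k < n ==> k' < n ==> mt k k' < n" and n: "0 < n"
    and B: "n \<le> B" "J [0] \<le> B" "J [1] \<le> B" "9 \<le> B" "!!i. i < J [0] ==> J [2, i] \<le> B \<and> J [3, i] \<le> B"
    and V: "!!x. set x \<subseteq> {..B} ==> length x \<le> 5 ==> rel (V' x) (V x)"
  shows "good R l n mt J V' = good D l n mt J V"
proof -
  have d: "a \<le> B" if "a < J [2, i]" "i < J [0]" for a i using B(5)[OF that(2)] that(1) by simp
  have e: "a \<le> B" if "a < J [3, i]" "i < J [0]" for a i using B(5)[OF that(2)] that(1) by simp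
  show ?thesis
    unfolding good_def
  proof (intro conj_cong all_less_cong imp_cong HOL.refl irr_cert_transfer chain_cert_transfer distinguishes_transfer mt n V)
  qed (insert B(1-4) d e, fastforce+)
qed

end

lemma good_J_cong:
  assumes J: "J' [0] = J [0]" "J' [1] = J [1]" "!!i. i < J [0] ==> J' [2, i] = J [2, i] \<and> J' [3, i] = J [3, i]"
    "!!p. p < J [1] ==> J' [4, p] = J [4, p] \<and> J' [5, p] = J [5, p]" and g: "good R l n mt J V"
  shows "good R l n mt J' V"
  unfolding good_def J(1,2)
proof (intro conjI allI impI)
  note g' = g[unfolded good_def]
  fix i assume i: "i < J [0]"
  show "irr_cert R l n mt (J' [2, i]) (J' [3, i]) (%k a b. V [0, i, k, a, b]) (%a b k. V [1, i, a, b, k]) (%e' k. V [2, i, e', k])"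
    using g' i J(3)[OF i] by simp
  fix i' assume "i' < J [0]" "i ~= i' \<and> J' [2, i] = J' [2, i']"
  thus "distinguishes R n (J' [2, i]) (%k a b. V [0, i, k, a, b]) (%k a b. V [0, i', k, a, b]) (%k. V [3, i, i', k])"
    using g' i J(3) by simp
next
  have c: "chain_cert R n mt (J [1]) (J [0]) (%i. J [2, i]) (%i k a b. V [0, i, k, a, b]) (%p. J [4, p]) (%p. J [5, p])
      (%p a k'. V [4, p, a, k']) (%p k a q. V [5, p, k, a, q]) (%p k'. V [6, p, k'])
      (%p a. V [7, p, a]) (%p q. V [8, p, q]) (%p. V [9, p])" using g unfolding good_def by simp
  have eq: "J' [4, p] = J [4, p]" "J' [5, p] = J [5, p]" "J' [2, J [4, p]] = J [2, J [4, p]]" if "p < J [1]" for p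
    using J(3,4) c that unfolding chain_cert_def by auto
  show "chain_cert R n mt (J [1]) (J [0]) (%i. J' [2, i]) (%i k a b. V [0, i, k, a, b]) (%p. J' [4, p]) (%p. J' [5, p])
      (%p a k'. V [4, p, a, k']) (%p k a q. V [5, p, k, a, q]) (%p k'. V [6, p, k'])
      (%p a. V [7, p, a]) (%p q. V [8, p, q]) (%p. V [9, p])"
    unfolding chain_cert_def
  proof (rule conjI, intro allI impI)
    fix p assume p: "p < J [1]"
    show "J' [4, p] < J [0] \<and> J' [5, p] \<le> p \<and> (\<forall>k < n. \<forall>a < J' [2, J' [4, p]]. \<forall>k' < n. V [4, p, a, k'] =
        rsum R (J' [2, J' [4, p]]) (%b. V [0, J' [4, p], k, b, a] \<otimes>\<^bsub>R\<^esub> V [4, p, b, mt k k']) \<oplus>\<^bsub>R\<^esub>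
        rsum R (J' [5, p]) (%q. V [5, p, k, a, q] \<otimes>\<^bsub>R\<^esub> V [6, q, mt k k'])) \<and>
      (\<forall>k' < n. V [6, p, k'] = rsum R (J' [2, J' [4, p]]) (%a. V [7, p, a] \<otimes>\<^bsub>R\<^esub> V [4, p, a, k']) \<oplus>\<^bsub>R\<^esub>
        rsum R (J' [5, p]) (%q. V [8, p, q] \<otimes>\<^bsub>R\<^esub> V [6, q, k']))"
      unfolding eq[OF p] using c p unfolding chain_cert_def by blast
  qed (use c in "simp add: chain_cert_def")
qed

section \<open>Finite fields as vectors of digits\<close>

text \<open>The entry of a list, in a form that is computable also beyond the end of the list.\<close>

definition dig :: "nat list => nat => nat" where
  "dig v i = hd (drop i v)"

lemma dig_nth [simp]: "i < length v ==> dig v i = v ! i"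
  by (simp add: dig_def hd_drop_conv_nth)

definition dadd :: "nat => nat list => nat list => nat list" where
  "dadd l v w = map (%i. (dig v i + dig w i) mod l) [0..<length v]"

definition dscale :: "nat => nat => nat list => nat list" where
  "dscale l c v = map (%a. c * a mod l) v"

text \<open>Multiplication by the root of the monic polynomial \<open>1 # cs\<close>: its leading power is replaced by
  the negative of \<open>cs\<close>.\<close>

definition dstep :: "nat => nat list => nat list => nat list" where
  "dstep l cs v = dadd l (tl v @ [0]) (dscale l ((l - 1) * dig v 0) cs)"

definition dmult :: "nat => nat list => nat list => nat list => nat list" where
  "dmult l cs v w = foldl (%acc a. dadd l (dstep l cs acc) (dscale l a w)) (replicate (length cs) 0) v"

definition dvecs :: "nat => nat => nat list list" where
  "dvecs l m = rec_nat [[]] (%_ vs. concat (map (%v. map (%a. a # v) [0..<l]) vs)) m"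

lemma set_dvecs: "set (dvecs l m) = {v. length v = m \<and> set v \<subseteq> {..<l}}"
proof (induction m)
  case (Suc m)
  have "set (dvecs l (Suc m)) = (\<Union>v \<in> set (dvecs l m). (%a. a # v) ` {..<l})" by (auto simp: dvecs_def)
  also have "\<dots> = {v. length v = Suc m \<and> set v \<subseteq> {..<l}}"
    unfolding Suc
  proof (intro equalityI subsetI)
    fix v assume "v \<in> {v. length v = Suc m \<and> set v \<subseteq> {..<l}}"
    thus "v \<in> (\<Union>v \<in> {v. length v = m \<and> set v \<subseteq> {..<l}}. (%a. a # v) ` {..<l})" by (cases v) auto
  qed auto
  finally show ?case .
qed (auto simp: dvecs_def)

definition dring :: "nat => nat list => nat list ring" where
  "dring l cs = \<lparr>carrier = set (dvecs l (length cs)), monoid.mult = dmult l cs,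
    one = replicate (length cs - 1) 0 @ [1], ring.zero = replicate (length cs) 0, ring.add = dadd l\<rparr>"

text \<open>Invertibility of the nonzero digit vectors is a finite test for the irreducibility of \<open>1 # cs\<close>.\<close>

definition dfield :: "nat => nat list => bool" where
  "dfield l cs \<longleftrightarrow> 0 < length cs \<and> set cs \<subseteq> {..<l} \<and>
    (\<forall>v \<in> set (dvecs l (length cs)). v = \<zero>\<^bsub>dring l cs\<^esub> \<or> (\<exists>w \<in> set (dvecs l (length cs)). v \<otimes>\<^bsub>dring l cs\<^esub> w = \<one>\<^bsub>dring l cs\<^esub>))"

lemma carrier_dring: "carrier (dring l cs) = {v. length v = length cs \<and> set v \<subseteq> {..<l}}"
  by (simp add: dring_def set_dvecs)

context prime_closure
begin

text \<open>The value at \<open>\<alpha>\<close> of the polynomial with the given digits, leading digit first.\<close>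

definition el :: "'a => nat list => 'a" where
  "el \<alpha> v = eval (map nt v) \<alpha>"

lemma elem_at_el: "elem_at L = el"
  by (intro ext) (simp add: elem_at_def el_def poly_over_def nt_def[abs_def])

lemma el_Nil: "el \<alpha> [] = \<zero>" and el_Cons: "el \<alpha> (a # v) = nt a \<otimes> \<alpha> [^] length v \<oplus> el \<alpha> v"
  by (simp_all add: el_def)

lemma el_closed [simp]: "\<alpha> \<in> carrier L ==> el \<alpha> v \<in> carrier L"
  by (induction v) (simp_all add: el_Nil el_Cons)

lemma el_append_single: "\<alpha> \<in> carrier L ==> el \<alpha> (v @ [a]) = el \<alpha> v \<otimes> \<alpha> \<oplus> nt a"
  by (induction v) (simp_all add: el_Nil el_Cons l_distr m_assoc a_assoc)

lemma el_replicate: "\<alpha> \<in> carrier L ==> el \<alpha> (replicate m 0 @ v) = el \<alpha> v"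
  by (induction m) (simp_all add: el_Cons nt_simps)

lemma el_scale: "\<alpha> \<in> carrier L ==> el \<alpha> (dscale l c v) = nt c \<otimes> el \<alpha> v"
  unfolding dscale_def by (induction v) (simp_all add: el_Nil el_Cons nt_mod nt_mult r_distr m_assoc)

lemma dadd_Cons: "dadd l (a # v) (b # w) = (a + b) mod l # dadd l v w"
proof -
  have "[0..<length (a # v)] = 0 # map Suc [0..<length v]" by (simp add: upt_conv_Cons map_Suc_upt del: upt_Suc)
  thus ?thesis by (simp add: dadd_def dig_def comp_def del: upt_Suc)
qed

lemma el_add: "\<alpha> \<in> carrier L ==> length v = length w ==> el \<alpha> (dadd l v w) = el \<alpha> v \<oplus> el \<alpha> w"
proof (induction v w rule: list_induct2')
  case (4 a v b w)
  have "length (dadd l v w) = length v" by (simp add: dadd_def)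
  thus ?case using 4 by (simp add: dadd_Cons el_Cons nt_mod nt_simps l_distr a_ac)
qed (simp_all add: dadd_def el_Nil)

lemma length_d [simp]: "length (dadd l v w) = length v" "length (dscale l c v) = length v"
  by (simp_all add: dadd_def dscale_def)

lemma set_dadd: "set (dadd l v w) \<subseteq> {..<l}"
  using prime_gt_0_nat[OF prime_l] by (auto simp: dadd_def)

context
  fixes cs \<alpha>
  assumes \<alpha>: "\<alpha> \<in> carrier L" "el \<alpha> (1 # cs) = \<zero>" and cs: "0 < length cs" "set cs \<subseteq> {..<l}"
begin

lemma el_top: "\<alpha> [^] length cs = nt (l - 1) \<otimes> el \<alpha> cs"
proof -
  have "nt (l - 1) \<oplus> \<one> = \<zero>" using nt_simps(2)[of "l - 1"] nt_l prime_gt_0_nat[OF prime_l] by simp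
  hence "(nt (l - 1) \<oplus> \<one>) \<otimes> el \<alpha> cs = \<zero>" using \<alpha> by simp
  hence a: "nt (l - 1) \<otimes> el \<alpha> cs \<oplus> el \<alpha> cs = \<zero>" using \<alpha> by (simp add: l_distr)
  have "\<alpha> [^] length cs \<oplus> el \<alpha> cs = \<zero>" using \<alpha> by (simp add: el_Cons nt_simps(3)[simplified])
  hence "\<alpha> [^] length cs \<oplus> el \<alpha> cs = nt (l - 1) \<otimes> el \<alpha> cs \<oplus> el \<alpha> cs" using a by simp
  thus ?thesis by (rule add.right_cancel[THEN iffD1, rotated 3]) (use \<alpha>(1) in simp_all)
qed

lemma length_dstep: "length v = length cs ==> length (dstep l cs v) = length cs"
  using cs by (simp add: dstep_def)

lemma el_step:
  assumes v: "length v = length cs"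
  shows "el \<alpha> (dstep l cs v) = el \<alpha> v \<otimes> \<alpha>"
proof -
  obtain a u where au: "v = a # u" using v cs by (cases v) auto
  have len: "length (u @ [0]) = length (dscale l ((l - 1) * a) cs)" using v au by simp
  have "dstep l cs v = dadd l (u @ [0]) (dscale l ((l - 1) * a) cs)" by (simp add: dstep_def au)
  hence "el \<alpha> (dstep l cs v) = el \<alpha> (u @ [0]) \<oplus> el \<alpha> (dscale l ((l - 1) * a) cs)" using el_add[OF \<alpha>(1) len] by simp
  also have "el \<alpha> (u @ [0]) = el \<alpha> u \<otimes> \<alpha>" using \<alpha>(1) by (simp add: el_append_single nt_simps(1))
  also have "el \<alpha> (dscale l ((l - 1) * a) cs) = nt (l - 1) \<otimes> nt a \<otimes> el \<alpha> cs" unfolding el_scale[OF \<alpha>(1)] nt_mult ..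
  also have "\<dots> = nt a \<otimes> \<alpha> [^] length cs" unfolding el_top using \<alpha>(1) by (simp add: m_ac)
  also have "\<alpha> [^] length cs = \<alpha> [^] length u \<otimes> \<alpha>" unfolding v[symmetric] au by simp
  also have "el \<alpha> u \<otimes> \<alpha> \<oplus> nt a \<otimes> (\<alpha> [^] length u \<otimes> \<alpha>) = el \<alpha> v \<otimes> \<alpha>"
    using \<alpha>(1) by (simp add: au el_Cons l_distr m_assoc a_comm)
  finally show ?thesis .
qed

lemma dmult:
  assumes w: "length w = length cs"
  shows "length (dmult l cs v w) = length cs" "el \<alpha> (dmult l cs v w) = el \<alpha> v \<otimes> el \<alpha> w"
    "v ~= [] ==> set (dmult l cs v w) \<subseteq> {..<l}"
proof -
  let ?f = "%acc a. dadd l (dstep l cs acc) (dscale l a w)"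
  have len: "length (foldl ?f u v) = length cs" if "length u = length cs" for u
    using that by (induction v arbitrary: u) (simp_all add: length_dstep)
  have el: "el \<alpha> (foldl ?f u v) = el \<alpha> u \<otimes> \<alpha> [^] length v \<oplus> el \<alpha> v \<otimes> el \<alpha> w" if "length u = length cs" for u
    using that
  proof (induction v arbitrary: u)
    case (Cons a v)
    have "el \<alpha> (?f u a) = el \<alpha> u \<otimes> \<alpha> \<oplus> nt a \<otimes> el \<alpha> w"
      using el_add[OF \<alpha>(1), of "dstep l cs u" "dscale l a w"] w Cons.prems
      by (simp add: length_dstep el_step[OF Cons.prems] el_scale[OF \<alpha>(1)])
    moreover have "length (?f u a) = length cs" using Cons.prems by (simp add: length_dstep)
    ultimately show ?case using Cons.IH[of "?f u a"] \<alpha>(1)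
      by (simp add: el_Cons l_distr r_distr m_ac a_ac)
  qed (use \<alpha> in "simp add: el_Nil")
  show "length (dmult l cs v w) = length cs" unfolding dmult_def by (rule len) simp
  show "el \<alpha> (dmult l cs v w) = el \<alpha> v \<otimes> el \<alpha> w"
    unfolding dmult_def using el[of "replicate (length cs) 0"] \<alpha>(1) el_replicate[OF \<alpha>(1), of "length cs" "[]"] by (simp add: el_Nil)
  show "set (dmult l cs v w) \<subseteq> {..<l}" if "v ~= []"
    unfolding dmult_def using that by (cases v rule: rev_cases) (auto simp: set_dadd intro: subsetD[OF set_dadd])
qed

lemma el_zero: "el \<alpha> \<zero>\<^bsub>dring l cs\<^esub> = \<zero>"
  using el_replicate[OF \<alpha>(1), of "length cs" "[]"] by (simp add: dring_def el_Nil)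

lemma el_one: "el \<alpha> \<one>\<^bsub>dring l cs\<^esub> = \<one>"
  using el_replicate[OF \<alpha>(1), of "length cs - 1" "[1]"] by (simp add: dring_def el_Nil el_Cons nt_simps(3)[simplified])

lemma dring_embedding:
  assumes inj: "inj_on (el \<alpha>) (carrier (dring l cs))"
  shows "ring_embedding (dring l cs) L (el \<alpha>)"
proof
  have l: "1 < l" using prime_gt_1_nat[OF prime_l] .
  show "\<zero>\<^bsub>dring l cs\<^esub> \<in> carrier (dring l cs)" "\<one>\<^bsub>dring l cs\<^esub> \<in> carrier (dring l cs)"
    unfolding carrier_dring using l cs by (auto simp: dring_def)
  fix v w assume "v \<in> carrier (dring l cs)" "w \<in> carrier (dring l cs)"
  hence vw: "length v = length cs" "length w = length cs" by (auto simp: carrier_dring)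
  hence ne: "v ~= []" using cs by auto
  show "v \<oplus>\<^bsub>dring l cs\<^esub> w \<in> carrier (dring l cs)"
    unfolding carrier_dring using vw set_dadd by (simp add: dring_def)
  show "v \<otimes>\<^bsub>dring l cs\<^esub> w \<in> carrier (dring l cs)"
    unfolding carrier_dring using dmult(1,3)[OF vw(2), of v] ne vw by (simp add: dring_def)
  show "el \<alpha> (v \<oplus>\<^bsub>dring l cs\<^esub> w) = el \<alpha> v \<oplus> el \<alpha> w" using vw \<alpha> by (simp add: dring_def el_add)
  show "el \<alpha> (v \<otimes>\<^bsub>dring l cs\<^esub> w) = el \<alpha> v \<otimes> el \<alpha> w" using dmult(2)[OF vw(2)] by (simp add: dring_def)
qed (fact el_zero el_one inj)+

text \<open>Two digit vectors with the same value differ by a vector of value zero, which has no inverse.\<close>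

lemma dfield_inj:
  assumes f: "dfield l cs"
  shows "inj_on (el \<alpha>) (carrier (dring l cs))"
proof (rule inj_onI)
  fix v w assume v: "v \<in> carrier (dring l cs)" and w: "w \<in> carrier (dring l cs)" and eq: "el \<alpha> v = el \<alpha> w"
  have len: "length v = length cs" "length w = length cs" using v w by (auto simp: carrier_dring)
  define u where "u = dadd l v (dscale l (l - 1) w)"
  have u: "u \<in> set (dvecs l (length cs))" using len set_dadd by (simp add: u_def set_dvecs)
  have nt1: "nt (l - 1) \<oplus> \<one> = \<zero>" using nt_simps(2)[of "l - 1"] nt_l prime_gt_0_nat[OF prime_l] by simp
  have "el \<alpha> u = \<one> \<otimes> el \<alpha> w \<oplus> nt (l - 1) \<otimes> el \<alpha> w" using len \<alpha>(1) eq by (simp add: u_def el_add el_scale)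
  also have "\<dots> = (nt (l - 1) \<oplus> \<one>) \<otimes> el \<alpha> w" using \<alpha>(1) by (simp add: l_distr a_comm)
  finally have u0: "el \<alpha> u = \<zero>" using nt1 \<alpha>(1) by simp
  have "u = \<zero>\<^bsub>dring l cs\<^esub>"
  proof (rule ccontr)
    assume "u ~= \<zero>\<^bsub>dring l cs\<^esub>"
    then obtain x where x: "x \<in> set (dvecs l (length cs))" "u \<otimes>\<^bsub>dring l cs\<^esub> x = \<one>\<^bsub>dring l cs\<^esub>"
      using f u unfolding dfield_def by blast
    have "\<one> = el \<alpha> (dmult l cs u x)" using el_one x(2) by (simp add: dring_def)
    also have "\<dots> = el \<alpha> u \<otimes> el \<alpha> x" by (rule dmult(2)) (use x in "simp add: set_dvecs")
    finally show False unfolding u0 using \<alpha>(1) by simp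
  qed
  hence z: "u ! i = 0" if "i < length cs" for i using that by (simp add: dring_def)
  show "v = w"
  proof (rule nth_equalityI)
    fix i assume "i < length v"
    hence i: "i < length cs" using len by simp
    have b: "v ! i < l" "w ! i < l" using v w i unfolding carrier_dring by (auto simp: subset_iff)
    have "(v ! i + (l - 1) * (w ! i) mod l) mod l = 0" using z[OF i] i len by (simp add: u_def dadd_def dscale_def)
    hence "(v ! i + (l - 1) * (w ! i)) mod l = 0" by (simp add: mod_add_right_eq)
    hence "nt (v ! i) \<oplus> nt (l - 1) \<otimes> nt (w ! i) = \<zero>" using nt_mod[of "v ! i + (l - 1) * (w ! i)"] by (simp add: nt_simps nt_mult)
    moreover have "nt (w ! i) \<oplus> nt (l - 1) \<otimes> nt (w ! i) = (nt (l - 1) \<oplus> \<one>) \<otimes> nt (w ! i)" by (simp add: l_distr a_comm)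
    ultimately have "nt (v ! i) \<oplus> nt (l - 1) \<otimes> nt (w ! i) = nt (w ! i) \<oplus> nt (l - 1) \<otimes> nt (w ! i)" using nt1 by simp
    hence "nt (v ! i) = nt (w ! i)" by (rule add.right_cancel[THEN iffD1, rotated 3]) simp_all
    thus "v ! i = w ! i" by (rule nt_inj[OF b])
  qed (use len in simp)
qed

end

end

context prime_closure
begin

lemma map_nt_poly: "map nt (1 # cs) \<in> carrier (K[X])"
  unfolding univ_poly_carrier[symmetric] polynomial_def using nt_K nt_simps(3) by auto

lemma poly_coeffs: "p \<in> carrier (K[X]) ==> set p \<subseteq> K"
  unfolding univ_poly_carrier[symmetric] polynomial_def by auto

lemma K_list:
  assumes "set xs \<subseteq> K"
  obtains cs where "xs = map nt cs" "set cs \<subseteq> {..<l}"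
proof -
  have "\<exists>cs. xs = map nt cs \<and> set cs \<subseteq> {..<l}"
    using assms
  proof (induction xs)
    case (Cons x xs)
    then obtain cs where "xs = map nt cs" "set cs \<subseteq> {..<l}" by auto
    moreover obtain c where "x = nt c" "c < l" using Cons.prems K_eq by auto
    ultimately show ?case by (intro exI[of _ "c # cs"]) auto
  qed simp
  thus ?thesis using that by blast
qed

lemma root_exists:
  assumes "0 < length cs"
  obtains \<alpha> where "\<alpha> \<in> carrier L" "el \<alpha> (1 # cs) = \<zero>"
proof -
  have K: "subring K L" by (rule subfieldE(1)[OF subfield_K])
  have "map nt (1 # cs) \<in> carrier (poly_ring L)"
    using map_nt_poly carrier_polynomial_shell[OF K] by blast
  hence p: "map nt (1 # cs) \<in> carrier (poly_ring L)" .
  have "splitted (map nt (1 # cs))" by (rule roots_over_carrier[OF p])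
  hence "size (roots (map nt (1 # cs))) = length cs" by (simp add: splitted_def)
  hence "roots (map nt (1 # cs)) ~= {#}" using assms by auto
  then obtain a where "a \<in># roots (map nt (1 # cs))" by blast
  hence "is_root (map nt (1 # cs)) a" using roots_mem_iff_is_root[OF p] by simp
  hence "a \<in> carrier L" "el a (1 # cs) = \<zero>" unfolding is_root_def el_def by blast+
  thus ?thesis by (rule that)
qed

text \<open>A digit field embeds, so no polynomial of smaller degree vanishes at the root.\<close>

lemma dfield_irreducible:
  assumes f: "dfield l cs"
  shows "pirreducible K (map nt (1 # cs))"
proof -
  have cs: "0 < length cs" "set cs \<subseteq> {..<l}" using f by (auto simp: dfield_def)
  obtain \<alpha> where \<alpha>: "\<alpha> \<in> carrier L" "el \<alpha> (1 # cs) = \<zero>" by (rule root_exists[OF cs(1)])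
  note inj = dfield_inj[OF \<alpha> cs f]
  have alg: "(algebraic over K) \<alpha>" by (rule algebraic_extension[OF \<alpha>(1)])
  note I = IrrE[OF subfield_K \<alpha>(1) alg]
  have deg: "1 \<le> degree (Irr K \<alpha>)" by (rule pirreducible_degree[OF subfield_K I(1,2)])
  hence "\<exists>x xs. Irr K \<alpha> = x # xs" by (cases "Irr K \<alpha>") auto
  then obtain x xs where Ix: "Irr K \<alpha> = x # xs" by (elim exE)
  have xs: "set xs \<subseteq> K" using poly_coeffs[OF I(1)] Ix by simp
  obtain ds where ds: "xs = map nt ds" "set ds \<subseteq> {..<l}" by (rule K_list[OF xs])
  have x: "x = \<one>" using I(3) Ix by simp
  have Ieq: "Irr K \<alpha> = map nt (1 # ds)" using Ix x ds by (simp add: nt_simps(3)[simplified])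
  have "Irr K \<alpha> pdivides map nt (1 # cs)"
    by (rule Irr_minimal[OF subfield_K \<alpha>(1) alg map_nt_poly]) (use \<alpha> in "simp add: el_def")
  hence le: "length ds \<le> length cs"
    using pdivides_imp_degree_le[OF subfieldE(1)[OF subfield_K] I(1) map_nt_poly] Ieq by simp
  have zero: "el \<alpha> (1 # ds) = \<zero>" using I(4) Ieq by (simp add: el_def)
  have l: "1 < l" by (rule prime_gt_1_nat[OF prime_l])
  have "length ds = length cs"
  proof (rule ccontr)
    assume "length ds ~= length cs"
    hence lt: "length ds < length cs" using le by simp
    let ?v = "replicate (length cs - Suc (length ds)) 0 @ (1 # ds)"
    have "?v \<in> carrier (dring l cs)" using lt l ds by (auto simp: carrier_dring)
    moreover have "replicate (length cs) 0 \<in> carrier (dring l cs)" using l by (auto simp: carrier_dring)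
    moreover have "el \<alpha> ?v = el \<alpha> (replicate (length cs) 0)"
      using zero el_replicate[OF \<alpha>(1)] el_replicate[OF \<alpha>(1), of "length cs" "[]"] by (simp add: el_Nil)
    ultimately have "?v = replicate (length cs) 0" using inj by (simp add: inj_on_def)
    hence "set ?v = {0}" using cs by simp
    thus False by auto
  qed
  moreover have "el \<alpha> ds = el \<alpha> cs"
  proof -
    have "\<alpha> [^] length cs \<oplus> el \<alpha> ds = \<alpha> [^] length cs \<oplus> el \<alpha> cs"
      using zero \<alpha> calculation by (simp add: el_Cons nt_simps(3)[simplified])
    thus ?thesis by (rule add.l_cancel) (use \<alpha>(1) in simp_all)
  qed
  ultimately have "ds = cs" using inj ds cs by (auto simp: inj_on_def carrier_dring)
  thus ?thesis using I(2) Ieq by simp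
qed

text \<open>The finite subfield generated by \<open>Y\<close> has a cyclic multiplicative group. Its generator is a root of an
  irreducible polynomial over the prime field, and the digit vectors are in bijection with the subfield by
  counting.\<close>

lemma dfield_exists:
  assumes Y: "finite Y" "Y \<subseteq> carrier L"
  obtains cs \<alpha> where "\<alpha> \<in> carrier L" "el \<alpha> (1 # cs) = \<zero>" "dfield l cs" "Y \<subseteq> el \<alpha> ` carrier (dring l cs)"
proof -
  obtain E s where E: "subfield E L" "finite E" "Y \<subseteq> E" by (rule finite_subfield[OF carrier_subfield Y])
  interpret E: field "L\<lparr>carrier := E\<rparr>" by (rule subfield_iff(2)[OF E(1)])
  have EL: "E \<subseteq> carrier L" by (rule subfieldE(3)[OF E(1)])
  have "finite (carrier (L\<lparr>carrier := E\<rparr>))" using E(2) by simp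
  from E.finite_field_mult_group_has_gen[OF this] obtain a where a1: "a \<in> carrier (Multiplicative_Group.mult_of (L\<lparr>carrier := E\<rparr>))" and
    a2: "carrier (Multiplicative_Group.mult_of (L\<lparr>carrier := E\<rparr>)) = {a [^]\<^bsub>L\<lparr>carrier := E\<rparr>\<^esub> i | i :: nat. i \<in> UNIV}" ..
  have c: "carrier (Multiplicative_Group.mult_of (L\<lparr>carrier := E\<rparr>)) = E - {\<zero>}" by simp
  note a = a1[unfolded c] a2[unfolded c nat_pow_consistent[symmetric]]
  have aL: "a \<in> carrier L" using a EL by blast
  have alg: "(algebraic over K) a" by (rule algebraic_extension[OF aL])
  let ?A = "simple_extension K a"
  have A: "subfield ?A L" using simple_extension_is_subfield[OF subfield_K aL] alg by simp
  have "?A \<subseteq> E" by (rule simple_extension_subring_incl[OF subfieldE(1)[OF E(1)] K_sub[OF E(1)]]) (use a(1) in simp)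
  have aA: "a \<in> ?A" by (rule simple_extension_mem[OF subfieldE(1)[OF subfield_K] aL])
  have "a [^] i \<in> ?A" for i :: nat
  proof (induction i)
    case 0
    show ?case using subringE(3)[OF subfieldE(1)[OF A]] by simp
  next
    case (Suc i)
    thus ?case using subringE(6)[OF subfieldE(1)[OF A] _ aA] by simp
  qed
  hence "E - {\<zero>} \<subseteq> ?A" unfolding a(2) by blast
  hence EA: "E \<subseteq> ?A" using subringE(2)[OF subfieldE(1)[OF A]] by blast
  note I = IrrE[OF subfield_K aL alg]
  have deg: "1 \<le> degree (Irr K a)" by (rule pirreducible_degree[OF subfield_K I(1,2)])
  hence "\<exists>x xs. Irr K a = x # xs" by (cases "Irr K a") auto
  then obtain x xs where Ix: "Irr K a = x # xs" by (elim exE)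
  have xs: "set xs \<subseteq> K" using poly_coeffs[OF I(1)] Ix by simp
  obtain cs where cs: "xs = map nt cs" "set cs \<subseteq> {..<l}" by (rule K_list[OF xs])
  have x: "x = \<one>" using I(3) Ix by simp
  have Ieq: "Irr K a = map nt (1 # cs)" using Ix x cs by (simp add: nt_simps(3)[simplified])
  have zero: "el a (1 # cs) = \<zero>" using I(4) Ieq by (simp add: el_def)
  have pos: "0 < length cs" using deg Ieq by (cases cs) auto
  have l: "1 < l" by (rule prime_gt_1_nat[OF prime_l])
  let ?D = "carrier (dring l cs)"
  have DA: "?A \<subseteq> el a ` ?D"
  proof
    fix y assume "y \<in> ?A"
    hence "y \<in> (%p. eval p a) ` {p \<in> carrier (K[X]). length p \<le> length cs}"
      using Span_exp_base[OF subfield_K aL alg] Span_eq_eval_img[OF subfield_K aL, of "length cs"] Ieq by simp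
    then obtain p where p: "y = eval p a" "p \<in> carrier (K[X])" "length p \<le> length cs" by blast
    obtain ds where ds: "p = map nt ds" "set ds \<subseteq> {..<l}" by (rule K_list[OF poly_coeffs[OF p(2)]])
    let ?v = "replicate (length cs - length ds) 0 @ ds"
    have "?v \<in> ?D" using p(3) ds l by (auto simp: carrier_dring)
    moreover have "el a ?v = y" using el_replicate[OF aL] p(1) ds(1) by (simp add: el_def)
    ultimately show "y \<in> el a ` ?D" by blast
  qed
  have cD: "card ?D = l ^ length cs" "finite ?D"
  proof -
    have eq: "?D = {v. set v \<subseteq> {..<l} \<and> length v = length cs}" by (auto simp: carrier_dring)
    show "card ?D = l ^ length cs" "finite ?D"
      unfolding eq using card_lists_length_eq[of "{..<l}" "length cs"] finite_lists_length_eq[of "{..<l}" "length cs"] by simp_all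
  qed
  have "dimension (length cs) K ?A" using dimension_simple_extension[OF subfield_K aL alg] Ieq by simp
  hence cA: "card ?A = l ^ length cs" using finite_subfield_card[OF subfield_K finite_K] card_K by simp
  have "card (el a ` ?D) \<ge> card ?A" by (rule card_mono[OF finite_imageI[OF cD(2)] DA])
  hence inj: "inj_on (el a) ?D"
    using card_image_le[OF cD(2), of "el a"] cA cD(1) by (intro eq_card_imp_inj_on[OF cD(2)]) simp
  have img: "el a ` ?D = ?A"
    by (rule card_seteq[symmetric, OF finite_imageI[OF cD(2)] DA]) (simp add: card_image[OF inj] cA cD(1))
  interpret h: ring_embedding "dring l cs" L "el a" by (rule dring_embedding[OF aL zero pos cs(2) inj])
  have "dfield l cs"
    unfolding dfield_def
  proof (intro conjI ballI)
    fix v assume "v \<in> set (dvecs l (length cs))"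
    hence v: "v \<in> ?D" by (simp add: carrier_dring set_dvecs)
    show "v = \<zero>\<^bsub>dring l cs\<^esub> \<or> (\<exists>w \<in> set (dvecs l (length cs)). v \<otimes>\<^bsub>dring l cs\<^esub> w = \<one>\<^bsub>dring l cs\<^esub>)"
    proof (cases "v = \<zero>\<^bsub>dring l cs\<^esub>")
      case False
      have nz: "el a v ~= \<zero>"
      proof
        assume "el a v = \<zero>"
        hence "el a v = el a \<zero>\<^bsub>dring l cs\<^esub>" using h.h_simps(1) by simp
        from inj_onD[OF inj this v h.D_closed(1)] False show False by simp
      qed
      have vA: "el a v \<in> ?A" using img v by blast
      have u: "el a v \<in> Units L" using nz aL by (simp add: field_Units)
      have "el a v \<in> ?A - {\<zero>}" using vA nz by simp
      hence "inv (el a v) \<in> el a ` ?D" using subfield_m_inv(1)[OF A] unfolding img by blast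
      then obtain w where w0: "inv (el a v) = el a w" "w \<in> ?D" by (rule imageE)
      note w = w0(2) w0(1)[symmetric]
      have "el a (v \<otimes>\<^bsub>dring l cs\<^esub> w) = el a \<one>\<^bsub>dring l cs\<^esub>"
        using h.h_simps(4)[OF v w(1)] h.h_simps(2) w(2) u by simp
      hence "v \<otimes>\<^bsub>dring l cs\<^esub> w = \<one>\<^bsub>dring l cs\<^esub>"
        by (rule inj_onD[OF inj]) (use h.D_closed v w in auto)
      thus ?thesis using w(1) by (auto simp: carrier_dring set_dvecs)
    qed simp
  qed (use pos cs in auto)
  moreover have "Y \<subseteq> el a ` ?D" using E(3) EA img by blast
  ultimately show ?thesis using that aL zero by blast
qed

end

section \<open>Presented groups\<close>

lemma word_eq_gwords: "word_eq n R u v ==> u \<in> gwords n \<and> v \<in> gwords n"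
  by (induction rule: word_eq.induct) (auto simp: gwords_def)

lemma word_eq_append:
  assumes "word_eq n R u v" "x \<in> gwords n" "y \<in> gwords n"
  shows "word_eq n R (x @ u @ y) (x @ v @ y)"
  using assms(1)
proof (induction rule: word_eq.induct)
  case (refl w)
  thus ?case using assms(2,3) by (intro word_eq.refl) (auto simp: gwords_def)
next
  case (trans u v w)
  show ?case by (rule word_eq.trans[OF trans.IH])
next
  case (cancel u v i b)
  have "word_eq n R ((x @ u) @ [(i, b), (i, \<not> b)] @ (v @ y)) ((x @ u) @ v @ y)"
    by (rule word_eq.cancel) (use cancel assms(2,3) in "auto simp: gwords_def")
  thus ?case by simp
next
  case (rel r s u v)
  have "word_eq n R ((x @ u) @ r @ (v @ y)) ((x @ u) @ s @ (v @ y))"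
    by (rule word_eq.rel) (use rel assms(2,3) in "auto simp: gwords_def")
  thus ?case by simp
qed (auto intro: word_eq.sym)

lemma word_eq_mult:
  assumes "word_eq n R u u'" "word_eq n R v v'"
  shows "word_eq n R (u @ v) (u' @ v')"
proof -
  note g = word_eq_gwords[OF assms(1)] word_eq_gwords[OF assms(2)]
  have e: "[] \<in> gwords n" by (simp add: gwords_def)
  have "word_eq n R ([] @ u @ v) ([] @ u' @ v)" by (rule word_eq_append[OF assms(1)]) (use g e in auto)
  moreover have "word_eq n R (u' @ v @ []) (u' @ v' @ [])" by (rule word_eq_append[OF assms(2)]) (use g e in auto)
  ultimately show ?thesis unfolding append_Nil append_Nil2 by (rule word_eq.trans)
qed

lemma word_class_eq:
  assumes "u \<in> gwords n"
  shows "word_class n R u = word_class n R v \<longleftrightarrow> word_eq n R u v"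
proof
  assume "word_class n R u = word_class n R v"
  moreover have "u \<in> word_class n R u" using assms by (simp add: word_class_def word_eq.refl)
  ultimately show "word_eq n R u v" by (auto simp: word_class_def intro: word_eq.sym)
next
  assume "word_eq n R u v"
  thus "word_class n R u = word_class n R v" unfolding word_class_def
    using word_eq.trans word_eq.sym by blast
qed

lemma presented_mult:
  assumes "u \<in> gwords n" "v \<in> gwords n"
  shows "word_class n R u \<otimes>\<^bsub>presented_group n R\<^esub> word_class n R v = word_class n R (u @ v)"
proof -
  have "(\<Union>x \<in> word_class n R u. \<Union>y \<in> word_class n R v. word_class n R (x @ y)) = word_class n R (u @ v)"
  proof (intro equalityI subsetI)
    fix z assume "z \<in> (\<Union>x \<in> word_class n R u. \<Union>y \<in> word_class n R v. word_class n R (x @ y))"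
    then obtain x y where "word_eq n R u x" "word_eq n R v y" "word_eq n R (x @ y) z" by (auto simp: word_class_def)
    thus "z \<in> word_class n R (u @ v)" using word_eq_mult word_eq.trans unfolding word_class_def by blast
  next
    fix z assume "z \<in> word_class n R (u @ v)"
    moreover have "u \<in> word_class n R u" "v \<in> word_class n R v" using assms by (simp_all add: word_class_def word_eq.refl)
    ultimately show "z \<in> (\<Union>x \<in> word_class n R u. \<Union>y \<in> word_class n R v. word_class n R (x @ y))" by blast
  qed
  thus ?thesis by (simp add: presented_group_def)
qed

lemma presented_carrier: "carrier (presented_group n R) = word_class n R ` gwords n"
  and presented_one: "\<one>\<^bsub>presented_group n R\<^esub> = word_class n R []"
  by (simp_all add: presented_group_def)

definition inv_word :: "gword => gword" where
  "inv_word w = rev (map (%(i, b). (i, \<not> b)) w)"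

lemma inv_word_gwords: "w \<in> gwords n ==> inv_word w \<in> gwords n"
  by (force simp: gwords_def inv_word_def)

lemma inv_word: "w \<in> gwords n ==> word_eq n R (inv_word w @ w) []"
proof (induction w)
  case Nil
  show ?case by (simp add: inv_word_def word_eq.refl gwords_def)
next
  case (Cons x w)
  obtain i b where x: "x = (i, b)" by (cases x)
  have w: "w \<in> gwords n" "i < n" using Cons.prems x by (auto simp: gwords_def)
  have "word_eq n R (inv_word w @ [(i, \<not> b), (i, \<not> \<not> b)] @ w) (inv_word w @ w)"
    by (rule word_eq.cancel) (use w inv_word_gwords[OF w(1)] in "auto simp: gwords_def")
  thus ?case using Cons.IH[OF w(1)] x word_eq.trans by (simp add: inv_word_def)
qed

lemma presented_group_group: "group (presented_group n R)"
proof (rule groupI)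
  have e: "[] \<in> gwords n" by (simp add: gwords_def)
  show "\<one>\<^bsub>presented_group n R\<^esub> \<in> carrier (presented_group n R)" using e by (simp add: presented_carrier presented_one)
  fix x assume "x \<in> carrier (presented_group n R)"
  then obtain u where u: "u \<in> gwords n" "x = word_class n R u" by (auto simp: presented_carrier)
  show "\<one>\<^bsub>presented_group n R\<^esub> \<otimes>\<^bsub>presented_group n R\<^esub> x = x" using u e by (simp add: presented_one presented_mult)
  have "word_class n R (inv_word u) \<otimes>\<^bsub>presented_group n R\<^esub> x = \<one>\<^bsub>presented_group n R\<^esub>"
  proof -
    have g: "inv_word u @ u \<in> gwords n" using inv_word_gwords[OF u(1)] u(1) by (auto simp: gwords_def)
    have "word_class n R (inv_word u @ u) = word_class n R []" by (rule word_class_eq[OF g, THEN iffD2, OF inv_word[OF u(1)]])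
    thus ?thesis unfolding u(2) presented_mult[OF inv_word_gwords[OF u(1)] u(1)] presented_one .
  qed
  thus "\<exists>y \<in> carrier (presented_group n R). y \<otimes>\<^bsub>presented_group n R\<^esub> x = \<one>\<^bsub>presented_group n R\<^esub>"
    using inv_word_gwords[OF u(1)] by (auto simp: presented_carrier)
  fix y assume "y \<in> carrier (presented_group n R)"
  then obtain v where v: "v \<in> gwords n" "y = word_class n R v" by (auto simp: presented_carrier)
  have uv: "u @ v \<in> gwords n" using u v by (auto simp: gwords_def)
  show "x \<otimes>\<^bsub>presented_group n R\<^esub> y \<in> carrier (presented_group n R)"
    using u v uv by (simp add: presented_mult) (simp add: presented_carrier)
  fix z assume "z \<in> carrier (presented_group n R)"
  then obtain w where w: "w \<in> gwords n" "z = word_class n R w" by (auto simp: presented_carrier)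
  have vw: "v @ w \<in> gwords n" using w v by (auto simp: gwords_def)
  show "x \<otimes>\<^bsub>presented_group n R\<^esub> y \<otimes>\<^bsub>presented_group n R\<^esub> z = x \<otimes>\<^bsub>presented_group n R\<^esub> (y \<otimes>\<^bsub>presented_group n R\<^esub> z)"
    using u v w uv vw by (simp add: presented_mult)
qed

section \<open>Certificates for a presentation of a finite group\<close>

type_synonym nword = "(nat \<times> nat) list"

definition enc_letter :: "nat \<times> bool => nat \<times> nat" where
  "enc_letter x = (fst x, if snd x then 1 else 0)"

definition dec_letter :: "nat \<times> nat => nat \<times> bool" where
  "dec_letter x = (fst x, snd x ~= 0)"

abbreviation "enc_word \<equiv> map enc_letter"
abbreviation "dec_word \<equiv> map dec_letter"

lemma dec_enc [simp]: "dec_letter (enc_letter x) = x"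
  by (cases x) (simp add: enc_letter_def dec_letter_def)

lemma dec_enc_comp [simp]: "dec_letter \<circ> enc_letter = (%x. x)"
  by (simp add: comp_def)

definition valid_word :: "nat => nword => bool" where
  "valid_word n w \<longleftrightarrow> (\<forall>x \<in> set w. fst x < n \<and> snd x < 2)"

lemma dec_gwords: "valid_word n w ==> dec_word w \<in> gwords n"
  by (auto simp: valid_word_def gwords_def dec_letter_def)

lemma enc_valid: "w \<in> gwords n ==> valid_word n (enc_word w)"
  by (auto simp: valid_word_def gwords_def enc_letter_def)

lemma enc_dec: "valid_word n w ==> enc_word (dec_word w) = w"
  by (rule map_idI[of w "enc_letter \<circ> dec_letter", unfolded map_map[symmetric]])
    (auto simp: valid_word_def enc_letter_def dec_letter_def less_2_cases_iff)

text \<open>Since the converses are included, derivations can be followed in one direction only.\<close>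

definition rewrite_rules :: "nat => (nword \<times> nword) list => (nword \<times> nword) list" where
  "rewrite_rules n rs = rs @ map (%p. (snd p, fst p)) rs @ concat (map (%i.
    [([(i, 0), (i, 1)], []), ([], [(i, 0), (i, 1)]), ([(i, 1), (i, 0)], []), ([], [(i, 1), (i, 0)])]) [0..<n])"

text \<open>A rewriting step \<open>((u, v), (r, s))\<close> replaces \<open>u r v\<close> by \<open>u s v\<close>. A step that does not apply
  changes nothing, so that every list of steps is a derivation.\<close>

type_synonym rewrite_step = "(nword \<times> nword) \<times> (nword \<times> nword)"

definition rewrite :: "nat => (nword \<times> nword) list => nword => rewrite_step => nword" where
  "rewrite n rs w x = (if w = fst (fst x) @ fst (snd x) @ snd (fst x) \<and> snd x \<in> set (rewrite_rules n rs) \<and>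
      valid_word n (fst (fst x) @ snd (snd x) @ snd (fst x))
    then fst (fst x) @ snd (snd x) @ snd (fst x) else w)"

definition derive_word :: "nat => (nword \<times> nword) list => nword => rewrite_step list => nword" where
  "derive_word n rs w xs = foldl (%w x. rewrite n rs w x) w xs"

abbreviation dec_rels :: "(nword \<times> nword) list => (gword \<times> gword) set" where
  "dec_rels rs \<equiv> (%p. (dec_word (fst p), dec_word (snd p))) ` set rs"

lemma rewrite_sound:
  assumes "valid_word n w"
  shows "valid_word n (rewrite n rs w x) \<and> word_eq n (dec_rels rs) (dec_word w) (dec_word (rewrite n rs w x))"
proof -
  obtain u v r s where x: "x = ((u, v), (r, s))" by (metis prod.collapse)
  show ?thesis
  proof (cases "w = u @ r @ v \<and> (r, s) \<in> set (rewrite_rules n rs) \<and> valid_word n (u @ s @ v)")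
    case False
    hence "rewrite n rs w x = w" unfolding rewrite_def x fst_conv snd_conv by (rule if_not_P)
    thus ?thesis using assms word_eq.refl[OF dec_gwords[OF assms]] by simp
  next
    case True
    hence eq: "rewrite n rs w x = u @ s @ v" unfolding rewrite_def x fst_conv snd_conv by (rule if_P)
    have g: "dec_word u @ dec_word r @ dec_word v \<in> gwords n" "dec_word u @ dec_word s @ dec_word v \<in> gwords n"
      using dec_gwords[OF assms] dec_gwords[of n "u @ s @ v"] True by auto
    have c: "word_eq n (dec_rels rs) (dec_word u @ [(i, b), (i, \<not> b)] @ dec_word v) (dec_word u @ dec_word v)" if "i < n" for i b
      by (rule word_eq.cancel) (use that g in "simp_all add: gwords_def image_Un")
    have "word_eq n (dec_rels rs) (dec_word u @ dec_word r @ dec_word v) (dec_word u @ dec_word s @ dec_word v)"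
    proof -
      have "(r, s) \<in> set rs \<or> (s, r) \<in> set rs \<or>
        (\<exists>i < n. (r, s) \<in> {([(i, 0), (i, 1)], []), ([], [(i, 0), (i, 1)]), ([(i, 1), (i, 0)], []), ([], [(i, 1), (i, 0)])})"
        using True by (auto simp: rewrite_rules_def)
      then consider (forward) "(r, s) \<in> set rs" | (backward) "(s, r) \<in> set rs"
        | (canc) i where "i < n" "(r, s) \<in> {([(i, 0), (i, 1)], []), ([], [(i, 0), (i, 1)]), ([(i, 1), (i, 0)], []), ([], [(i, 1), (i, 0)])}"
        by blast
      thus ?thesis
      proof cases
        case forward
        hence "(dec_word r, dec_word s) \<in> dec_rels rs" by force
        thus ?thesis by (rule word_eq.rel) (use g in auto)
      next
        case backward
        hence "(dec_word s, dec_word r) \<in> dec_rels rs" by force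
        thus ?thesis by (intro word_eq.sym[OF word_eq.rel]) (use g in auto)
      next
        case canc
        thus ?thesis using c[OF canc(1), of False] c[OF canc(1), of True] word_eq.sym
          by (auto simp: dec_letter_def)
      qed
    qed
    thus ?thesis using eq True by simp
  qed
qed

lemma derive_word_sound:
  assumes "valid_word n w"
  shows "valid_word n (derive_word n rs w xs) \<and> word_eq n (dec_rels rs) (dec_word w) (dec_word (derive_word n rs w xs))"
  using assms
proof (induction xs arbitrary: w)
  case Nil
  thus ?case by (simp add: derive_word_def word_eq.refl dec_gwords)
next
  case (Cons x xs)
  have "derive_word n rs w (x # xs) = derive_word n rs (rewrite n rs w x) xs" by (simp add: derive_word_def)
  moreover note r = rewrite_sound[OF Cons.prems, of rs x]
  moreover note Cons.IH[of "rewrite n rs w x"]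
  ultimately show ?case using word_eq.trans[of n "dec_rels rs" "dec_word w" "dec_word (rewrite n rs w x)"] by simp
qed

lemma derive_word_complete:
  assumes rs: "!!p. p \<in> set rs ==> \<exists>r s. p = (enc_word r, enc_word s)"
    and w: "word_eq n (dec_rels rs) u v"
  shows "(\<exists>xs. derive_word n rs (enc_word u) xs = enc_word v) \<and> (\<exists>xs. derive_word n rs (enc_word v) xs = enc_word u)"
  using w
proof (induction rule: word_eq.induct)
  case (refl w)
  have "derive_word n rs (enc_word w) [] = enc_word w" by (simp add: derive_word_def)
  thus ?case by blast
next
  case (trans u v w)
  have "derive_word n rs x (xs @ ys) = derive_word n rs (derive_word n rs x xs) ys" for x xs ys by (simp add: derive_word_def)
  hence *: "\<exists>zs. derive_word n rs x zs = z" if "\<exists>xs. derive_word n rs x xs = y" "\<exists>ys. derive_word n rs y ys = z" for x y z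
    using that by blast
  show ?case using *[of "enc_word u" "enc_word v" "enc_word w"] *[of "enc_word w" "enc_word v" "enc_word u"] trans.IH by simp
next
  case (cancel u v i b)
  let ?r = "enc_word [(i, b), (i, \<not> b)]"
  have m: "(?r, []) \<in> set (rewrite_rules n rs)" "([], ?r) \<in> set (rewrite_rules n rs)"
    using cancel(2) by (cases b; auto simp: rewrite_rules_def enc_letter_def)+
  have g: "valid_word n (enc_word u @ ?r @ enc_word v)" "valid_word n (enc_word u @ [] @ enc_word v)"
    using enc_valid[of "u @ [(i, b), (i, \<not> b)] @ v" n] enc_valid[of "u @ v" n] cancel by (auto simp: gwords_def)
  have "derive_word n rs (enc_word u @ ?r @ enc_word v) [((enc_word u, enc_word v), (?r, []))] = enc_word u @ [] @ enc_word v"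
    "derive_word n rs (enc_word u @ [] @ enc_word v) [((enc_word u, enc_word v), ([], ?r))] = enc_word u @ ?r @ enc_word v"
    using m g by (simp_all add: derive_word_def rewrite_def)
  thus ?case unfolding map_append by auto
next
  case (rel r s u v)
  obtain p where p: "p \<in> set rs" "(r, s) = (dec_word (fst p), dec_word (snd p))" using rel(1) by blast
  then obtain r' s' where "p = (enc_word r', enc_word s')" using rs by blast
  hence "p = (enc_word r, enc_word s)" using p(2) by simp
  hence m: "(enc_word r, enc_word s) \<in> set (rewrite_rules n rs)" "(enc_word s, enc_word r) \<in> set (rewrite_rules n rs)"
    using p(1) by (force simp: rewrite_rules_def)+
  have g: "valid_word n (enc_word u @ enc_word r @ enc_word v)" "valid_word n (enc_word u @ enc_word s @ enc_word v)"
    using enc_valid[OF rel(2)] enc_valid[OF rel(3)] by auto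
  have "derive_word n rs (enc_word u @ enc_word r @ enc_word v) [((enc_word u, enc_word v), (enc_word r, enc_word s))] = enc_word u @ enc_word s @ enc_word v"
    "derive_word n rs (enc_word u @ enc_word s @ enc_word v) [((enc_word u, enc_word v), (enc_word s, enc_word r))] = enc_word u @ enc_word r @ enc_word v"
    using m g by (simp_all add: derive_word_def rewrite_def)
  thus ?case unfolding map_append by auto
qed blast

text \<open>A finite table of values, indexed by lists of numbers through their codes, with a default value \<open>z\<close>.\<close>

definition look :: "'v => 'v list => nat list => 'v" where
  "look z xs x = (if code x < length xs then hd (drop (code x) xs) else z)"

lemma finite_table:
  assumes I: "finite I" and W: "!!x. x \<notin> I ==> W x = z"
  obtains xs where "look z xs = W" "set xs \<subseteq> range W"
proof
  define N where "N = Suc (Max (insert 0 (code ` I)))"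
  let ?xs = "map (%c. W (inv_into UNIV code c)) [0..<N]"
  have inv: "inv_into UNIV code (code x) = x" for x :: "nat list" by (rule inv_into_f_f) (simp_all add: inj_on_def)
  have N: "code x < N" if "x \<in> I" for x
    using Max_ge[of "insert 0 (code ` I)" "code x"] I that by (auto simp: N_def less_Suc_eq_le)
  show "look z ?xs = W"
  proof
    fix x
    show "look z ?xs x = W x"
      using N[of x] W[of x] by (cases "code x < N") (auto simp: look_def hd_drop_conv_nth inv)
  qed
  show "set ?xs \<subseteq> range W" by auto
qed

text \<open>The certificate names the group elements \<open>0, \<dots>, m - 1\<close>. It consists of the multiplication table, the numbers of the
  letters, a word for every element, and derivations which show that the words multiply as the
  table says. Conversely, the right multiplications satisfy the relations.\<close>

definition gmul :: "nat list => nat => nat => nat" where "gmul ms k k' = look 0 ms [0, k, k']"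
definition glet :: "nat list => nat => nat => nat" where "glet ms j b = look 0 ms [1, j, b]"
definition gwalk :: "nat list => nat => nword => nat" where
  "gwalk ms k w = foldl (%k x. gmul ms k (glet ms (fst x) (snd x))) k w"

definition group_cert :: "nat => (nword \<times> nword) list => nat => nat list => nword list => rewrite_step list list => bool" where
  "group_cert n rs m ms ws ds \<longleftrightarrow> 0 < m \<and> look [] ws [0] = [] \<and>
    (\<forall>k < m. valid_word n (look [] ws [k]) \<and> gmul ms 0 k = k \<and> gwalk ms 0 (look [] ws [k]) = k) \<and>
    (\<forall>k < m. \<forall>k' < m. gmul ms k k' < m \<and>
      derive_word n rs (look [] ws [k] @ look [] ws [k']) (look [] ds [0, k, k']) = look [] ws [gmul ms k k']) \<and>
    (\<forall>j < n. \<forall>b < 2. glet ms j b < m \<and> derive_word n rs [(j, b)] (look [] ds [1, j, b]) = look [] ws [glet ms j b] \<and>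
      (\<forall>k < m. gwalk ms k [(j, b), (j, 1 - b)] = k)) \<and>
    (\<forall>p \<in> set rs. \<forall>k < m. gwalk ms k (fst p) = gwalk ms k (snd p))"

lemma gwalk_append: "gwalk ms k (u @ v) = gwalk ms (gwalk ms k u) v"
  by (simp add: gwalk_def)

text \<open>Let \<open>F u\<close> be the number reached from \<open>0\<close> by walking along the word \<open>u\<close>. It respects the relations, and by the
  derivations every word \<open>u\<close> equals the chosen word of \<open>F u\<close>; so the classes of the chosen words are all the
  elements, and they are distinct.\<close>

lemma group_cert_sound:
  fixes n rs
  defines "G \<equiv> presented_group n (dec_rels rs)"
  assumes rs: "!!p. p \<in> set rs ==> \<exists>r s. p = (enc_word r, enc_word s)" and c: "group_cert n rs m ms ws ds"
  shows "\<exists>\<phi>. bij_betw \<phi> {..<m} (carrier G) \<and> \<phi> 0 = \<one>\<^bsub>G\<^esub> \<and>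
    (\<forall>k < m. \<forall>k' < m. \<phi> (gmul ms k k') = \<phi> k \<otimes>\<^bsub>G\<^esub> \<phi> k') \<and>
    (\<forall>j < n. glet ms j 0 < m \<and> \<phi> (glet ms j 0) = word_class n (dec_rels rs) [(j, False)])"
proof -
  let ?R = "dec_rels rs" and ?w = "%k. look [] ws [k]"
  note c = c[unfolded group_cert_def]
  have m: "0 < m" "?w 0 = []" using c by simp_all
  have w: "valid_word n (?w k)" "gwalk ms 0 (?w k) = k" if "k < m" for k using c that by simp_all
  have mul: "gmul ms k k' < m" "derive_word n rs (?w k @ ?w k') (look [] ds [0, k, k']) = ?w (gmul ms k k')"
    if "k < m" "k' < m" for k k' using c that by simp_all
  have let': "glet ms j b < m" "derive_word n rs [(j, b)] (look [] ds [1, j, b]) = ?w (glet ms j b)"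
    if "j < n" "b < 2" for j b using c that by simp_all
  have canc: "gwalk ms k [(j, b), (j, 1 - b)] = k" if "j < n" "b < 2" "k < m" for j b k using c that by simp
  have rels: "gwalk ms k (fst p) = gwalk ms k (snd p)" if "p \<in> set rs" "k < m" for p k using c that by simp
  define F where "F k u = gwalk ms k (enc_word u)" for k u
  have step: "gmul ms k (glet ms j (if b then 1 else 0)) < m" if "k < m" "j < n" for k j b
    by (rule mul(1)[OF that(1) let'(1)[OF that(2)]]) simp
  have F_less: "F k u < m" if "u \<in> gwords n" "k < m" for u k
    using that
  proof (induction u arbitrary: k)
    case (Cons x u)
    have "F k (x # u) = F (gmul ms k (glet ms (fst x) (if snd x then 1 else 0))) u" by (simp add: F_def gwalk_def enc_letter_def)
    thus ?case using Cons step[of k "fst x" "snd x"] by (simp add: gwords_def)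
  qed (simp add: F_def gwalk_def)
  have F_append: "F k (u @ v) = F (F k u) v" for k u v by (simp add: F_def gwalk_append)
  have F_eq: "F k u = F k v" if "word_eq n ?R u v" "k < m" for u v k
    using that
  proof (induction arbitrary: k rule: word_eq.induct)
    case (cancel u v i b)
    have u: "F k u < m" by (rule F_less) (use cancel in "auto simp: gwords_def")
    have "F (F k u) [(i, b), (i, \<not> b)] = F k u"
      using canc[OF cancel(2) _ u, of "if b then 1 else 0"] by (cases b) (simp_all add: F_def enc_letter_def)
    thus ?case by (simp only: F_append)
  next
    case (rel r s u v)
    have u: "F k u < m" by (rule F_less) (use rel in "auto simp: gwords_def")
    obtain p where p: "p \<in> set rs" "(r, s) = (dec_word (fst p), dec_word (snd p))" using rel(1) by blast
    then obtain r' s' where "p = (enc_word r', enc_word s')" using rs by blast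
    hence "p = (enc_word r, enc_word s)" using p(2) by simp
    hence "F (F k u) r = F (F k u) s" using rels[OF p(1) u] by (simp add: F_def)
    thus ?case by (simp only: F_append)
  qed auto
  have w_mul: "word_eq n ?R (dec_word (?w k) @ dec_word (?w k')) (dec_word (?w (gmul ms k k')))" if "k < m" "k' < m" for k k'
  proof -
    have "valid_word n (?w k @ ?w k')" using w(1) that by (auto simp: valid_word_def)
    thus ?thesis using derive_word_sound[of n "?w k @ ?w k'" rs "look [] ds [0, k, k']"] mul(2)[OF that] by simp
  qed
  have w_let: "word_eq n ?R [(j, b)] (dec_word (?w (glet ms j (if b then 1 else 0))))" if "j < n" for j b
    using derive_word_sound[of n "[(j, if b then 1 else 0)]" rs "look [] ds [1, j, if b then 1 else 0]"]
      let'(2)[OF that, of "if b then 1 else 0"] that by (auto simp: valid_word_def dec_letter_def split: if_splits)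
  have canon: "word_eq n ?R u (dec_word (?w (F 0 u)))" if "u \<in> gwords n" for u
    using that
  proof (induction u rule: rev_induct)
    case Nil
    show ?case using m by (simp add: F_def gwalk_def word_eq.refl gwords_def)
  next
    case (snoc x u)
    obtain j b where x: "x = (j, b)" by (cases x)
    have u: "u \<in> gwords n" "j < n" using snoc.prems x by (auto simp: gwords_def)
    let ?g = "glet ms j (if b then 1 else 0)"
    have g: "?g < m" using let'(1)[OF u(2)] by simp
    have "word_eq n ?R (u @ [x]) (dec_word (?w (F 0 u)) @ dec_word (?w ?g))"
      unfolding x by (rule word_eq_mult[OF snoc.IH[OF u(1)] w_let[OF u(2)]])
    moreover have eq: "F 0 (u @ [x]) = gmul ms (F 0 u) ?g" by (simp add: F_append x) (simp add: F_def gwalk_def enc_letter_def)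
    ultimately show ?case unfolding eq by (intro word_eq.trans[OF _ w_mul[OF F_less[OF u(1) m(1)] g]])
  qed
  define \<phi> where "\<phi> k = word_class n ?R (dec_word (?w k))" for k
  have wg: "dec_word (?w k) \<in> gwords n" if "k < m" for k by (rule dec_gwords[OF w(1)[OF that]])
  have Fw: "F 0 (dec_word (?w k)) = k" if "k < m" for k
    using w(2)[OF that] enc_dec[OF w(1)[OF that]] by (simp add: F_def)
  have "bij_betw \<phi> {..<m} (carrier G)"
    unfolding bij_betw_def
  proof
    show "inj_on \<phi> {..<m}"
    proof (rule inj_onI)
      fix k k' assume k: "k \<in> {..<m}" "k' \<in> {..<m}" "\<phi> k = \<phi> k'"
      hence "word_eq n ?R (dec_word (?w k)) (dec_word (?w k'))" unfolding \<phi>_def using word_class_eq[OF wg] by simp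
      from F_eq[OF this m(1)] show "k = k'" using Fw k by simp
    qed
    show "\<phi> ` {..<m} = carrier G"
    proof (intro equalityI subsetI)
      fix g assume "g \<in> carrier G"
      then obtain u where u: "u \<in> gwords n" "g = word_class n ?R u" by (auto simp: G_def presented_carrier)
      hence "g = \<phi> (F 0 u)" unfolding \<phi>_def using word_class_eq[OF u(1)] canon[OF u(1)] by simp
      thus "g \<in> \<phi> ` {..<m}" using F_less[OF u(1) m(1)] by simp
    qed (use wg in "auto simp: \<phi>_def G_def presented_carrier")
  qed
  moreover have "\<phi> 0 = \<one>\<^bsub>G\<^esub>" using m by (simp add: \<phi>_def G_def presented_one)
  moreover have "\<phi> (gmul ms k k') = \<phi> k \<otimes>\<^bsub>G\<^esub> \<phi> k'" if "k < m" "k' < m" for k k'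
  proof -
    have "word_class n ?R (dec_word (?w k) @ dec_word (?w k')) = \<phi> (gmul ms k k')"
      unfolding \<phi>_def by (subst word_class_eq) (use w_mul[OF that] word_eq_gwords in auto)
    thus ?thesis by (simp add: \<phi>_def G_def presented_mult wg that)
  qed
  moreover have "\<phi> (glet ms j 0) = word_class n ?R [(j, False)]" if "j < n" for j
    unfolding \<phi>_def using w_let[OF that, of False] word_class_eq[of "[(j, False)]" n ?R "dec_word (?w (glet ms j 0))"] that
    by (simp add: gwords_def)
  ultimately show ?thesis using let'(1) by auto
qed

text \<open>The equality of words that defines the group is generated by the rewriting steps, so a true equation has a
  derivation.\<close>

lemma group_cert_exists:
  fixes n rs
  defines "G \<equiv> presented_group n (dec_rels rs)"
  assumes rs: "!!p. p \<in> set rs ==> \<exists>r s. p = (enc_word r, enc_word s) \<and> r \<in> gwords n \<and> s \<in> gwords n" and fin: "finite (carrier G)"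
  shows "\<exists>m ms ws ds. group_cert n rs m ms ws ds"
proof -
  let ?R = "dec_rels rs"
  interpret G: group G unfolding G_def by (rule presented_group_group)
  define m where "m = card (carrier G)"
  have m: "0 < m" unfolding m_def using fin G.one_closed by (auto simp: card_gt_0_iff)
  obtain f where f: "bij_betw f {..<m} (carrier G)"
    using ex_bij_betw_nat_finite[OF fin] by (auto simp: m_def atLeast0LessThan)
  have "\<one>\<^bsub>G\<^esub> \<in> f ` {..<m}" using f G.one_closed by (simp add: bij_betw_def)
  then obtain i0 where i0': "\<one>\<^bsub>G\<^esub> = f i0" "i0 \<in> {..<m}" by (rule imageE)
  have i0: "i0 < m" "f i0 = \<one>\<^bsub>G\<^esub>" using i0'(2) i0'(1)[symmetric] by simp_all
  define \<phi> where "\<phi> = f \<circ> Transposition.transpose 0 i0"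
  have \<phi>: "bij_betw \<phi> {..<m} (carrier G)" unfolding \<phi>_def
    by (rule bij_betw_trans[OF _ f]) (use m i0 in "simp add: bij_betw_transpose_iff")
  have \<phi>0: "\<phi> 0 = \<one>\<^bsub>G\<^esub>" by (simp add: \<phi>_def i0)
  define \<psi> where "\<psi> = inv_into {..<m} \<phi>"
  have \<psi>: "\<psi> g < m" "\<phi> (\<psi> g) = g" if "g \<in> carrier G" for g
  proof -
    have g: "g \<in> \<phi> ` {..<m}" using that \<phi> by (simp add: bij_betw_def)
    show "\<psi> g < m" using inv_into_into[OF g] by (simp add: \<psi>_def)
    show "\<phi> (\<psi> g) = g" using f_inv_into_f[OF g] by (simp add: \<psi>_def)
  qed
  have \<psi>\<phi>: "\<psi> (\<phi> k) = k" if "k < m" for k using \<phi> that unfolding \<psi>_def bij_betw_def by (simp add: inv_into_f_f)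
  have \<phi>c: "\<phi> k \<in> carrier G" if "k < m" for k using \<phi> that unfolding bij_betw_def by auto
  define cl where "cl u = word_class n ?R u" for u
  have clc: "cl u \<in> carrier G" if "u \<in> gwords n" for u using that by (simp add: cl_def G_def presented_carrier)
  have clm: "cl (u @ v) = cl u \<otimes>\<^bsub>G\<^esub> cl v" if "u \<in> gwords n" "v \<in> gwords n" for u v using that by (simp add: cl_def G_def presented_mult)
  have "\<exists>u. u \<in> gwords n \<and> (k < m --> cl u = \<phi> k) \<and> (k = 0 --> u = [])" for k
  proof (cases "k = 0 \<or> m \<le> k")
    case True
    have "cl [] = \<phi> 0" by (simp add: \<phi>0 cl_def G_def presented_one)
    moreover have "k < m ==> k = 0" using True by simp
    moreover have "[] \<in> gwords n" by (simp add: gwords_def)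
    ultimately show ?thesis by (intro exI[of _ "[]"]) blast
  next
    case False
    hence "\<phi> k \<in> cl ` gwords n" using \<phi>c[of k] by (simp add: G_def presented_carrier cl_def)
    then obtain u where "\<phi> k = cl u" "u \<in> gwords n" by (rule imageE)
    thus ?thesis using False by (intro exI[of _ u]) simp
  qed
  hence "\<forall>k. \<exists>u. u \<in> gwords n \<and> (k < m --> cl u = \<phi> k) \<and> (k = 0 --> u = [])" by (rule allI)
  from choice[OF this] obtain w where "\<forall>k. w k \<in> gwords n \<and> (k < m --> cl (w k) = \<phi> k) \<and> (k = 0 --> w k = [])" ..
  hence w: "!!k. w k \<in> gwords n" "!!k. k < m ==> cl (w k) = \<phi> k" "w 0 = []" by blast+
  define L where "L j b = cl [(j, b ~= (0 :: nat))]" for j b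
  have Lc: "L j b \<in> carrier G" if "j < n" for j b unfolding L_def by (rule clc) (use that in "simp add: gwords_def")
  define M where "M x = (case x of [c, k, k'] => if c = 0 \<and> k < m \<and> k' < m then \<psi> (\<phi> k \<otimes>\<^bsub>G\<^esub> \<phi> k')
    else if c = 1 \<and> k < n \<and> k' < 2 then \<psi> (L k k') else 0 | _ => 0)" for x :: "nat list"
  obtain ms where ms: "look 0 ms = M"
  proof (rule finite_table[of "{x. set x \<subseteq> {..m + n + 2} \<and> length x \<le> 3}" M 0])
    show "finite {x. set x \<subseteq> {..m + n + 2} \<and> length x \<le> 3}" by (rule finite_lists_length_le) simp
    show "M x = 0" if "x \<notin> {x. set x \<subseteq> {..m + n + 2} \<and> length x \<le> 3}" for x
      using that by (auto simp: M_def split: list.splits if_splits)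
  qed
  have mul: "gmul ms k k' = \<psi> (\<phi> k \<otimes>\<^bsub>G\<^esub> \<phi> k')" if "k < m" "k' < m" for k k' using that by (simp add: gmul_def ms M_def)
  have let': "glet ms j b = \<psi> (L j b)" if "j < n" "b < 2" for j b using that by (simp add: glet_def ms M_def)
  define Wf where "Wf x = (case x of [k] => if k < m then enc_word (w k) else [] | _ => [])" for x :: "nat list"
  obtain ws where ws: "look [] ws = Wf"
  proof (rule finite_table[of "{x. set x \<subseteq> {..m} \<and> length x \<le> 1}" Wf "[]"])
    show "finite {x. set x \<subseteq> {..m} \<and> length x \<le> 1}" by (rule finite_lists_length_le) simp
    show "Wf x = []" if "x \<notin> {x. set x \<subseteq> {..m} \<and> length x \<le> 1}" for x
      using that by (auto simp: Wf_def split: list.splits if_splits)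
  qed
  have wk: "look [] ws [k] = enc_word (w k)" if "k < m" for k using that by (simp add: ws Wf_def)
  have rs': "!!p. p \<in> set rs ==> \<exists>r s. p = (enc_word r, enc_word s)" using rs by blast
  have deriv: "\<exists>xs. derive_word n rs (enc_word u) xs = enc_word v" if "u \<in> gwords n" "cl u = cl v" for u v
  proof -
    have "word_eq n ?R u v" using that word_class_eq[OF that(1), of ?R v] by (simp add: cl_def)
    from derive_word_complete[OF rs' this] show ?thesis by blast
  qed
  define D1 where "D1 k k' = (SOME xs. derive_word n rs (enc_word (w k @ w k')) xs = enc_word (w (gmul ms k k')))" for k k'
  define D2 where "D2 j b = (SOME xs. derive_word n rs (enc_word [(j, b ~= 0)]) xs = enc_word (w (glet ms j b)))" for j b
  have mulm: "gmul ms k k' < m" "\<phi> (gmul ms k k') = \<phi> k \<otimes>\<^bsub>G\<^esub> \<phi> k'" if "k < m" "k' < m" for k k'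
    using \<psi>[of "\<phi> k \<otimes>\<^bsub>G\<^esub> \<phi> k'"] mul that \<phi>c by simp_all
  have letm: "glet ms j b < m" "\<phi> (glet ms j b) = L j b" if "j < n" "b < 2" for j b
    using \<psi>[OF Lc[OF that(1)], of b] let'[OF that] by simp_all
  have D1: "derive_word n rs (enc_word (w k @ w k')) (D1 k k') = enc_word (w (gmul ms k k'))" if "k < m" "k' < m" for k k'
    unfolding D1_def by (rule someI_ex, rule deriv)
      (use w(1) that clm[OF w(1) w(1)] w(2) mulm[OF that] in "auto simp: gwords_def")
  have D2: "derive_word n rs (enc_word [(j, b ~= 0)]) (D2 j b) = enc_word (w (glet ms j b))" if "j < n" "b < 2" for j b
    unfolding D2_def by (rule someI_ex, rule deriv)
      (use that w(2) letm[OF that] in "auto simp: gwords_def L_def")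
  define Df where "Df x = (case x of [c, k, k'] => if c = 0 \<and> k < m \<and> k' < m then D1 k k'
    else if c = 1 \<and> k < n \<and> k' < 2 then D2 k k' else [] | _ => [])" for x :: "nat list"
  obtain ds where ds: "look [] ds = Df"
  proof (rule finite_table[of "{x. set x \<subseteq> {..m + n + 2} \<and> length x \<le> 3}" Df "[]"])
    show "finite {x. set x \<subseteq> {..m + n + 2} \<and> length x \<le> 3}" by (rule finite_lists_length_le) simp
    show "Df x = []" if "x \<notin> {x. set x \<subseteq> {..m + n + 2} \<and> length x \<le> 3}" for x
      using that by (auto simp: Df_def split: list.splits if_splits)
  qed
  have walk: "gwalk ms k (enc_word u) = \<psi> (\<phi> k \<otimes>\<^bsub>G\<^esub> cl u)" if "u \<in> gwords n" "k < m" for u k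
    using that
  proof (induction u arbitrary: k)
    case Nil
    thus ?case using \<phi>c \<psi>\<phi> by (simp add: gwalk_def cl_def presented_one[symmetric] G_def[symmetric])
  next
    case (Cons x u)
    obtain j b where x: "x = (j, b)" by (cases x)
    let ?b = "if b then 1 else 0 :: nat"
    have u: "u \<in> gwords n" "j < n" "[x] \<in> gwords n" using Cons.prems x by (auto simp: gwords_def)
    have L: "L j ?b = cl [x]" by (simp add: L_def x)
    have g: "glet ms j ?b < m" "\<phi> (glet ms j ?b) = cl [x]" using letm[OF u(2), of ?b] L by simp_all
    have "gwalk ms k (enc_word (x # u)) = gwalk ms (gmul ms k (glet ms j ?b)) (enc_word u)" by (simp add: gwalk_def x enc_letter_def)
    also have "\<dots> = \<psi> (\<phi> k \<otimes>\<^bsub>G\<^esub> cl [x] \<otimes>\<^bsub>G\<^esub> cl u)"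
      using Cons.IH[OF u(1) mulm(1)[OF Cons.prems(2) g(1)]] mulm(2)[OF Cons.prems(2) g(1)] g(2) by simp
    also have "\<dots> = \<psi> (\<phi> k \<otimes>\<^bsub>G\<^esub> cl (x # u))"
      using clm[OF u(3,1)] G.m_assoc[OF \<phi>c[OF Cons.prems(2)] clc[OF u(3)] clc[OF u(1)]] by simp
    finally show ?case .
  qed
  have "group_cert n rs m ms ws ds"
    unfolding group_cert_def
  proof (intro conjI allI impI ballI)
    show "0 < m" by (rule m)
    show "look [] ws [0] = []" using wk[OF m] w(3) by simp
    fix k assume k: "k < m"
    show "valid_word n (look [] ws [k])" using wk[OF k] enc_valid[OF w(1)] by simp
    show "gmul ms 0 k = k" using mul[OF m k] \<phi>0 \<phi>c[OF k] \<psi>\<phi>[OF k] by simp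
    show "gwalk ms 0 (look [] ws [k]) = k" using wk[OF k] walk[OF w(1) m] w(2)[OF k] \<phi>0 \<phi>c[OF k] \<psi>\<phi>[OF k] by simp
    fix k' assume k': "k' < m"
    show "gmul ms k k' < m" by (rule mulm(1)[OF k k'])
    show "derive_word n rs (look [] ws [k] @ look [] ws [k']) (look [] ds [0, k, k']) = look [] ws [gmul ms k k']"
      using D1[OF k k'] wk[OF k] wk[OF k'] wk[OF mulm(1)[OF k k']] k k' by (simp add: ds Df_def)
  next
    fix j b :: nat assume j: "j < n" and b: "b < 2"
    show "glet ms j b < m" by (rule letm(1)[OF j b])
    have eb: "enc_letter (j, b ~= 0) = (j, b)" using b by (auto simp: enc_letter_def)
    show "derive_word n rs [(j, b)] (look [] ds [1, j, b]) = look [] ws [glet ms j b]"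
      using D2[OF j b] wk[OF letm(1)[OF j b]] j b eb by (simp add: ds Df_def)
    fix k assume k: "k < m"
    have g: "[(j, b ~= 0), (j, b = 0)] \<in> gwords n" using j by (simp add: gwords_def)
    have "enc_word [(j, b ~= 0), (j, b = 0)] = [(j, b), (j, 1 - b)]" using b by (auto simp: enc_letter_def)
    moreover have "word_eq n ?R ([] @ [(j, b ~= 0), (j, \<not> b ~= 0)] @ []) ([] @ [])"
      by (rule word_eq.cancel) (use j in "auto simp: gwords_def")
    hence "cl [(j, b ~= 0), (j, b = 0)] = \<one>\<^bsub>G\<^esub>"
      using word_class_eq[OF g, of ?R "[]"] by (simp add: cl_def G_def presented_one)
    ultimately show "gwalk ms k [(j, b), (j, 1 - b)] = k" using walk[OF g k] \<phi>c[OF k] \<psi>\<phi>[OF k] by simp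
  next
    fix p k assume p: "p \<in> set rs" and k: "k < m"
    obtain r s where r: "p = (enc_word r, enc_word s)" "r \<in> gwords n" "s \<in> gwords n" using rs[OF p] by blast
    have "(r, s) \<in> ?R" using p r(1) by (intro image_eqI[of _ _ p]) simp_all
    hence "word_eq n ?R ([] @ r @ []) ([] @ s @ [])" by (rule word_eq.rel) (use r in auto)
    hence "cl r = cl s" using word_class_eq[OF r(2), of ?R s] by (simp add: cl_def)
    thus "gwalk ms k (fst p) = gwalk ms k (snd p)" using walk[OF r(2) k] walk[OF r(3) k] r(1) by simp
  qed
  thus ?thesis by blast
qed

section \<open>Matrix representations in coordinates\<close>

text \<open>The group \<open>G\<close> is identified with the table \<open>mt\<close> by \<open>\<phi>\<close>, and matrices over \<open>R\<close> with functions on indices.\<close>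

locale coordinates = rep_setting R n mt for R (structure) and n mt +
  fixes G :: "('g, 'c) monoid_scheme" and \<phi> :: "nat => 'g"
  assumes grp: "group G" and \<phi>_bij: "bij_betw \<phi> {..<n} (carrier G)" and \<phi>_one: "\<phi> 0 = \<one>\<^bsub>G\<^esub>"
    and \<phi>_mult: "k < n ==> k' < n ==> \<phi> (mt k k') = \<phi> k \<otimes>\<^bsub>G\<^esub> \<phi> k'"
begin

abbreviation "MM \<equiv> mat_monoid R"
abbreviation "CS \<equiv> coord_space R"

interpretation G: group G by (rule grp)

definition \<psi> :: "'g => nat" where "\<psi> = inv_into {..<n} \<phi>"

lemma \<phi>_carrier: "k < n ==> \<phi> k \<in> carrier G"
  using \<phi>_bij by (auto simp: bij_betw_def)

lemma \<psi>: "g \<in> carrier G ==> \<psi> g < n" "g \<in> carrier G ==> \<phi> (\<psi> g) = g" "k < n ==> \<psi> (\<phi> k) = k"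
proof -
  assume "g \<in> carrier G"
  hence g: "g \<in> \<phi> ` {..<n}" using \<phi>_bij by (simp add: bij_betw_def)
  show "\<psi> g < n" using inv_into_into[OF g] by (simp add: \<psi>_def)
  show "\<phi> (\<psi> g) = g" using f_inv_into_f[OF g] by (simp add: \<psi>_def)
next
  assume "k < n"
  thus "\<psi> (\<phi> k) = k" using \<phi>_bij unfolding \<psi>_def bij_betw_def by (simp add: inv_into_f_f)
qed

lemma \<psi>_mult: "g \<in> carrier G ==> h \<in> carrier G ==> \<psi> (g \<otimes>\<^bsub>G\<^esub> h) = mt (\<psi> g) (\<psi> h)"
  using \<psi>(3)[OF mt_closed, of "\<psi> g" "\<psi> h"] \<phi>_mult[of "\<psi> g" "\<psi> h"] \<psi>(1,2) by simp

lemma \<psi>_one: "\<psi> \<one>\<^bsub>G\<^esub> = 0"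
  using \<psi>(3)[OF n_pos] \<phi>_one by simp

lemma mat_monoid_simps:
  "A \<in> carrier (MM d) \<longleftrightarrow> A \<in> carrier_mat d d \<and> (\<forall>i < d. \<forall>j < d. A $$ (i, j) \<in> carrier R)"
  "A \<otimes>\<^bsub>MM d\<^esub> B = mat d d (%(i, j). \<Oplus>l \<in> {..<d}. A $$ (i, l) \<otimes> B $$ (l, j))"
  "\<one>\<^bsub>MM d\<^esub> = mat d d (%(i, j). if i = j then \<one> else \<zero>)"
  by (auto simp: mat_monoid_def elements_mat_def UN_subset_iff image_subset_iff)

definition ent :: "nat => 'a mat => nat => nat => 'a" where
  "ent d A i j = (if i < d \<and> j < d then A $$ (i, j) else \<zero>)"

lemma ent_mats: "A \<in> carrier (MM d) ==> ent d A \<in> mats R"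
  by (rule matsI) (auto simp: ent_def mat_monoid_simps)

lemma ent_mult:
  assumes "A \<in> carrier (MM d)" "B \<in> carrier (MM d)"
  shows "meq d d (ent d (A \<otimes>\<^bsub>MM d\<^esub> B)) (mm R d (ent d A) (ent d B))"
  unfolding meq_def
proof (intro allI impI)
  fix i j assume ij: "i < d" "j < d"
  have "(\<Oplus>l \<in> {..<d}. A $$ (i, l) \<otimes> B $$ (l, j)) = S d (%l. A $$ (i, l) \<otimes> B $$ (l, j))"
    by (rule S_finsum) (use assms ij in "auto simp: mat_monoid_simps")
  also have "\<dots> = mm R d (ent d A) (ent d B) i j"
    unfolding mm_def by (rule gsum_cong) (use ij in "simp add: ent_def")
  finally show "ent d (A \<otimes>\<^bsub>MM d\<^esub> B) i j = mm R d (ent d A) (ent d B) i j"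
    using ij by (simp add: mat_monoid_simps(2)) (simp add: ent_def)
qed

lemma ent_one: "meq d d (ent d \<one>\<^bsub>MM d\<^esub>) (uvec R)"
  by (auto simp: meq_def ent_def mat_monoid_simps(3) uvec_def)

lemma ent_eq:
  assumes "A \<in> carrier (MM d)" "B \<in> carrier (MM d)" "meq d d (ent d A) (ent d B)"
  shows "A = B"
  by (rule eq_matI) (use assms in "auto simp: mat_monoid_simps meq_def ent_def")

lemma mult_closed:
  assumes "A \<in> carrier (MM d)" "B \<in> carrier (MM d)"
  shows "A \<otimes>\<^bsub>MM d\<^esub> B \<in> carrier (MM d)"
proof -
  have "(\<Oplus>l \<in> {..<d}. A $$ (i, l) \<otimes> B $$ (l, j)) \<in> carrier R" if "i < d" "j < d" for i j
    by (rule finsum_closed) (use assms that in "auto simp: mat_monoid_simps")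
  thus ?thesis unfolding mat_monoid_simps(1) by (auto simp: mat_monoid_simps(2))
qed

lemma one_closed': "\<one>\<^bsub>MM d\<^esub> \<in> carrier (MM d)"
  unfolding mat_monoid_simps(1) by (auto simp: mat_monoid_simps(3))

lemma mat_monoid: "monoid (MM d)"
proof (rule monoidI)
  fix A B C assume A: "A \<in> carrier (MM d)" and B: "B \<in> carrier (MM d)"
  show "A \<otimes>\<^bsub>MM d\<^esub> B \<in> carrier (MM d)" by (rule mult_closed[OF A B])
  assume C: "C \<in> carrier (MM d)"
  show "A \<otimes>\<^bsub>MM d\<^esub> B \<otimes>\<^bsub>MM d\<^esub> C = A \<otimes>\<^bsub>MM d\<^esub> (B \<otimes>\<^bsub>MM d\<^esub> C)"
  proof (rule ent_eq)
    have "meq d d (ent d (A \<otimes>\<^bsub>MM d\<^esub> B \<otimes>\<^bsub>MM d\<^esub> C)) (mm R d (ent d (A \<otimes>\<^bsub>MM d\<^esub> B)) (ent d C))"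
      by (rule ent_mult[OF mult_closed[OF A B] C])
    also have "meq d d \<dots> (mm R d (mm R d (ent d A) (ent d B)) (ent d C))" by (rule mm_congL[OF ent_mult[OF A B]])
    also have "\<dots> = mm R d (ent d A) (mm R d (ent d B) (ent d C))" by (rule mm_assoc[symmetric]) (intro ent_mats A B C)+
    also have "meq d d \<dots> (mm R d (ent d A) (ent d (B \<otimes>\<^bsub>MM d\<^esub> C)))" by (rule mm_congR[OF meq_sym[OF ent_mult[OF B C]]])
    also have "meq d d \<dots> (ent d (A \<otimes>\<^bsub>MM d\<^esub> (B \<otimes>\<^bsub>MM d\<^esub> C)))"
      by (rule meq_sym[OF ent_mult[OF A mult_closed[OF B C]]])
    finally show "meq d d (ent d (A \<otimes>\<^bsub>MM d\<^esub> B \<otimes>\<^bsub>MM d\<^esub> C)) (ent d (A \<otimes>\<^bsub>MM d\<^esub> (B \<otimes>\<^bsub>MM d\<^esub> C)))" .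
  qed (intro mult_closed A B C)+
next
  fix A assume A: "A \<in> carrier (MM d)"
  show "\<one>\<^bsub>MM d\<^esub> \<otimes>\<^bsub>MM d\<^esub> A = A"
  proof (rule ent_eq[OF mult_closed[OF one_closed' A] A])
    have "meq d d (ent d (\<one>\<^bsub>MM d\<^esub> \<otimes>\<^bsub>MM d\<^esub> A)) (mm R d (ent d \<one>\<^bsub>MM d\<^esub>) (ent d A))"
      by (rule ent_mult[OF one_closed' A])
    also have "meq d d \<dots> (mm R d (uvec R) (ent d A))" by (rule mm_congL[OF ent_one])
    also have "meq d d \<dots> (ent d A)" by (rule mm_unit_left[OF ent_mats[OF A]])
    finally show "meq d d (ent d (\<one>\<^bsub>MM d\<^esub> \<otimes>\<^bsub>MM d\<^esub> A)) (ent d A)" .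
  qed
  show "A \<otimes>\<^bsub>MM d\<^esub> \<one>\<^bsub>MM d\<^esub> = A"
  proof (rule ent_eq[OF mult_closed[OF A one_closed'] A])
    have "meq d d (ent d (A \<otimes>\<^bsub>MM d\<^esub> \<one>\<^bsub>MM d\<^esub>)) (mm R d (ent d A) (ent d \<one>\<^bsub>MM d\<^esub>))"
      by (rule ent_mult[OF A one_closed'])
    also have "meq d d \<dots> (mm R d (ent d A) (uvec R))" by (rule mm_congR[OF ent_one])
    also have "meq d d \<dots> (ent d A)" by (rule mm_unit_right[OF ent_mats[OF A]])
    finally show "meq d d (ent d (A \<otimes>\<^bsub>MM d\<^esub> \<one>\<^bsub>MM d\<^esub>)) (ent d A)" .
  qed
qed (rule one_closed')

lemma GL_simps: "carrier (GL R d) = Units (MM d)" "A \<otimes>\<^bsub>GL R d\<^esub> B = A \<otimes>\<^bsub>MM d\<^esub> B" "\<one>\<^bsub>GL R d\<^esub> = \<one>\<^bsub>MM d\<^esub>"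
  by (simp_all add: GL_def units_of_carrier units_of_mult units_of_one)

lemma GL_group: "group (GL R d)"
  unfolding GL_def by (rule monoid.units_group[OF mat_monoid])

lemma GL_closed: "A \<in> carrier (GL R d) ==> A \<in> carrier (MM d)"
  unfolding GL_simps by (rule monoid.Units_closed[OF mat_monoid])

definition to_mat :: "nat => (nat => nat => 'a) => 'a mat" where
  "to_mat d A = mat d d (%(i, j). A i j)"

lemma to_mat: "A \<in> mats R ==> to_mat d A \<in> carrier (MM d)" "meq d d (ent d (to_mat d A)) A"
  by (auto simp: mat_monoid_simps(1) to_mat_def meq_def ent_def)

lemma to_mat_mult:
  assumes A: "A \<in> mats R" and B: "B \<in> mats R"
  shows "to_mat d A \<otimes>\<^bsub>MM d\<^esub> to_mat d B = to_mat d (mm R d A B)"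
proof (rule ent_eq[OF mult_closed[OF to_mat(1)[OF A] to_mat(1)[OF B]] to_mat(1)[OF mm_mats[OF A B]]])
  have "meq d d (ent d (to_mat d A \<otimes>\<^bsub>MM d\<^esub> to_mat d B)) (mm R d (ent d (to_mat d A)) (ent d (to_mat d B)))"
    by (rule ent_mult[OF to_mat(1)[OF A] to_mat(1)[OF B]])
  also have "meq d d \<dots> (mm R d A B)" by (rule mm_cong[OF to_mat(2) to_mat(2)])
  also have "meq d d \<dots> (ent d (to_mat d (mm R d A B)))" by (rule meq_sym[OF to_mat(2)])
  finally show "meq d d (ent d (to_mat d A \<otimes>\<^bsub>MM d\<^esub> to_mat d B)) (ent d (to_mat d (mm R d A B)))" .
qed

lemma to_mat_cong: "meq d d A B ==> to_mat d A = to_mat d B"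
  by (rule eq_matI) (auto simp: to_mat_def meq_def)

lemma to_mat_one: "to_mat d (uvec R) = \<one>\<^bsub>MM d\<^esub>"
  by (rule eq_matI) (auto simp: to_mat_def mat_monoid_simps(3) uvec_def)

definition mrep :: "nat => (nat => nat => nat => 'a) => 'g => 'a mat" where
  "mrep d N g = to_mat d (N (\<psi> g))"

lemma matrix_rep_mrep:
  assumes N: "rep R n mt d N"
  shows "matrix_rep R G d (mrep d N)"
proof -
  note Nm = repD(1)[OF N]
  have mul: "mrep d N (g \<otimes>\<^bsub>G\<^esub> h) = mrep d N g \<otimes>\<^bsub>MM d\<^esub> mrep d N h" if "g \<in> carrier G" "h \<in> carrier G" for g h
    unfolding mrep_def \<psi>_mult[OF that] to_mat_mult[OF Nm Nm] by (rule to_mat_cong[OF repD(3)[OF N \<psi>(1)[OF that(1)] \<psi>(1)[OF that(2)]]])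
  have one: "mrep d N \<one>\<^bsub>G\<^esub> = \<one>\<^bsub>MM d\<^esub>"
    unfolding mrep_def \<psi>_one to_mat_one[symmetric] by (rule to_mat_cong[OF repD(2)[OF N]])
  have cl: "mrep d N g \<in> carrier (MM d)" for g unfolding mrep_def by (rule to_mat(1)[OF Nm])
  have "mrep d N g \<in> Units (MM d)" if g: "g \<in> carrier G" for g
  proof -
    have "mrep d N (inv\<^bsub>G\<^esub> g) \<otimes>\<^bsub>MM d\<^esub> mrep d N g = \<one>\<^bsub>MM d\<^esub>"
      "mrep d N g \<otimes>\<^bsub>MM d\<^esub> mrep d N (inv\<^bsub>G\<^esub> g) = \<one>\<^bsub>MM d\<^esub>"
      using mul[of "inv\<^bsub>G\<^esub> g" g] mul[of g "inv\<^bsub>G\<^esub> g"] g one by simp_all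
    thus ?thesis unfolding Units_def using cl by blast
  qed
  thus ?thesis unfolding matrix_rep_def hom_def by (simp add: GL_simps mul)
qed

definition describes :: "nat => (nat => nat => nat => 'a) => ('g => 'a mat) => bool" where
  "describes d N \<rho> \<longleftrightarrow> matrix_rep R G d \<rho> \<and> (\<forall>k. N k \<in> mats R) \<and> (\<forall>k < n. meq d d (ent d (\<rho> (\<phi> k))) (N k))"

lemma describes_mrep:
  assumes "rep R n mt d N"
  shows "describes d N (mrep d N)"
  unfolding describes_def
proof (intro conjI allI impI)
  show "matrix_rep R G d (mrep d N)" by (rule matrix_rep_mrep[OF assms])
  show "N k \<in> mats R" for k by (rule repD(1)[OF assms])
  show "meq d d (ent d (mrep d N (\<phi> k))) (N k)" if "k < n" for k
    unfolding mrep_def \<psi>(3)[OF that] by (rule to_mat(2))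
qed

lemma describes_exists:
  assumes s: "matrix_rep R G d \<rho>"
  obtains N where "describes d N \<rho>" "rep R n mt d N" "!!k. N k = ent d (\<rho> (\<phi> (if k < n then k else 0)))"
proof
  define N where "N k = ent d (\<rho> (\<phi> (if k < n then k else 0)))" for k
  have hom: "\<rho> \<in> hom G (GL R d)" using s by (simp add: matrix_rep_def)
  have cl: "\<rho> (\<phi> k) \<in> carrier (MM d)" if "k < n" for k
    by (rule GL_closed[OF hom_in_carrier[OF hom \<phi>_carrier[OF that]]])
  have Nm: "N k \<in> mats R" for k unfolding N_def by (rule ent_mats) (use cl n_pos in simp)
  show "describes d N \<rho>" unfolding describes_def using s Nm by (simp add: N_def)
  show "rep R n mt d N"
    unfolding rep_def
  proof (intro conjI allI impI)
    show "N k \<in> mats R" for k by (rule Nm)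
    have "\<rho> \<one>\<^bsub>G\<^esub> = \<one>\<^bsub>GL R d\<^esub>" by (rule hom_one[OF hom grp GL_group])
    thus "meq d d (N 0) (uvec R)" unfolding N_def using ent_one n_pos by (simp add: \<phi>_one GL_simps)
    fix k k' assume k: "k < n" "k' < n"
    have "\<rho> (\<phi> (mt k k')) = \<rho> (\<phi> k) \<otimes>\<^bsub>MM d\<^esub> \<rho> (\<phi> k')"
      using hom_mult[OF hom \<phi>_carrier[OF k(1)] \<phi>_carrier[OF k(2)]] by (simp add: \<phi>_mult[OF k] GL_simps)
    thus "meq d d (N (mt k k')) (mm R d (N k) (N k'))"
      unfolding N_def using ent_mult[OF cl[OF k(1)] cl[OF k(2)]] k mt_closed[OF k] by simp
  qed
  show "N k = ent d (\<rho> (\<phi> (if k < n then k else 0)))" for k by (rule N_def)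
qed

lemma equivalent_iff_eqv:
  assumes N: "describes d N \<rho>" and M: "describes d M \<tau>"
  shows "equivalent_reps R G d \<rho> \<tau> \<longleftrightarrow> eqv R n d N M"
proof -
  interpret H: group "GL R d" by (rule GL_group)
  have Nm: "N k \<in> mats R" "M k \<in> mats R" for k using N M by (auto simp: describes_def)
  have s: "\<rho> (\<phi> k) \<in> carrier (GL R d)" "\<tau> (\<phi> k) \<in> carrier (GL R d)" if "k < n" for k
    using N M \<phi>_carrier[OF that] unfolding describes_def matrix_rep_def by (auto intro: hom_in_carrier)
  have sN: "meq d d (ent d (\<rho> (\<phi> k))) (N k)" "meq d d (ent d (\<tau> (\<phi> k))) (M k)" if "k < n" for k
    using N M that by (auto simp: describes_def)
  have sm: "\<rho> (\<phi> k) = to_mat d (N k)" "\<tau> (\<phi> k) = to_mat d (M k)" if "k < n" for k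
    by (rule ent_eq[OF GL_closed[OF s(1)[OF that]] to_mat(1)[OF Nm(1)] meq_trans[OF sN(1)[OF that] meq_sym[OF to_mat(2)]]],
      rule ent_eq[OF GL_closed[OF s(2)[OF that]] to_mat(1)[OF Nm(2)] meq_trans[OF sN(2)[OF that] meq_sym[OF to_mat(2)]]])
  show ?thesis
  proof
    assume "equivalent_reps R G d \<rho> \<tau>"
    then obtain T where T: "T \<in> carrier (GL R d)" and eq: "!!g. g \<in> carrier G ==> \<tau> g = T \<otimes>\<^bsub>GL R d\<^esub> \<rho> g \<otimes>\<^bsub>GL R d\<^esub> inv\<^bsub>GL R d\<^esub> T"
      unfolding equivalent_reps_def by blast
    let ?T' = "inv\<^bsub>GL R d\<^esub> T"
    have T': "?T' \<in> carrier (GL R d)" using T by simp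
    note c = GL_closed[OF T] GL_closed[OF T']
    show "eqv R n d N M"
      unfolding eqv_def
    proof (rule bexI[OF _ ent_mats[OF c(1)]], rule bexI[OF _ ent_mats[OF c(2)]], intro conjI allI impI)
      have "T \<otimes>\<^bsub>MM d\<^esub> ?T' = \<one>\<^bsub>MM d\<^esub>" "?T' \<otimes>\<^bsub>MM d\<^esub> T = \<one>\<^bsub>MM d\<^esub>"
        using H.r_inv[OF T] H.l_inv[OF T] by (simp_all add: GL_simps)
      thus "meq d d (mm R d (ent d T) (ent d ?T')) (uvec R)" "meq d d (mm R d (ent d ?T') (ent d T)) (uvec R)"
        using meq_trans[OF meq_sym[OF ent_mult[OF c]]] meq_trans[OF meq_sym[OF ent_mult[OF c(2,1)]]] ent_one by simp_all
      fix k assume k: "k < n"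
      have "\<tau> (\<phi> k) \<otimes>\<^bsub>GL R d\<^esub> T = T \<otimes>\<^bsub>GL R d\<^esub> \<rho> (\<phi> k)"
        unfolding eq[OF \<phi>_carrier[OF k]] using T T' s[OF k] by (simp add: H.m_assoc)
      hence e: "T \<otimes>\<^bsub>MM d\<^esub> \<rho> (\<phi> k) = \<tau> (\<phi> k) \<otimes>\<^bsub>MM d\<^esub> T" by (simp add: GL_simps)
      have "meq d d (mm R d (ent d T) (N k)) (mm R d (ent d T) (ent d (\<rho> (\<phi> k))))" by (rule mm_congR[OF meq_sym[OF sN(1)[OF k]]])
      also have "meq d d \<dots> (ent d (T \<otimes>\<^bsub>MM d\<^esub> \<rho> (\<phi> k)))" by (rule meq_sym[OF ent_mult[OF c(1) GL_closed[OF s(1)[OF k]]]])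
      also have "\<dots> = ent d (\<tau> (\<phi> k) \<otimes>\<^bsub>MM d\<^esub> T)" unfolding e ..
      also have "meq d d \<dots> (mm R d (ent d (\<tau> (\<phi> k))) (ent d T))" by (rule ent_mult[OF GL_closed[OF s(2)[OF k]] c(1)])
      also have "meq d d \<dots> (mm R d (M k) (ent d T))" by (rule mm_congL[OF sN(2)[OF k]])
      finally show "meq d d (mm R d (ent d T) (N k)) (mm R d (M k) (ent d T))" .
    qed
  next
    assume "eqv R n d N M"
    then obtain T T' where T: "T \<in> mats R" "T' \<in> mats R" "meq d d (mm R d T T') (uvec R)" "meq d d (mm R d T' T) (uvec R)"
      "!!k. k < n ==> meq d d (mm R d T (N k)) (mm R d (M k) T)"
      unfolding eqv_def by blast
    have TT: "to_mat d T \<otimes>\<^bsub>MM d\<^esub> to_mat d T' = \<one>\<^bsub>MM d\<^esub>" "to_mat d T' \<otimes>\<^bsub>MM d\<^esub> to_mat d T = \<one>\<^bsub>MM d\<^esub>"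
      unfolding to_mat_mult[OF T(1,2)] to_mat_mult[OF T(2,1)] to_mat_one[symmetric] by (rule to_mat_cong, rule T)+
    have u: "to_mat d T \<in> carrier (GL R d)" "to_mat d T' \<in> carrier (GL R d)"
      unfolding GL_simps Units_def using TT to_mat(1)[OF T(1)] to_mat(1)[OF T(2)] by blast+
    have inv: "inv\<^bsub>GL R d\<^esub> (to_mat d T) = to_mat d T'" by (rule H.inv_equality) (use u TT in "simp_all add: GL_simps")
    have "\<tau> g = to_mat d T \<otimes>\<^bsub>GL R d\<^esub> \<rho> g \<otimes>\<^bsub>GL R d\<^esub> inv\<^bsub>GL R d\<^esub> (to_mat d T)" if g: "g \<in> carrier G" for g
    proof -
      note k = \<psi>(1)[OF g]
      have "to_mat d T \<otimes>\<^bsub>GL R d\<^esub> \<rho> g = \<tau> g \<otimes>\<^bsub>GL R d\<^esub> to_mat d T"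
        using sm[OF k] to_mat_mult[OF T(1) Nm(1)] to_mat_mult[OF Nm(2) T(1)] to_mat_cong[OF T(5)[OF k]] by (simp add: \<psi>(2)[OF g] GL_simps)
      thus ?thesis using s[OF k] u by (simp add: \<psi>(2)[OF g] H.m_assoc)
    qed
    thus "equivalent_reps R G d \<rho> \<tau>" unfolding equivalent_reps_def using u(1) by blast
  qed
qed

lemma mat_apply_ent:
  assumes A: "A \<in> carrier (MM d)" and w: "w \<in> vecs R" "!!i. i < d ==> w i = v $ i" and v: "v \<in> carrier_vec d"
  shows "mat_apply R A v = vec d (mv R d (ent d A) w)"
proof (rule eq_vecI)
  have dim: "dim_row A = d" "dim_col A = d" using A by (auto simp: mat_monoid_simps)
  show "dim_vec (mat_apply R A v) = dim_vec (vec d (mv R d (ent d A) w))" by (simp add: mat_apply_def dim)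
  fix i assume "i < dim_vec (vec d (mv R d (ent d A) w))"
  hence i: "i < d" by simp
  have "(\<Oplus>j \<in> {..<d}. A $$ (i, j) \<otimes> v $ j) = S d (%j. A $$ (i, j) \<otimes> v $ j)"
  proof (rule S_finsum)
    fix j assume j: "j < d"
    have "v $ j \<in> carrier R" unfolding w(2)[OF j, symmetric] by (rule vecsD[OF w(1)])
    thus "A $$ (i, j) \<otimes> v $ j \<in> carrier R" using A i j by (simp add: mat_monoid_simps)
  qed
  also have "\<dots> = mv R d (ent d A) w i" unfolding mv_def by (rule gsum_cong) (use i w in "simp add: ent_def")
  finally show "mat_apply R A v $ i = vec d (mv R d (ent d A) w) $ i" using i by (simp add: mat_apply_def dim)
qed

lemma coord_space_simps:
  "carrier (CS d) = {v \<in> carrier_vec d. \<forall>i < d. v $ i \<in> carrier R}"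
  "\<zero>\<^bsub>CS d\<^esub> = vec d (%_. \<zero>)"
  "v \<oplus>\<^bsub>CS d\<^esub> w = vec d (%i. v $ i \<oplus> w $ i)"
  "a \<odot>\<^bsub>CS d\<^esub> v = vec d (%i. a \<otimes> v $ i)"
  by (simp_all add: coord_space_def)

lemma submodule_comb:
  assumes W: "submodule W R (CS d)" and c: "c \<in> vecs R" and f: "!!k. k < m ==> vec d (f k) \<in> W"
    and fv: "!!k. f k \<in> vecs R"
  shows "vec d (%i. S m (%k. c k \<otimes> f k i)) \<in> W"
  using f
proof (induction m)
  case 0
  show ?case using subgroup.one_closed[OF submodule.axioms(1)[OF W]] by (simp add: coord_space_simps)
next
  case (Suc m)
  have a: "c m \<odot>\<^bsub>CS d\<^esub> vec d (f m) \<in> W" by (rule submodule.smult_closed[OF W]) (use c Suc.prems in auto)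
  have "vec d (%i. S m (%k. c k \<otimes> f k i)) \<in> W" by (rule Suc.IH) (use Suc.prems in simp)
  hence "vec d (%i. S m (%k. c k \<otimes> f k i)) \<oplus>\<^bsub>CS d\<^esub> (c m \<odot>\<^bsub>CS d\<^esub> vec d (f m)) \<in> W"
    using subgroup.m_closed[OF submodule.axioms(1)[OF W]] a by simp
  moreover have "vec d (%i. S m (%k. c k \<otimes> f k i)) \<oplus>\<^bsub>CS d\<^esub> (c m \<odot>\<^bsub>CS d\<^esub> vec d (f m))
      = vec d (%i. S (Suc m) (%k. c k \<otimes> f k i))"
    by (rule eq_vecI) (simp_all add: coord_space_simps)
  ultimately show ?case by simp
qed

text \<open>A nonzero vector \<open>v\<close> of an invariant subspace has a nonzero coordinate \<open>b\<close>; the matrix units with column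
  \<open>b\<close> map it to nonzero multiples of all unit vectors.\<close>

lemma irreducible_of_combs:
  assumes N: "rep R n mt d N" and c: "unit_mat_combs R n d N c" and d: "0 < d"
  shows "irreducible_rep R G d (mrep d N)"
  unfolding irreducible_rep_def
proof (intro conjI allI impI)
  note Nm = repD(1)[OF N]
  show "matrix_rep R G d (mrep d N)" by (rule matrix_rep_mrep[OF N])
  show "0 < d" by (rule d)
  fix W assume "submodule W R (CS d) \<and> (\<forall>g \<in> carrier G. \<forall>v \<in> W. mat_apply R (mrep d N g) v \<in> W)"
  hence W: "submodule W R (CS d)" and inv: "!!g v. g \<in> carrier G ==> v \<in> W ==> mat_apply R (mrep d N g) v \<in> W" by auto
  have sub: "W \<subseteq> carrier (CS d)" using subgroup.subset[OF submodule.axioms(1)[OF W]] by simp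
  have zero: "vec d (%_. \<zero>) \<in> W" using subgroup.one_closed[OF submodule.axioms(1)[OF W]] by (simp add: coord_space_simps)
  show "W = {\<zero>\<^bsub>CS d\<^esub>} \<or> W = carrier (CS d)"
  proof (cases "\<exists>v \<in> W. \<exists>b < d. v $ b ~= \<zero>")
    case False
    have "v = vec d (%_. \<zero>)" if "v \<in> W" for v
      by (rule eq_vecI) (use False that sub in "auto simp: coord_space_simps")
    thus ?thesis using zero unfolding coord_space_simps by blast
  next
    case True
    then obtain v b where v: "v \<in> W" "b < d" "v $ b ~= \<zero>" by blast
    have vc: "v \<in> carrier_vec d" "!!i. i < d ==> v $ i \<in> carrier R" using sub v(1) by (auto simp: coord_space_simps)
    define w where "w i = (if i < d then v $ i else \<zero>)" for i
    have w: "w \<in> vecs R" "!!i. i < d ==> w i = v $ i" by (auto simp: w_def vc intro!: vecsI)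
    have vb: "v $ b \<in> carrier R" by (rule vc(2)[OF v(2)])
    obtain \<beta> where \<beta>: "\<beta> \<in> carrier R" "\<beta> \<otimes> v $ b = \<one>" using field_inverse[OF vb v(3)] by metis
    have Nw: "vec d (mv R d (N k) w) \<in> W" if k: "k < n" for k
    proof -
      have A: "mrep d N (\<phi> k) \<in> carrier (MM d)" unfolding mrep_def by (rule to_mat(1)[OF Nm])
      have "mat_apply R (mrep d N (\<phi> k)) v = vec d (mv R d (ent d (mrep d N (\<phi> k))) w)" by (rule mat_apply_ent[OF A w vc(1)])
      also have "\<dots> = vec d (mv R d (N k) w)"
      proof -
        have "veq d (mv R d (ent d (to_mat d (N k))) w) (mv R d (N k) w)" by (rule mv_cong[OF to_mat(2) veq_refl])
        thus ?thesis by (intro eq_vecI) (simp_all add: mrep_def \<psi>(3)[OF k] veq_def)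
      qed
      finally show ?thesis using inv[OF \<phi>_carrier[OF k] v(1)] by simp
    qed
    have E: "vec d (%i. if i = a then v $ b else \<zero>) \<in> W" if a: "a < d" for a
    proof -
      have ca: "c a b \<in> vecs R" using c a v(2) by (simp add: unit_mat_combs_def)
      have "vec d (%i. S n (%k. c a b k \<otimes> mv R d (N k) w i)) \<in> W" by (rule submodule_comb[OF W ca Nw]) (use Nm w in auto)
      moreover have "vec d (%i. S n (%k. c a b k \<otimes> mv R d (N k) w i)) = vec d (%i. if i = a then v $ b else \<zero>)"
      proof (rule eq_vecI)
        fix i assume "i < dim_vec (vec d (%i. if i = a then v $ b else \<zero>))"
        hence i: "i < d" by simp
        show "vec d (%i. S n (%k. c a b k \<otimes> mv R d (N k) w i)) $ i = vec d (%i. if i = a then v $ b else \<zero>) $ i"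
          using unit_mat_combs_act[OF Nm c w(1) a v(2) i] i by (simp add: act_def w(2)[OF v(2)])
      qed simp
      ultimately show ?thesis by simp
    qed
    have "t \<in> W" if t: "t \<in> carrier (CS d)" for t
    proof -
      have tc: "t \<in> carrier_vec d" "!!i. i < d ==> t $ i \<in> carrier R" using t by (auto simp: coord_space_simps)
      define x where "x a = (if a < d then t $ a \<otimes> \<beta> else \<zero>)" for a
      have x: "x \<in> vecs R" by (rule vecsI) (use tc \<beta> in "auto simp: x_def")
      have fv: "(%i. if i = a then v $ b else \<zero>) \<in> vecs R" for a by (rule vecsI) (use vb in auto)
      have "vec d (%i. S d (%a. x a \<otimes> (if i = a then v $ b else \<zero>))) \<in> W" by (rule submodule_comb[OF W x E fv])
      moreover have "S d (%a. x a \<otimes> (if i = a then v $ b else \<zero>)) = t $ i" if i: "i < d" for i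
      proof -
        have "S d (%a. x a \<otimes> (if i = a then v $ b else \<zero>)) = S d (%a. if a = i then x a \<otimes> v $ b else \<zero>)"
          by (rule gsum_cong) (use x vb in auto)
        also have "\<dots> = x i \<otimes> v $ b" by (rule S_delta[OF i]) (use x vb in simp)
        also have "\<dots> = t $ i" using i tc \<beta> vb by (simp add: x_def m_assoc)
        finally show ?thesis .
      qed
      hence "vec d (%i. S d (%a. x a \<otimes> (if i = a then v $ b else \<zero>))) = t" by (intro eq_vecI) (use tc in auto)
      ultimately show ?thesis by simp
    qed
    thus ?thesis using sub by blast
  qed
qed

text \<open>The span of the orbit of a nonzero vector is an invariant subspace.\<close>

lemma irr_of_irreducible:
  assumes s: "irreducible_rep R G d \<rho>" and N: "describes d N \<rho>" "rep R n mt d N"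
  shows "irr R n d N"
proof (rule irrI)
  show "0 < d" using s by (simp add: irreducible_rep_def)
  note Nm = repD(1)[OF N(2)]
  fix v i0 t assume v: "v \<in> vecs R" "i0 < d" "v i0 ~= \<zero>" and t: "t \<in> vecs R"
  let ?u = "%k. mv R d (N k) v"
  have u: "?u \<in> mats R" by (rule matsI, rule vecsD) (use Nm v in auto)
  define ext where "ext w i = (if i < d then w $ i else \<zero>)" for w :: "'a vec" and i
  have extv: "ext w \<in> vecs R" if "w \<in> carrier (CS d)" for w
    by (rule vecsI) (use that in "auto simp: ext_def coord_space_simps")
  define W where "W = {w \<in> carrier (CS d). in_span R d ?u n (ext w)}"
  have hom: "\<rho> \<in> hom G (GL R d)" using N(1) by (simp add: describes_def matrix_rep_def)
  have mod_closed: "w \<oplus>\<^bsub>CS d\<^esub> w' \<in> carrier (CS d)" "a \<odot>\<^bsub>CS d\<^esub> w \<in> carrier (CS d)"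
    if "w \<in> carrier (CS d)" "w' \<in> carrier (CS d)" "a \<in> carrier R" for w w' a
    using that by (auto simp: coord_space_simps)
  have Wadd: "w \<oplus>\<^bsub>CS d\<^esub> w' \<in> W" if "w \<in> W" "w' \<in> W" for w w'
  proof -
    have "in_span R d ?u n (%i. ext w i \<oplus> ext w' i)" by (rule in_span_add[OF u]) (use that extv in "auto simp: W_def")
    hence "in_span R d ?u n (ext (w \<oplus>\<^bsub>CS d\<^esub> w'))" by (rule in_span_eq) (simp add: ext_def coord_space_simps)
    thus ?thesis using mod_closed[of w w' \<zero>] that by (auto simp: W_def)
  qed
  have Wsmult: "a \<odot>\<^bsub>CS d\<^esub> w \<in> W" if "a \<in> carrier R" "w \<in> W" for a w
  proof -
    have "in_span R d ?u n (%i. a \<otimes> ext w i)" by (rule in_span_smult[OF u]) (use that extv in "auto simp: W_def")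
    hence "in_span R d ?u n (ext (a \<odot>\<^bsub>CS d\<^esub> w))" by (rule in_span_eq) (simp add: ext_def coord_space_simps)
    thus ?thesis using mod_closed[of w w a] that by (auto simp: W_def)
  qed
  have Wzero: "\<zero>\<^bsub>CS d\<^esub> \<in> W"
  proof -
    have "in_span R d ?u n (ext \<zero>\<^bsub>CS d\<^esub>)" by (rule in_span_zero[OF u]) (simp add: ext_def coord_space_simps)
    thus ?thesis by (simp add: W_def) (simp add: coord_space_simps)
  qed
  have Wneg: "inv\<^bsub>add_monoid (CS d)\<^esub> w \<in> W" if w: "w \<in> W" for w
  proof -
    let ?m = "(\<ominus> \<one>) \<odot>\<^bsub>CS d\<^esub> w"
    have wc: "w \<in> carrier (CS d)" using w by (simp add: W_def)
    have mW: "?m \<in> W" by (rule Wsmult) (use w in auto)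
    hence mc: "?m \<in> carrier (CS d)" by (simp add: W_def)
    have sum: "w \<oplus>\<^bsub>CS d\<^esub> ?m = \<zero>\<^bsub>CS d\<^esub>" "?m \<oplus>\<^bsub>CS d\<^esub> w = \<zero>\<^bsub>CS d\<^esub>"
      by (rule eq_vecI; use wc in "auto simp: coord_space_simps l_minus r_neg l_neg")+
    have "inv\<^bsub>add_monoid (CS d)\<^esub> w = ?m"
      unfolding m_inv_def
    proof (rule the_equality)
      show "?m \<in> carrier (add_monoid (CS d)) \<and> w \<otimes>\<^bsub>add_monoid (CS d)\<^esub> ?m = \<one>\<^bsub>add_monoid (CS d)\<^esub> \<and>
        ?m \<otimes>\<^bsub>add_monoid (CS d)\<^esub> w = \<one>\<^bsub>add_monoid (CS d)\<^esub>" using mc sum by simp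
      fix y assume "y \<in> carrier (add_monoid (CS d)) \<and> w \<otimes>\<^bsub>add_monoid (CS d)\<^esub> y = \<one>\<^bsub>add_monoid (CS d)\<^esub> \<and>
        y \<otimes>\<^bsub>add_monoid (CS d)\<^esub> w = \<one>\<^bsub>add_monoid (CS d)\<^esub>"
      hence y: "y \<in> carrier (CS d)" "y \<oplus>\<^bsub>CS d\<^esub> w = \<zero>\<^bsub>CS d\<^esub>" by auto
      have "y $ i = (\<ominus> \<one>) \<otimes> w $ i" if i: "i < d" for i
      proof -
        have cc: "y $ i \<in> carrier R" "w $ i \<in> carrier R" using y wc i by (auto simp: coord_space_simps)
        have "y $ i \<oplus> w $ i = \<zero>" using arg_cong[OF y(2), of "%z. z $ i"] i by (simp add: coord_space_simps)
        from minus_equality[OF this cc(2,1)] show ?thesis using cc by (simp add: l_minus)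
      qed
      thus "y = ?m" by (intro eq_vecI) (use y(1) in "auto simp: coord_space_simps")
    qed
    thus ?thesis using mW by simp
  qed
  have "submodule W R (CS d)"
  proof (intro submodule.intro subgroup.intro submodule_axioms.intro)
    show "W \<subseteq> carrier (add_monoid (CS d))" by (auto simp: W_def)
    show "x \<otimes>\<^bsub>add_monoid (CS d)\<^esub> y \<in> W" if "x \<in> W" "y \<in> W" for x y using Wadd[OF that] by simp
    show "\<one>\<^bsub>add_monoid (CS d)\<^esub> \<in> W" using Wzero by simp
  qed (fact Wneg Wsmult)+
  moreover have "mat_apply R (\<rho> g) w \<in> W" if g: "g \<in> carrier G" and w: "w \<in> W" for g w
  proof -
    have wc: "w \<in> carrier (CS d)" "in_span R d ?u n (ext w)" using w by (auto simp: W_def)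
    have A: "\<rho> g \<in> carrier (MM d)" by (rule GL_closed[OF hom_in_carrier[OF hom g]])
    let ?k = "\<psi> g"
    note k = \<psi>(1)[OF g]
    have "mat_apply R (\<rho> g) w = vec d (mv R d (ent d (\<rho> g)) (ext w))"
      by (rule mat_apply_ent[OF A extv[OF wc(1)]]) (use wc in "auto simp: ext_def coord_space_simps")
    also have "\<dots> = vec d (mv R d (N ?k) (ext w))"
    proof -
      have "meq d d (ent d (\<rho> (\<phi> ?k))) (N ?k)" using N(1) k by (simp add: describes_def)
      hence "veq d (mv R d (ent d (\<rho> g)) (ext w)) (mv R d (N ?k) (ext w))" unfolding \<psi>(2)[OF g] by (rule mv_cong) simp
      thus ?thesis by (intro eq_vecI) (simp_all add: veq_def)
    qed
    finally have eq: "mat_apply R (\<rho> g) w = vec d (mv R d (N ?k) (ext w))" .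
    have "in_span R d ?u n (mv R d (N ?k) (ext w))"
    proof (rule in_span_mv[OF Nm u u wc(2)])
      fix p assume p: "p < n"
      have "in_span R d ?u n (?u (mt ?k p))" by (rule in_span_member[OF u mt_closed[OF k p]])
      thus "in_span R d ?u n (mv R d (N ?k) (?u p))" by (rule in_span_eq) (simp add: mv_rep_mt[OF N(2) v(1) k p])
    qed
    hence "in_span R d ?u n (ext (mat_apply R (\<rho> g) w))" by (rule in_span_eq) (simp add: eq ext_def)
    moreover have "mat_apply R (\<rho> g) w \<in> carrier (CS d)"
      unfolding eq coord_space_simps using mv_vecs[OF Nm extv[OF wc(1)]] by simp
    ultimately show ?thesis by (simp add: W_def)
  qed
  ultimately have W: "W = {\<zero>\<^bsub>CS d\<^esub>} \<or> W = carrier (CS d)"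
    using s unfolding irreducible_rep_def by blast
  have "vec d v \<in> W"
  proof -
    have "in_span R d ?u n (?u 0)" by (rule in_span_member[OF u n_pos])
    moreover have "?u 0 i = ext (vec d v) i" if "i < d" for i
      using mv_cong[OF repD(2)[OF N(2)] veq_refl, of R v] mv_unit_mat[OF v(1), of d] that by (simp add: veq_def ext_def)
    ultimately have "in_span R d ?u n (ext (vec d v))" by (rule in_span_eq)
    thus ?thesis using v(1) by (simp add: W_def) (simp add: coord_space_simps)
  qed
  moreover have "vec d v ~= \<zero>\<^bsub>CS d\<^esub>"
  proof
    assume "vec d v = \<zero>\<^bsub>CS d\<^esub>"
    from arg_cong[OF this, of "%x. x $ i0"] show False using v(2,3) by (simp add: coord_space_simps)
  qed
  ultimately have "W = carrier (CS d)" using W by blast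
  moreover have "vec d t \<in> carrier (CS d)" using t by (simp add: coord_space_simps)
  ultimately have "in_span R d ?u n (ext (vec d t))" unfolding W_def by blast
  thus "in_span R d ?u n t" by (rule in_span_eq) (simp add: ext_def)
qed

end

section \<open>Certificates with digit entries\<close>

context prime_rep
begin

lemma digit_cert_sound:
  assumes \<alpha>: "\<alpha> \<in> carrier L" "el \<alpha> (1 # cs) = \<zero>" and f: "dfield l cs" and V: "!!x. V x \<in> carrier (dring l cs)"
    and g: "good (dring l cs) l n mt J V"
  shows "good L l n mt J (%x. el \<alpha> (V x))"
proof -
  have cs: "0 < length cs" "set cs \<subseteq> {..<l}" using f by (auto simp: dfield_def)
  interpret h: ring_embedding "dring l cs" L "el \<alpha>" by (rule dring_embedding[OF \<alpha> cs dfield_inj[OF \<alpha> cs f]])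
  define B where "B = n + J [0] + J [1] + 9 + (\<Sum>i < J [0]. J [2, i] + J [3, i])"
  have "J [2, i] + J [3, i] \<le> (\<Sum>i < J [0]. J [2, i] + J [3, i])" if "i < J [0]" for i
    by (rule member_le_sum) (use that in auto)
  hence B: "n \<le> B" "J [0] \<le> B" "J [1] \<le> B" "9 \<le> B" "!!i. i < J [0] ==> J [2, i] \<le> B \<and> J [3, i] \<le> B"
    unfolding B_def by (simp_all, fastforce)
  have "good L l n mt J (%x. el \<alpha> (V x)) = good (dring l cs) l n mt J V"
    by (rule h.good_transfer[OF mt_closed n_pos B]) (simp_all add: h.rel_def V)
  thus ?thesis using g by simp
qed

lemma digit_cert_exists:
  "\<exists>cs js vs. dfield l cs \<and> set vs \<subseteq> carrier (dring l cs) \<and>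
    good (dring l cs) l n mt (look 0 js) (look (replicate (length cs) 0) vs)"
proof -
  obtain J V where V: "!!x. V x \<in> carrier L" and g: "good L l n mt J V" using good_exists by blast
  define B where "B = n + J [0] + J [1] + 9 + (\<Sum>i < J [0]. J [2, i] + J [3, i])"
  have "J [2, i] + J [3, i] \<le> (\<Sum>i < J [0]. J [2, i] + J [3, i])" if "i < J [0]" for i
    by (rule member_le_sum) (use that in auto)
  hence B: "n \<le> B" "J [0] \<le> B" "J [1] \<le> B" "9 \<le> B" "!!i. i < J [0] ==> J [2, i] \<le> B \<and> J [3, i] \<le> B"
    unfolding B_def by (simp_all, fastforce)
  define I where "I = {x. set x \<subseteq> {..B} \<and> length x \<le> 5}"
  have fI: "finite I" unfolding I_def by (rule finite_lists_length_le) simp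
  have Y: "finite (V ` I)" "V ` I \<subseteq> carrier L" using fI V by auto
  obtain cs \<alpha> where \<alpha>: "\<alpha> \<in> carrier L" "el \<alpha> (1 # cs) = \<zero>" and f: "dfield l cs" and im: "V ` I \<subseteq> el \<alpha> ` carrier (dring l cs)"
    by (rule dfield_exists[OF Y])
  have cs: "0 < length cs" "set cs \<subseteq> {..<l}" using f by (auto simp: dfield_def)
  interpret h: ring_embedding "dring l cs" L "el \<alpha>" by (rule dring_embedding[OF \<alpha> cs dfield_inj[OF \<alpha> cs f]])
  let ?z = "replicate (length cs) 0 :: nat list"
  have z: "?z \<in> carrier (dring l cs)" using h.D_closed(1) by (simp add: dring_def)
  define W where "W x = (if x \<in> I then inv_into (carrier (dring l cs)) (el \<alpha>) (V x) else ?z)" for x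
  have W: "W x \<in> carrier (dring l cs)" "x \<in> I ==> el \<alpha> (W x) = V x" for x
  proof -
    have m: "V x \<in> el \<alpha> ` carrier (dring l cs)" if "x \<in> I" using im that by blast
    show "W x \<in> carrier (dring l cs)" using inv_into_into[OF m] z by (simp add: W_def)
    show "x \<in> I ==> el \<alpha> (W x) = V x" using f_inv_into_f[OF m] by (simp add: W_def)
  qed
  obtain vs where vs: "look ?z vs = W" "set vs \<subseteq> range W"
    by (rule finite_table[OF fI, of W ?z]) (simp_all add: W_def)
  have g': "good (dring l cs) l n mt J W"
  proof -
    have "good L l n mt J V = good (dring l cs) l n mt J W"
      by (rule h.good_transfer[OF mt_closed n_pos B]) (simp_all add: h.rel_def W I_def)
    thus ?thesis using g by simp
  qed
  obtain js where js: "look 0 js = (%x. if x \<in> I then J x else 0)"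
    by (rule finite_table[OF fI, of "%x. if x \<in> I then J x else 0" 0]) simp_all
  have "good (dring l cs) l n mt (look 0 js) W"
    by (rule good_J_cong[OF _ _ _ _ g']) (use B(2-4) in "auto simp: js I_def")
  moreover have "set vs \<subseteq> carrier (dring l cs)" using vs(2) W(1) by blast
  ultimately show ?thesis using f vs(1) by auto
qed

end

section \<open>Soundness of certificates\<close>

lemma fin_group_of_bij:
  assumes G: "group G" and \<phi>: "bij_betw \<phi> {..<n} (carrier G)" "\<phi> 0 = \<one>\<^bsub>G\<^esub>" and n: "0 < n"
    and mt: "!!k k'. k < n ==> k' < n ==> mt k k' < n" "!!k k'. k < n ==> k' < n ==> \<phi> (mt k k') = \<phi> k \<otimes>\<^bsub>G\<^esub> \<phi> k'"
  shows "fin_group n mt"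
proof -
  interpret G: group G by (rule G)
  have inj: "a = b" if "a < n" "b < n" "\<phi> a = \<phi> b" for a b using \<phi>(1) that unfolding bij_betw_def inj_on_def by simp
  have c: "\<phi> k \<in> carrier G" if "k < n" for k using \<phi>(1) that unfolding bij_betw_def by auto
  show ?thesis
  proof
    show "0 < n" by (rule n)
    show "mt k k' < n" if "k < n" "k' < n" for k k' by (rule mt(1)[OF that])
    show "mt (mt a b) d = mt a (mt b d)" if "a < n" "b < n" "d < n" for a b d
      by (rule inj) (use that mt c in "simp_all add: G.m_assoc")
    show "mt 0 k = k" "mt k 0 = k" if "k < n" for k
      by (rule inj; use that mt c \<phi>(2) n in simp)+
    show "bij_betw (mt k) {..<n} {..<n}" if k: "k < n" for k
    proof -
      have "inj_on (mt k) {..<n}"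
      proof (rule inj_onI)
        fix a b assume ab: "a \<in> {..<n}" "b \<in> {..<n}" "mt k a = mt k b"
        hence "\<phi> k \<otimes>\<^bsub>G\<^esub> \<phi> a = \<phi> k \<otimes>\<^bsub>G\<^esub> \<phi> b" using mt(2)[OF k, of a] mt(2)[OF k, of b] by simp
        hence "\<phi> a = \<phi> b" using c k ab by simp
        thus "a = b" using inj ab by simp
      qed
      moreover have "mt k ` {..<n} \<subseteq> {..<n}" using mt(1)[OF k] by auto
      ultimately show ?thesis unfolding bij_betw_def using endo_inj_surj[of "{..<n}" "mt k"] by simp
    qed
  qed
qed

lemma hom_rsum:
  assumes "h \<in> Ring.ring_hom R S" "ring R" "ring S" "!!i. i < m ==> f i \<in> carrier R"
  shows "h (rsum R m f) = rsum S m (%i. h (f i))"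
proof -
  interpret R: ring R by (rule assms(2))
  show ?thesis using assms(4)
    by (induction m) (simp_all add: ring_hom_zero[OF assms(1-3)] ring_hom_add[OF assms(1)] R.S_closed)
qed

locale closure_coordinates = prime_rep L K l n mt + coordinates L n mt G \<phi>
  for L :: "'a ring" (structure) and K l n mt and G :: "('g, 'c) monoid_scheme" and \<phi>
begin

text \<open>A homomorphism to another field preserves the expressions for the matrix units.\<close>

lemma absolutely_irreducible_mrep:
  assumes N: "rep L n mt d N" and c: "unit_mat_combs L n d N c" and d: "0 < d"
  shows "absolutely_irreducible_rep L G d (mrep d N)"
  unfolding absolutely_irreducible_rep_def
proof (intro conjI allI impI)
  show "matrix_rep L G d (mrep d N)" by (rule matrix_rep_mrep[OF N])
  fix L' :: "'a ring" and h assume a: "field L' \<and> h \<in> Ring.ring_hom L L'"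
  hence fL: "field L'" and h: "h \<in> Ring.ring_hom L L'" by auto
  note Nm = repD(1)[OF N]
  interpret L': field L' by (rule fL)
  interpret C': coordinates L' n mt G \<phi>
    by (intro coordinates.intro rep_setting.intro coordinates_axioms.intro fL fin_group_axioms grp \<phi>_bij \<phi>_one \<phi>_mult)
  note hs = ring_hom_closed[OF h] ring_hom_mult[OF h] ring_hom_one[OF h] ring_hom_zero[OF h ring_axioms L'.ring_axioms]
    hom_rsum[OF h ring_axioms L'.ring_axioms]
  let ?N = "%k a b. h (N k a b)"
  have rep': "rep L' n mt d ?N"
    unfolding rep_def
  proof (intro conjI allI impI)
    show "(%a b. h (N k a b)) \<in> mats L'" for k by (rule matsI) (simp add: hs Nm)
    show "meq d d (%a b. h (N 0 a b)) (uvec L')"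
      using repD(2)[OF N] by (auto simp: meq_def uvec_def hs)
    fix k k' assume k: "k < n" "k' < n"
    show "meq d d (%a b. h (N (mt k k') a b)) (mm L' d (%a b. h (N k a b)) (%a b. h (N k' a b)))"
      unfolding meq_def
    proof (intro allI impI)
      fix i j assume "i < d" "j < d"
      hence "N (mt k k') i j = S d (%c. N k i c \<otimes> N k' c j)" using repD(3)[OF N k] by (simp add: meq_def mm_def)
      thus "h (N (mt k k') i j) = mm L' d (%a b. h (N k a b)) (%a b. h (N k' a b)) i j"
        by (simp add: hs Nm mm_def)
    qed
  qed
  have combs': "unit_mat_combs L' n d ?N (%a b k. h (c a b k))"
    unfolding unit_mat_combs_def
  proof (intro allI impI conjI)
    fix a b assume ab: "a < d" "b < d"
    have cv: "c a b \<in> vecs L" using c ab by (simp add: unit_mat_combs_def)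
    show "(%k. h (c a b k)) \<in> vecs L'" by (rule vecsI) (simp add: hs cv)
    fix i j assume ij: "i < d" "j < d"
    have "rsum L' n (%k. h (c a b k) \<otimes>\<^bsub>L'\<^esub> h (N k i j)) = h (S n (%k. c a b k \<otimes> N k i j))" by (simp add: hs cv Nm)
    also have "S n (%k. c a b k \<otimes> N k i j) = (if i = a \<and> j = b then \<one> else \<zero>)" using c ab ij by (simp add: unit_mat_combs_def)
    finally show "rsum L' n (%k. h (c a b k) \<otimes>\<^bsub>L'\<^esub> h (N k i j)) = (if i = a \<and> j = b then \<one>\<^bsub>L'\<^esub> else \<zero>\<^bsub>L'\<^esub>)" by (simp add: hs)
  qed
  have "(%g. map_mat h (mrep d N g)) = C'.mrep d ?N"
    by (rule ext, rule eq_matI) (auto simp: mrep_def C'.mrep_def to_mat_def C'.to_mat_def \<psi>_def C'.\<psi>_def)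
  thus "irreducible_rep L' G d (%g. map_mat h (mrep d N g))" using C'.irreducible_of_combs[OF rep' combs' d] by simp
qed

lemma elements_mem: "A \<in> carrier_mat d d ==> elements_mat A \<subseteq> F \<longleftrightarrow> (\<forall>i < d. \<forall>j < d. A $$ (i, j) \<in> F)"
  by (auto simp: elements_mat_def UN_subset_iff image_subset_iff)

lemma minimal_field_mrep:
  assumes N: "minrep d e N"
  shows "written_over_minimal_field L G d (mrep d N)"
proof -
  note r = minrepD[OF N]
  note Nm = minrepD(6)[OF N]
  define F where "F = {x \<in> carrier L. x [^] (l ^ e) = x}"
  have F: "subfield F L" unfolding F_def by (rule fixed_subfield[OF r(3)])
  note dN = describes_mrep[OF r(1)]
  have ent: "entries_in G (mrep d N) F"
    unfolding entries_in_def
  proof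
    fix g assume g: "g \<in> carrier G"
    have "mrep d N g \<in> carrier_mat d d" by (simp add: mrep_def to_mat_def)
    thus "elements_mat (mrep d N g) \<subseteq> F"
      using r(4)[OF \<psi>(1)[OF g]] Nm by (subst elements_mem) (auto simp: mrep_def to_mat_def F_def)
  qed
  have real: "realizable_over L G d (mrep d N) F"
    unfolding realizable_over_def
  proof (rule exI[of _ "mrep d N"], intro conjI)
    show "equivalent_reps L G d (mrep d N) (mrep d N)" unfolding equivalent_iff_eqv[OF dN dN] by (rule eqv_refl[OF Nm])
  qed (fact matrix_rep_mrep[OF r(1)] ent)+
  have least: "F \<subseteq> F'" if F': "subfield F' L" "realizable_over L G d (mrep d N) F'" for F'
  proof
    fix x assume x: "x \<in> F"
    obtain \<tau> where t: "matrix_rep L G d \<tau>" "equivalent_reps L G d (mrep d N) \<tau>" "entries_in G \<tau> F'"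
      using F'(2) unfolding realizable_over_def by (elim exE conjE)
    obtain M where M: "describes d M \<tau>" "rep L n mt d M" "!!k. M k = ent d (\<tau> (\<phi> (if k < n then k else 0)))"
    proof (rule describes_exists[OF t(1)])
      fix M assume a: "describes d M \<tau>" "rep L n mt d M" "!!k. M k = ent d (\<tau> (\<phi> (if k < n then k else 0)))"
      show ?thesis by (rule that[OF a])
    qed
    have E: "eqv L n d N M" using t(2) equivalent_iff_eqv[OF dN M(1)] by simp
    have "M k i j \<in> F'" if k: "k < n" and ij: "i < d" "j < d" for k i j
    proof -
      have c: "\<tau> (\<phi> k) \<in> carrier_mat d d"
        using GL_closed[OF hom_in_carrier[OF _ \<phi>_carrier[OF k]], of \<tau> d] t(1) by (simp add: matrix_rep_def mat_monoid_simps(1))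
      have "elements_mat (\<tau> (\<phi> k)) \<subseteq> F'" using t(3) \<phi>_carrier[OF k] by (simp add: entries_in_def)
      hence "\<tau> (\<phi> k) $$ (i, j) \<in> F'" using elements_mem[OF c] ij by simp
      thus ?thesis using k ij by (simp add: M(3) ent_def)
    qed
    from minrep_field[OF N repD(1)[OF M(2)] E F'(1) this] show "x \<in> F'" using x by (simp add: F_def)
  qed
  have "is_minimal_field L G d (mrep d N) F"
    unfolding is_minimal_field_def using F real least by blast
  moreover have "F' = F" if "is_minimal_field L G d (mrep d N) F'" for F'
    using that F real least unfolding is_minimal_field_def by blast
  ultimately have ex1: "\<exists>!F. is_minimal_field L G d (mrep d N) F" and the: "(THE F. is_minimal_field L G d (mrep d N) F) = F"
    by (blast, intro the_equality)
  show ?thesis unfolding written_over_minimal_field_def the using ex1 ent by simp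
qed

lemma full_set:
  assumes V: "!!x. V x \<in> carrier L" and g: "good L l n mt J V"
  shows "full_set_of_reps L G (map (%i. (J [2, i], mrep (J [2, i]) (%k a b. V [0, i, k, a, b]))) [0..<J [0]])"
proof -
  let ?N = "%i k a b. V [0, i, k, a, b]"
  let ?ss = "map (%i. (J [2, i], mrep (J [2, i]) (?N i))) [0..<J [0]]"
  note gr = good_rep[OF V g]
  have Nm: "?N i k \<in> mats L" for i k by (rule matsI) (rule V)
  have d: "describes (J [2, i]) (?N i) (mrep (J [2, i]) (?N i))" if "i < J [0]" for i by (rule describes_mrep[OF gr(1)[OF that]])
  have "absolutely_irreducible_rep L G (J [2, i]) (mrep (J [2, i]) (?N i))" if i: "i < J [0]" for i
    by (rule absolutely_irreducible_mrep[OF gr(1,2)[OF i]]) (use minrepD(2)[OF gr(3)[OF i]] in "simp add: irr_def")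
  moreover have "written_over_minimal_field L G (J [2, i]) (mrep (J [2, i]) (?N i))" if i: "i < J [0]" for i
    by (rule minimal_field_mrep[OF gr(3)[OF i]])
  moreover have "\<exists>!i. i < length ?ss \<and> fst (?ss ! i) = dd \<and> equivalent_reps L G dd \<tau> (snd (?ss ! i))"
    if ab: "absolutely_irreducible_rep L G dd \<tau>" for dd \<tau>
  proof -
    have "id \<in> Ring.ring_hom L L" by (simp add: Ring.ring_hom_def)
    hence "irreducible_rep L G dd (%g. map_mat id (\<tau> g))" using ab field_axioms unfolding absolutely_irreducible_rep_def by blast
    moreover have "map_mat id A = A" for A :: "'a mat" by (rule eq_matI) simp_all
    ultimately have irrt: "irreducible_rep L G dd \<tau>" by simp
    have mr: "matrix_rep L G dd \<tau>" using ab by (simp add: absolutely_irreducible_rep_def)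
    obtain M where M: "describes dd M \<tau>" "rep L n mt dd M"
    proof (rule describes_exists[OF mr])
      fix M assume a: "describes dd M \<tau>" "rep L n mt dd M"
      show ?thesis by (rule that[OF a])
    qed
    note Mm = repD(1)[OF M(2)]
    have irrM: "irr L n dd M" by (rule irr_of_irreducible[OF irrt M])
    obtain i where i: "i < J [0]" "J [2, i] = dd" "eqv L n dd (?N i) M" using good_complete[OF V g M(2) irrM] by blast
    have eq: "equivalent_reps L G dd \<tau> (mrep (J [2, j]) (?N j)) \<longleftrightarrow> eqv L n dd M (?N j)" if "j < J [0]" "J [2, j] = dd" for j
      using equivalent_iff_eqv[OF M(1), of "?N j" "mrep dd (?N j)"] d[OF that(1)] that(2) by simp
    show ?thesis
    proof (rule ex1I[of _ i])
      show "i < length ?ss \<and> fst (?ss ! i) = dd \<and> equivalent_reps L G dd \<tau> (snd (?ss ! i))"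
        using i eq[OF i(1,2)] eqv_sym[OF Nm Mm i(3)] by simp
      fix j assume j: "j < length ?ss \<and> fst (?ss ! j) = dd \<and> equivalent_reps L G dd \<tau> (snd (?ss ! j))"
      have lt: "j < J [0]" using j by simp
      hence ssj: "?ss ! j = (J [2, j], mrep (J [2, j]) (?N j))" by simp
      have dj: "J [2, j] = dd" using j unfolding ssj by simp
      note j' = lt dj
      have "equivalent_reps L G dd \<tau> (mrep (J [2, j]) (?N j))" using j unfolding ssj snd_conv by (elim conjE)
      hence "eqv L n dd M (?N j)" by (rule eq[OF j', THEN iffD1])
      hence "eqv L n (J [2, i]) (?N i) (?N j)" unfolding i(2) by (rule eqv_trans[OF Nm Mm Nm i(3)])
      thus "j = i" using good_distinct[OF V g i(1) j'(1)] i(2) j'(2) by (cases "i = j") simp_all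
    qed
  qed
  ultimately show ?thesis unfolding full_set_of_reps_def by auto
qed

end

section \<open>The certificates are decidable\<close>

lemma comp_power: "computable f ==> computable g ==> computable (%x. f x ^ g x :: nat)"
proof -
  assume fg: "computable f" "computable g"
  have "a ^ b = rec_nat 1 (%_ y. y * a) b" for a b :: nat by (induction b) simp_all
  moreover have "computable (%x. rec_nat 1 (%_ y. y * f x) (g x))"
    by (rule comp_rec_nat[where s = "%x k y. y * f x"])
      (intro comp_const comp_times comp_snd comp_id comp_comp[OF fg(1)] comp_fst fg(2))+
  ultimately show ?thesis by simp
qed

lemma dec_mem: "computable f ==> computable l ==> dec (%x. f x \<in> set (l x))"
proof -
  assume fl: "computable f" "computable l"
  have "dec (%x. \<exists>e \<in> set (l x). f x = e)"
    by (rule dec_bex_set[where P = "%x e. f x = e"]) (intro dec_eq comp_comp[OF fl(1)] comp_fst comp_snd comp_id fl(2))+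
  thus ?thesis by simp
qed

lemma comp_dig: "computable v ==> computable i ==> computable (%x. dig (v x) (i x))"
  unfolding dig_def by (intro comp_hd comp_drop)

lemma comp_dadd: "computable l ==> computable v ==> computable w ==> computable (%x. dadd (l x) (v x) (w x))"
  unfolding dadd_def
  by (rule comp_map[where f = "%x i. (dig (v x) i + dig (w x) i) mod l x"])
    (intro comp_mod comp_plus comp_dig comp_fst comp_snd comp_id comp_upt comp_length | erule comp_comp)+

lemma comp_dscale: "computable l ==> computable c ==> computable v ==> computable (%x. dscale (l x) (c x) (v x))"
  unfolding dscale_def
  by (rule comp_map[where f = "%x a. c x * a mod l x"])
    (intro comp_mod comp_times comp_fst comp_snd comp_id | erule comp_comp | assumption)+

lemma comp_dstep: "computable l ==> computable cs ==> computable v ==> computable (%x. dstep (l x) (cs x) (v x))"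
  unfolding dstep_def
  by (intro comp_dadd comp_append comp_tl comp_const comp_dscale comp_times comp_minus comp_dig)

lemma comp_dmult:
  "computable l ==> computable cs ==> computable v ==> computable w ==> computable (%x. dmult (l x) (cs x) (v x) (w x))"
  unfolding dmult_def
  by (rule comp_foldl[where s = "%x acc a. dadd (l x) (dstep (l x) (cs x) acc) (dscale (l x) a (w x))"])
    (intro comp_dadd comp_dstep comp_dscale comp_fst comp_snd comp_id comp_replicate comp_length comp_const | erule comp_comp | assumption)+

lemma comp_dvecs: "computable l ==> computable m ==> computable (%x. dvecs (l x) (m x))"
  unfolding dvecs_def
proof (rule comp_rec_nat[where s = "%x _ vs. concat (map (%v. map (%a. a # v) [0..<l x]) vs)"])
  assume l: "computable l"
  show "computable (%p. concat (map (%v. map (%a. a # v) [0..<l (fst p)]) (snd (snd p))))"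
    by (intro comp_concat comp_map comp_Cons comp_upt comp_comp[OF l] comp_fst comp_snd comp_id)
qed (rule comp_const)

lemma dring_simps: "\<zero>\<^bsub>dring l cs\<^esub> = replicate (length cs) 0" "\<one>\<^bsub>dring l cs\<^esub> = replicate (length cs - 1) 0 @ [1]"
  "v \<oplus>\<^bsub>dring l cs\<^esub> w = dadd l v w" "v \<otimes>\<^bsub>dring l cs\<^esub> w = dmult l cs v w"
  by (simp_all add: dring_def)

lemma comp_zero: "computable cs ==> computable (%x. \<zero>\<^bsub>dring (l x) (cs x)\<^esub>)"
  and comp_one: "computable cs ==> computable (%x. \<one>\<^bsub>dring (l x) (cs x)\<^esub>)"
  and comp_add: "computable l ==> computable v ==> computable w ==> computable (%x. v x \<oplus>\<^bsub>dring (l x) (cs x)\<^esub> w x)"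
  and comp_mult: "computable l ==> computable cs ==> computable v ==> computable w ==> computable (%x. v x \<otimes>\<^bsub>dring (l x) (cs x)\<^esub> w x)"
  unfolding dring_simps
  by (intro comp_replicate comp_append comp_length comp_minus comp_const comp_dadd comp_dmult; assumption)+

text \<open>Sums and powers in the digit ring are primitive recursions whose parameters may depend on the argument.\<close>

lemma comp_rsum:
  assumes l: "computable l" and cs: "computable cs" and m: "computable m" and f: "computable (%p. f (fst p) (snd p))"
  shows "computable (%x. rsum (dring (l x) (cs x)) (m x) (%i. f x i))"
proof -
  have "rsum R k g = rec_nat \<zero>\<^bsub>R\<^esub> (%i y. y \<oplus>\<^bsub>R\<^esub> g i) k" for R :: "nat list ring" and k g by (induction k) simp_all
  moreover have "computable (%x. rec_nat \<zero>\<^bsub>dring (l x) (cs x)\<^esub> (%i y. y \<oplus>\<^bsub>dring (l x) (cs x)\<^esub> f x i) (m x))"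
  proof (rule comp_rec_nat[where s = "%x i y. y \<oplus>\<^bsub>dring (l x) (cs x)\<^esub> f x i"])
    have "computable (%p. (fst p, fst (snd p)))" by (intro comp_Pair comp_fst comp_snd comp_id)
    from comp_comp[OF f this] have g: "computable (%p. f (fst p) (fst (snd p)))" by simp
    show "computable (%p. snd (snd p) \<oplus>\<^bsub>dring (l (fst p)) (cs (fst p))\<^esub> f (fst p) (fst (snd p)))"
      by (intro comp_add g comp_comp[OF l] comp_fst comp_snd comp_id)
  qed (intro comp_zero cs m)+
  ultimately show ?thesis by simp
qed

lemma comp_pow:
  assumes "computable l" "computable cs" "computable v" "computable m"
  shows "computable (%x. v x [^]\<^bsub>dring (l x) (cs x)\<^esub> (m x :: nat))"
  unfolding nat_pow_def
  by (rule comp_rec_nat[where s = "%x k y. y \<otimes>\<^bsub>dring (l x) (cs x)\<^esub> v x"])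
    (intro comp_one comp_mult comp_fst comp_snd comp_id assms comp_comp[OF assms(1)] comp_comp[OF assms(2)] comp_comp[OF assms(3)])+

lemma comp_look: "computable z ==> computable xs ==> computable i ==> computable (%x. look (z x) (xs x) (i x))"
  unfolding look_def by (intro comp_If dec_less comp_code comp_length comp_hd comp_drop)

lemma comp_gmul: "computable ms ==> computable k ==> computable k' ==> computable (%x. gmul (ms x) (k x) (k' x))"
  and comp_glet: "computable ms ==> computable k ==> computable k' ==> computable (%x. glet (ms x) (k x) (k' x))"
  unfolding gmul_def glet_def by (intro comp_look comp_const comp_Cons; assumption)+

lemma comp_gwalk: "computable ms ==> computable k ==> computable w ==> computable (%x. gwalk (ms x) (k x) (w x))"
  unfolding gwalk_def
  by (rule comp_foldl[where s = "%x k y. gmul (ms x) k (glet (ms x) (fst y) (snd y))"])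
    (intro comp_gmul comp_glet comp_fst comp_snd comp_id | erule comp_comp | assumption)+

lemma dec_valid: "computable n ==> computable w ==> dec (%x. valid_word (n x) (w x))"
  unfolding valid_word_def
  by (rule dec_ball_set[where P = "%x y. fst y < n x \<and> snd y < 2"])
    (intro dec_and dec_less comp_const comp_fst comp_snd comp_id | erule comp_comp | assumption)+

lemma comp_rules: "computable n ==> computable rs ==> computable (%x. rewrite_rules (n x) (rs x))"
  unfolding rewrite_rules_def
  by (intro comp_append comp_map comp_Pair comp_concat comp_upt comp_Cons comp_const comp_fst comp_snd comp_id; assumption)

lemma comp_derive: 
  assumes n: "computable n" and rs: "computable rs" and w: "computable w" "computable ds"
  shows "computable (%x. derive_word (n x) (rs x) (w x) (ds x))"
  unfolding derive_word_def
proof (rule comp_foldl[where s = "%x w y. rewrite (n x) (rs x) w y"])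
  show "computable (%p. rewrite (n (fst p)) (rs (fst p)) (fst (snd p)) (snd (snd p)))"
    unfolding rewrite_def
    by (intro comp_If dec_and dec_eq dec_mem dec_valid comp_rules comp_append comp_comp[OF n] comp_comp[OF rs] comp_fst comp_snd comp_id)
qed (fact w)+

lemma dec_group_cert:
  "computable n ==> computable rs ==> computable m ==> computable ms ==> computable ws ==> computable ds ==>
    dec (%x. group_cert (n x) (rs x) (m x) (ms x) (ws x) (ds x))"
  unfolding group_cert_def
  by (intro dec_and dec_all_less dec_ball_set dec_eq dec_less dec_valid comp_gmul comp_gwalk comp_glet comp_derive comp_look
      comp_append comp_Cons comp_Pair comp_minus comp_fst comp_snd comp_id comp_const | assumption | erule comp_comp)+

lemma dec_dfield: "computable l ==> computable cs ==> dec (%x. dfield (l x) (cs x))"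
proof -
  have "set cs \<subseteq> {..<l} \<longleftrightarrow> (\<forall>c \<in> set cs. c < l)" for cs and l :: nat by auto
  moreover assume "computable l" "computable cs"
  ultimately show ?thesis unfolding dfield_def
    by (simp only:) (intro dec_and dec_or dec_ball_set dec_bex_set dec_less dec_eq comp_dvecs comp_zero comp_one comp_mult comp_length
      comp_fst comp_snd comp_id comp_const | assumption | erule comp_comp)+
qed

lemma dec_good:
  "computable l ==> computable cs ==> computable m ==> computable ms ==> computable js ==> computable vs ==>
    dec (%x. good (dring (l x) (cs x)) (l x) (m x) (gmul (ms x)) (look 0 (js x)) (look (replicate (length (cs x)) 0) (vs x)))"
  unfolding good_def irr_cert_def chain_cert_def distinguishes_def meq_def mm_def frm_def uvec_def
  by (intro dec_and dec_or dec_imp dec_not dec_all_less dec_ex_less dec_eq dec_less dec_le comp_rsum comp_add comp_mult comp_pow comp_If comp_zero comp_one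
      comp_look comp_gmul comp_power comp_replicate comp_length comp_Cons comp_fst comp_snd comp_id comp_const | assumption | erule comp_comp)+

section \<open>The algorithm\<close>

type_synonym input = "nat \<times> nat list \<times> nword list \<times> nword list list"
type_synonym cert = "(nat \<times> nat list \<times> nword list \<times> rewrite_step list list) \<times> (nat list \<times> nat list \<times> nat list list)"

definition input_of :: "nat => pc_presentation => input" where
  "input_of l P = (l, exps P, map enc_word (powers P), map (map enc_word) (conjs P))"

text \<open>The letter \<open>(i, 0)\<close> is a generator and \<open>(i, 1)\<close> its inverse.\<close>

definition relators :: "nat list => nword list => nword list list => (nword \<times> nword) list" where
  "relators e pw cj =
    map (%i. (replicate (hd (drop i e)) (i, 0), hd (drop i pw))) [0..<length e] @
    concat (map (%j. map (%i. ([(i, 1), (j, 0), (i, 0)], hd (drop (j - Suc i) (hd (drop i cj))))) [0..<j]) [0..<length e])"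

definition certified :: "input => cert => bool" where
  "certified = (%(l, e, pw, cj) ((m, ms, ws, ds), (cs, js, vs)).
    group_cert (length e) (relators e pw cj) m ms ws ds \<and> dfield l cs \<and>
    (\<forall>v \<in> set vs. v \<in> set (dvecs l (length cs))) \<and>
    good (dring l cs) l m (gmul ms) (look 0 js) (look (replicate (length cs) 0) vs))"

definition answer :: "input \<times> cert => nat list \<times> (nat \<times> nat list list list list) list" where
  "answer = (%((l, e, pw, cj), ((m, ms, ws, ds), (cs, js, vs))). (1 # cs, map (%i. (look 0 js [2, i],
    map (%j. map (%a. map (%b. look (replicate (length cs) 0) vs [0, i, glet ms j 0, a, b]) [0..<look 0 js [2, i]]) [0..<look 0 js [2, i]])
      [0..<length e])) [0..<look 0 js [0]]))"

lemma dec_certified: "dec (%p. certified (fst p) (snd p))"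
  unfolding certified_def relators_def case_prod_beta
  by (intro dec_and dec_group_cert dec_dfield dec_good dec_ball_set dec_mem comp_dvecs comp_append comp_concat comp_map comp_Pair comp_Cons comp_upt
      comp_replicate comp_hd comp_drop comp_minus comp_Suc comp_length comp_fst comp_snd comp_id comp_const)

lemma comp_answer: "computable answer"
  unfolding answer_def case_prod_beta
  by (intro comp_Pair comp_Cons comp_map comp_upt comp_look comp_glet comp_replicate comp_length comp_fst comp_snd comp_id comp_const)

lemma code_nat: "code n = n" for n :: nat
  by (simp add: code_nat_def)

lemma code_nat_list: "code xs = list_encode xs" for xs :: "nat list"
  by (simp add: code_list_def code_nat map_idI)

lemma code_pair: "code (a, b) = prod_encode (code a, code b)"
  by (simp add: code_prod_def)

lemma code_input: "code (input_of l P) = encode_input l P"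
proof -
  have w: "code (enc_word w) = encode_gword w" for w
    by (simp add: code_list_def encode_gword_def enc_letter_def code_prod_def code_nat comp_def case_prod_unfold)
  have ws: "code (map enc_word ws) = list_encode (map encode_gword ws)" for ws
    unfolding code_list_def[of "map enc_word ws"] map_map comp_def w ..
  have "code (map (map enc_word) wss) = list_encode (map (%ws. list_encode (map encode_gword ws)) wss)" for wss
    unfolding code_list_def[of "map (map enc_word) wss"] map_map comp_def ws ..
  thus ?thesis by (simp only: input_of_def encode_input_def code_pair code_nat code_nat_list ws)
qed

lemma code_output: "code p = encode_output (fst p) (snd p)"
proof -
  have row: "code row = list_encode (map list_encode row)" for row :: "nat list list"
    by (simp add: code_list_def[of row] code_nat_list cong: map_cong)
  have M: "code M = encode_matrix M" for M :: "nat list list list"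
    by (simp add: code_list_def[of M] encode_matrix_def row cong: map_cong)
  have Ms: "code Ms = list_encode (map encode_matrix Ms)" for Ms :: "nat list list list list"
    by (simp add: code_list_def[of Ms] M cong: map_cong)
  have r: "code r = encode_rep r" for r :: "nat \<times> nat list list list list"
    by (cases r) (simp add: encode_rep_def code_pair code_nat Ms)
  have "code rs = list_encode (map encode_rep rs)" for rs :: "(nat \<times> nat list list list list) list"
    by (simp add: code_list_def[of rs] r cong: map_cong)
  thus ?thesis by (cases p) (simp add: encode_output_def code_pair code_nat_list)
qed

lemma relators:
  assumes P: "pc_presentation_wf P"
  defines "rs \<equiv> relators (exps P) (map enc_word (powers P)) (map (map enc_word) (conjs P))"
  shows "dec_rels rs = pc_relations P"
    "p \<in> set rs ==> \<exists>r s. p = (enc_word r, enc_word s) \<and> r \<in> gwords (pc_size P) \<and> s \<in> gwords (pc_size P)"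
proof -
  let ?n = "pc_size P"
  let ?f = "%i. (replicate (exps P ! i) (i, False), powers P ! i)"
  let ?g = "%(i, j). ([(i, True), (j, False), (i, False)], conjs P ! i ! (j - Suc i))"
  let ?e = "%p. (enc_word (fst p), enc_word (snd p))"
  have len: "length (exps P) = ?n" "length (powers P) = ?n" "length (conjs P) = ?n" using P by (simp_all add: pc_presentation_wf_def pc_size_def Let_def)
  have wf: "fst ` set (powers P ! i) \<subseteq> {i<..<?n}" "length (conjs P ! i) = ?n - Suc i"
    "w \<in> set (conjs P ! i) ==> fst ` set w \<subseteq> {i<..<?n}" if "i < ?n" for i w
    using P that by (simp_all add: pc_presentation_wf_def Let_def)
  have f: "(replicate (hd (drop i (exps P))) (i, 0), hd (drop i (map enc_word (powers P)))) = ?e (?f i)" if "i < ?n" for i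
    using that by (simp add: len hd_drop_conv_nth map_replicate enc_letter_def)
  have g: "([(i, 1), (j, 0), (i, 0)], hd (drop (j - Suc i) (hd (drop i (map (map enc_word) (conjs P)))))) = ?e (?g (i, j))" if "i < j" "j < ?n" for i j
  proof -
    have i: "i < ?n" "j - Suc i < length (conjs P ! i)" using that wf(2)[of i] by auto
    thus ?thesis by (simp add: len hd_drop_conv_nth enc_letter_def)
  qed
  let ?A = "{(i, j). i < j \<and> j < ?n}"
  have "set rs = (%i. ?e (?f i)) ` {..<?n} \<union> (%p. ?e (?g p)) ` ?A"
  proof -
    have "set rs = (%i. (replicate (hd (drop i (exps P))) (i, 0), hd (drop i (map enc_word (powers P))))) ` {..<?n} \<union>
      (%(i, j). ([(i, 1), (j, 0), (i, 0)], hd (drop (j - Suc i) (hd (drop i (map (map enc_word) (conjs P))))))) ` ?A"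
      unfolding rs_def relators_def len by (auto simp: lessThan_atLeast0 image_iff)
    also have "\<dots> = (%i. ?e (?f i)) ` {..<?n} \<union> (%p. ?e (?g p)) ` ?A"
    proof (intro arg_cong2[where f = "(\<union>)"] image_cong HOL.refl)
      fix i assume "i \<in> {..<?n}"
      thus "(replicate (hd (drop i (exps P))) (i, 0), hd (drop i (map enc_word (powers P)))) = ?e (?f i)" by (intro f) simp
    next
      fix p assume "p \<in> ?A"
      then obtain i j where p: "p = (i, j)" "i < j" "j < ?n" by auto
      show "(case p of (i, j) => ([(i, 1), (j, 0), (i, 0)], hd (drop (j - Suc i) (hd (drop i (map (map enc_word) (conjs P))))))) = ?e (?g p)"
        unfolding p(1) prod.case using g[OF p(2,3)] by simp
    qed
    finally show ?thesis .
  qed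
  hence set: "set rs = ?e ` (?f ` {..<?n} \<union> ?g ` ?A)" by (simp add: image_Un image_image)
  have rel: "pc_relations P = ?f ` {..<?n} \<union> ?g ` ?A" unfolding pc_relations_def by auto
  have "(%p. (dec_word (fst p), dec_word (snd p))) (?e p) = p" for p by simp
  thus "dec_rels rs = pc_relations P" unfolding set rel image_image by simp
  have gw: "fst p \<in> gwords ?n \<and> snd p \<in> gwords ?n" if "p \<in> ?f ` {..<?n} \<union> ?g ` ?A" for p
    using that
  proof
    assume "p \<in> ?f ` {..<?n}"
    then obtain i where i: "i < ?n" "p = ?f i" by auto
    show ?thesis using wf(1)[OF i(1)] i by (auto simp: gwords_def)
  next
    assume "p \<in> ?g ` ?A"
    then obtain i j where ij: "i < j" "j < ?n" "p = ?g (i, j)" by auto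
    have "conjs P ! i ! (j - Suc i) \<in> set (conjs P ! i)" by (rule nth_mem) (use ij wf(2)[of i] in auto)
    hence "fst ` set (conjs P ! i ! (j - Suc i)) \<subseteq> {i<..<?n}" using wf(3)[of i] ij by simp
    thus ?thesis using ij by (auto simp: gwords_def)
  qed
  assume "p \<in> set rs"
  then obtain q where "q \<in> ?f ` {..<?n} \<union> ?g ` ?A" "p = ?e q" unfolding set by blast
  thus "\<exists>r s. p = (enc_word r, enc_word s) \<and> r \<in> gwords ?n \<and> s \<in> gwords ?n" using gw by blast
qed

lemma group_cert_coordinates:
  assumes P: "pc_presentation_wf P"
    and c: "group_cert (pc_size P) (relators (exps P) (map enc_word (powers P)) (map (map enc_word) (conjs P))) m ms ws ds"
  shows "\<exists>\<phi>. fin_group m (gmul ms) \<and> group (pc_group P) \<and> bij_betw \<phi> {..<m} (carrier (pc_group P)) \<and> \<phi> 0 = \<one>\<^bsub>pc_group P\<^esub> \<and>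
    (\<forall>k < m. \<forall>k' < m. \<phi> (gmul ms k k') = \<phi> k \<otimes>\<^bsub>pc_group P\<^esub> \<phi> k') \<and>
    (\<forall>j < pc_size P. glet ms j 0 < m \<and> \<phi> (glet ms j 0) = pc_gen P j)"
proof -
  let ?rs = "relators (exps P) (map enc_word (powers P)) (map (map enc_word) (conjs P))"
  have G: "group (pc_group P)" unfolding pc_group_def by (rule presented_group_group)
  have rs: "\<exists>r s. p = (enc_word r, enc_word s)" if "p \<in> set ?rs" for p using relators(2)[OF P that] by blast
  obtain \<phi> where \<phi>: "bij_betw \<phi> {..<m} (carrier (pc_group P))" "\<phi> 0 = \<one>\<^bsub>pc_group P\<^esub>"
    "\<forall>k < m. \<forall>k' < m. \<phi> (gmul ms k k') = \<phi> k \<otimes>\<^bsub>pc_group P\<^esub> \<phi> k'"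
    "\<forall>j < pc_size P. glet ms j 0 < m \<and> \<phi> (glet ms j 0) = pc_gen P j"
    using group_cert_sound[OF rs c] unfolding relators(1)[OF P] pc_group_def[symmetric] pc_gen_def[symmetric] by blast
  have m: "0 < m" "gmul ms k k' < m" if "k < m" "k' < m" for k k' using c that by (simp_all add: group_cert_def)
  have "0 < m" using c by (simp add: group_cert_def)
  have "fin_group m (gmul ms)"
    by (rule fin_group_of_bij[OF G \<phi>(1,2) \<open>0 < m\<close> m(2)]) (use \<phi>(3) in auto)
  thus ?thesis using G \<phi> by blast
qed

text \<open>This closure serves to find a certificate. The certificate is then correct over every closure, of
  whatever element type.\<close>

lemma prime_closure_exists:
  assumes "Factorial_Ring.prime (l :: nat)"
  shows "\<exists>(L :: (((int list \<times> nat) multiset) => int) ring) K. prime_closure L K l"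
proof -
  interpret residues_prime l "residue_ring (int l)" by (simp_all add: residues_prime.intro assms)
  note E = alg_closureE
  let ?c = "indexed_const :: int => (int list \<times> nat) multiset => int"
  have "inj_on ?c (carrier (residue_ring (int l)))"
  proof (rule inj_onI)
    fix x y :: int assume "?c x = ?c y"
    from fun_cong[OF this, of "{#}"] show "x = y" by (simp add: indexed_const_def)
  qed
  hence "card (?c ` carrier (residue_ring (int l))) = l"
    by (simp add: card_image res_carrier_eq)
  hence "prime_closure alg_closure (?c ` carrier (residue_ring (int l))) l"
    by (intro prime_closure.intro E(1) prime_closure_axioms.intro assms)
  thus ?thesis by blast
qed

lemma certificate_exists:
  assumes l: "Factorial_Ring.prime l" and P: "consistent_pc_presentation P"
  shows "\<exists>c. certified (input_of l P) c"
proof -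
  have wf: "pc_presentation_wf P" and fin: "finite (carrier (pc_group P))" using P by (simp_all add: consistent_pc_presentation_def)
  let ?rs = "relators (exps P) (map enc_word (powers P)) (map (map enc_word) (conjs P))"
  obtain m ms ws ds where gc: "group_cert (pc_size P) ?rs m ms ws ds"
  proof -
    have "\<exists>m ms ws ds. group_cert (pc_size P) ?rs m ms ws ds"
    proof (rule group_cert_exists)
      show "\<exists>r s. p = (enc_word r, enc_word s) \<and> r \<in> gwords (pc_size P) \<and> s \<in> gwords (pc_size P)" if "p \<in> set ?rs" for p
        by (rule relators(2)[OF wf that])
      show "finite (carrier (presented_group (pc_size P) (dec_rels ?rs)))" using fin by (simp only: relators(1)[OF wf] pc_group_def)
    qed
    thus ?thesis using that by blast
  qed
  obtain L :: "(((int list \<times> nat) multiset) => int) ring" and K where LK: "prime_closure L K l"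
    using prime_closure_exists[OF l] by blast
  interpret prime_closure L K l by (rule LK)
  have "fin_group m (gmul ms)" using group_cert_coordinates[OF wf gc] by blast
  then interpret prime_rep L K l m "gmul ms" by (intro prime_rep.intro rep_setting.intro LK field_axioms)
  obtain cs js vs where "dfield l cs" "set vs \<subseteq> carrier (dring l cs)" "good (dring l cs) l m (gmul ms) (look 0 js) (look (replicate (length cs) 0) vs)"
    using digit_cert_exists by blast
  hence "certified (input_of l P) ((m, ms, ws, ds), (cs, js, vs))"
    using gc by (auto simp: certified_def input_of_def pc_size_def carrier_dring set_dvecs)
  thus ?thesis ..
qed

lemma certified_correct:
  fixes K :: "'k ring"
  assumes l: "Factorial_Ring.prime l" and wf: "pc_presentation_wf P" and c: "certified (input_of l P) c"
    and K: "algebraic_closure K k0" "card k0 = l"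
  shows "correct_output K k0 P (fst (answer (input_of l P, c))) (snd (answer (input_of l P, c)))"
proof -
  obtain m ms ws ds cs js vs where c_eq: "c = ((m, ms, ws, ds), (cs, js, vs))" by (metis prod.collapse)
  let ?rs = "relators (exps P) (map enc_word (powers P)) (map (map enc_word) (conjs P))"
  let ?z = "replicate (length cs) 0 :: nat list"
  let ?J = "look 0 js" and ?V = "look ?z vs"
  have gc: "group_cert (pc_size P) ?rs m ms ws ds" and f: "dfield l cs" and vs: "\<forall>v \<in> set vs. v \<in> set (dvecs l (length cs))"
    and g: "good (dring l cs) l m (gmul ms) ?J ?V"
    using c by (simp_all add: c_eq certified_def input_of_def pc_size_def)
  interpret prime_closure K k0 l by (intro prime_closure.intro K prime_closure_axioms.intro l)
  obtain \<phi> where fg: "fin_group m (gmul ms)" and \<phi>: "group (pc_group P)" "bij_betw \<phi> {..<m} (carrier (pc_group P))" "\<phi> 0 = \<one>\<^bsub>pc_group P\<^esub>"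
    "\<forall>k < m. \<forall>k' < m. \<phi> (gmul ms k k') = \<phi> k \<otimes>\<^bsub>pc_group P\<^esub> \<phi> k'"
    "\<forall>j < pc_size P. glet ms j 0 < m \<and> \<phi> (glet ms j 0) = pc_gen P j"
    using group_cert_coordinates[OF wf gc] by blast
  have rs: "rep_setting K m (gmul ms)" by (intro rep_setting.intro field_axioms fg)
  have pr: "prime_rep K k0 l m (gmul ms)" by (intro prime_rep.intro prime_closure_axioms rs)
  have co: "coordinates K m (gmul ms) (pc_group P) \<phi>"
    by (intro coordinates.intro rs coordinates_axioms.intro \<phi>(1-3)) (use \<phi>(4) in auto)
  interpret C: closure_coordinates K k0 l m "gmul ms" "pc_group P" \<phi>
    by (intro closure_coordinates.intro pr co)
  have cs: "0 < length cs" "set cs \<subseteq> {..<l}" using f by (auto simp: dfield_def)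
  have z: "?z \<in> carrier (dring l cs)" using prime_gt_0_nat[OF l] by (auto simp: carrier_dring)
  have V: "?V x \<in> carrier (dring l cs)" for x
  proof (cases "code x < length vs")
    case True
    hence "?V x \<in> set vs" by (simp add: look_def hd_drop_conv_nth)
    thus ?thesis using vs by (auto simp: carrier_dring set_dvecs)
  qed (use z in "simp add: look_def")
  have out: "answer (input_of l P, c) = (1 # cs, map (%i. (?J [2, i],
    map (%j. map (%a. map (%b. ?V [0, i, glet ms j 0, a, b]) [0..<?J [2, i]]) [0..<?J [2, i]]) [0..<pc_size P])) [0..<?J [0]])"
    by (simp add: answer_def c_eq input_of_def pc_size_def)
  have poly: "poly_over K (1 # cs) = map nt (1 # cs)" by (simp add: poly_over_def nt_def)
  show ?thesis
    unfolding correct_output_def out fst_conv snd_conv poly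
  proof (intro conjI ballI impI)
    show "map nt (1 # cs) \<in> carrier (univ_poly K k0)" by (rule map_nt_poly)
    show "pirreducible\<^bsub>K\<^esub> k0 (map nt (1 # cs))" by (rule dfield_irreducible[OF f])
    fix \<alpha> assume a: "\<alpha> \<in> carrier K" "eval (map nt (1 # cs)) \<alpha> = \<zero>\<^bsub>K\<^esub>"
    have \<alpha>: "el \<alpha> (1 # cs) = \<zero>\<^bsub>K\<^esub>" using a(2) by (simp only: el_def)
    let ?W = "%x. el \<alpha> (?V x)"
    have gK: "good K l m (gmul ms) ?J ?W" by (rule C.digit_cert_sound[OF a(1) \<alpha> f V g])
    let ?ss = "map (%i. (?J [2, i], C.mrep (?J [2, i]) (%k a b. ?W [0, i, k, a, b]))) [0..<?J [0]]"
    have full: "full_set_of_reps K (pc_group P) ?ss" by (rule C.full_set[OF _ gK]) (simp add: a(1))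
    have "rep_data_denotes K \<alpha> P (?J [2, i], map (%j. map (%a. map (%b. ?V [0, i, glet ms j 0, a, b]) [0..<?J [2, i]]) [0..<?J [2, i]]) [0..<pc_size P])
      (?J [2, i], C.mrep (?J [2, i]) (%k a b. ?W [0, i, k, a, b]))" for i
    proof -
      have "C.mrep (?J [2, i]) (%k a b. ?W [0, i, k, a, b]) (pc_gen P j) =
        matrix_at K \<alpha> (?J [2, i]) (map (%a. map (%b. ?V [0, i, glet ms j 0, a, b]) [0..<?J [2, i]]) [0..<?J [2, i]])" if j: "j < pc_size P" for j
      proof -
        have k: "glet ms j 0 < m" "pc_gen P j = \<phi> (glet ms j 0)" using \<phi>(5) j by auto
        show ?thesis unfolding k(2) C.mrep_def C.\<psi>(3)[OF k(1)] C.to_mat_def matrix_at_def elem_at_el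
          by (rule eq_matI) simp_all
      qed
      thus ?thesis by (auto simp: rep_data_denotes_def)
    qed
    hence "list_all2 (rep_data_denotes K \<alpha> P) (map (%i. (?J [2, i],
      map (%j. map (%a. map (%b. ?V [0, i, glet ms j 0, a, b]) [0..<?J [2, i]]) [0..<?J [2, i]]) [0..<pc_size P])) [0..<?J [0]]) ?ss"
      by (simp add: list_all2_conv_all_nth)
    thus "\<exists>\<sigma>s. list_all2 (rep_data_denotes K \<alpha> P) (map (%i. (?J [2, i],
      map (%j. map (%a. map (%b. ?V [0, i, glet ms j 0, a, b]) [0..<?J [2, i]]) [0..<?J [2, i]]) [0..<pc_size P])) [0..<?J [0]]) \<sigma>s \<and>
      full_set_of_reps K (pc_group P) \<sigma>s"
      using full by blast
  qed
qed

theorem mainTheorem2: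
  shows "\<exists>alg. \<forall>l P.
    Factorial_Ring.prime l \<and> consistent_pc_presentation P \<and> solvable (pc_group P) \<longrightarrow>
    (\<exists>f reps. computes alg [encode_input l P] (encode_output f reps) \<and>
      (\<forall>(K :: 'k ring) k0. algebraic_closure K k0 \<and> card k0 = l \<longrightarrow> correct_output K k0 P f reps))"
proof -
  obtain alg where alg: "!!x. \<exists>c. certified x c ==> \<exists>c. certified x c \<and> computes alg [code x] (code (answer (x, c)))"
    using search_program[OF dec_certified comp_answer] by blast
  show ?thesis
  proof (intro exI[of _ alg] allI impI)
    fix l :: nat and P assume a: "Factorial_Ring.prime l \<and> consistent_pc_presentation P \<and> solvable (pc_group P)"
    have wf: "pc_presentation_wf P" using a by (simp add: consistent_pc_presentation_def)
    obtain c where c: "certified (input_of l P) c" "computes alg [code (input_of l P)] (code (answer (input_of l P, c)))"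
      using alg[OF certificate_exists] a by blast
    show "\<exists>f reps. computes alg [encode_input l P] (encode_output f reps) \<and>
      (\<forall>(K :: 'k ring) k0. algebraic_closure K k0 \<and> card k0 = l --> correct_output K k0 P f reps)"
      using c certified_correct[OF _ wf c(1)] a by (metis code_input code_output)
  qed
qed

end
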